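(* Let $n\ge2$, $r\ge2$, and let $a_1,\dots,a_n\in\mathbb Z_{\ge0}$ with $\sum_{i=1}^na_i=r$; put $\bar{\boldsymbol a}=(a_1,\dots,a_n)$ and $\boldsymbol a=(a_1,\dots,a_{n-1})$. Assume $q_1^{n+r}q_3^{n+1}=1$, in the precise sense that for $x,y\in\mathbb Z$ one has $q_1^xq_3^y=1$ if and only if $x=(n+r)\kappa$, $y=(n+1)\kappa$ for some $\kappa\in\mathbb Z$; let $u\in\mathbb C^\times$. Let $\mathcal M_{\bar{\boldsymbol a}}=\mathcal M^{n+r,n+1}_{\boldsymbol a,\boldsymbol 0}(u)$ and $G_{\bar{\boldsymbol a}}=G^{n,r}_{\bar{\boldsymbol a}}$ (with the same parameter $u$), with basis labels $P_{\bar{\boldsymbol a}}$ and $\mathcal P_{\bar{\boldsymbol a}}$ respectively, and let $\iota:P_{\bar{\boldsymbol a}}\to\mathcal P_{\bar{\boldsymbol a}}$, $\boldsymbol\lambda\mapsto\Lambda$, be the bijection $\Lambda_{ns+i}=\lambda^{(i)}_{s+1}+\Lambda^0_{ns+i}$ for $i=1,\dots,n$, $s\in\mathbb Z_{\ge0}$. Then there exist non-zero constants $c_\Lambda$, $\Lambda\in\mathcal P_{\bar{\boldsymbol a}}$, such that the linear map $$\mathcal M_{\bar{\boldsymbol a}}\to G_{\bar{\boldsymbol a}},\qquad |\boldsymbol\lambda\rangle\mapsto c_\Lambda|\Lambda\rangle,\quad \Lambda=\iota(\boldsymbol\lambda),$$ is an isomorphism of graded $\mathcal E$-modules.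
   Context: **Algebra.** $q_1,q_2,q_3\in\mathbb C^\times$ satisfy $q_1q_2q_3=1$ and none of them is a root of unity. Put $g(z,w)=(z-q_1w)(z-q_2w)(z-q_3w)$, $\delta(z)=\sum_{k\in\mathbb Z}z^k$. The algebra $\mathcal E$ is the associative algebra generated by $e_i,f_i$ ($i\in\mathbb Z$), $\psi^+_i,\psi^-_{-i}$ ($i\ge0$) and $(\psi_0^\pm)^{-1}$; with $e(z)=\sum_i e_iz^{-i}$, $f(z)=\sum_i f_iz^{-i}$, $\psi^\pm(z)=\sum_{\pm i\ge0}\psi^\pm_iz^{-i}$ the relations are: $g(z,w)e(z)e(w)=-g(w,z)e(w)e(z)$; $g(w,z)f(z)f(w)=-g(z,w)f(w)f(z)$; $g(z,w)\psi^\pm(z)e(w)=-g(w,z)e(w)\psi^\pm(z)$; $g(w,z)\psi^\pm(z)f(w)=-g(z,w)f(w)\psi^\pm(z)$; $[e(z),f(w)]=\frac{\delta(z/w)}{g(1,1)}(\psi^+(z)-\psi^-(z))$; all $\psi^\pm_i$ commute with each other; $\psi^\pm_0(\psi^\pm_0)^{-1}=(\psi^\pm_0)^{-1}\psi^\pm_0=1$; $[e_0,[e_1,e_{-1}]]=0=[f_0,[f_1,f_{-1}]]$. $\mathcal E$ is $\mathbb Z$-graded by $\deg e_i=1$, $\deg f_i=-1$, $\deg\psi_i^\pm=0$. **Tensor product action (independent parameters $q_1,q_3,u_1,\dots,u_n$).** $\mathcal P^+$ is the set of finite partitions $\lambda=(\lambda_1\ge\lambda_2\ge\cdots)$ (integers,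 finitely many nonzero), $\emptyset$ the empty partition. Set $$\psi_{\lambda,j}(x)=\frac{(1-q_1^{\lambda_j}q_3^{j}x)(1-q_1^{\lambda_j}q_2q_3^{j-1}x)}{(1-q_1^{\lambda_j}q_3^{j-1}x)(1-q_1^{\lambda_j-1}q_3^{j-1}x)},\qquad \psi_\lambda(x)=\frac{1-q_2x}{1-x}\prod_{j\ge1}\frac{\psi_{\lambda,j}(x)}{\psi_{\emptyset,j}(x)}.$$ On the space with basis $|\boldsymbol\lambda\rangle=|\lambda^{(1)},\dots,\lambda^{(n)}\rangle$, $\lambda^{(i)}\in\mathcal P^+$ (degree $\sum_{i,s}\lambda^{(i)}_s$): $\psi^\pm(z)|\boldsymbol\lambda\rangle=\prod_i\psi_{\lambda^{(i)}}(u_i/z)|\boldsymbol\lambda\rangle$ (expanded in $z^{\mp1}$). Let $\boldsymbol\lambda+\mathbf 1_s^{(i)}$ be $\boldsymbol\lambda$ with $\lambda^{(i)}_s$ increased by 1. If both $\boldsymbol\lambda$ and $\boldsymbol\lambda+\mathbf 1_s^{(i)}$ are tuples of finite partitions and $v=q_1^{\lambda^{(i)}_s}q_3^{s-1}u_i$, $$\langle\boldsymbol\lambda+\mathbf1_s^{(i)}|e(z)|\boldsymbol\lambda\rangle=\frac{\delta(v/z)}{1-q_1}\prod_{j<i}\psi_{\lambda^{(j)}}(u_j/v)\prod_{t<s}\psi_{\lambda^{(i)},t}(u_i/v),$$ $$\langle\boldsymbol\lambda|f(z)|\boldsymbol\lambda+\mathbf1_s^{(i)}\rangle=\frac{q_1\delta(v/z)}{1-q_1}\cdot\frac{1-q_2q_3^{s}u_i/v}{1-q_3^su_i/v}\prod_{t>s}\frac{\psi_{\lambda^{(i)},t}(u_i/v)}{\psi_{\emptyset,t}(u_i/v)}\prod_{j>i}\psi_{\lambda^{(j)}}(u_j/v);$$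 all other matrix coefficients of $e(z),f(z)$ are zero. **The module $\mathcal M_{\bar{\boldsymbol a}}=\mathcal M^{n+r,n+1}_{\boldsymbol a,\boldsymbol 0}(u)$.** Put $b_1=\dots=b_{n-1}=0$, $b_n=1$. Its basis is $|\boldsymbol\lambda\rangle$ with $\boldsymbol\lambda$ in $$P_{\bar{\boldsymbol a}}=\{(\lambda^{(1)},\dots,\lambda^{(n)}):\lambda^{(i)}\in\mathcal P^+,\ \lambda^{(i)}_j\ge\lambda^{(i+1)}_{j}-a_i\ (1\le i\le n-1),\ \lambda^{(n)}_j\ge\lambda^{(1)}_{j+1}-a_n,\ j\in\mathbb Z_{\ge1}\}.$$ Matrix coefficients between basis vectors are obtained from the tensor product ones in two steps: (1) treating them as rational functions of independent $q_1,q_3,u_1,\dots,u_n$ ($q_2=(q_1q_3)^{-1}$) times delta functions, cancel common factors and substitute $u_1=u$, $u_i=u_{i+1}q_1^{a_i+1}q_3^{b_i+1}$ ($1\le i\le n-1$); (2) treating the results as rational functions of $q_1,q_3,u$, cancel common factors and substitute values with $q_1^{n+r}q_3^{n+1}=1$. This is well-defined and gives a graded $\mathcal E$-module. (At the resonance $u_i=q_1^{-c_{i-1}}q_2^{i-1}u$, with $c_i$ as below.) **The module $G_{\bar{\boldsymbol a}}=G^{n,r}_{\bar{\boldsymbol a}}$.** Let $c_i=\sum_{j=1}^ia_j$ ($c_0=0$) and $\Lambda^0_{\nu n+i+1}=-\nu r-c_i$ for $\nu\ge0$, $0\le i\le n-1$. Its basis is $|\Lambda\rangle$, with $\Lambda$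 in the set of $(n,r)$-admissible partitions $$\mathcal P_{\bar{\boldsymbol a}}=\{\Lambda=(\Lambda_j)_{j\ge1}:\ \Lambda_j\in\mathbb Z,\ \Lambda_j\ge\Lambda_{j+1},\ \Lambda_j-\Lambda_{j+n}\ge r\ \ (j\ge1),\ \Lambda_j=\Lambda^0_j\ \text{for all large }j\},$$ and $\deg|\Lambda\rangle=\sum_j(\Lambda_j-\Lambda^0_j)$. Set $$y_{\Lambda,j}(x)=\frac{(1-q_1^{\Lambda_j}q_2^{j}x)(1-q_1^{\Lambda_j}q_3q_2^{j-1}x)}{(1-q_1^{\Lambda_j}q_2^{j-1}x)(1-q_1^{\Lambda_j-1}q_2^{j-1}x)},\qquad \psi_\emptyset(x)=\frac{1-q_2x}{1-x}.$$ Then $$\psi^\pm(z)|\Lambda\rangle=\prod_{i=0}^{n-1}\psi_\emptyset(q_1^{-c_i}q_2^iu/z)\prod_{j\ge1}\frac{y_{\Lambda,j}(u/z)}{y_{\Lambda^0,j}(u/z)}\,|\Lambda\rangle$$ (expanded in $z^{\mp1}$). Writing $\Lambda+\mathbf 1_i$ for $\Lambda$ with $\Lambda_i$ increased by 1, whenever $\Lambda,\Lambda+\mathbf 1_i\in\mathcal P_{\bar{\boldsymbol a}}$ and with $v=q_1^{\Lambda_i}q_2^{i-1}u$, $$\langle\Lambda+\mathbf 1_i|e(z)|\Lambda\rangle=\frac{\delta(v/z)}{1-q_1}\prod_{j=1}^{i-1}y_{\Lambda,j}(u/v),$$ $$\langle\Lambda|f(z)|\Lambda+\mathbf 1_i\rangle=\frac{q_1\delta(v/z)}{1-q_1}\Bigl[\prod_{j>i}\frac{y_{\Lambda,j}(u/z)}{y_{\Lambda^0,j}(u/z)}\prod_{j=0}^{n-1}\psi_\emptyset(q_1^{\Lambda^0_{i+j+1}}q_2^{i+j}u/z)\Bigr]_{z=v},$$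 where the bracket is a rational function of $z$ evaluated after cancellation; all other matrix coefficients of $e(z),f(z)$ are zero. This is a graded $\mathcal E$-module. *)

theory Defs
  imports "HOL-Computational_Algebra.Computational_Algebra" "HOL-Library.Poly_Mapping"
begin

section \<open>Graded modules over the algebra E\<close>

text \<open>
  The vector space with basis \<open>labels V\<close> is the set of finitely supported functions on the labels;
  \<open>|b\<rangle>\<close> is \<open>Poly_Mapping.single b 1\<close>.  All generators are indexed by the integers:
  \<open>op_psi_plus V k\<close> and \<open>op_psi_minus V k\<close> are the coefficients of \<open>z\<^sup>-\<^sup>k\<close> in \<open>\<psi>\<^sup>+(z)\<close> and \<open>\<psi>\<^sup>-(z)\<close>,
  which must vanish for \<open>k < 0\<close>, respectively \<open>k > 0\<close>.
\<close>

record 'b graded_rep =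
  labels :: "'b set"
  label_deg :: "'b \<Rightarrow> int"
  op_e :: "int \<Rightarrow> ('b \<Rightarrow>\<^sub>0 complex) \<Rightarrow> ('b \<Rightarrow>\<^sub>0 complex)"
  op_f :: "int \<Rightarrow> ('b \<Rightarrow>\<^sub>0 complex) \<Rightarrow> ('b \<Rightarrow>\<^sub>0 complex)"
  op_psi_plus :: "int \<Rightarrow> ('b \<Rightarrow>\<^sub>0 complex) \<Rightarrow> ('b \<Rightarrow>\<^sub>0 complex)"
  op_psi_minus :: "int \<Rightarrow> ('b \<Rightarrow>\<^sub>0 complex) \<Rightarrow> ('b \<Rightarrow>\<^sub>0 complex)"

definition scale :: "complex \<Rightarrow> ('b \<Rightarrow>\<^sub>0 complex) \<Rightarrow> ('b \<Rightarrow>\<^sub>0 complex)" where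
  "scale c x = Poly_Mapping.map ((*) c) x"

definition space :: "'b graded_rep \<Rightarrow> ('b \<Rightarrow>\<^sub>0 complex) set" where
  "space V = {x. Poly_Mapping.keys x \<subseteq> labels V}"

definition component :: "'b graded_rep \<Rightarrow> int \<Rightarrow> ('b \<Rightarrow>\<^sub>0 complex) set" where
  "component V d = {x \<in> space V. \<forall>b \<in> Poly_Mapping.keys x. label_deg V b = d}"

definition linear_on_space ::
  "('b \<Rightarrow>\<^sub>0 complex) set \<Rightarrow> (('b \<Rightarrow>\<^sub>0 complex) \<Rightarrow> ('c \<Rightarrow>\<^sub>0 complex)) \<Rightarrow> bool" where
  "linear_on_space S T \<longleftrightarrow>
     (\<forall>x\<in>S. \<forall>y\<in>S. T (x + y) = T x + T y) \<and> (\<forall>c. \<forall>x\<in>S. T (scale c x) = scale c (T x))"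

definition homogeneous_op ::
  "'b graded_rep \<Rightarrow> int \<Rightarrow> (('b \<Rightarrow>\<^sub>0 complex) \<Rightarrow> ('b \<Rightarrow>\<^sub>0 complex)) \<Rightarrow> bool" where
  "homogeneous_op V s T \<longleftrightarrow>
     linear_on_space (space V) T \<and> T ` space V \<subseteq> space V \<and>
     (\<forall>d. T ` component V d \<subseteq> component V (d + s))"

definition op_comm :: "('v \<Rightarrow> 'v) \<Rightarrow> ('v \<Rightarrow> 'v) \<Rightarrow> 'v \<Rightarrow> 'v::ab_group_add" where
  "op_comm X Y v = X (Y v) - Y (X v)"

text \<open>
  \<open>g(z,w) = \<Sum>\<^sub>a\<^sub>\<le>\<^sub>3 \<gamma>\<^sub>a z\<^sup>a w\<^sup>3\<^sup>-\<^sup>a\<close>; hence \<open>\<gamma>\<^sub>3\<^sub>-\<^sub>a\<close> are the corresponding coefficients of \<open>g(w,z)\<close>.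
\<close>

definition g_coeff :: "complex \<Rightarrow> complex \<Rightarrow> complex \<Rightarrow> nat \<Rightarrow> complex" where
  "g_coeff q1 q2 q3 a = poly.coeff ([:- q1, 1:] * [:- q2, 1:] * [:- q3, 1:]) a"

text \<open>
  If \<open>p(z,w) = \<Sum>\<^sub>a\<^sub>\<le>\<^sub>3 \<gamma>\<^sub>a z\<^sup>a w\<^sup>3\<^sup>-\<^sup>a\<close>, then \<open>quadratic_rel\<close> is the coefficient of \<open>z\<^sup>-\<^sup>k w\<^sup>-\<^sup>l\<close>, for all \<open>k\<close> and \<open>l\<close>,
  in the relation \<open>p(z,w) X(z) Y(w) = - p(w,z) Y(w) X(z)\<close> of currents
  \<open>X(z) = \<Sum>\<^sub>i X\<^sub>i z\<^sup>-\<^sup>i\<close> and \<open>Y(w) = \<Sum>\<^sub>i Y\<^sub>i w\<^sup>-\<^sup>i\<close>.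
\<close>

definition quadratic_rel ::
  "(nat \<Rightarrow> complex) \<Rightarrow> ('b \<Rightarrow>\<^sub>0 complex) set \<Rightarrow>
   (int \<Rightarrow> ('b \<Rightarrow>\<^sub>0 complex) \<Rightarrow> ('b \<Rightarrow>\<^sub>0 complex)) \<Rightarrow>
   (int \<Rightarrow> ('b \<Rightarrow>\<^sub>0 complex) \<Rightarrow> ('b \<Rightarrow>\<^sub>0 complex)) \<Rightarrow> bool" where
  "quadratic_rel \<gamma> S X Y \<longleftrightarrow>
     (\<forall>k l. \<forall>v\<in>S.
        (\<Sum>a\<le>3. scale (\<gamma> a) (X (k + int a) (Y (l + 3 - int a) v))) =
      - (\<Sum>a\<le>3. scale (\<gamma> a) (Y (l + int a) (X (k + 3 - int a) v))))"

text \<open>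
  A graded module over the algebra E given by generators and relations is a graded vector space
  with homogeneous operators satisfying the defining relations.  The generators
  \<open>(\<psi>\<^sub>0\<^sup>\<plusminus>)\<^sup>-\<^sup>1\<close> act by the inverses of \<open>\<psi>\<^sub>0\<^sup>\<plusminus>\<close>, so they amount to bijectivity of the latter.
\<close>

definition graded_E_module ::
  "complex \<Rightarrow> complex \<Rightarrow> complex \<Rightarrow> 'b graded_rep \<Rightarrow> bool" where
  "graded_E_module q1 q2 q3 V \<longleftrightarrow>
     (let S = space V; e = op_e V; f = op_f V; \<psi>p = op_psi_plus V; \<psi>m = op_psi_minus V;
          g = g_coeff q1 q2 q3; g' = (\<lambda>a. g (3 - a)) in
       (\<forall>k. homogeneous_op V 1 (e k)) \<and>
       (\<forall>k. homogeneous_op V (- 1) (f k)) \<and>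
       (\<forall>k. homogeneous_op V 0 (\<psi>p k)) \<and>
       (\<forall>k. homogeneous_op V 0 (\<psi>m k)) \<and>
       (\<forall>k<0. \<forall>v\<in>S. \<psi>p k v = 0) \<and>
       (\<forall>k>0. \<forall>v\<in>S. \<psi>m k v = 0) \<and>
       bij_betw (\<psi>p 0) S S \<and> bij_betw (\<psi>m 0) S S \<and>
       quadratic_rel g S e e \<and>
       quadratic_rel g' S f f \<and>
       quadratic_rel g S \<psi>p e \<and> quadratic_rel g S \<psi>m e \<and>
       quadratic_rel g' S \<psi>p f \<and> quadratic_rel g' S \<psi>m f \<and>
       (\<forall>k l. \<forall>v\<in>S. op_comm (e k) (f l) v =
          scale (1 / ((1 - q1) * (1 - q2) * (1 - q3))) (\<psi>p (k + l) v - \<psi>m (k + l) v)) \<and>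
       (\<forall>k l. \<forall>v\<in>S. op_comm (\<psi>p k) (\<psi>p l) v = 0 \<and> op_comm (\<psi>m k) (\<psi>m l) v = 0 \<and>
                     op_comm (\<psi>p k) (\<psi>m l) v = 0) \<and>
       (\<forall>v\<in>S. op_comm (e 0) (op_comm (e 1) (e (- 1))) v = 0 \<and>
               op_comm (f 0) (op_comm (f 1) (f (- 1))) v = 0))"

definition graded_E_iso ::
  "complex \<Rightarrow> complex \<Rightarrow> complex \<Rightarrow> 'b graded_rep \<Rightarrow> 'c graded_rep \<Rightarrow>
   (('b \<Rightarrow>\<^sub>0 complex) \<Rightarrow> ('c \<Rightarrow>\<^sub>0 complex)) \<Rightarrow> bool" where
  "graded_E_iso q1 q2 q3 V W \<phi> \<longleftrightarrow>
     graded_E_module q1 q2 q3 V \<and> graded_E_module q1 q2 q3 W \<and>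
     linear_on_space (space V) \<phi> \<and> bij_betw \<phi> (space V) (space W) \<and>
     (\<forall>d. \<phi> ` component V d = component W d) \<and>
     (\<forall>k. \<forall>v\<in>space V.
        \<phi> (op_e V k v) = op_e W k (\<phi> v) \<and>
        \<phi> (op_f V k v) = op_f W k (\<phi> v) \<and>
        \<phi> (op_psi_plus V k v) = op_psi_plus W k (\<phi> v) \<and>
        \<phi> (op_psi_minus V k v) = op_psi_minus W k (\<phi> v))"

definition linear_extension ::
  "('b \<Rightarrow> ('c \<Rightarrow>\<^sub>0 complex)) \<Rightarrow> ('b \<Rightarrow>\<^sub>0 complex) \<Rightarrow> ('c \<Rightarrow>\<^sub>0 complex)" where
  "linear_extension F x = (\<Sum>b \<in> Poly_Mapping.keys x. scale (Poly_Mapping.lookup x b) (F b))"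

text \<open>\<open>m b' b\<close> is the matrix coefficient \<open>\<langle>b'|X|b\<rangle>\<close>; every column has finite support in what follows.\<close>

definition matrix_op ::
  "'b set \<Rightarrow> ('b \<Rightarrow> 'b \<Rightarrow> complex) \<Rightarrow> ('b \<Rightarrow>\<^sub>0 complex) \<Rightarrow> ('b \<Rightarrow>\<^sub>0 complex)" where
  "matrix_op B m =
     linear_extension (\<lambda>b. \<Sum>b' | b' \<in> B \<and> m b' b \<noteq> 0. Poly_Mapping.single b' (m b' b))"

definition diagonal_op :: "('b \<Rightarrow> complex) \<Rightarrow> ('b \<Rightarrow>\<^sub>0 complex) \<Rightarrow> ('b \<Rightarrow>\<^sub>0 complex)" where
  "diagonal_op d = linear_extension (\<lambda>b. Poly_Mapping.single b (d b))"


section \<open>Evaluating rational functions after cancellation\<close>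

text \<open>
  The value of a fraction \<open>F\<close> under a ring homomorphism \<open>h\<close> of numerators and denominators,
  after cancelling common factors.  All representations \<open>P/Q\<close> of \<open>F\<close> with \<open>h Q \<noteq> 0\<close> yield the same
  value, and over a factorial ring there is one iff the reduced fraction is one.
\<close>

definition eval_fract :: "('a::idom \<Rightarrow> 'k::field) \<Rightarrow> 'a fract \<Rightarrow> 'k" where
  "eval_fract h F = (THE w. \<exists>P Q. F = Fraction_Field.Fract P Q \<and> h Q \<noteq> 0 \<and> w = h P / h Q)"

text \<open>
  Polynomials over the complex numbers in the variables \<open>X\<^sub>0, X\<^sub>1, X\<^sub>2, \<dots>\<close>.  Below, \<open>X\<^sub>0 = q\<^sub>1\<close>,
  \<open>X\<^sub>1 = q\<^sub>3\<close> and \<open>X\<^sub>i\<^sub>+\<^sub>1 = u\<^sub>i\<close> for \<open>i \<ge> 1\<close>; after the first substitution \<open>X\<^sub>2\<close> plays the role of \<open>u\<close>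
  and the variables beyond it no longer occur.
\<close>

type_synonym cpoly = "(nat \<Rightarrow>\<^sub>0 nat) \<Rightarrow>\<^sub>0 complex"

definition eval_cpoly :: "(complex \<Rightarrow> 'k) \<Rightarrow> (nat \<Rightarrow> 'k) \<Rightarrow> cpoly \<Rightarrow> 'k::comm_ring_1" where
  "eval_cpoly h x p =
     (\<Sum>m \<in> Poly_Mapping.keys p. h (Poly_Mapping.lookup p m) *
        (\<Prod>i \<in> Poly_Mapping.keys m. x i ^ Poly_Mapping.lookup m i))"

definition ratfun_const :: "complex \<Rightarrow> cpoly fract" where
  "ratfun_const c = Fraction_Field.Fract (Poly_Mapping.single 0 c) 1"

definition ratfun_var :: "nat \<Rightarrow> cpoly fract" where
  "ratfun_var i = Fraction_Field.Fract (Poly_Mapping.single (Poly_Mapping.single i 1) 1) 1"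

abbreviation "rf_q1 \<equiv> ratfun_var 0"
abbreviation "rf_q3 \<equiv> ratfun_var 1"
abbreviation "rf_q2 \<equiv> inverse (rf_q1 * rf_q3)"
abbreviation "rf_u i \<equiv> ratfun_var (i + 1)"

text \<open>
  \<open>u\<^sub>1 = u\<close> and \<open>u\<^sub>i = u\<^sub>i\<^sub>+\<^sub>1 q\<^sub>1\<^bsup>a\<^sub>i+1\<^esup> q\<^sub>3\<^bsup>b\<^sub>i+1\<^esup>\<close> for \<open>1 \<le> i \<le> n - 1\<close>, where \<open>b\<^sub>i = 0\<close>.
\<close>

definition resonant_u :: "(nat \<Rightarrow> nat) \<Rightarrow> nat \<Rightarrow> cpoly fract" where
  "resonant_u a i = rf_u 1 * (\<Prod>k\<in>{1..<i}. inverse (rf_q1 ^ (a k + 1) * rf_q3))"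

definition specialize_u :: "(nat \<Rightarrow> nat) \<Rightarrow> cpoly fract \<Rightarrow> cpoly fract" where
  "specialize_u a = eval_fract (eval_cpoly ratfun_const
     (\<lambda>i. if i = 0 then rf_q1 else if i = 1 then rf_q3 else resonant_u a (i - 1)))"

definition specialize_q :: "complex \<Rightarrow> complex \<Rightarrow> complex \<Rightarrow> cpoly fract \<Rightarrow> complex" where
  "specialize_q q1 q3 u = eval_fract (eval_cpoly (\<lambda>c. c)
     (\<lambda>i. if i = 0 then q1 else if i = 1 then q3 else u))"

definition specialize ::
  "(nat \<Rightarrow> nat) \<Rightarrow> complex \<Rightarrow> complex \<Rightarrow> complex \<Rightarrow> cpoly fract \<Rightarrow> complex" where
  "specialize a q1 q3 u F = specialize_q q1 q3 u (specialize_u a F)"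


section \<open>Matrix coefficients of tensor products\<close>

text \<open>
  Parts and components are numbered from 1.  An \<open>n\<close>-tuple of partitions is a function of the number
  of the component and the number of the part, equal to 0 outside the range of these numbers.

  The formulas are polymorphic in the field: for \<open>e\<close> and \<open>f\<close> it is the field of
  rational functions of the parameters, for \<open>\<psi>\<^sup>\<plusminus>(z)\<close> the field of Laurent series over it in \<open>z\<^sup>-\<^sup>1\<close> or \<open>z\<close>, so
  that division in the field performs the expansion.  \<open>Prod_any\<close> is the product of all factors different
  from 1, of which there are finitely many.
\<close>

definition psi_empty :: "'k \<Rightarrow> 'k \<Rightarrow> 'k::field" where
  "psi_empty q2 x = (1 - q2 * x) / (1 - x)"

definition psi_part :: "'k \<Rightarrow> 'k \<Rightarrow> 'k \<Rightarrow> (nat \<Rightarrow> nat) \<Rightarrow> nat \<Rightarrow> 'k \<Rightarrow> 'k::field" where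
  "psi_part q1 q2 q3 lam j x =
     ((1 - q1 powi int (lam j) * q3 ^ j * x) * (1 - q1 powi int (lam j) * q2 * q3 ^ (j - 1) * x)) /
     ((1 - q1 powi int (lam j) * q3 ^ (j - 1) * x) * (1 - q1 powi (int (lam j) - 1) * q3 ^ (j - 1) * x))"

definition psi_partition :: "'k \<Rightarrow> 'k \<Rightarrow> 'k \<Rightarrow> (nat \<Rightarrow> nat) \<Rightarrow> 'k \<Rightarrow> 'k::field" where
  "psi_partition q1 q2 q3 lam x = psi_empty q2 x *
     Prod_any (\<lambda>j. if 1 \<le> j then psi_part q1 q2 q3 lam j x / psi_part q1 q2 q3 (\<lambda>_. 0) j x else 1)"

definition add_box :: "(nat \<Rightarrow> nat \<Rightarrow> nat) \<Rightarrow> nat \<Rightarrow> nat \<Rightarrow> (nat \<Rightarrow> nat \<Rightarrow> nat)" where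
  "add_box lam i s = lam(i := (lam i)(s := lam i s + 1))"

text \<open>\<open>z\<^sup>-\<^sup>k\<close>-coefficient of \<open>\<langle>\<lambda> + 1\<^sub>s\<^sup>(\<^sup>i\<^sup>)|e(z)|\<lambda>\<rangle>\<close>: \<open>\<delta>(v/z)\<close> contributes \<open>v\<^sup>k\<close>.\<close>

definition tensor_e ::
  "'k \<Rightarrow> 'k \<Rightarrow> 'k \<Rightarrow> (nat \<Rightarrow> 'k) \<Rightarrow> (nat \<Rightarrow> nat \<Rightarrow> nat) \<Rightarrow> nat \<Rightarrow> nat \<Rightarrow> int \<Rightarrow> 'k::field" where
  "tensor_e q1 q2 q3 u lam i s k =
     (let v = q1 ^ lam i s * q3 ^ (s - 1) * u i in
       v powi k / (1 - q1) *
       (\<Prod>j\<in>{1..<i}. psi_partition q1 q2 q3 (lam j) (u j / v)) *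
       (\<Prod>t\<in>{1..<s}. psi_part q1 q2 q3 (lam i) t (u i / v)))"

text \<open>\<open>z\<^sup>-\<^sup>k\<close>-coefficient of \<open>\<langle>\<lambda>|f(z)|\<lambda> + 1\<^sub>s\<^sup>(\<^sup>i\<^sup>)\<rangle>\<close>.\<close>

definition tensor_f ::
  "nat \<Rightarrow> 'k \<Rightarrow> 'k \<Rightarrow> 'k \<Rightarrow> (nat \<Rightarrow> 'k) \<Rightarrow> (nat \<Rightarrow> nat \<Rightarrow> nat) \<Rightarrow> nat \<Rightarrow> nat \<Rightarrow> int \<Rightarrow> 'k::field" where
  "tensor_f n q1 q2 q3 u lam i s k =
     (let v = q1 ^ lam i s * q3 ^ (s - 1) * u i in
       q1 * v powi k / (1 - q1) *
       ((1 - q2 * q3 ^ s * u i / v) / (1 - q3 ^ s * u i / v)) *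
       Prod_any (\<lambda>t. if s < t then psi_part q1 q2 q3 (lam i) t (u i / v) /
                                  psi_part q1 q2 q3 (\<lambda>_. 0) t (u i / v) else 1) *
       (\<Prod>j\<in>{i<..n}. psi_partition q1 q2 q3 (lam j) (u j / v)))"

definition tensor_psi ::
  "nat \<Rightarrow> 'k \<Rightarrow> 'k \<Rightarrow> 'k \<Rightarrow> (nat \<Rightarrow> 'k) \<Rightarrow> (nat \<Rightarrow> nat \<Rightarrow> nat) \<Rightarrow> 'k \<Rightarrow> 'k::field" where
  "tensor_psi n q1 q2 q3 u lam z = (\<Prod>i\<in>{1..n}. psi_partition q1 q2 q3 (lam i) (u i / z))"

text \<open>
  In the expansion in \<open>z\<^sup>-\<^sup>1\<close> the variable of the Laurent series is \<open>z\<^sup>-\<^sup>1\<close>, in the expansion in \<open>z\<close> it is \<open>z\<close>.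
\<close>

definition tensor_psi_plus :: "nat \<Rightarrow> (nat \<Rightarrow> nat \<Rightarrow> nat) \<Rightarrow> int \<Rightarrow> cpoly fract" where
  "tensor_psi_plus n lam k = fls_nth
     (tensor_psi n (fls_const rf_q1) (fls_const rf_q2) (fls_const rf_q3) (\<lambda>i. fls_const (rf_u i)) lam
        (inverse fls_X)) k"

definition tensor_psi_minus :: "nat \<Rightarrow> (nat \<Rightarrow> nat \<Rightarrow> nat) \<Rightarrow> int \<Rightarrow> cpoly fract" where
  "tensor_psi_minus n lam k = fls_nth
     (tensor_psi n (fls_const rf_q1) (fls_const rf_q2) (fls_const rf_q3) (\<lambda>i. fls_const (rf_u i)) lam
        fls_X) (- k)"


section \<open>The module M\<close>

definition finite_partition :: "(nat \<Rightarrow> nat) \<Rightarrow> bool" where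
  "finite_partition lam \<longleftrightarrow> lam 0 = 0 \<and> (\<forall>j\<ge>1. lam (j + 1) \<le> lam j) \<and> finite {j. lam j \<noteq> 0}"

definition M_labels :: "nat \<Rightarrow> (nat \<Rightarrow> nat) \<Rightarrow> (nat \<Rightarrow> nat \<Rightarrow> nat) set" where
  "M_labels n a = {lam.
     (\<forall>i\<in>{1..n}. finite_partition (lam i)) \<and> (\<forall>i. i \<notin> {1..n} \<longrightarrow> lam i = (\<lambda>_. 0)) \<and>
     (\<forall>i\<in>{1..<n}. \<forall>j\<ge>1. int (lam i j) \<ge> int (lam (i + 1) j) - int (a i)) \<and>
     (\<forall>j\<ge>1. int (lam n j) \<ge> int (lam 1 (j + 1)) - int (a n))}"

text \<open>The sums over \<open>(i, s)\<close> have at most one term; they are 0 where the matrix coefficient is zero.\<close>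

definition M_rep ::
  "nat \<Rightarrow> (nat \<Rightarrow> nat) \<Rightarrow> complex \<Rightarrow> complex \<Rightarrow> complex \<Rightarrow> (nat \<Rightarrow> nat \<Rightarrow> nat) graded_rep" where
  "M_rep n a q1 q3 u = \<lparr>
     labels = M_labels n a,
     label_deg = (\<lambda>lam. \<Sum>i\<in>{1..n}. Sum_any (\<lambda>s. int (lam i s))),
     op_e = (\<lambda>k. matrix_op (M_labels n a) (\<lambda>\<mu> lam.
       \<Sum>(i, s) | i \<in> {1..n} \<and> 1 \<le> s \<and> \<mu> = add_box lam i s.
         specialize a q1 q3 u (tensor_e rf_q1 rf_q2 rf_q3 rf_u lam i s k))),
     op_f = (\<lambda>k. matrix_op (M_labels n a) (\<lambda>lam \<mu>.
       \<Sum>(i, s) | i \<in> {1..n} \<and> 1 \<le> s \<and> \<mu> = add_box lam i s.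
         specialize a q1 q3 u (tensor_f n rf_q1 rf_q2 rf_q3 rf_u lam i s k))),
     op_psi_plus = (\<lambda>k. diagonal_op (\<lambda>lam. specialize a q1 q3 u (tensor_psi_plus n lam k))),
     op_psi_minus = (\<lambda>k. diagonal_op (\<lambda>lam. specialize a q1 q3 u (tensor_psi_minus n lam k))) \<rparr>"


section \<open>The module G\<close>

text \<open>
  \<open>\<Lambda>\<^sup>0\<close>; the sequences are numbered from 1, and the entry with number 0 is pinned to the value 0,
  which the formula takes there by truncated subtraction.
\<close>

definition vac :: "nat \<Rightarrow> nat \<Rightarrow> (nat \<Rightarrow> nat) \<Rightarrow> nat \<Rightarrow> int" where
  "vac n r a j = - (int ((j - 1) div n) * int r) - int (\<Sum>k\<in>{1..(j - 1) mod n}. a k)"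

definition G_labels :: "nat \<Rightarrow> nat \<Rightarrow> (nat \<Rightarrow> nat) \<Rightarrow> (nat \<Rightarrow> int) set" where
  "G_labels n r a = {\<Lambda>. \<Lambda> 0 = 0 \<and> (\<forall>j\<ge>1. \<Lambda> j \<ge> \<Lambda> (j + 1)) \<and>
     (\<forall>j\<ge>1. \<Lambda> j - \<Lambda> (j + n) \<ge> int r) \<and> (\<forall>\<^sub>F j in sequentially. \<Lambda> j = vac n r a j)}"

definition y_part :: "'k \<Rightarrow> 'k \<Rightarrow> 'k \<Rightarrow> (nat \<Rightarrow> int) \<Rightarrow> nat \<Rightarrow> 'k \<Rightarrow> 'k::field" where
  "y_part q1 q2 q3 \<Lambda> j x =
     ((1 - q1 powi \<Lambda> j * q2 ^ j * x) * (1 - q1 powi \<Lambda> j * q3 * q2 ^ (j - 1) * x)) /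
     ((1 - q1 powi \<Lambda> j * q2 ^ (j - 1) * x) * (1 - q1 powi (\<Lambda> j - 1) * q2 ^ (j - 1) * x))"

definition G_psi ::
  "nat \<Rightarrow> nat \<Rightarrow> (nat \<Rightarrow> nat) \<Rightarrow> 'k \<Rightarrow> 'k \<Rightarrow> 'k \<Rightarrow> 'k \<Rightarrow> (nat \<Rightarrow> int) \<Rightarrow> 'k \<Rightarrow> 'k::field" where
  "G_psi n r a q1 q2 q3 u \<Lambda> z =
     (\<Prod>i\<in>{0..<n}. psi_empty q2 (q1 powi (- int (\<Sum>k\<in>{1..i}. a k)) * q2 ^ i * u / z)) *
     Prod_any (\<lambda>j. if 1 \<le> j then y_part q1 q2 q3 \<Lambda> j (u / z) / y_part q1 q2 q3 (vac n r a) j (u / z)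
                   else 1)"

definition G_psi_plus ::
  "nat \<Rightarrow> nat \<Rightarrow> (nat \<Rightarrow> nat) \<Rightarrow> complex \<Rightarrow> complex \<Rightarrow> complex \<Rightarrow> complex \<Rightarrow> (nat \<Rightarrow> int) \<Rightarrow> int \<Rightarrow> complex"
  where
  "G_psi_plus n r a q1 q2 q3 u \<Lambda> k = fls_nth
     (G_psi n r a (fls_const q1) (fls_const q2) (fls_const q3) (fls_const u) \<Lambda> (inverse fls_X)) k"

definition G_psi_minus ::
  "nat \<Rightarrow> nat \<Rightarrow> (nat \<Rightarrow> nat) \<Rightarrow> complex \<Rightarrow> complex \<Rightarrow> complex \<Rightarrow> complex \<Rightarrow> (nat \<Rightarrow> int) \<Rightarrow> int \<Rightarrow> complex"
  where
  "G_psi_minus n r a q1 q2 q3 u \<Lambda> k = fls_nth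
     (G_psi n r a (fls_const q1) (fls_const q2) (fls_const q3) (fls_const u) \<Lambda> fls_X) (- k)"

definition add_one :: "(nat \<Rightarrow> int) \<Rightarrow> nat \<Rightarrow> (nat \<Rightarrow> int)" where
  "add_one \<Lambda> i = \<Lambda>(i := \<Lambda> i + 1)"

definition G_e ::
  "complex \<Rightarrow> complex \<Rightarrow> complex \<Rightarrow> complex \<Rightarrow> (nat \<Rightarrow> int) \<Rightarrow> nat \<Rightarrow> int \<Rightarrow> complex" where
  "G_e q1 q2 q3 u \<Lambda> i k =
     (let v = q1 powi \<Lambda> i * q2 ^ (i - 1) * u in
       v powi k / (1 - q1) * (\<Prod>j\<in>{1..<i}. y_part q1 q2 q3 \<Lambda> j (u / v)))"

text \<open>The bracket in the matrix coefficient of \<open>f(z)\<close>, as a function of \<open>z\<close>.\<close>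

definition G_bracket ::
  "nat \<Rightarrow> nat \<Rightarrow> (nat \<Rightarrow> nat) \<Rightarrow> 'k \<Rightarrow> 'k \<Rightarrow> 'k \<Rightarrow> 'k \<Rightarrow> (nat \<Rightarrow> int) \<Rightarrow> nat \<Rightarrow> 'k \<Rightarrow> 'k::field" where
  "G_bracket n r a q1 q2 q3 u \<Lambda> i z =
     Prod_any (\<lambda>j. if i < j then y_part q1 q2 q3 \<Lambda> j (u / z) / y_part q1 q2 q3 (vac n r a) j (u / z)
                   else 1) *
     (\<Prod>j\<in>{0..<n}. psi_empty q2 (q1 powi vac n r a (i + j + 1) * q2 ^ (i + j) * u / z))"

abbreviation ratfun1 :: "complex poly \<Rightarrow> complex poly fract" where
  "ratfun1 p \<equiv> Fraction_Field.Fract p 1"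

definition G_f ::
  "nat \<Rightarrow> nat \<Rightarrow> (nat \<Rightarrow> nat) \<Rightarrow> complex \<Rightarrow> complex \<Rightarrow> complex \<Rightarrow> complex \<Rightarrow>
   (nat \<Rightarrow> int) \<Rightarrow> nat \<Rightarrow> int \<Rightarrow> complex" where
  "G_f n r a q1 q2 q3 u \<Lambda> i k =
     (let v = q1 powi \<Lambda> i * q2 ^ (i - 1) * u in
       q1 * v powi k / (1 - q1) *
       eval_fract (\<lambda>p. poly p v)
         (G_bracket n r a (ratfun1 [:q1:]) (ratfun1 [:q2:]) (ratfun1 [:q3:]) (ratfun1 [:u:]) \<Lambda> i
            (ratfun1 [:0, 1:])))"

definition G_rep ::
  "nat \<Rightarrow> nat \<Rightarrow> (nat \<Rightarrow> nat) \<Rightarrow> complex \<Rightarrow> complex \<Rightarrow> complex \<Rightarrow> complex \<Rightarrow> (nat \<Rightarrow> int) graded_rep"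
  where
  "G_rep n r a q1 q2 q3 u = \<lparr>
     labels = G_labels n r a,
     label_deg = (\<lambda>\<Lambda>. Sum_any (\<lambda>j. \<Lambda> j - vac n r a j)),
     op_e = (\<lambda>k. matrix_op (G_labels n r a) (\<lambda>M \<Lambda>.
       \<Sum>i | 1 \<le> i \<and> M = add_one \<Lambda> i. G_e q1 q2 q3 u \<Lambda> i k)),
     op_f = (\<lambda>k. matrix_op (G_labels n r a) (\<lambda>\<Lambda> M.
       \<Sum>i | 1 \<le> i \<and> M = add_one \<Lambda> i. G_f n r a q1 q2 q3 u \<Lambda> i k)),
     op_psi_plus = (\<lambda>k. diagonal_op (\<lambda>\<Lambda>. G_psi_plus n r a q1 q2 q3 u \<Lambda> k)),
     op_psi_minus = (\<lambda>k. diagonal_op (\<lambda>\<Lambda>. G_psi_minus n r a q1 q2 q3 u \<Lambda> k)) \<rparr>"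


section \<open>The bijection of basis labels\<close>

text \<open>\<open>j = n s + i\<close> with \<open>1 \<le> i \<le> n\<close> means \<open>i = (j - 1) mod n + 1\<close> and \<open>s = (j - 1) div n\<close>.\<close>

definition iota :: "nat \<Rightarrow> nat \<Rightarrow> (nat \<Rightarrow> nat) \<Rightarrow> (nat \<Rightarrow> nat \<Rightarrow> nat) \<Rightarrow> (nat \<Rightarrow> int)" where
  "iota n r a lam j =
     (if j = 0 then 0 else int (lam ((j - 1) mod n + 1) ((j - 1) div n + 1)) + vac n r a j)"

definition not_root_of_unity :: "complex \<Rightarrow> bool" where
  "not_root_of_unity q \<longleftrightarrow> (\<forall>k::nat. 1 \<le> k \<longrightarrow> q ^ k \<noteq> 1)"

end

theory Submission
  imports Defs
begin

text \<open>
  Why the two modules are isomorphic.  To the entry \<open>\<Lambda>\<^sub>j\<close> of an admissible partition belongs the weight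
  \<open>w\<^sub>j = q\<^sub>1^\<Lambda>\<^sub>j q\<^sub>2^(j - 1) u\<close>.  With a cut-off \<open>N\<close> beyond which \<open>\<Lambda>\<close> agrees with the vacuum, all structure
  constants of \<open>G\<close> are finite products of one local factor: \<open>box_factor\<close> at \<open>w\<^sub>j / w\<^sub>p\<close> for the columns \<open>j \<le> N\<close>,
  and \<open>psi_empty\<close> for the \<open>n\<close> columns that follow, into which the infinite rest telescopes because
  \<open>q\<^sub>3 = q\<^sub>1^(- r) q\<^sub>2^n\<close> at the resonance.  Raising \<open>\<Lambda>\<^sub>p\<close> by \<open>e(z)\<close> takes the factors with \<open>j < p\<close>, lowering it
  again by \<open>f(z)\<close> those with \<open>j > p\<close>, and \<open>\<psi>\<close> takes all of them.

  In the specialized tensor product the part \<open>s\<close> of the component \<open>i\<close> has precisely the weight of the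
  position \<open>n (s - 1) + i\<close>, and the structure constants are the same products, except that earlier and
  later positions are meant in another linear order: first by component, then by row
  (\<open>sp_tensor_e\<close>, \<open>sp_tensor_f\<close>, \<open>psi_specialized\<close>).  No factor has a zero or a pole at an addable position
  (\<open>addable_generic\<close>), so both substitution steps are plain evaluations.

  Consequently \<open>\<psi>\<close> has the same eigenvalues on \<open>|\<lambda>\<rangle>\<close> and on its image, the products of the coefficients of \<open>e\<close>
  and \<open>f\<close> along an edge agree, and for either order the coefficients of \<open>e\<close> obey the same exchange law when
  two positions are raised in succession (\<open>exchangeable\<close>).  The ratio of the two coefficients of \<open>e\<close> is
  therefore a multiplicative cocycle on the graph of admissible partitions, and since all its cycles are
  generated by squares, it is a coboundary: the resulting \<open>c\<^sub>\<Lambda>\<close> intertwine \<open>e\<close>, \<open>f\<close> and \<open>\<psi>\<close>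
  (\<open>cocycle_solution\<close>, \<open>coefficients_match\<close>).

  An isomorphism of modules also requires that \<open>G\<close> and \<open>M\<close> satisfy the defining relations.  For \<open>G\<close> this is
  verified directly in \<open>G_module\<close>: the quadratic relations are the exchange law; the commutator of \<open>e\<close> and \<open>f\<close>
  is the partial fraction decomposition of the eigenvalue of \<open>\<psi>\<close>, whose poles are simple and lie at the weights
  of the addable and removable positions (\<open>psi_difference\<close>); the cubic relations reduce by the exchange law
  to one polynomial identity (\<open>serre_identity\<close>).  The bijective intertwiner then transports the relations
  to \<open>M\<close> (\<open>module_V\<close>).
\<close>

section \<open>Specialization of rational functions\<close>

text \<open>The contribution of a single part, \<open>psi_part\<close> or \<open>y_part\<close>, as a function of the ratio of two weights.\<close>

definition box_factor :: "'k \<Rightarrow> 'k \<Rightarrow> 'k \<Rightarrow> 'k \<Rightarrow> 'k::field" where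
  "box_factor q1 q2 q3 x = ((1 - q3 * x) * (1 - q2 * x)) / ((1 - x) * (1 - x / q1))"

definition g_cubic :: "'k \<Rightarrow> 'k \<Rightarrow> 'k \<Rightarrow> 'k \<Rightarrow> 'k \<Rightarrow> 'k::field" where
  "g_cubic q1 q2 q3 z w = (z - q1 * w) * (z - q2 * w) * (z - q3 * w)"

text \<open>
  A specialization in the sense of places: a partially defined ring homomorphism between fields,
  presented as the graph of a single-valued relation.  Cancelling before substituting defines such a
  relation, and it is closed under all field operations whose result makes sense; a formula is then
  evaluated by following its syntax.
\<close>

locale specialization =
  fixes S :: "'a::field \<Rightarrow> 'k::field \<Rightarrow> bool"
  assumes one: "S 1 1"
    and add: "S x a \<Longrightarrow> S y b \<Longrightarrow> S (x + y) (a + b)"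
    and mult: "S x a \<Longrightarrow> S y b \<Longrightarrow> S (x * y) (a * b)"
    and uminus: "S x a \<Longrightarrow> S (- x) (- a)"
    and inverse: "S x a \<Longrightarrow> a \<noteq> 0 \<Longrightarrow> S (inverse x) (inverse a)"
    and unique: "S x a \<Longrightarrow> S x b \<Longrightarrow> a = b"
begin

lemma zero: "S 0 0"
  using add[OF one uminus[OF one]] by simp

lemma nonzero: "S x a \<Longrightarrow> a \<noteq> 0 \<Longrightarrow> x \<noteq> 0"
  using zero unique by blast

lemma diff: "S x a \<Longrightarrow> S y b \<Longrightarrow> S (x - y) (a - b)"
  using add[OF _ uminus] by fastforce

lemma divide: "S x a \<Longrightarrow> S y b \<Longrightarrow> b \<noteq> 0 \<Longrightarrow> S (x / y) (a / b)"
  using mult[OF _ inverse] by (simp add: divide_inverse)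

lemma power: "S x a \<Longrightarrow> S (x ^ m) (a ^ m)"
  by (induction m) (auto intro: one mult)

lemma power_int: "S x a \<Longrightarrow> a \<noteq> 0 \<Longrightarrow> S (x powi k) (a powi k)"
  by (auto simp: power_int_def intro: power inverse)

lemma prod: "(\<And>i. i \<in> A \<Longrightarrow> S (x i) (a i)) \<Longrightarrow> S (\<Prod>i\<in>A. x i) (\<Prod>i\<in>A. a i)"
  by (induction A rule: infinite_finite_induct) (auto intro: one mult)

lemma sum: "(\<And>i. i \<in> A \<Longrightarrow> S (x i) (a i)) \<Longrightarrow> S (\<Sum>i\<in>A. x i) (\<Sum>i\<in>A. a i)"
  by (induction A rule: infinite_finite_induct) (auto intro: zero add)

lemma box_factor:
  assumes "S Q1 q1" "S Q2 q2" "S Q3 q3" "S x a" and "q1 \<noteq> 0" "a \<noteq> 1" "a \<noteq> q1"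
  shows "S (box_factor Q1 Q2 Q3 x) (box_factor q1 q2 q3 a)"
  unfolding box_factor_def using assms by (intro divide mult diff one) auto

lemma psi_empty:
  assumes "S Q2 q2" "S x a" and "a \<noteq> 1"
  shows "S (psi_empty Q2 x) (psi_empty q2 a)"
  unfolding psi_empty_def using assms by (intro divide mult diff one) auto

end

text \<open>
  For an inverse one needs that the intermediate value is non-zero as soon as the final one is, which is
  \<open>nonzero\<close>.
\<close>

lemma specialization_compose:
  assumes "specialization S" and "specialization T"
  shows "specialization (\<lambda>x z. \<exists>y. S x y \<and> T y z)"
proof -
  interpret S: specialization S by fact
  interpret T: specialization T by fact
  show ?thesis
  proof
    show "\<exists>y. S (inverse x) y \<and> T y (inverse a)" if "\<exists>y. S x y \<and> T y a" "a \<noteq> 0" for x a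
      using that S.inverse T.inverse T.nonzero by blast
  next
    show "\<exists>y. S 1 y \<and> T y 1" using S.one T.one by blast
  next
    fix x a y b assume *: "\<exists>z. S x z \<and> T z a" "\<exists>z. S y z \<and> T z b"
    then show "\<exists>z. S (x + y) z \<and> T z (a + b)" using S.add T.add by meson
    show "\<exists>z. S (x * y) z \<and> T z (a * b)" using S.mult T.mult * by meson
  next
    fix x a assume *: "\<exists>z. S x z \<and> T z a"
    show "\<exists>z. S (- x) z \<and> T z (- a)" using S.uminus T.uminus * by meson
    show "a = b" if "\<exists>z. S x z \<and> T z b" for b
      using * that S.unique T.unique by metis
  qed
qed

definition evaluates :: "('a::idom \<Rightarrow> 'k::field) \<Rightarrow> 'a fract \<Rightarrow> 'k \<Rightarrow> bool" where
  "evaluates h F w \<longleftrightarrow> (\<exists>P Q. F = Fraction_Field.Fract P Q \<and> h Q \<noteq> 0 \<and> w = h P / h Q)"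

locale ring_hom_to_field =
  fixes h :: "'a::idom \<Rightarrow> 'k::field"
  assumes hom_one: "h 1 = 1"
    and hom_add: "h (x + y) = h x + h y"
    and hom_mult: "h (x * y) = h x * h y"
begin

lemma hom_zero: "h 0 = 0"
  using hom_add[of 0 0] by (metis add_cancel_left_left add_0_left)

lemma hom_uminus: "h (- x) = - h x"
  using hom_add[of x "- x"] hom_zero by (simp add: eq_neg_iff_add_eq_0 add.commute)

lemma specialization_evaluates: "specialization (evaluates h)"
proof
  show "evaluates h 1 1"
    unfolding evaluates_def by (intro exI[of _ 1]) (simp add: hom_one One_fract_def)
next
  fix x y a b assume "evaluates h x a" "evaluates h y b"
  then obtain P Q P' Q' where *: "x = Fraction_Field.Fract P Q" "h Q \<noteq> 0" "a = h P / h Q"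
    "y = Fraction_Field.Fract P' Q'" "h Q' \<noteq> 0" "b = h P' / h Q'"
    unfolding evaluates_def by blast
  then have nz: "Q \<noteq> 0" "Q' \<noteq> 0" using hom_zero by auto
  show "evaluates h (x + y) (a + b)" unfolding evaluates_def
    by (rule exI[of _ "P * Q' + P' * Q"], rule exI[of _ "Q * Q'"])
      (use * nz in \<open>auto simp: hom_add hom_mult field_simps\<close>)
  show "evaluates h (x * y) (a * b)" unfolding evaluates_def
    by (rule exI[of _ "P * P'"], rule exI[of _ "Q * Q'"])
      (use * nz in \<open>auto simp: hom_mult\<close>)
next
  fix x a assume "evaluates h x a"
  then obtain P Q where *: "x = Fraction_Field.Fract P Q" "h Q \<noteq> 0" "a = h P / h Q"
    unfolding evaluates_def by blast
  show "evaluates h (- x) (- a)" unfolding evaluates_def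
    by (rule exI[of _ "- P"], rule exI[of _ "Q"]) (use * in \<open>auto simp: hom_uminus\<close>)
  assume "a \<noteq> 0"
  then show "evaluates h (inverse x) (inverse a)" unfolding evaluates_def
    by (intro exI[of _ Q] exI[of _ P]) (use * in auto)
next
  fix x a b assume "evaluates h x a" "evaluates h x b"
  then obtain P Q P' Q' where *: "x = Fraction_Field.Fract P Q" "h Q \<noteq> 0" "a = h P / h Q"
    "x = Fraction_Field.Fract P' Q'" "h Q' \<noteq> 0" "b = h P' / h Q'"
    unfolding evaluates_def by blast
  then have "Q \<noteq> 0" "Q' \<noteq> 0" using hom_zero by auto
  then have "P * Q' = P' * Q" using * by (simp add: eq_fract)
  then have "h P * h Q' = h P' * h Q" by (metis hom_mult)
  then show "a = b" using * by (simp add: frac_eq_eq)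
qed

lemma eval_fract_eq: "evaluates h F w \<Longrightarrow> eval_fract h F = w"
proof -
  assume w: "evaluates h F w"
  have "eval_fract h F = (THE w. evaluates h F w)"
    unfolding eval_fract_def evaluates_def ..
  also have "\<dots> = w"
    using w specialization.unique[OF specialization_evaluates] by (intro the_equality) blast+
  finally show ?thesis .
qed

lemma evaluates_Fract_one: "evaluates h (Fraction_Field.Fract P 1) (h P)"
  unfolding evaluates_def by (rule exI[of _ P], rule exI[of _ 1]) (simp add: hom_one)

end

section \<open>Substitution into polynomials\<close>

definition eval_monom :: "(nat \<Rightarrow> 'k) \<Rightarrow> (nat \<Rightarrow>\<^sub>0 nat) \<Rightarrow> 'k::comm_ring_1" where
  "eval_monom x m = (\<Prod>i\<in>Poly_Mapping.keys m. x i ^ Poly_Mapping.lookup m i)"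

lemma eval_monom_superset:
  assumes "finite A" "Poly_Mapping.keys m \<subseteq> A"
  shows "eval_monom x m = (\<Prod>i\<in>A. x i ^ Poly_Mapping.lookup m i)"
  unfolding eval_monom_def using assms
  by (intro prod.mono_neutral_left) (auto simp: in_keys_iff)

lemma eval_monom_add: "eval_monom x (m + m') = eval_monom x m * eval_monom x m'"
proof -
  let ?A = "Poly_Mapping.keys m \<union> Poly_Mapping.keys m'"
  have "eval_monom x (m + m') = (\<Prod>i\<in>?A. x i ^ Poly_Mapping.lookup (m + m') i)"
    using Poly_Mapping.keys_add[of m m'] by (intro eval_monom_superset) auto
  also have "\<dots> = (\<Prod>i\<in>?A. x i ^ Poly_Mapping.lookup m i) * (\<Prod>i\<in>?A. x i ^ Poly_Mapping.lookup m' i)"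
    by (simp add: lookup_add power_add prod.distrib)
  also have "\<dots> = eval_monom x m * eval_monom x m'"
    using eval_monom_superset[of ?A m x] eval_monom_superset[of ?A m' x] by auto
  finally show ?thesis .
qed

lemma eval_cpoly_superset:
  assumes "h 0 = 0" "finite A" "Poly_Mapping.keys p \<subseteq> A"
  shows "eval_cpoly h x p = (\<Sum>m\<in>A. h (Poly_Mapping.lookup p m) * eval_monom x m)"
  unfolding eval_cpoly_def eval_monom_def[symmetric] using assms
  by (intro sum.mono_neutral_left) (auto simp: in_keys_iff)

lemma sum_single_lookup: "(\<Sum>m\<in>Poly_Mapping.keys p. Poly_Mapping.single m (Poly_Mapping.lookup p m)) = p"
  by (rule poly_mapping_eqI) (auto simp: lookup_sum lookup_single when_def in_keys_iff)

text \<open>Multiplicativity is checked on monomials, into which both factors are expanded.\<close>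

lemma ring_hom_eval_cpoly:
  fixes x :: "nat \<Rightarrow> 'k::field"
  assumes "ring_hom_to_field h"
  shows "ring_hom_to_field (eval_cpoly h x)"
proof -
  interpret h: ring_hom_to_field h by fact
  have add: "eval_cpoly h x (p + q) = eval_cpoly h x p + eval_cpoly h x q" for p q
  proof -
    let ?A = "Poly_Mapping.keys p \<union> Poly_Mapping.keys q"
    have "eval_cpoly h x r = (\<Sum>m\<in>?A. h (Poly_Mapping.lookup r m) * eval_monom x m)"
      if "Poly_Mapping.keys r \<subseteq> ?A" for r
      using that h.hom_zero by (intro eval_cpoly_superset) auto
    then show ?thesis using Poly_Mapping.keys_add[of p q]
      by (simp add: lookup_add h.hom_add algebra_simps sum.distrib)
  qed
  have zero: "eval_cpoly h x 0 = 0" by (simp add: eval_cpoly_def)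
  have sum: "eval_cpoly h x (\<Sum>i\<in>A. p i) = (\<Sum>i\<in>A. eval_cpoly h x (p i))" for A :: "'i set" and p
    by (induction A rule: infinite_finite_induct) (auto simp: add zero)
  have sum': "eval_cpoly h x (\<Sum>i\<in>A. p i) = (\<Sum>i\<in>A. eval_cpoly h x (p i))"
    for A :: "(nat \<Rightarrow>\<^sub>0 nat) set" and p
    by (induction A rule: infinite_finite_induct) (auto simp: add zero)
  have single: "eval_cpoly h x (Poly_Mapping.single m c) = h c * eval_monom x m" for m c
    using h.hom_zero by (subst eval_cpoly_superset[of _ "{m}"]) auto
  have mult: "eval_cpoly h x (p * q) = eval_cpoly h x p * eval_cpoly h x q" for p q
  proof -
    have "p * q = (\<Sum>m\<in>Poly_Mapping.keys p. Poly_Mapping.single m (Poly_Mapping.lookup p m)) *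
        (\<Sum>m\<in>Poly_Mapping.keys q. Poly_Mapping.single m (Poly_Mapping.lookup q m))"
      by (simp add: sum_single_lookup)
    also have "eval_cpoly h x \<dots> = (\<Sum>m\<in>Poly_Mapping.keys p. \<Sum>m'\<in>Poly_Mapping.keys q.
        (h (Poly_Mapping.lookup p m) * eval_monom x m) * (h (Poly_Mapping.lookup q m') * eval_monom x m'))"
      by (simp add: sum_product sum' mult_single single h.hom_mult eval_monom_add mult_ac)
    also have "\<dots> = eval_cpoly h x p * eval_cpoly h x q"
      by (simp add: sum_product[symmetric] eval_cpoly_def eval_monom_def)
    finally show ?thesis .
  qed
  show ?thesis
    by standard (auto simp: add mult single[of 0 1, simplified] eval_monom_def h.hom_one)
qed

lemma ring_hom_ratfun_const: "ring_hom_to_field ratfun_const"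
  by standard (auto simp: ratfun_const_def One_fract_def single_add mult_single)

lemma ring_hom_id: "ring_hom_to_field (\<lambda>c::complex. c)"
  by standard auto

lemma eval_cpoly_var:
  assumes "ring_hom_to_field h"
  shows "eval_cpoly h x (Poly_Mapping.single (Poly_Mapping.single i 1) 1) = (x i :: 'k::field)"
  by (simp add: eval_cpoly_def ring_hom_to_field.hom_one[OF assms])

text \<open>
  The two substitution steps performed one after the other, as a relation: it records that both steps are
  defined, and not just the value that a definite description would return.
\<close>

definition specializes :: "(nat \<Rightarrow> nat) \<Rightarrow> complex \<Rightarrow> complex \<Rightarrow> complex \<Rightarrow> cpoly fract \<Rightarrow> complex \<Rightarrow> bool" where
  "specializes a q1 q3 u F w \<longleftrightarrow>
     (\<exists>F'. evaluates (eval_cpoly ratfun_const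
              (\<lambda>i. if i = 0 then rf_q1 else if i = 1 then rf_q3 else resonant_u a (i - 1))) F F' \<and>
           evaluates (eval_cpoly (\<lambda>c. c) (\<lambda>i. if i = 0 then q1 else if i = 1 then q3 else u)) F' w)"

lemma specialization_specializes: "specialization (specializes a q1 q3 u)"
  unfolding specializes_def
  by (intro specialization_compose ring_hom_to_field.specialization_evaluates
        ring_hom_eval_cpoly ring_hom_ratfun_const ring_hom_id)

lemma specialize_eq: "specializes a q1 q3 u F w \<Longrightarrow> specialize a q1 q3 u F = w"
  unfolding specializes_def specialize_def specialize_u_def specialize_q_def
  using ring_hom_to_field.eval_fract_eq[OF ring_hom_eval_cpoly[OF ring_hom_ratfun_const]]
    ring_hom_to_field.eval_fract_eq[OF ring_hom_eval_cpoly[OF ring_hom_id]] by blast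

lemma evaluates_ratfun_var:
  assumes "ring_hom_to_field h"
  shows "evaluates (eval_cpoly h x) (ratfun_var i) (x i)"
  unfolding ratfun_var_def
  using ring_hom_to_field.evaluates_Fract_one[OF ring_hom_eval_cpoly[OF assms]] eval_cpoly_var[OF assms]
  by metis

lemma specializes_q1: "specializes a q1 q3 u rf_q1 q1"
  and specializes_q3: "specializes a q1 q3 u rf_q3 q3"
proof -
  let ?x = "\<lambda>i. if i = 0 then rf_q1 else if i = 1 then rf_q3 else resonant_u a (i - 1)"
  let ?y = "\<lambda>i::nat. if i = 0 then q1 else if i = 1 then q3 else u"
  show "specializes a q1 q3 u rf_q1 q1" unfolding specializes_def
    using evaluates_ratfun_var[OF ring_hom_ratfun_const, of ?x 0] evaluates_ratfun_var[OF ring_hom_id, of ?y 0]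
    by (intro exI[of _ rf_q1]) simp
  show "specializes a q1 q3 u rf_q3 q3" unfolding specializes_def
    using evaluates_ratfun_var[OF ring_hom_ratfun_const, of ?x 1] evaluates_ratfun_var[OF ring_hom_id, of ?y 1]
    by (intro exI[of _ rf_q3]) simp
qed

lemma specializes_u:
  assumes "q1 \<noteq> 0" "q3 \<noteq> 0" "1 \<le> i"
  shows "specializes a q1 q3 u (rf_u i) (u * (\<Prod>k\<in>{1..<i}. inverse (q1 ^ (a k + 1) * q3)))"
proof -
  let ?x = "\<lambda>i. if i = 0 then q1 else if i = 1 then q3 else u"
  interpret E: specialization "evaluates (eval_cpoly (\<lambda>c. c) ?x)"
    by (intro ring_hom_to_field.specialization_evaluates ring_hom_eval_cpoly ring_hom_id)
  have "evaluates (eval_cpoly (\<lambda>c. c) ?x) rf_q1 q1" "evaluates (eval_cpoly (\<lambda>c. c) ?x) rf_q3 q3"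
    "evaluates (eval_cpoly (\<lambda>c. c) ?x) (rf_u 1) u"
    using evaluates_ratfun_var[OF ring_hom_id, of ?x 0] evaluates_ratfun_var[OF ring_hom_id, of ?x 1]
      evaluates_ratfun_var[OF ring_hom_id, of ?x 2] by (auto simp: numeral_2_eq_2)
  then have "evaluates (eval_cpoly (\<lambda>c. c) ?x) (resonant_u a i)
      (u * (\<Prod>k\<in>{1..<i}. inverse (q1 ^ (a k + 1) * q3)))"
    unfolding resonant_u_def using assms by (intro E.mult E.prod E.inverse E.power) auto
  moreover have "evaluates (eval_cpoly ratfun_const
      (\<lambda>i. if i = 0 then rf_q1 else if i = 1 then rf_q3 else resonant_u a (i - 1))) (rf_u i) (resonant_u a i)"
    using evaluates_ratfun_var[OF ring_hom_ratfun_const,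
        of "\<lambda>i. if i = 0 then rf_q1 else if i = 1 then rf_q3 else resonant_u a (i - 1)" "i + 1"] assms(3)
    by simp
  ultimately show ?thesis unfolding specializes_def by blast
qed

section \<open>Admissible partitions\<close>

locale resonant_parameters =
  fixes q1 q2 q3 u :: complex and n r :: nat and a :: "nat \<Rightarrow> nat"
  assumes n_ge_2: "n \<ge> 2" and r_ge_2: "r \<ge> 2"
    and sum_a: "(\<Sum>i\<in>{1..n}. a i) = r"
    and q123: "q1 * q2 * q3 = 1"
    and nru1: "not_root_of_unity q1" and nru2: "not_root_of_unity q2" and nru3: "not_root_of_unity q3"
    and resonance: "q1 powi x * q3 powi y = 1 \<longleftrightarrow>
           (\<exists>\<kappa>::int. x = int (n + r) * \<kappa> \<and> y = int (n + 1) * \<kappa>)"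
    and u_nz: "u \<noteq> 0"
begin

abbreviation "\<Lambda>0 \<equiv> vac n r a"
abbreviation "Adm \<equiv> G_labels n r a"

lemma n_pos [simp]: "0 < n" "n \<noteq> 0" and r_pos [simp]: "0 < r" "r \<noteq> 0"
  using n_ge_2 r_ge_2 by auto

lemma q_nz [simp]: "q1 \<noteq> 0" "q2 \<noteq> 0" "q3 \<noteq> 0"
  using q123 by auto

lemma u_nonzero [simp]: "u \<noteq> 0"
  by (rule u_nz)

lemma q_ne_1 [simp]: "q1 \<noteq> 1" "q2 \<noteq> 1" "q3 \<noteq> 1"
  using nru1 nru2 nru3 unfolding not_root_of_unity_def by (metis le_refl power_one_right)+

lemma vac_0 [simp]: "\<Lambda>0 0 = 0"
  by (simp add: vac_def)

lemma vac_add_n: "1 \<le> j \<Longrightarrow> \<Lambda>0 (j + n) = \<Lambda>0 j - int r"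
proof -
  assume "1 \<le> j"
  then have "j + n - 1 = (j - 1) + n" by simp
  then show ?thesis by (simp add: vac_def algebra_simps del: One_nat_def)
qed

lemma vac_Suc_le: "1 \<le> j \<Longrightarrow> \<Lambda>0 (j + 1) \<le> \<Lambda>0 j"
proof -
  assume j: "1 \<le> j"
  define d m where "d = (j - 1) div n" and "m = (j - 1) mod n"
  have jj: "j = d * n + m + 1" using j by (simp add: d_def m_def)
  have m: "m < n" by (simp add: m_def)
  show ?thesis
  proof (cases "m + 1 < n")
    case True
    then have "(j + 1 - 1) div n = d" "(j + 1 - 1) mod n = m + 1"
      using jj div_mult_self3[of n d "m + 1"] mod_mult_self3[of d n "m + 1"] by auto
    then show ?thesis unfolding vac_def d_def[symmetric] m_def[symmetric] by simp
  next
    case False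
    then have mn: "m + 1 = n" using m by simp
    then have "j + 1 - 1 = (d + 1) * n" using jj by simp
    then have "(j + 1 - 1) div n = d + 1" "(j + 1 - 1) mod n = 0" by simp_all
    moreover have "(\<Sum>k\<in>{1..m}. a k) \<le> r"
      unfolding sum_a[symmetric] using mn by (intro sum_mono2) auto
    ultimately show ?thesis unfolding vac_def d_def[symmetric] m_def[symmetric]
      by (simp add: algebra_simps) (metis of_nat_le_iff of_nat_sum)
  qed
qed

lemma Adm_0: "\<Lambda> \<in> Adm \<Longrightarrow> \<Lambda> 0 = 0"
  and Adm_Suc: "\<Lambda> \<in> Adm \<Longrightarrow> 1 \<le> j \<Longrightarrow> \<Lambda> (j + 1) \<le> \<Lambda> j"
  and Adm_n: "\<Lambda> \<in> Adm \<Longrightarrow> 1 \<le> j \<Longrightarrow> \<Lambda> (j + n) + int r \<le> \<Lambda> j"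
  by (auto simp: G_labels_def algebra_simps)

lemma Adm_antimono: "\<Lambda> \<in> Adm \<Longrightarrow> 1 \<le> i \<Longrightarrow> i \<le> j \<Longrightarrow> \<Lambda> j \<le> \<Lambda> i"
proof (induction "j - i" arbitrary: j)
  case (Suc k)
  then have "i \<le> j - 1" "k = j - 1 - i" "1 \<le> j - 1" "j - 1 + 1 = j" by auto
  then show ?case using Suc.hyps(1)[of "j - 1"] Adm_Suc[of \<Lambda> "j - 1"] Suc.prems by simp
qed auto

lemma Adm_diff_mult: "\<Lambda> \<in> Adm \<Longrightarrow> 1 \<le> j \<Longrightarrow> \<Lambda> (j + k * n) + int r * int k \<le> \<Lambda> j"
proof (induction k)
  case (Suc k)
  then show ?case using Adm_n[of \<Lambda> "j + k * n"] by (simp add: algebra_simps)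
qed auto

lemma Adm_diff:
  assumes "\<Lambda> \<in> Adm" "1 \<le> j" "j \<le> p"
  shows "int r * int ((p - j) div n) \<le> \<Lambda> j - \<Lambda> p"
proof -
  let ?k = "(p - j) div n"
  have "\<Lambda> p \<le> \<Lambda> (j + ?k * n)"
    using assms div_times_less_eq_dividend[of "p - j" n] by (intro Adm_antimono) linarith+
  then show ?thesis using Adm_diff_mult[OF assms(1,2), of ?k] by simp
qed

lemma Adm_stable: "\<Lambda> \<in> Adm \<Longrightarrow> \<exists>N. \<forall>j\<ge>N. \<Lambda> j = \<Lambda>0 j"
  by (auto simp: G_labels_def eventually_sequentially)

lemma vac_diff_mult: "1 \<le> j \<Longrightarrow> \<Lambda>0 (j + k * n) + int r * int k = \<Lambda>0 j"
proof (induction k)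
  case (Suc k)
  then show ?case using vac_add_n[of "j + k * n"] by (simp add: algebra_simps)
qed auto

text \<open>
  Following \<open>j, j + n, j + 2n, \<dots>\<close> up to where \<open>\<Lambda>\<close> is the vacuum, \<open>\<Lambda>\<close> drops by at least \<open>r\<close> in each step and
  the vacuum by exactly \<open>r\<close>.
\<close>

lemma Adm_ge_vac: "\<Lambda> \<in> Adm \<Longrightarrow> \<Lambda>0 j \<le> \<Lambda> j"
proof (cases "j = 0")
  case False
  assume L: "\<Lambda> \<in> Adm"
  then obtain N where N: "\<forall>j\<ge>N. \<Lambda> j = \<Lambda>0 j" using Adm_stable by blast
  have "N \<le> j + N * n" using n_pos by (metis le_add2 nat_mult_le_cancel_disj mult.commute mult_1 Suc_leI One_nat_def trans_le_add2)
  then have "\<Lambda> (j + N * n) = \<Lambda>0 (j + N * n)" using N by blast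
  then show ?thesis
    using Adm_diff_mult[OF L, of j N] vac_diff_mult[of j N] False by simp
qed (simp add: Adm_0)

lemma Adm_min: "\<Lambda> \<in> Adm \<Longrightarrow> \<Lambda>' \<in> Adm \<Longrightarrow> (\<lambda>j. min (\<Lambda> j) (\<Lambda>' j)) \<in> Adm"
  and Adm_max: "\<Lambda> \<in> Adm \<Longrightarrow> \<Lambda>' \<in> Adm \<Longrightarrow> (\<lambda>j. max (\<Lambda> j) (\<Lambda>' j)) \<in> Adm"
  unfolding G_labels_def by (auto elim: eventually_elim2 simp: min_def max_def) 

definition sub_one :: "(nat \<Rightarrow> int) \<Rightarrow> nat \<Rightarrow> (nat \<Rightarrow> int)" where
  "sub_one \<Lambda> p = \<Lambda>(p := \<Lambda> p - 1)"

lemma add_sub_one [simp]: "add_one (sub_one \<Lambda> p) p = \<Lambda>" "sub_one (add_one \<Lambda> p) p = \<Lambda>"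
  by (auto simp: sub_one_def add_one_def)

lemma add_one_apply: "add_one \<Lambda> p j = (if j = p then \<Lambda> j + 1 else \<Lambda> j)"
  by (simp add: add_one_def)

lemma sub_one_apply: "sub_one \<Lambda> p j = (if j = p then \<Lambda> j - 1 else \<Lambda> j)"
  by (simp add: sub_one_def)

lemma add_one_inj [simp]: "add_one \<Lambda> p = add_one \<Lambda> p' \<longleftrightarrow> p = p'"
  by (auto simp: add_one_def fun_eq_iff split: if_splits)

lemma add_one_commute: "add_one (add_one \<Lambda> p) q = add_one (add_one \<Lambda> q) p"
  by (auto simp: add_one_def fun_eq_iff)

lemma add_sub_commute: "p \<noteq> q \<Longrightarrow> add_one (sub_one \<Lambda> q) p = sub_one (add_one \<Lambda> p) q"
  by (auto simp: add_one_def sub_one_def fun_eq_iff)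

lemma eventually_upd:
  "eventually (\<lambda>j. (\<Lambda>(p := c)) j = \<Lambda>0 j) sequentially \<longleftrightarrow> eventually (\<lambda>j. \<Lambda> j = (\<Lambda>0 j :: int)) sequentially"
proof -
  have "eventually (\<lambda>j. j \<noteq> p) sequentially"
    by (rule eventually_sequentiallyI[of "p + 1"]) auto
  then have "eventually (\<lambda>j. (\<Lambda>(p := c)) j = \<Lambda>0 j \<longleftrightarrow> \<Lambda> j = \<Lambda>0 j) sequentially"
    by (rule eventually_mono) auto
  then show ?thesis by (rule eventually_subst)
qed

lemma add_one_Adm_iff:
  assumes "\<Lambda> \<in> Adm" "1 \<le> p"
  shows "add_one \<Lambda> p \<in> Adm \<longleftrightarrow>
    (p > 1 \<longrightarrow> \<Lambda> p < \<Lambda> (p - 1)) \<and> (p > n \<longrightarrow> \<Lambda> p + int r < \<Lambda> (p - n))"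
    (is "?A \<longleftrightarrow> ?B \<and> ?C")
proof (intro iffI conjI impI)
  assume A: ?A
  show "\<Lambda> p < \<Lambda> (p - 1)" if "p > 1"
    using Adm_Suc[OF A, of "p - 1"] that by (auto simp: add_one_apply Suc_le_eq split: if_splits)
  show "\<Lambda> p + int r < \<Lambda> (p - n)" if "p > n"
    using Adm_n[OF A, of "p - n"] that by (auto simp: add_one_apply Suc_le_eq split: if_splits)
next
  assume "?B \<and> ?C"
  then have *: ?B ?C by blast+
  have "add_one \<Lambda> p (j + 1) \<le> add_one \<Lambda> p j" if "1 \<le> j" for j
    using Adm_Suc[OF assms(1) that] *(1) that by (auto simp: add_one_apply)
  moreover have "int r \<le> add_one \<Lambda> p j - add_one \<Lambda> p (j + n)" if "1 \<le> j" for j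
    using Adm_n[OF assms(1) that] *(2) that by (auto simp: add_one_apply)
  moreover have "eventually (\<lambda>j. add_one \<Lambda> p j = \<Lambda>0 j) sequentially"
    using assms(1) unfolding add_one_def by (subst eventually_upd) (simp add: G_labels_def)
  ultimately show ?A using assms Adm_0[OF assms(1)] by (simp add: G_labels_def) (simp add: add_one_apply)
qed

lemma sub_one_Adm_iff:
  assumes "\<Lambda> \<in> Adm" "1 \<le> p"
  shows "sub_one \<Lambda> p \<in> Adm \<longleftrightarrow> \<Lambda> (p + 1) < \<Lambda> p \<and> \<Lambda> (p + n) + int r < \<Lambda> p"
    (is "?A \<longleftrightarrow> ?B \<and> ?C")
proof (intro iffI conjI)
  assume A: ?A
  show "\<Lambda> (p + 1) < \<Lambda> p"
    using Adm_Suc[OF A, of p] assms by (simp add: sub_one_apply split: if_splits)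
  show "\<Lambda> (p + n) + int r < \<Lambda> p"
    using Adm_n[OF A, of p] assms by (simp add: sub_one_apply split: if_splits)
next
  assume "?B \<and> ?C"
  then have *: ?B ?C by blast+
  have "sub_one \<Lambda> p (j + 1) \<le> sub_one \<Lambda> p j" if "1 \<le> j" for j
    using Adm_Suc[OF assms(1) that] *(1) that by (auto simp: sub_one_apply)
  moreover have "int r \<le> sub_one \<Lambda> p j - sub_one \<Lambda> p (j + n)" if "1 \<le> j" for j
    using Adm_n[OF assms(1) that] *(2) that by (auto simp: sub_one_apply)
  moreover have "eventually (\<lambda>j. sub_one \<Lambda> p j = \<Lambda>0 j) sequentially"
    using assms(1) unfolding sub_one_def by (subst eventually_upd) (simp add: G_labels_def)
  ultimately show ?A using assms Adm_0[OF assms(1)] by (simp add: G_labels_def) (simp add: sub_one_apply)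
qed

text \<open>
  Admissible sequences form a lattice under pointwise minimum and maximum, since both admissibility
  conditions compare two entries.  This makes the graph of admissible partitions closed under completing
  squares, here upwards and in the following lemma downwards.
\<close>

lemma add_one_twice_Adm:
  assumes "add_one \<Lambda> p \<in> Adm" "add_one \<Lambda> q \<in> Adm" "p \<noteq> q"
  shows "add_one (add_one \<Lambda> p) q \<in> Adm"
proof -
  have "(\<lambda>j. max (add_one \<Lambda> p j) (add_one \<Lambda> q j)) = add_one (add_one \<Lambda> p) q"
    using assms(3) by (auto simp: fun_eq_iff add_one_apply)
  then show ?thesis using Adm_max[OF assms(1,2)] by simp
qed

lemma add_one_meet_Adm:
  assumes "add_one \<Lambda> p \<in> Adm" "add_one \<Lambda> q \<in> Adm" "p \<noteq> q"
  shows "\<Lambda> \<in> Adm"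
proof -
  have "(\<lambda>j. min (add_one \<Lambda> p j) (add_one \<Lambda> q j)) = \<Lambda>"
    using assms(3) by (auto simp: fun_eq_iff add_one_apply)
  then show ?thesis using Adm_min[OF assms(1,2)] by simp
qed

text \<open>The last position where \<open>\<Lambda>\<close> differs from the vacuum can be lowered.\<close>

lemma last_removable:
  assumes "\<Lambda> \<in> Adm" "\<Lambda> \<noteq> \<Lambda>0"
  shows "\<exists>p\<ge>1. sub_one \<Lambda> p \<in> Adm"
proof -
  obtain N where N: "\<forall>j\<ge>N. \<Lambda> j = \<Lambda>0 j" using Adm_stable assms by blast
  let ?S = "{j. \<Lambda> j \<noteq> \<Lambda>0 j}"
  have fin: "finite ?S" by (rule finite_subset[of _ "{..N}"]) (use N in \<open>auto intro: leI order.strict_implies_order\<close>)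
  have ne: "?S \<noteq> {}" using assms(2) by auto
  define p where "p = Max ?S"
  have p: "\<Lambda> p \<noteq> \<Lambda>0 p" using Max_in[OF fin ne] by (simp add: p_def)
  then have p1: "1 \<le> p" using Adm_0[OF assms(1)] by (cases p) auto
  have later: "\<Lambda> j = \<Lambda>0 j" if "j > p" for j
    using Max_ge[OF fin, of j] that by (auto simp: p_def[symmetric] not_less[symmetric])
  have "\<Lambda>0 p < \<Lambda> p" using Adm_ge_vac[OF assms(1), of p] p by simp
  then have "sub_one \<Lambda> p \<in> Adm"
    using later vac_Suc_le[OF p1] vac_add_n[OF p1] by (simp add: sub_one_Adm_iff[OF assms(1) p1])
  then show ?thesis using p1 by blast
qed

section \<open>Coincidences between weights\<close>

text \<open>The resonance condition in terms of \<open>q\<^sub>1\<close> and \<open>q\<^sub>2\<close>: the relation lattice is generated by \<open>(r - 1, - n - 1)\<close>.\<close>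

lemma resonance12:
  "q1 powi x * q2 powi y = 1 \<longleftrightarrow> (\<exists>\<kappa>::int. x = (int r - 1) * \<kappa> \<and> y = - (int n + 1) * \<kappa>)"
proof -
  have "q2 = inverse (q1 * q3)" using q123 by (simp add: field_simps)
  then have "q2 powi y = q1 powi (- y) * q3 powi (- y)"
    by (simp add: power_int_inverse power_int_mult_distrib power_int_minus inverse_mult_distrib)
  then have "q1 powi x * q2 powi y = q1 powi (x - y) * q3 powi (- y)"
    by (simp add: power_int_add[symmetric] mult.assoc[symmetric])
  then have "q1 powi x * q2 powi y = 1 \<longleftrightarrow>
      (\<exists>\<kappa>::int. x - y = int (n + r) * \<kappa> \<and> - y = int (n + 1) * \<kappa>)"
    by (simp only: resonance)
  also have "\<dots> \<longleftrightarrow> (\<exists>\<kappa>::int. x = (int r - 1) * \<kappa> \<and> y = - (int n + 1) * \<kappa>)"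
    by (intro arg_cong[where f = Ex] ext) (auto simp: algebra_simps)
  finally show ?thesis .
qed

text \<open>
  Here \<open>d > 0\<close> is a distance of positions and \<open>D\<close> the corresponding difference of entries.  A coincidence
  given by the \<open>\<kappa>\<close>-fold relation has distance about \<open>\<kappa> (n + 1)\<close>, over which admissibility
  forces a drop of at least \<open>\<kappa> r\<close>, while the relation allows only \<open>\<kappa> (r - 1) + s\<close>; this leaves \<open>\<kappa> = 0\<close>, and \<open>\<kappa> = 1\<close>
  with equality everywhere.
\<close>

lemma resonance_cases:
  assumes "0 < d" and D: "int r * int (d div n) \<le> D"
    and st: "-1 \<le> t" "t \<le> 1" "s \<le> 1" and eq: "q1 powi (D - s) * q2 powi (t - int d) = 1"
  shows "(s = 1 \<and> D = int r \<and> int d = int n + 1 + t) \<or> (t = 1 \<and> d = 1 \<and> D = s)"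
proof -
  obtain \<kappa> where k: "D - s = (int r - 1) * \<kappa>" "t - int d = - (int n + 1) * \<kappa>"
    using eq resonance12 by blast
  then have k2: "int d = (int n + 1) * \<kappa> + t" by (simp add: algebra_simps)
  show ?thesis
  proof (cases "\<kappa> \<le> 0")
    case True
    then have "(int n + 1) * \<kappa> \<le> 0" by (simp add: mult_nonneg_nonpos)
    moreover have "1 \<le> int d" using assms(1) by simp
    ultimately have "int d = t" "t = 1" using k2 st by linarith+
    then have "(int n + 1) * \<kappa> = 0" using k2 by linarith
    then have "\<kappa> = 0" by (simp only: mult_eq_0_iff) linarith
    then show ?thesis using k \<open>int d = t\<close> \<open>t = 1\<close> by auto
  next
    case False
    have "\<kappa> * int n \<le> int d" using k2 st False by (simp add: algebra_simps)
    then have "(\<kappa> * int n) div int n \<le> int d div int n" by (rule zdiv_mono1) simp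
    then have "\<kappa> \<le> int d div int n" by simp
    then have "int r * \<kappa> \<le> D" using D by (metis mult_left_mono of_nat_0_le_iff order_trans zdiv_int)
    then have "\<kappa> \<le> s" using k by (simp add: algebra_simps)
    then have "\<kappa> = 1" "s = 1" using False st by auto
    then show ?thesis using k by simp
  qed
qed

definition weight :: "(nat \<Rightarrow> int) \<Rightarrow> nat \<Rightarrow> complex" where
  "weight \<Lambda> j = q1 powi \<Lambda> j * q2 ^ (j - 1) * u"

lemma weight_nz [simp]: "weight \<Lambda> j \<noteq> 0"
  by (simp add: weight_def)

lemma weight_add_one: "weight (add_one \<Lambda> p) j = (if j = p then q1 * weight \<Lambda> j else weight \<Lambda> j)"
  by (simp add: weight_def add_one_apply power_int_add)

lemma weight_sub_one: "weight (sub_one \<Lambda> p) j = (if j = p then weight \<Lambda> j / q1 else weight \<Lambda> j)"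
  by (simp add: weight_def sub_one_apply power_int_diff)

lemma q3_eq: "q3 = q1 powi (-1) * q2 powi (-1)"
  using q123 by (simp add: field_simps power_int_minus)

lemma weight_ratio:
  assumes "1 \<le> j" "1 \<le> p"
  shows "weight \<Lambda> j * (q1 powi s * q2 powi t) = weight \<Lambda> p * (q1 powi s' * q2 powi t') \<longleftrightarrow>
     q1 powi (\<Lambda> j - \<Lambda> p + s - s') * q2 powi (int j - int p + t - t') = 1"
proof -
  have e: "q2 ^ (i - 1) = q2 powi (int i) / q2" if "1 \<le> i" for i
    using that by (cases i) (auto simp: power_int_add)
  show ?thesis unfolding weight_def e[OF assms(1)] e[OF assms(2)]
    by (simp add: power_int_add power_int_diff field_simps)
qed

lemma weight_ratio_later:
  assumes "1 \<le> j" "j < p" and D: "int r * int ((p - j) div n) \<le> \<Lambda> j - \<Lambda> p"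
    and "weight \<Lambda> j * (q1 powi (- s) * q2 powi t) = weight \<Lambda> p" "-1 \<le> t" "t \<le> 1" "s \<le> 1"
  shows "(s = 1 \<and> \<Lambda> j = \<Lambda> p + int r \<and> int p = int j + int n + 1 + t) \<or> (t = 1 \<and> p = j + 1 \<and> \<Lambda> j = \<Lambda> p + s)"
proof -
  have "q1 powi (\<Lambda> j - \<Lambda> p - s) * q2 powi (t - int (p - j)) = 1"
    using weight_ratio[of j p \<Lambda> "-s" t 0 0] assms by (simp add: of_nat_diff algebra_simps)
  from resonance_cases[OF _ D _ _ _ this] show ?thesis using assms by auto
qed

text \<open>
  The complete list of ratios \<open>1, q\<^sub>i, q\<^sub>i\<^sup>-\<^sup>1\<close> between the weights of two positions.  They occur only in the
  rigid situations where the admissibility conditions between the two positions are equalities.  The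
  hypothesis on the difference is weaker than admissibility, so that the lemma also applies to
  sequences that are met in the middle of a chain of raisings.
\<close>

lemma weight_coincidence_later:
  assumes "1 \<le> j" "j < p" and D: "int r * int ((p - j) div n) \<le> \<Lambda> j - \<Lambda> p"
  shows "weight \<Lambda> j \<noteq> weight \<Lambda> p"
    and "weight \<Lambda> j = q1 * weight \<Lambda> p \<Longrightarrow> p = j + n + 1 \<and> \<Lambda> j = \<Lambda> p + int r"
    and "weight \<Lambda> p \<noteq> q1 * weight \<Lambda> j"
    and "weight \<Lambda> p = q2 * weight \<Lambda> j \<Longrightarrow> p = j + 1 \<and> \<Lambda> j = \<Lambda> p"
    and "weight \<Lambda> j \<noteq> q2 * weight \<Lambda> p"
    and "weight \<Lambda> p = q3 * weight \<Lambda> j \<Longrightarrow> p = j + n \<and> \<Lambda> j = \<Lambda> p + int r"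
    and "weight \<Lambda> j \<noteq> q3 * weight \<Lambda> p"
proof -
  note L = weight_ratio_later[OF assms]
  have D0: "\<Lambda> p \<le> \<Lambda> j" using D by (smt (verit) mult_nonneg_nonneg of_nat_0_le_iff)
  show "weight \<Lambda> j \<noteq> weight \<Lambda> p" using L[of 0 0] by auto
  show "p = j + n + 1 \<and> \<Lambda> j = \<Lambda> p + int r" if "weight \<Lambda> j = q1 * weight \<Lambda> p"
    using L[of 1 0] that by (auto simp: power_int_minus field_simps)
  show "weight \<Lambda> p \<noteq> q1 * weight \<Lambda> j" using L[of "-1" 0] by (auto simp: field_simps)
  show "p = j + 1 \<and> \<Lambda> j = \<Lambda> p" if "weight \<Lambda> p = q2 * weight \<Lambda> j"
    using L[of 0 1] that by (auto simp: field_simps)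
  show "weight \<Lambda> j \<noteq> q2 * weight \<Lambda> p"
    using L[of 0 "-1"] by (auto simp: power_int_minus field_simps)
  show "p = j + n \<and> \<Lambda> j = \<Lambda> p + int r" if "weight \<Lambda> p = q3 * weight \<Lambda> j"
    using L[of 1 "-1"] that by (auto simp: q3_eq field_simps)
  show "weight \<Lambda> j \<noteq> q3 * weight \<Lambda> p"
  proof
    assume *: "weight \<Lambda> j = q3 * weight \<Lambda> p"
    have "weight \<Lambda> j * (q1 * q2) = weight \<Lambda> p" unfolding * using q123 by (simp add: mult_ac)
    then show False using L[of "-1" 1] D0 by simp
  qed
qed

lemma weight_inj:
  assumes "\<Lambda> \<in> Adm" "1 \<le> j" "1 \<le> p" "weight \<Lambda> j = weight \<Lambda> p"
  shows "j = p"
proof (cases j p rule: linorder_cases)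
  case less
  then show ?thesis
    using weight_coincidence_later(1)[OF assms(2) less Adm_diff[OF assms(1,2)]] assms(4) by auto
next
  case equal
  then show ?thesis using assms(4) by simp
next
  case greater
  then show ?thesis
    using weight_coincidence_later(1)[OF assms(3) greater Adm_diff[OF assms(1,3)]] assms(4) by auto
qed

lemma weight_eq_q1:
  assumes "\<Lambda> \<in> Adm" "1 \<le> j" "1 \<le> p" "weight \<Lambda> j = q1 * weight \<Lambda> p"
  shows "p = j + n + 1 \<and> \<Lambda> j = \<Lambda> p + int r"
proof (cases j p rule: linorder_cases)
  case less
  then show ?thesis
    using weight_coincidence_later(2)[OF assms(2) less Adm_diff[OF assms(1,2)]] assms(4) by auto
next
  case equal
  then show ?thesis using assms(4) by simp
next
  case greater
  then show ?thesis
    using weight_coincidence_later(3)[OF assms(3) greater Adm_diff[OF assms(1,3)]] assms(4) by auto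
qed

lemma weight_eq_q2:
  assumes "\<Lambda> \<in> Adm" "1 \<le> j" "1 \<le> p" "weight \<Lambda> j = q2 * weight \<Lambda> p"
  shows "j = p + 1 \<and> \<Lambda> j = \<Lambda> p"
proof (cases j p rule: linorder_cases)
  case less
  then show ?thesis
    using weight_coincidence_later(5)[OF assms(2) less Adm_diff[OF assms(1,2)]] assms(4) by auto
next
  case equal
  then show ?thesis using assms(4) by simp
next
  case greater
  then show ?thesis
    using weight_coincidence_later(4)[OF assms(3) greater Adm_diff[OF assms(1,3)]] assms(4) by auto
qed

lemma weight_eq_q3:
  assumes "\<Lambda> \<in> Adm" "1 \<le> j" "1 \<le> p" "weight \<Lambda> j = q3 * weight \<Lambda> p"
  shows "j = p + n \<and> \<Lambda> p = \<Lambda> j + int r"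
proof (cases j p rule: linorder_cases)
  case less
  then show ?thesis
    using weight_coincidence_later(7)[OF assms(2) less Adm_diff[OF assms(1,2)]] assms(4) by auto
next
  case equal
  then show ?thesis using assms(4) by simp
next
  case greater
  then show ?thesis
    using weight_coincidence_later(6)[OF assms(3) greater Adm_diff[OF assms(1,3)]] assms(4) by auto
qed

lemma weight_step: "1 \<le> j \<Longrightarrow> \<Lambda> (j + 1) = \<Lambda> j \<Longrightarrow> weight \<Lambda> (j + 1) = q2 * weight \<Lambda> j"
  by (cases j) (simp_all add: weight_def)

lemma weight_step_n:
  assumes "1 \<le> j" "\<Lambda> (j + n) + int r = \<Lambda> j"
  shows "weight \<Lambda> (j + n) = q3 * weight \<Lambda> j"
proof -
  have *: "\<Lambda> (j + n) - \<Lambda> j = - int r" using assms(2) by simp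
  have "weight \<Lambda> (j + n) * (q1 powi 0 * q2 powi 0) = weight \<Lambda> j * (q1 powi (-1) * q2 powi (-1))"
    unfolding weight_ratio[OF trans_le_add1[OF assms(1)] assms(1)] * resonance12
    by (intro exI[of _ "-1"]) auto
  then show ?thesis by (simp add: q3_eq mult_ac)
qed

text \<open>
  A coincidence with \<open>w\<^sub>p\<close> forces an equality that blocks raising \<open>\<Lambda>\<^sub>p\<close>.  Hence, seen from an addable position,
  all factors in the matrix coefficients are regular and non-zero, although \<open>q\<^sub>1\<close> and \<open>q\<^sub>3\<close> are not generic.
\<close>

lemma addable_generic:
  assumes "\<Lambda> \<in> Adm" "add_one \<Lambda> p \<in> Adm" "1 \<le> j" "1 \<le> p" "j \<noteq> p"
  shows "weight \<Lambda> j \<noteq> weight \<Lambda> p" "weight \<Lambda> j \<noteq> q1 * weight \<Lambda> p"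
    "weight \<Lambda> p \<noteq> q2 * weight \<Lambda> j" "weight \<Lambda> p \<noteq> q3 * weight \<Lambda> j"
proof -
  note I = add_one_Adm_iff[OF assms(1,4), THEN iffD1, OF assms(2)]
  show "weight \<Lambda> j \<noteq> weight \<Lambda> p" using weight_inj assms by blast
  show "weight \<Lambda> j \<noteq> q1 * weight \<Lambda> p"
  proof
    assume "weight \<Lambda> j = q1 * weight \<Lambda> p"
    then have *: "p = j + n + 1" "\<Lambda> j = \<Lambda> p + int r" using weight_eq_q1 assms by blast+
    then show False using I Adm_n[OF assms(1,3)] by simp
  qed
  show "weight \<Lambda> p \<noteq> q2 * weight \<Lambda> j"
    using weight_eq_q2[OF assms(1,4,3)] I assms(3) by force
  show "weight \<Lambda> p \<noteq> q3 * weight \<Lambda> j"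
    using weight_eq_q3[OF assms(1,4,3)] I assms(3) by force
qed

abbreviation "g_fun \<equiv> g_cubic q1 q2 q3"

lemma square_generic:
  assumes "\<Lambda> \<in> Adm" "add_one \<Lambda> p \<in> Adm" "add_one \<Lambda> q \<in> Adm" "1 \<le> p" "1 \<le> q" "p \<noteq> q"
  shows "g_fun (weight \<Lambda> p) (weight \<Lambda> q) \<noteq> 0"
  using addable_generic[OF assms(1,2,5,4)] addable_generic[OF assms(1,3,4,5)] assms(6)
  by (auto simp: g_cubic_def)

end

section \<open>Box factors\<close>

text \<open>The source of all telescoping products below: one column is a quotient of two neighbouring values of \<open>psi_empty\<close>.\<close>

lemma box_factor_eq_psi_empty:
  fixes q1 q2 q3 :: "'k::field"
  assumes "q1 * q2 * q3 = 1"
  shows "box_factor q1 q2 q3 x = psi_empty q2 x / psi_empty q2 (q3 * x)"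
proof -
  have "q1 \<noteq> 0" using assms by auto
  then have "x / q1 = q2 * (q3 * x)"
    by (metis assms mult.assoc mult.left_neutral nonzero_mult_div_cancel_left)
  then show ?thesis by (simp add: box_factor_def psi_empty_def mult_ac)
qed

text \<open>
  Moving the weight \<open>w\<close> of a column to \<open>q\<^sub>1 w\<close> multiplies its factor by \<open>- g(w, z) / g(z, w)\<close>.  Every relation
  that involves the structure function \<open>g\<close> goes back to this identity.
\<close>

lemma box_factor_shift:
  fixes q1 q2 q3 z w :: "'k::field"
  assumes q: "q1 * q2 * q3 = 1" and "z \<noteq> 0" "z \<noteq> w" "w \<noteq> q1 * z" "z \<noteq> q1 * w"
  shows "box_factor q1 q2 q3 (q1 * w / z) * g_cubic q1 q2 q3 z w =
    - (box_factor q1 q2 q3 (w / z) * g_cubic q1 q2 q3 w z)"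
proof -
  have nz: "q1 \<noteq> 0" "q2 \<noteq> 0" "q3 \<noteq> 0" using q by auto
  have b1: "box_factor q1 q2 q3 (q1 * w / z) = ((z - q3 * q1 * w) * (z - q2 * q1 * w)) / ((z - q1 * w) * (z - w))"
    unfolding box_factor_def using assms nz by (simp add: divide_simps) (simp add: mult_ac)
  have b2: "box_factor q1 q2 q3 (w / z) = q1 * ((z - q3 * w) * (z - q2 * w)) / ((z - w) * (q1 * z - w))"
    unfolding box_factor_def using assms nz by (simp add: divide_simps) (simp add: algebra_simps)
  have c: "z - q3 * q1 * w = - q3 * q1 * (w - q2 * z)" "z - q2 * q1 * w = - q2 * q1 * (w - q3 * z)"
    using q by (simp_all add: algebra_simps)
  have e: "z - q1 * w \<noteq> 0" "z - w \<noteq> 0" "q1 * z - w \<noteq> 0" using assms by auto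
  have g1: "(((- q3 * q1 * X) * (- q2 * q1 * Y)) / (B * A)) * (B * E * F) = q1 * (X * Y * E * F) / A"
    if "B \<noteq> 0" "A \<noteq> 0" for X Y A B E F
  proof -
    have "(- q3 * q1 * X) * (- q2 * q1 * Y) * (B * E * F) = (q1 * q2 * q3) * (q1 * (X * Y * E * F)) * B"
      by (simp add: mult_ac)
    then show ?thesis using that q by (simp add: divide_simps)
  qed
  have g2: "q1 * (F * E) / (A * C) * (- C * X * Y) = - (q1 * (X * Y * E * F) / A)"
    if "C \<noteq> 0" "A \<noteq> 0" for X Y A C E F
    using that by (simp add: divide_simps mult_ac)
  have w: "w - q1 * z = - (q1 * z - w)" by simp
  show ?thesis
    unfolding b1 b2 g_cubic_def c g1[OF e(1,2)] w g2[OF e(3,2)] by simp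
qed

lemma g_coeff_eqs:
  assumes "q1 * q2 * q3 = 1"
  shows "g_coeff q1 q2 q3 0 = -1" "g_coeff q1 q2 q3 (Suc 0) = q1 * q2 + q1 * q3 + q2 * q3"
    "g_coeff q1 q2 q3 2 = - (q1 + q2 + q3)" "g_coeff q1 q2 q3 3 = 1"
  using assms by (simp_all add: g_coeff_def numeral_2_eq_2 numeral_3_eq_3 algebra_simps)

lemma sum_upto_3: "(\<Sum>a\<le>(3::nat). f a) = f 0 + f (Suc 0) + f 2 + (f 3 :: 'x::comm_monoid_add)"
  by (simp add: numeral_3_eq_3 numeral_2_eq_2 add_ac)

lemma g_cubic_expand:
  fixes q1 q2 q3 z w :: "'k::field"
  assumes "q1 * q2 * q3 = 1"
  shows "g_cubic q1 q2 q3 z w = z ^ 3 - (q1 + q2 + q3) * z\<^sup>2 * w + (q1 * q2 + q1 * q3 + q2 * q3) * z * w\<^sup>2 - w ^ 3"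
proof -
  have "g_cubic q1 q2 q3 z w = z ^ 3 - (q1 + q2 + q3) * z\<^sup>2 * w + (q1 * q2 + q1 * q3 + q2 * q3) * z * w\<^sup>2
      - (q1 * q2 * q3) * w ^ 3"
    unfolding g_cubic_def by (simp add: algebra_simps power2_eq_square power3_eq_cube)
  then show ?thesis using assms by simp
qed

section \<open>Partial fractions\<close>

lemma dvd_of_order_le:
  fixes P Q :: "complex poly"
  assumes "Q \<noteq> 0" "P \<noteq> 0" "\<And>x. order x Q \<le> order x P"
  shows "Q dvd P"
  using assms
proof (induction "degree Q" arbitrary: P Q)
  case 0
  then show ?case by (simp add: is_unit_iff_degree unit_imp_dvd)
next
  case (Suc d)
  then have "\<not> constant (poly Q)" by (simp add: constant_degree)
  then obtain x where x: "poly Q x = 0" using fundamental_theorem_of_algebra by blast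
  then have "0 < order x Q" using Suc.prems(1) by (simp add: order_root)
  then have "0 < order x P" using Suc.prems(3)[of x] by linarith
  then have "poly P x = 0" by (simp add: order_root)
  obtain Q1 where Q1: "Q = [:-x, 1:] * Q1" using x poly_eq_0_iff_dvd by (metis dvdE)
  obtain P1 where P1: "P = [:-x, 1:] * P1" using \<open>poly P x = 0\<close> poly_eq_0_iff_dvd by (metis dvdE)
  have nz: "Q1 \<noteq> 0" "P1 \<noteq> 0" using Q1 P1 Suc.prems by auto
  have "d = degree Q1" using Suc.hyps(2) nz unfolding Q1
    by (simp add: degree_mult_eq del: mult_pCons_left)
  moreover have "order y Q1 \<le> order y P1" for y
    using Suc.prems(3)[of y] Suc.prems(1,2) unfolding Q1 P1
    by (simp add: order_mult del: mult_pCons_left)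
  ultimately have "Q1 dvd P1" using Suc.hyps(1)[of Q1 P1] nz by blast
  then show ?case unfolding Q1 P1 by (rule mult_dvd_mono[OF dvd_refl])
qed

lemma linear_factor_root: "poly [:1, - c:] x = 0 \<longleftrightarrow> c * x = (1::complex)"
  by (auto simp: algebra_simps)

lemma order_linear_factor: "order x [:1, - c:] = (if c * x = (1::complex) then 1 else 0)"
proof (cases "c * x = 1")
  case True
  have "order x [:1, - c:] \<le> 1"
    using order_degree[of "[:1, - c:]" x] by (simp split: if_splits)
  moreover have "order x [:1, - c:] \<noteq> 0"
    using True linear_factor_root[of c x] order_root[of "[:1, - c:]" x] by auto
  ultimately show ?thesis using True by simp
next
  case False
  then show ?thesis using linear_factor_root[of c x] by (auto intro: order_0I)
qed

lemma order_linear_factors: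
  assumes "finite A"
  shows "order x (\<Prod>i\<in>A. [:1, - c i:]) = card {i \<in> A. c i * x = (1::complex)}"
  using assms
proof (induction A)
  case (insert i A)
  have "(\<Prod>i\<in>A. [:1, - c i:]) \<noteq> 0" using insert by (simp add: prod_zero_iff)
  moreover have "{j \<in> insert i A. c j * x = 1} = (if c i * x = 1 then insert i {i \<in> A. c i * x = 1} else {i \<in> A. c i * x = 1})"
    by auto
  ultimately show ?case using insert
    by (simp add: order_mult order_linear_factor del: mult_pCons_left mult_pCons_right)
qed simp

lemma degree_linear_factors_le: "degree (\<Prod>i\<in>A. [:1, - c i:]) \<le> card A"
proof -
  have "degree (\<Prod>i\<in>A. [:1, - c i:]) \<le> sum (degree \<circ> (\<lambda>i. [:1, - c i:])) A" if "finite A"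
    by (rule degree_prod_sum_le) fact
  also have "sum (degree \<circ> (\<lambda>i. [:1, - c i:])) A \<le> sum (\<lambda>_. 1) A"
    by (rule sum_mono) simp
  finally show ?thesis by (cases "finite A") auto
qed

lemma degree_linear_factors:
  "(\<And>i. i \<in> A \<Longrightarrow> c i \<noteq> 0) \<Longrightarrow> finite A \<Longrightarrow> degree (\<Prod>i\<in>A. [:1, - (c i::complex):]) = card A"
  by (subst degree_prod_eq_sum_degree) auto

text \<open>
  Partial fractions for \<open>P / Q\<close> with at most simple poles, written without denominators.  The polynomials have
  constant term 1, in the variable \<open>1/z\<close>, so poles are at \<open>1 / s\<close>.  The number \<open>\<rho> s\<close> is the value at \<open>1 / s\<close> of
  \<open>P (1 - s x) / Q\<close> after cancellation, expressed by some quotient \<open>A / B\<close>.  The difference of the two sides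
  vanishes at all \<open>1 / s\<close> and has too small a degree to be more than a constant multiple of \<open>\<Prod> (1 - s x)\<close>.
\<close>

lemma partial_fractions:
  fixes P Q :: "complex poly"
  assumes "finite S" "0 \<notin> S" and nz: "P \<noteq> 0" "Q \<noteq> 0" and deg: "degree P \<le> degree Q"
    and ord: "\<And>x. order x Q \<le> order x (P * (\<Prod>s\<in>S. [:1, - s:]))"
    and res: "\<And>s. s \<in> S \<Longrightarrow> \<exists>A B. P * [:1, - s:] * B = A * Q \<and> poly B (1 / s) \<noteq> 0 \<and>
      \<rho> s = poly A (1 / s) / poly B (1 / s)"
  shows "\<exists>C. P * (\<Prod>s\<in>S. [:1, - s:]) =
    Q * (smult C (\<Prod>s\<in>S. [:1, - s:]) + (\<Sum>s\<in>S. smult (\<rho> s) (\<Prod>t\<in>S - {s}. [:1, - t:])))"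
proof -
  define T where "T = (\<Prod>s\<in>S. [:1, - s:])"
  define T' where "T' s = (\<Prod>t\<in>S - {s}. [:1, - t:])" for s
  have T0: "T \<noteq> 0" unfolding T_def using assms(1) by (simp add: prod_zero_iff)
  have TT': "T = [:1, - s:] * T' s" if "s \<in> S" for s
    unfolding T_def T'_def using assms(1) that by (rule prod.remove)
  have T'_self: "poly (T' s) (1 / s) \<noteq> 0" if "s \<in> S" for s
    unfolding T'_def poly_prod using that assms(1,2) by (auto simp: prod_zero_iff field_simps)
  have T'_other: "poly (T' t) (1 / s) = 0" if "s \<in> S" "t \<noteq> s" for s t
    unfolding T'_def poly_prod using that assms(1,2)
    by (intro prod_zero) (auto intro!: bexI[of _ s])
  have "Q dvd P * T"
    using nz T0 ord unfolding T_def by (intro dvd_of_order_le) auto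
  then obtain W where W: "P * T = Q * W" by (elim dvdE)
  have W0: "W \<noteq> 0" using W nz T0 by auto
  have "degree T = card S" unfolding T_def using assms(1,2) by (intro degree_linear_factors) auto
  then have degW: "degree W \<le> card S"
    using arg_cong[OF W, of degree] nz T0 W0 deg by (simp add: degree_mult_eq)
  have W_at: "poly W (1 / s) = \<rho> s * poly (T' s) (1 / s)" if s: "s \<in> S" for s
  proof -
    obtain A B where AB: "P * [:1, - s:] * B = A * Q" "poly B (1 / s) \<noteq> 0"
      "\<rho> s = poly A (1 / s) / poly B (1 / s)" using res[OF s] by blast
    have "Q * (W * B) = P * T * B" by (simp add: W mult_ac)
    also have "\<dots> = (P * [:1, - s:] * B) * T' s"
      unfolding TT'[OF s] by (simp only: mult_ac)
    also have "\<dots> = Q * (A * T' s)" unfolding AB(1) by (simp only: mult_ac)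
    finally have "W * B = A * T' s" using nz by (metis mult_left_cancel)
    then have "poly W (1 / s) * poly B (1 / s) = poly A (1 / s) * poly (T' s) (1 / s)" by (metis poly_mult)
    then show ?thesis unfolding AB(3) using AB(2) by (simp add: field_simps)
  qed
  define V where "V = W - (\<Sum>s\<in>S. smult (\<rho> s) (T' s))"
  have V_at: "poly V (1 / s) = 0" if s: "s \<in> S" for s
  proof -
    have "(\<Sum>t\<in>S. \<rho> t * poly (T' t) (1 / s)) = (\<Sum>t\<in>S. if t = s then \<rho> s * poly (T' s) (1 / s) else 0)"
      using T'_other[OF s] by (intro sum.cong) auto
    then show ?thesis unfolding V_def using W_at[OF s] s assms(1) by (simp add: poly_sum)
  qed
  have "degree (\<Sum>s\<in>S. smult (\<rho> s) (T' s)) \<le> card S"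
  proof (rule degree_sum_le[OF assms(1)])
    fix s assume "s \<in> S"
    have "degree (T' s) \<le> card (S - {s})" unfolding T'_def by (rule degree_linear_factors_le)
    also have "\<dots> \<le> card S" using assms(1) by (simp add: card_Diff1_le)
    finally show "degree (smult (\<rho> s) (T' s)) \<le> card S" using degree_smult_le order_trans by blast
  qed
  then have degV: "degree V \<le> card S" unfolding V_def using degW by (intro degree_diff_le)
  have "\<exists>C. V = smult C T"
  proof (cases "V = 0")
    case False
    have "T dvd V"
    proof (rule dvd_of_order_le[OF T0 False])
      fix x
      show "order x T \<le> order x V"
      proof (cases "\<exists>s\<in>S. s * x = 1")
        case True
        then obtain s where s: "s \<in> S" "s * x = 1" by blast
        then have "x = 1 / s" by (metis mult_zero_left nonzero_mult_div_cancel_left zero_neq_one)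
        then have "order x V \<noteq> 0" using V_at[OF s(1)] False by (simp add: order_root)
        moreover have "{i \<in> S. i * x = 1} = {s}" using s by auto (metis mult_cancel_right mult_zero_right zero_neq_one)
        ultimately show ?thesis unfolding T_def using order_linear_factors[OF assms(1), of x "\<lambda>s. s"] by simp
      next
        case False
        then have "{i \<in> S. i * x = 1} = {}" by auto
        then show ?thesis unfolding T_def using order_linear_factors[OF assms(1), of x "\<lambda>s. s"]
          by (simp only: card.empty)
      qed
    qed
    then obtain K where K: "V = T * K" by (elim dvdE)
    then have "degree K = 0" using False degV \<open>degree T = card S\<close> by (simp add: degree_mult_eq)
    then obtain c where "K = [:c:]" using degree_eq_zeroE by blast
    then show ?thesis using K by auto
  qed (auto intro: exI[of _ 0])
  then obtain C where "V = smult C T" by blast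
  then have "W = smult C T + (\<Sum>s\<in>S. smult (\<rho> s) (T' s))" unfolding V_def by (simp add: algebra_simps)
  then show ?thesis using W unfolding T_def T'_def by blast
qed

section \<open>Expansions\<close>

lemma poly_map_poly_hom:
  assumes "ring_hom_to_field h"
  shows "poly (map_poly h (p + q)) x = poly (map_poly h p) x + poly (map_poly h q) x"
    and "poly (map_poly h (p * q)) x = poly (map_poly h p) x * poly (map_poly h q) x"
    and "poly (map_poly h (smult c q)) x = h c * poly (map_poly h q) x"
    and "poly (map_poly h [:c, d:]) x = h c + h d * x"
    and "poly (map_poly h 1) x = 1"
proof -
  interpret ring_hom_to_field h by fact
  note [simp] = hom_zero hom_add hom_mult hom_one
  have pc: "poly (map_poly h (pCons a p)) x = h a + x * poly (map_poly h p) x" for a p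
    by (cases "pCons a p = 0") (auto simp: map_poly_pCons)
  show add: "poly (map_poly h (p + q)) x = poly (map_poly h p) x + poly (map_poly h q) x" for p q
    by (induction p q rule: poly_induct2) (auto simp: pc algebra_simps)
  have smult: "poly (map_poly h (smult c q)) x = h c * poly (map_poly h q) x" for c q
    by (induction q) (auto simp: pc algebra_simps)
  then show "poly (map_poly h (smult c q)) x = h c * poly (map_poly h q) x" .
  show "poly (map_poly h (p * q)) x = poly (map_poly h p) x * poly (map_poly h q) x" for p q
    by (induction p) (auto simp: add smult pc algebra_simps)
  show "poly (map_poly h [:c, d:]) x = h c + h d * x" by (simp add: pc mult.commute)
  show "poly (map_poly h 1) x = 1" by (simp add: map_poly_1')
qed

lemma poly_map_poly_hom_prod:
  assumes "ring_hom_to_field h"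
  shows "poly (map_poly h (\<Prod>i\<in>A. f i)) x = (\<Prod>i\<in>A. poly (map_poly h (f i)) x)"
  by (induction A rule: infinite_finite_induct) (auto simp: poly_map_poly_hom[OF assms])

lemma poly_map_poly_hom_sum:
  assumes "ring_hom_to_field h"
  shows "poly (map_poly h (\<Sum>i\<in>A. f i)) x = (\<Sum>i\<in>A. poly (map_poly h (f i)) x)"
  by (induction A rule: infinite_finite_induct) (auto simp: poly_map_poly_hom[OF assms])

lemma ring_hom_fls_const: "ring_hom_to_field (fls_const :: complex \<Rightarrow> complex fls)"
  by standard (auto simp: fls_const_mult_const fls_plus_const)

lemma fls_const_power: "fls_const (c ^ m) = fls_const (c :: 'k::field) ^ m"
  by (induction m) (auto simp: fls_const_mult_const[symmetric])

lemma fls_const_powi: "fls_const ((c :: 'k::field) powi k) = fls_const c powi k"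
  by (simp add: power_int_def fls_const_power fls_inverse_const)

lemma fls_const_uminus: "fls_const (- c) = - fls_const (c :: 'k::field)"
  by (rule fls_eqI) simp

text \<open>
  Both expansions of a rational function of \<open>z\<close> at once: \<open>Z\<close> is the series that represents \<open>z\<close>, and \<open>cf F k\<close> the
  coefficient of \<open>z\<^sup>-\<^sup>k\<close>.
\<close>

locale expansion =
  fixes Z :: "complex fls" and cf :: "complex fls \<Rightarrow> int \<Rightarrow> complex"
  assumes cf_add: "cf (F + G) k = cf F k + cf G k"
    and cf_scale: "cf (fls_const c * F) k = c * cf F k"
    and cf_shift: "cf (F * Z) k = cf F (k + 1)"
    and cf_one: "cf 1 k = (if k = 0 then 1 else 0)"
    and Z_nonconst: "Z \<noteq> fls_const c"
begin

lemma Z_nonzero [simp]: "Z \<noteq> 0"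
  using Z_nonconst[of 0] by simp

lemma cf_uminus: "cf (- F) k = - cf F k"
  using cf_scale[of "-1" F k] by (simp add: fls_const_uminus)

lemma cf_sum: "cf (\<Sum>i\<in>A. F i) k = (\<Sum>i\<in>A. cf (F i) k)"
proof -
  have "cf 0 k = 0" using cf_add[of 0 0 k] by simp
  then show ?thesis by (induction A rule: infinite_finite_induct) (auto simp: cf_add)
qed

lemma cf_const: "cf (fls_const c) k = (if k = 0 then c else 0)"
  using cf_scale[of c 1 k] by (simp add: cf_one)

lemma cf_shift_power: "cf (F * Z ^ m) k = cf F (k + int m)"
proof (induction m arbitrary: k)
  case (Suc m)
  have "cf (F * Z ^ Suc m) k = cf (F * Z ^ m * Z) k" by (simp add: mult_ac)
  also have "\<dots> = cf F (k + 1 + int m)" by (simp only: cf_shift Suc)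
  finally show ?case by (simp add: algebra_simps)
qed simp

lemma cf_term: "cf (F * (fls_const c * Z ^ m)) k = c * cf F (k + int m)"
proof -
  have "F * (fls_const c * Z ^ m) = fls_const c * (F * Z ^ m)" by (rule mult.left_commute)
  then show ?thesis by (simp only: cf_scale cf_shift_power)
qed

lemma cf_times_g:
  assumes q: "q1 * q2 * q3 = 1"
  shows "cf (F * g_cubic (fls_const q1) (fls_const q2) (fls_const q3) Z (fls_const x)) k =
      (\<Sum>a\<le>3. g_coeff q1 q2 q3 a * cf F (k + int a) * x ^ (3 - a))" (is ?A)
    and "cf (F * g_cubic (fls_const q1) (fls_const q2) (fls_const q3) (fls_const x) Z) k =
      (\<Sum>a\<le>3. g_coeff q1 q2 q3 a * cf F (k + 3 - int a) * x ^ a)" (is ?B)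
proof -
  let ?C = "fls_const :: complex \<Rightarrow> complex fls"
  define s1 s2 where "s1 = q1 + q2 + q3" and "s2 = q1 * q2 + q1 * q3 + q2 * q3"
  have Q: "?C q1 * ?C q2 * ?C q3 = 1" using q by (simp add: fls_const_mult_const)
  have s: "?C q1 + ?C q2 + ?C q3 = ?C s1" "?C q1 * ?C q2 + ?C q1 * ?C q3 + ?C q2 * ?C q3 = ?C s2"
    unfolding s1_def s2_def fls_const_mult_const fls_plus_const by simp_all
  have c: "?C (- s1 * x) = - (?C s1 * ?C x)" "?C (s2 * x\<^sup>2) = ?C s2 * (?C x)\<^sup>2"
    "?C (- (x ^ 3)) = - ((?C x) ^ 3)" "?C (x ^ 3) = ?C x ^ 3" "?C (- s1 * x\<^sup>2) = - (?C s1 * (?C x)\<^sup>2)"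
    "?C (s2 * x) = ?C s2 * ?C x"
    by (simp_all only: fls_const_uminus fls_const_mult_const[symmetric] fls_const_power mult_minus_left)
  have c1: "?C 1 = 1" "?C (-1) = -1"
    by (simp_all add: fls_const_uminus)
  have gen1: "F * (z ^ 3 - S1 * z\<^sup>2 * w + S2 * z * w\<^sup>2 - w ^ 3) =
      F * (?C 1 * z ^ 3) + F * (- (S1 * w) * z ^ 2) + F * (S2 * w\<^sup>2 * z ^ 1) + F * (- (w ^ 3) * z ^ 0)"
    for F z w S1 S2 :: "complex fls"
    by (simp add: c1 ring_distribs mult_ac)
  have gen2: "F * (w ^ 3 - S1 * w\<^sup>2 * z + S2 * w * z\<^sup>2 - z ^ 3) =
      F * (w ^ 3 * z ^ 0) + F * (- (S1 * w\<^sup>2) * z ^ 1) + F * (S2 * w * z ^ 2) + F * (?C (-1) * z ^ 3)"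
    for F z w S1 S2 :: "complex fls"
    by (simp add: c1 ring_distribs mult_ac)
  show ?A unfolding g_cubic_expand[OF Q] s gen1
    unfolding c[symmetric] cf_add cf_term sum_upto_3 g_coeff_eqs[OF q]
      s1_def[symmetric] s2_def[symmetric]
    by (simp add: cf_uminus mult.commute[of F] cf_scale) (simp add: algebra_simps)?
  show ?B unfolding g_cubic_expand[OF Q] s gen2
    unfolding c[symmetric] cf_add cf_term sum_upto_3 g_coeff_eqs[OF q]
      s1_def[symmetric] s2_def[symmetric]
    by (simp add: cf_uminus mult.commute[of F] cf_scale) (simp add: algebra_simps)?
qed

end

definition coeff_plus :: "complex fls \<Rightarrow> int \<Rightarrow> complex" where "coeff_plus F k = fls_nth F k"
definition coeff_minus :: "complex fls \<Rightarrow> int \<Rightarrow> complex" where "coeff_minus F k = fls_nth F (- k)"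

interpretation plus: expansion "inverse fls_X" coeff_plus
proof
  show "inverse fls_X \<noteq> (fls_const c :: complex fls)" for c
  proof
    assume "inverse fls_X = (fls_const c :: complex fls)"
    then have "fls_nth (inverse fls_X :: complex fls) (-1) = fls_nth (fls_const c) (-1)" by simp
    then show False by (simp add: fls_inverse_X)
  qed
qed (auto simp: coeff_plus_def fls_inverse_X fls_X_inv_times_conv_shift)

interpretation minus: expansion fls_X coeff_minus
proof
  show "fls_X \<noteq> (fls_const c :: complex fls)" for c
  proof
    assume "fls_X = (fls_const c :: complex fls)"
    then have "fls_nth (fls_X :: complex fls) 1 = fls_nth (fls_const c) 1" by simp
    then show False by simp
  qed
qed (auto simp: coeff_minus_def fls_X_times_conv_shift)

definition geometric :: "complex \<Rightarrow> complex fls" where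
  "geometric s = fps_to_fls (Abs_fps (\<lambda>k. s ^ k))"

lemma geometric: "1 / (1 - fls_const s * fls_X) = geometric s"
proof -
  have "Abs_fps (\<lambda>k. s ^ k) * (1 - fps_const s * fps_X) = 1"
  proof (rule fps_ext)
    fix k
    have "Abs_fps (\<lambda>k. s ^ k) * (1 - fps_const s * fps_X) =
        Abs_fps (\<lambda>k. s ^ k) - fps_const s * (fps_X * Abs_fps (\<lambda>k. s ^ k))"
      by (simp add: algebra_simps)
    then show "(Abs_fps (\<lambda>k. s ^ k) * (1 - fps_const s * fps_X)) $ k = 1 $ k"
      by (cases k) auto
  qed
  then have "fps_to_fls (Abs_fps (\<lambda>k. s ^ k) * (1 - fps_const s * fps_X)) = 1" by simp
  then have *: "geometric s * (1 - fls_const s * fls_X) = 1"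
    by (simp add: geometric_def fls_times_fps_to_fls)
  then have "1 - fls_const s * fls_X \<noteq> 0" by (metis mult_zero_right zero_neq_one)
  then show ?thesis using * by (simp add: field_simps)
qed

text \<open>The two expansions of a simple pole differ by the delta function.\<close>

lemma delta_expansion:
  assumes "s \<noteq> 0"
  shows "coeff_plus (1 / (1 - fls_const s / inverse fls_X)) k -
    coeff_minus (1 / (1 - fls_const s / fls_X)) k = s powi k"
proof -
  have 1: "1 / (1 - fls_const s / inverse fls_X) = geometric s"
    using geometric[of s] by (simp add: divide_inverse)
  have "1 / (1 - fls_const s / fls_X) = - (fls_const (1 / s) * (1 / (1 - fls_const (1 / s) * fls_X) * fls_X))"
  proof -
    have c: "fls_const (1 / s) = 1 / fls_const s"
      by (simp add: fls_inverse_const divide_inverse)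
    have gen: "1 / (1 - S / X) = - (1 / S * (1 / (1 - 1 / S * X) * X))"
      if "S \<noteq> 0" "S \<noteq> X" "X \<noteq> 0" for S X :: "complex fls"
      using that by (simp add: divide_simps) (simp add: algebra_simps)
    show ?thesis unfolding c using assms minus.Z_nonconst[of s] by (intro gen) auto
  qed
  then have 2: "1 / (1 - fls_const s / fls_X) = - (fls_const (1 / s) * (geometric (1 / s) * fls_X))"
    by (simp only: geometric)
  have p: "coeff_plus (geometric s) k = (if k < 0 then 0 else s ^ nat k)"
    by (simp add: coeff_plus_def geometric_def)
  have m: "coeff_minus (- (fls_const (1 / s) * (geometric (1 / s) * fls_X))) k =
      (if k < 0 then - (1 / s * (1 / s) ^ nat (- k - 1)) else 0)"
    by (simp add: coeff_minus_def geometric_def fls_X_times_conv_shift)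
  show ?thesis
  proof (cases "k < 0")
    case True
    then have "nat (- k) = Suc (nat (- k - 1))" by simp
    then have "1 / s * (1 / s) ^ nat (- k - 1) = (1 / s) ^ nat (- k)" by (simp only: power_Suc)
    then show ?thesis unfolding 1 2 p m using True by (simp add: power_int_def divide_inverse)
  next
    case False
    then show ?thesis unfolding 1 2 p m by (simp add: power_int_def)
  qed
qed

context resonant_parameters begin

section \<open>Truncated products\<close>

lemma y_part_eq:
  fixes Q1 :: "'k::field"
  assumes "1 \<le> j" "Q1 \<noteq> 0"
  shows "y_part Q1 Q2 Q3 \<Lambda> j x = box_factor Q1 Q2 Q3 (Q1 powi \<Lambda> j * Q2 ^ (j - 1) * x)"
proof -
  obtain i where "j = Suc i" using assms(1) by (cases j) auto
  then show ?thesis using assms(2)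
    by (simp add: y_part_def box_factor_def power_int_diff mult_ac)
qed

text \<open>
  By \<open>box_factor_eq_psi_empty\<close> and \<open>X (j + n) = Q\<^sub>3 X j\<close> the column \<open>j\<close> of the vacuum is the quotient of the values of
  \<open>psi_empty\<close> at the positions \<open>j\<close> and \<open>j + n\<close>.  Their product over \<open>i < j \<le> N\<close> telescopes in steps of \<open>n\<close>, and the
  \<open>n\<close> factors in the definition of the bracket exchange the initial window for the final one.
\<close>

lemma G_bracket_truncated:
  fixes Q1 Q2 Q3 U z :: "'k::field"
  defines "X \<equiv> \<lambda>j. Q1 powi \<Lambda>0 j * Q2 ^ (j - 1) * (U / z)"
  assumes q: "Q1 * Q2 * Q3 = 1" and Q3: "Q3 = Q1 powi (- int r) * Q2 ^ n"
    and nz: "\<And>j. 1 \<le> j \<Longrightarrow> X j \<noteq> 1" "\<And>j. 1 \<le> j \<Longrightarrow> Q2 * X j \<noteq> 1"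
    and N: "\<And>j. N < j \<Longrightarrow> \<Lambda> j = \<Lambda>0 j" and "i \<le> N"
  shows "G_bracket n r a Q1 Q2 Q3 U \<Lambda> i z =
    (\<Prod>j\<in>{i<..N}. box_factor Q1 Q2 Q3 (Q1 powi \<Lambda> j * Q2 ^ (j - 1) * (U / z))) *
    (\<Prod>j\<in>{N<..N + n}. psi_empty Q2 (X j))"
proof -
  have Q1nz: "Q1 \<noteq> 0" "Q2 \<noteq> 0" using q by auto
  define B where "B j = box_factor Q1 Q2 Q3 (Q1 powi \<Lambda> j * Q2 ^ (j - 1) * (U / z))" for j
  define p where "p j = psi_empty Q2 (X j)" for j
  have p_nz: "p j \<noteq> 0" if "1 \<le> j" for j
    using nz[OF that] by (simp add: p_def psi_empty_def)
  have X_n: "X (j + n) = Q3 * X j" if "1 \<le> j" for j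
  proof -
    have "j + n - 1 = (j - 1) + n" using that by simp
    then show ?thesis unfolding X_def Q3 vac_add_n[OF that] using Q1nz
      by (simp add: power_add power_int_diff power_int_minus divide_inverse mult_ac del: One_nat_def)
  qed
  have vac_part: "y_part Q1 Q2 Q3 \<Lambda>0 j (U / z) = p j / p (j + n)" if "1 \<le> j" for j
    unfolding y_part_eq[OF that Q1nz(1)] box_factor_eq_psi_empty[OF q] p_def X_n[OF that] by (simp add: X_def)
  have part: "y_part Q1 Q2 Q3 \<Lambda> j (U / z) = B j" if "1 \<le> j" for j
    unfolding y_part_eq[OF that Q1nz(1)] B_def ..
  have "Prod_any (\<lambda>j. if i < j then y_part Q1 Q2 Q3 \<Lambda> j (U / z) / y_part Q1 Q2 Q3 \<Lambda>0 j (U / z) else 1) =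
      (\<Prod>j\<in>{i<..N}. if i < j then y_part Q1 Q2 Q3 \<Lambda> j (U / z) / y_part Q1 Q2 Q3 \<Lambda>0 j (U / z) else 1)"
  proof (rule Prod_any.expand_superset)
    show "{j. (if i < j then y_part Q1 Q2 Q3 \<Lambda> j (U / z) / y_part Q1 Q2 Q3 \<Lambda>0 j (U / z) else 1) \<noteq> 1} \<subseteq> {i<..N}"
    proof
      fix j assume "j \<in> {j. (if i < j then y_part Q1 Q2 Q3 \<Lambda> j (U / z) / y_part Q1 Q2 Q3 \<Lambda>0 j (U / z) else 1) \<noteq> 1}"
      then have j: "i < j" "y_part Q1 Q2 Q3 \<Lambda> j (U / z) / y_part Q1 Q2 Q3 \<Lambda>0 j (U / z) \<noteq> 1"
        by (auto split: if_splits)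
      have "j \<le> N"
      proof (rule ccontr)
        assume "\<not> j \<le> N"
        then have "y_part Q1 Q2 Q3 \<Lambda> j (U / z) = y_part Q1 Q2 Q3 \<Lambda>0 j (U / z)"
          using N[of j] by (simp add: y_part_def)
        moreover have "y_part Q1 Q2 Q3 \<Lambda>0 j (U / z) \<noteq> 0"
          using j vac_part[of j] p_nz[of j] p_nz[of "j + n"] by simp
        ultimately show False using j by simp
      qed
      then show "j \<in> {i<..N}" using j by simp
    qed
  qed simp
  also have "\<dots> = (\<Prod>j\<in>{i<..N}. B j * (p (j + n) / p j))"
    by (intro prod.cong) (auto simp: part vac_part)
  also have "\<dots> = (\<Prod>j\<in>{i<..N}. B j) * ((\<Prod>j\<in>{i<..N}. p (j + n)) / (\<Prod>j\<in>{i<..N}. p j))"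
    by (simp add: prod.distrib prod_dividef)
  finally have 1: "Prod_any (\<lambda>j. if i < j then y_part Q1 Q2 Q3 \<Lambda> j (U / z) / y_part Q1 Q2 Q3 \<Lambda>0 j (U / z) else 1) =
      (\<Prod>j\<in>{i<..N}. B j) * ((\<Prod>j\<in>{i<..N}. p (j + n)) / (\<Prod>j\<in>{i<..N}. p j))" .
  have 2: "(\<Prod>j\<in>{0..<n}. psi_empty Q2 (Q1 powi \<Lambda>0 (i + j + 1) * Q2 ^ (i + j) * U / z)) = (\<Prod>j\<in>{i<..i + n}. p j)"
    by (rule prod.reindex_bij_witness[of _ "\<lambda>j. j - i - 1" "\<lambda>j. i + j + 1"]) (auto simp: p_def X_def)
  have 3: "(\<Prod>j\<in>{i<..N}. p (j + n)) = (\<Prod>j\<in>{i + n<..N + n}. p j)"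
    by (rule prod.reindex_bij_witness[of _ "\<lambda>j. j - n" "\<lambda>j. j + n"]) auto
  have 4: "(\<Prod>j\<in>{i + n<..N + n}. p j) * (\<Prod>j\<in>{i<..i + n}. p j) = (\<Prod>j\<in>{i<..N + n}. p j)"
    using \<open>i \<le> N\<close> by (subst prod.union_disjoint[symmetric]) (auto intro!: prod.cong)
  have 5: "(\<Prod>j\<in>{i<..N + n}. p j) = (\<Prod>j\<in>{i<..N}. p j) * (\<Prod>j\<in>{N<..N + n}. p j)"
    using \<open>i \<le> N\<close> by (subst prod.union_disjoint[symmetric]) (auto intro!: prod.cong)
  have 6: "(\<Prod>j\<in>{i<..N}. p j) \<noteq> 0" using p_nz by simp
  have "G_bracket n r a Q1 Q2 Q3 U \<Lambda> i z = (\<Prod>j\<in>{i<..N}. B j) *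
      (((\<Prod>j\<in>{i + n<..N + n}. p j) * (\<Prod>j\<in>{i<..i + n}. p j)) / (\<Prod>j\<in>{i<..N}. p j))"
    unfolding G_bracket_def 1 2 3 by simp
  also have "\<dots> = (\<Prod>j\<in>{i<..N}. B j) * (\<Prod>j\<in>{N<..N + n}. p j)"
    unfolding 4 5 using 6 by simp
  finally show ?thesis unfolding B_def p_def .
qed

lemma G_psi_eq_G_bracket: "G_psi n r a Q1 Q2 Q3 U \<Lambda> z = G_bracket n r a Q1 Q2 Q3 U \<Lambda> 0 z"
proof -
  have "(\<Prod>i\<in>{0..<n}. psi_empty Q2 (Q1 powi (- int (\<Sum>k\<in>{1..i}. a k)) * Q2 ^ i * U / z)) =
      (\<Prod>j\<in>{0..<n}. psi_empty Q2 (Q1 powi \<Lambda>0 (0 + j + 1) * Q2 ^ (0 + j) * U / z))"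
    by (intro prod.cong) (auto simp: vac_def)
  moreover have "(\<lambda>j. if 1 \<le> j then y_part Q1 Q2 Q3 \<Lambda> j (U / z) / y_part Q1 Q2 Q3 \<Lambda>0 j (U / z) else 1) =
      (\<lambda>j. if 0 < j then y_part Q1 Q2 Q3 \<Lambda> j (U / z) / y_part Q1 Q2 Q3 \<Lambda>0 j (U / z) else 1)"
    by auto
  ultimately show ?thesis unfolding G_psi_def G_bracket_def by (simp only: mult.commute)
qed

text \<open>
  A cut-off \<open>N\<close> for \<open>\<Lambda>\<close>.  The margin of \<open>n\<close> below \<open>N\<close> ensures that all addable positions are less than \<open>N\<close>: at
  \<open>p \<ge> N\<close> the vacuum differences between \<open>p - n\<close> and \<open>p\<close> leave no room.
\<close>

definition settled :: "nat \<Rightarrow> (nat \<Rightarrow> int) \<Rightarrow> bool" where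
  "settled N \<Lambda> \<longleftrightarrow> n < N \<and> (\<forall>j. N \<le> j + n \<longrightarrow> \<Lambda> j = \<Lambda>0 j)"

lemma settled_exists: "\<Lambda> \<in> Adm \<Longrightarrow> \<exists>N. \<forall>N'\<ge>N. settled N' \<Lambda>"
proof -
  assume "\<Lambda> \<in> Adm"
  then obtain N where "\<forall>j\<ge>N. \<Lambda> j = \<Lambda>0 j" using Adm_stable by blast
  then show ?thesis by (intro exI[of _ "N + n + 1"]) (auto simp: settled_def)
qed

lemma settled_mono: "settled N \<Lambda> \<Longrightarrow> N \<le> N' \<Longrightarrow> settled N' \<Lambda>"
  by (auto simp: settled_def)

lemma settled_after: "settled N \<Lambda> \<Longrightarrow> N \<le> j \<Longrightarrow> \<Lambda> j = \<Lambda>0 j"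
  by (auto simp: settled_def)

lemma addable_less:
  assumes "\<Lambda> \<in> Adm" "settled N \<Lambda>" "1 \<le> p" "add_one \<Lambda> p \<in> Adm"
  shows "p < N"
proof (rule ccontr)
  assume "\<not> p < N"
  then have "n < p" "\<Lambda> p = \<Lambda>0 p" "\<Lambda> (p - n) = \<Lambda>0 (p - n)" using assms(2) by (auto simp: settled_def)
  moreover have "\<Lambda>0 (p - n + n) = \<Lambda>0 (p - n) - int r" using \<open>n < p\<close> by (intro vac_add_n) simp
  ultimately show False using add_one_Adm_iff[OF assms(1,3)] assms(4) by simp
qed

lemma removable_less:
  assumes "\<Lambda> \<in> Adm" "settled N \<Lambda>" "1 \<le> p" "sub_one \<Lambda> p \<in> Adm"
  shows "p + n < N"
proof (rule ccontr)
  assume "\<not> p + n < N"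
  then have "\<Lambda> p = \<Lambda>0 p" "\<Lambda> (p + n) = \<Lambda>0 (p + n)" using assms(2) by (auto simp: settled_def)
  then show False using vac_add_n[OF assms(3)] sub_one_Adm_iff[OF assms(1,3)] assms(4) by simp
qed

lemma settled_add_one:
  "settled N \<Lambda> \<Longrightarrow> p < N \<Longrightarrow> settled (N + n) (add_one \<Lambda> p)"
  by (auto simp: settled_def add_one_apply)

lemma settled_add_one_removed:
  "settled N (add_one \<Lambda> p) \<Longrightarrow> \<Lambda> \<in> Adm \<Longrightarrow> add_one \<Lambda> p \<in> Adm \<Longrightarrow> 1 \<le> p \<Longrightarrow> settled N \<Lambda>"
  using removable_less[of "add_one \<Lambda> p" N p]
  by (auto simp: settled_def add_one_apply split: if_splits)

text \<open>The columns \<open>N < j \<le> N + n\<close> stand for the telescoped infinite rest.\<close>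

definition column_factor :: "nat \<Rightarrow> nat \<Rightarrow> complex \<Rightarrow> complex" where
  "column_factor N j x = (if j \<le> N then box_factor q1 q2 q3 x else psi_empty q2 x)"

definition E_amp :: "(nat \<Rightarrow> int) \<Rightarrow> nat \<Rightarrow> complex" where
  "E_amp \<Lambda> p = 1 / (1 - q1) * (\<Prod>j\<in>{1..<p}. box_factor q1 q2 q3 (weight \<Lambda> j / weight \<Lambda> p))"

definition F_amp :: "nat \<Rightarrow> (nat \<Rightarrow> int) \<Rightarrow> nat \<Rightarrow> complex" where
  "F_amp N \<Lambda> p = q1 / (1 - q1) * (\<Prod>j\<in>{p<..N + n}. column_factor N j (weight \<Lambda> j / weight \<Lambda> p))"

lemma G_e_eq: "1 \<le> p \<Longrightarrow> G_e q1 q2 q3 u \<Lambda> p k = weight \<Lambda> p powi k * E_amp \<Lambda> p"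
proof -
  have "(\<Prod>j\<in>{1..<p}. y_part q1 q2 q3 \<Lambda> j (u / weight \<Lambda> p)) =
      (\<Prod>j\<in>{1..<p}. box_factor q1 q2 q3 (weight \<Lambda> j / weight \<Lambda> p))"
    by (intro prod.cong) (auto simp: y_part_eq weight_def)
  then show ?thesis unfolding G_e_def E_amp_def Let_def weight_def[symmetric] by simp
qed

lemma q3_vac: "q3 = q1 powi (- int r) * q2 ^ n"
proof -
  have "q1 powi (int r - 1) * q2 powi (- (int n + 1)) = 1"
    unfolding resonance12 by (intro exI[of _ 1]) auto
  then have "q1 ^ r = q1 * (q2 ^ n * q2)"
    by (simp add: power_int_diff power_int_minus power_int_add field_simps)
  moreover have "q3 * (q1 * q2) = 1" using q123 by (simp add: mult_ac)
  ultimately have "q3 * q1 ^ r = q2 ^ n" by (simp add: mult_ac)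
  then show ?thesis by (simp add: power_int_minus field_simps)
qed

lemma ring_hom_poly_at: "ring_hom_to_field (\<lambda>p::complex poly. poly p v)"
  by standard auto

lemma ratfun1_mult: "ratfun1 (p * q) = ratfun1 p * ratfun1 q"
  by simp

lemma ratfun1_const_power: "ratfun1 [:c ^ m:] = ratfun1 [:c:] ^ m"
proof (induction m)
  case (Suc m)
  have "ratfun1 [:c ^ Suc m:] = ratfun1 ([:c:] * [:c ^ m:])" by (simp add: mult.commute)
  then show ?case by (simp only: ratfun1_mult Suc power_Suc)
qed (simp add: One_fract_def one_pCons)

lemma ratfun1_const_powi: "c \<noteq> 0 \<Longrightarrow> ratfun1 [:c powi k:] = ratfun1 [:c:] powi k"
proof (cases "0 \<le> k")
  case False
  assume c: "c \<noteq> 0"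
  have "ratfun1 [:inverse c ^ m:] * ratfun1 [:c ^ m:] = 1" for m
    using c by (simp add: power_mult_distrib[symmetric] One_fract_def one_pCons)
  then have "ratfun1 [:inverse c ^ m:] = inverse (ratfun1 [:c ^ m:])" for m
    using inverse_unique[of "ratfun1 [:c ^ m:]" "ratfun1 [:inverse c ^ m:]"] by (simp add: mult.commute)
  then show ?thesis using False
    by (simp only: power_int_def ratfun1_const_power if_False power_inverse)
qed (simp add: power_int_def ratfun1_const_power)

text \<open>
  The evaluation after cancellation is direct, since by \<open>addable_generic\<close> no factor of the truncated product has a
  pole at \<open>z = v\<close>.
\<close>

lemma G_f_eq:
  assumes L: "\<Lambda> \<in> Adm" "add_one \<Lambda> p \<in> Adm" "1 \<le> p" and N: "settled N \<Lambda>"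
  shows "G_f n r a q1 q2 q3 u \<Lambda> p k = weight \<Lambda> p powi k * F_amp N \<Lambda> p"
proof -
  define v where "v = weight \<Lambda> p"
  let ?R = "\<lambda>c::complex. ratfun1 [:c:]"
  let ?z = "ratfun1 [:0, 1:]"
  interpret S: specialization "evaluates (\<lambda>p. poly p v)"
    by (intro ring_hom_to_field.specialization_evaluates ring_hom_poly_at)
  have ev: "evaluates (\<lambda>p. poly p v) (ratfun1 p) (poly p v)" for p
    by (rule ring_hom_to_field.evaluates_Fract_one[OF ring_hom_poly_at])
  have evc: "evaluates (\<lambda>p. poly p v) (?R c) c" for c using ev[of "[:c:]"] by simp
  have evz: "evaluates (\<lambda>p. poly p v) ?z v" using ev[of "[:0, 1:]"] by simp
  have v_nz: "v \<noteq> 0" by (simp add: v_def)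
  have p_less: "p < N" using addable_less L N by blast
  have const: "?R q1 powi \<Lambda>' j * ?R q2 ^ (j - 1) * (?R u / ?z) = ?R (weight \<Lambda>' j) / ?z" for \<Lambda>' j
    unfolding weight_def ratfun1_const_powi[OF q_nz(1), symmetric] ratfun1_const_power[symmetric]
    by (simp add: mult_ac)
  have evw: "evaluates (\<lambda>p. poly p v) (?R c / ?z) (c / v)" for c
    by (intro S.divide evc evz v_nz)
  have not1: "?R c / ?z \<noteq> 1" for c
  proof
    assume "?R c / ?z = 1"
    then have "c / w = 1" if "w \<noteq> 0" for w
    proof -
      interpret S: specialization "evaluates (\<lambda>p. poly p w)"
        by (intro ring_hom_to_field.specialization_evaluates ring_hom_poly_at)
      have "evaluates (\<lambda>p. poly p w) (?R c / ?z) (c / w)"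
        using that ring_hom_to_field.evaluates_Fract_one[OF ring_hom_poly_at, of w "[:c:]"]
          ring_hom_to_field.evaluates_Fract_one[OF ring_hom_poly_at, of w "[:0,1:]"]
        by (intro S.divide) auto
      then show ?thesis unfolding \<open>?R c / ?z = 1\<close> using S.unique S.one by blast
    qed
    from this[of 1] this[of 2] show False by simp
  qed
  have "G_bracket n r a (?R q1) (?R q2) (?R q3) (?R u) \<Lambda> p ?z =
      (\<Prod>j\<in>{p<..N}. box_factor (?R q1) (?R q2) (?R q3) (?R (weight \<Lambda> j) / ?z)) *
      (\<Prod>j\<in>{N<..N + n}. psi_empty (?R q2) (?R (weight \<Lambda>0 j) / ?z))"
    unfolding const[symmetric]
  proof (rule G_bracket_truncated)
    have "?R q1 * ?R q2 * ?R q3 = ?R (q1 * q2 * q3)" by (simp add: mult_ac)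
    then show "?R q1 * ?R q2 * ?R q3 = 1" unfolding q123 by (simp add: One_fract_def one_pCons)
    show "?R q3 = ?R q1 powi - int r * ?R q2 ^ n"
      unfolding ratfun1_const_powi[OF q_nz(1), symmetric] ratfun1_const_power[symmetric]
      by (subst q3_vac) (simp add: mult.commute)
    show "?R q1 powi \<Lambda>0 j * ?R q2 ^ (j - 1) * (?R u / ?z) \<noteq> 1" for j
      unfolding const by (rule not1)
    have "?R q2 * (?R c / ?z) = ?R (q2 * c) / ?z" for c by (simp add: mult.commute)
    then show "?R q2 * (?R q1 powi \<Lambda>0 j * ?R q2 ^ (j - 1) * (?R u / ?z)) \<noteq> 1" for j
      unfolding const using not1 by metis
  qed (use N p_less in \<open>auto simp: settled_after\<close>)
  moreover have "evaluates (\<lambda>p. poly p v)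
      ((\<Prod>j\<in>{p<..N}. box_factor (?R q1) (?R q2) (?R q3) (?R (weight \<Lambda> j) / ?z)) *
       (\<Prod>j\<in>{N<..N + n}. psi_empty (?R q2) (?R (weight \<Lambda>0 j) / ?z)))
      ((\<Prod>j\<in>{p<..N}. box_factor q1 q2 q3 (weight \<Lambda> j / v)) *
       (\<Prod>j\<in>{N<..N + n}. psi_empty q2 (weight \<Lambda>0 j / v)))"
  proof (intro S.mult S.prod S.box_factor S.psi_empty evc evw)
    fix j assume "j \<in> {p<..N}"
    then have "1 \<le> j" "j \<noteq> p" by auto
    from addable_generic[OF L(1,2) this(1) L(3) this(2)]
    show "weight \<Lambda> j / v \<noteq> 1" "weight \<Lambda> j / v \<noteq> q1" using v_nz by (auto simp: v_def field_simps)
  next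
    fix j assume j: "j \<in> {N<..N + n}"
    then have "1 \<le> j" "j \<noteq> p" using p_less by auto
    from addable_generic[OF L(1,2) this(1) L(3) this(2)]
    have "weight \<Lambda> j / v \<noteq> 1" using v_nz by (auto simp: v_def field_simps)
    moreover have "weight \<Lambda>0 j = weight \<Lambda> j" using settled_after[OF N, of j] j by (simp add: weight_def)
    ultimately show "weight \<Lambda>0 j / v \<noteq> 1" by simp
  qed simp
  ultimately have *: "eval_fract (\<lambda>p. poly p v) (G_bracket n r a (?R q1) (?R q2) (?R q3) (?R u) \<Lambda> p ?z) =
      (\<Prod>j\<in>{p<..N}. box_factor q1 q2 q3 (weight \<Lambda> j / v)) * (\<Prod>j\<in>{N<..N + n}. psi_empty q2 (weight \<Lambda>0 j / v))"
    using ring_hom_to_field.eval_fract_eq[OF ring_hom_poly_at] by metis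
  also have "\<dots> = (\<Prod>j\<in>{p<..N}. column_factor N j (weight \<Lambda> j / v)) *
      (\<Prod>j\<in>{N<..N + n}. column_factor N j (weight \<Lambda> j / v))"
    using settled_after[OF N] by (intro arg_cong2[where f = "(*)"] prod.cong) (auto simp: column_factor_def weight_def)
  also have "\<dots> = (\<Prod>j\<in>{p<..N + n}. column_factor N j (weight \<Lambda> j / v))"
    using p_less by (subst prod.union_disjoint[symmetric]) (auto intro!: prod.cong)
  finally show ?thesis unfolding G_f_def Let_def weight_def[symmetric] F_amp_def v_def[symmetric] by simp
qed

end

text \<open>
  The cubic relation at three distinct weights.  The polynomial \<open>G\<close> is \<open>g\<close> with symmetric functions \<open>\<sigma>\<close>, \<open>\<tau>\<close>
  of its parameters and \<open>q\<^sub>1 q\<^sub>2 q\<^sub>3 = 1\<close>.  Expanding the products directly would be hopeless; splitting each \<open>G\<close>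
  into its symmetric part \<open>B\<close> and antisymmetric part \<open>A\<close> makes most terms cancel, and \<open>B\<close> factors.
\<close>

lemma serre_identity:
  fixes x y z \<sigma> \<tau> :: complex
  defines "G \<equiv> \<lambda>z w. z ^ 3 - \<sigma> * z\<^sup>2 * w + \<tau> * z * w\<^sup>2 - w ^ 3"
  shows "G x y * G x z * G y z * ((x + z) * (y\<^sup>2 - x * z)) - G y x * G x z * G y z * ((y + z) * (x\<^sup>2 - y * z))
    - G x y * G x z * G z y * ((x + y) * (z\<^sup>2 - x * y)) + G y z * G y x * G z x * ((y + x) * (z\<^sup>2 - x * y))
    + G z x * G z y * G x y * ((z + y) * (x\<^sup>2 - y * z)) - G z y * G z x * G y x * ((z + x) * (y\<^sup>2 - x * z)) = 0"
proof -
  \<comment> \<open>Chosen such that \<open>B + A\<close> and \<open>B - A\<close> are \<open>G x y\<close> and \<open>G y x\<close>.\<close>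
  define h k where "h = (\<sigma> + \<tau>) / 2 - 1" and "k = (\<tau> - \<sigma>) / 2"
  define A B where "A = (\<lambda>x y. (x - y) * (x\<^sup>2 + y\<^sup>2 - h * (x * y)))" and "B = (\<lambda>x y. k * (x * y * (x + y)))"
  have G: "G x y = B x y + A x y" "G y x = B x y - A x y" for x y
    unfolding G_def A_def B_def h_def k_def
    by (simp_all add: field_simps power2_eq_square power3_eq_cube)
  define u1 u2 where "u1 = (x + z) * (y\<^sup>2 - x * z)" and "u2 = (y + z) * (x\<^sup>2 - y * z)"
  have u3: "(x + y) * (z\<^sup>2 - x * y) = - u1 - u2" "(y + x) * (z\<^sup>2 - x * y) = - u1 - u2"
    "(z + y) * (x\<^sup>2 - y * z) = u2" "(z + x) * (y\<^sup>2 - x * z) = u1"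
    unfolding u1_def u2_def by (simp_all add: algebra_simps power2_eq_square)
  have red: "(P + p) * (Q + q) * (R + r) * u1 - (P - p) * (Q + q) * (R + r) * u2
      - (P + p) * (Q + q) * (R - r) * (- u1 - u2) + (R + r) * (P - p) * (Q - q) * (- u1 - u2)
      + (Q - q) * (R - r) * (P + p) * u2 - (R - r) * (Q - q) * (P - p) * u1 =
      4 * (P * q * R * u1 - P * Q * r * u2 - p * Q * R * (- u1 - u2))" for P Q R p q r :: complex
    by (simp add: algebra_simps)
  have "z * (x - y) * (x\<^sup>2 + y\<^sup>2 - h * (x * y)) * (z\<^sup>2 - x * y) - y * (x - z) * (x\<^sup>2 + z\<^sup>2 - h * (x * z)) * (y\<^sup>2 - x * z)
      + x * (y - z) * (y\<^sup>2 + z\<^sup>2 - h * (y * z)) * (x\<^sup>2 - y * z) = 0" (is "?K = 0")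
    by (simp add: algebra_simps power2_eq_square)
  moreover have "B x y * A x z * B y z * u1 - B x y * B x z * A y z * u2 - A x y * B x z * B y z * (- u1 - u2) =
      - (k\<^sup>2 * (x * y * z) * ((x + y) * (x + z) * (y + z)) * ?K)"
    unfolding u3(1)[symmetric] unfolding A_def B_def u1_def u2_def
    by (simp add: right_diff_distrib distrib_left power2_eq_square mult_ac)
  ultimately have "B x y * A x z * B y z * u1 - B x y * B x z * A y z * u2 - A x y * B x z * B y z * (- u1 - u2) = 0"
    by simp
  then show ?thesis
    unfolding G[where x = x and y = y] G[where x = x and y = z] G[where x = y and y = z] u3 u1_def[symmetric] u2_def[symmetric] red by simp
qed

context resonant_parameters begin

section \<open>Amplitudes\<close>

text \<open>
  For \<open>A\<close> the set of positions before \<open>p\<close>, or after \<open>p\<close>, in some linear order, these are the matrix coefficients of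
  \<open>e\<close> and \<open>f\<close>: the natural order gives \<open>G\<close>, another one \<open>M\<close>.
\<close>

definition amplitude :: "nat \<Rightarrow> nat set \<Rightarrow> (nat \<Rightarrow> int) \<Rightarrow> nat \<Rightarrow> complex" where
  "amplitude N A \<Lambda> p = (\<Prod>j\<in>A. column_factor N j (weight \<Lambda> j / weight \<Lambda> p))"

lemma E_amp_eq: "p \<le> N + 1 \<Longrightarrow> E_amp \<Lambda> p = 1 / (1 - q1) * amplitude N {1..<p} \<Lambda> p"
  unfolding E_amp_def amplitude_def column_factor_def
  by (intro arg_cong2[where f = "(*)"] prod.cong) auto

lemma F_amp_eq: "F_amp N \<Lambda> p = q1 / (1 - q1) * amplitude N {p<..N + n} \<Lambda> p"
  unfolding F_amp_def amplitude_def ..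

lemma amplitude_other:
  "q \<notin> A \<Longrightarrow> q \<noteq> p \<Longrightarrow> amplitude N A (add_one \<Lambda> q) p = amplitude N A \<Lambda> p"
  unfolding amplitude_def by (intro prod.cong) (auto simp: weight_add_one)

text \<open>Only the column \<open>q\<close> changes, and \<open>box_factor_shift\<close> says how.\<close>

lemma amplitude_shift:
  assumes "\<Lambda> \<in> Adm" "add_one \<Lambda> p \<in> Adm" "add_one \<Lambda> q \<in> Adm" "1 \<le> p" "1 \<le> q" "p \<noteq> q"
    and "finite A" "q \<in> A" "q \<le> N"
  shows "amplitude N A (add_one \<Lambda> q) p * g_fun (weight \<Lambda> p) (weight \<Lambda> q) =
    - (amplitude N A \<Lambda> p * g_fun (weight \<Lambda> q) (weight \<Lambda> p))"
proof -
  define r' where "r' = (\<Prod>j\<in>A - {q}. column_factor N j (weight \<Lambda> j / weight \<Lambda> p))"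
  have 1: "amplitude N A \<Lambda> p = box_factor q1 q2 q3 (weight \<Lambda> q / weight \<Lambda> p) * r'"
    unfolding amplitude_def r'_def using assms(7-9) by (subst prod.remove[of A q]) (auto simp: column_factor_def)
  have 2: "amplitude N A (add_one \<Lambda> q) p = box_factor q1 q2 q3 (q1 * weight \<Lambda> q / weight \<Lambda> p) * r'"
    unfolding amplitude_def r'_def using assms(6-9)
    by (subst prod.remove[of A q]) (auto simp: column_factor_def weight_add_one intro!: prod.cong)
  have "box_factor q1 q2 q3 (q1 * weight \<Lambda> q / weight \<Lambda> p) * g_fun (weight \<Lambda> p) (weight \<Lambda> q) =
      - (box_factor q1 q2 q3 (weight \<Lambda> q / weight \<Lambda> p) * g_fun (weight \<Lambda> q) (weight \<Lambda> p))"
    using addable_generic[OF assms(1,2,5,4)] addable_generic[OF assms(1,3,4,5)] assms(6)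
    by (intro box_factor_shift q123) auto
  then show ?thesis unfolding 1 2 by (simp add: mult_ac)
qed

lemma column_factor_nz:
  assumes "\<Lambda> \<in> Adm" "add_one \<Lambda> p \<in> Adm" "1 \<le> j" "1 \<le> p" "j \<noteq> p"
  shows "column_factor N j (weight \<Lambda> j / weight \<Lambda> p) \<noteq> 0"
proof -
  let ?x = "weight \<Lambda> j / weight \<Lambda> p"
  have "1 - ?x \<noteq> 0" "1 - ?x / q1 \<noteq> 0" "1 - q2 * ?x \<noteq> 0" "1 - q3 * ?x \<noteq> 0"
    using addable_generic[OF assms] by (auto simp: divide_simps mult_ac)
  then show ?thesis unfolding column_factor_def box_factor_def psi_empty_def by simp
qed

lemma amplitude_nz:
  assumes "\<Lambda> \<in> Adm" "add_one \<Lambda> p \<in> Adm" "1 \<le> p" "p \<notin> A" "0 \<notin> A"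
  shows "amplitude N A \<Lambda> p \<noteq> 0"
proof (cases "finite A")
  case True
  have "1 \<le> j \<and> j \<noteq> p" if "j \<in> A" for j using that assms(4,5) by (cases j) auto
  then show ?thesis unfolding amplitude_def using column_factor_nz[OF assms(1,2) _ assms(3)] True
    by (simp add: prod_zero_iff)
qed (simp add: amplitude_def)

text \<open>This is \<open>F_amp N\<close> for every cut-off \<open>N\<close>; defined without a choice of \<open>N\<close>.\<close>

definition F_lim :: "(nat \<Rightarrow> int) \<Rightarrow> nat \<Rightarrow> complex" where
  "F_lim \<Lambda> p = G_f n r a q1 q2 q3 u \<Lambda> p 0"

lemma F_lim_eq:
  "\<Lambda> \<in> Adm \<Longrightarrow> add_one \<Lambda> p \<in> Adm \<Longrightarrow> 1 \<le> p \<Longrightarrow> settled N \<Lambda> \<Longrightarrow> F_lim \<Lambda> p = F_amp N \<Lambda> p"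
  by (simp add: F_lim_def G_f_eq)

lemma G_f_eq_F_lim:
  "\<Lambda> \<in> Adm \<Longrightarrow> add_one \<Lambda> p \<in> Adm \<Longrightarrow> 1 \<le> p \<Longrightarrow>
    G_f n r a q1 q2 q3 u \<Lambda> p k = weight \<Lambda> p powi k * F_lim \<Lambda> p"
  using settled_exists[of \<Lambda>] G_f_eq[of \<Lambda> p _ k] F_lim_eq by (metis le_refl)

text \<open>
  The quadratic relation for the coefficients of two raisings at different positions, both of which are
  possible from the start.
\<close>

definition exchangeable :: "((nat \<Rightarrow> int) \<Rightarrow> nat \<Rightarrow> complex) \<Rightarrow> bool" where
  "exchangeable X \<longleftrightarrow> (\<forall>\<Lambda> p q. \<Lambda> \<in> Adm \<longrightarrow> add_one \<Lambda> p \<in> Adm \<longrightarrow> add_one \<Lambda> q \<in> Adm \<longrightarrow> 1 \<le> p \<longrightarrow> 1 \<le> q \<longrightarrow>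
     p \<noteq> q \<longrightarrow>
     g_fun (weight \<Lambda> p) (weight \<Lambda> q) * (X \<Lambda> q * X (add_one \<Lambda> q) p) +
     g_fun (weight \<Lambda> q) (weight \<Lambda> p) * (X \<Lambda> p * X (add_one \<Lambda> p) q) = 0)"

lemma exchange_E_aux:
  assumes "\<Lambda> \<in> Adm" "add_one \<Lambda> p \<in> Adm" "add_one \<Lambda> q \<in> Adm" "1 \<le> p" "1 \<le> q" "p < q"
  shows "E_amp (add_one \<Lambda> q) p = E_amp \<Lambda> p"
    and "E_amp (add_one \<Lambda> p) q * g_fun (weight \<Lambda> q) (weight \<Lambda> p) =
      - (E_amp \<Lambda> q * g_fun (weight \<Lambda> p) (weight \<Lambda> q))"
  using amplitude_other[of q "{1..<p}" p q \<Lambda>] amplitude_shift[OF assms(1,3,2,5,4), of "{1..<q}" q] assms(6)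
  by (auto simp: E_amp_eq[of _ q] \<open>1 \<le> p\<close>[simplified])

lemma exchangeable_E: "exchangeable E_amp"
  unfolding exchangeable_def
proof (intro allI impI)
  fix \<Lambda> p q
  assume *: "\<Lambda> \<in> Adm" "add_one \<Lambda> p \<in> Adm" "add_one \<Lambda> q \<in> Adm" "1 \<le> p" "1 \<le> q" "p \<noteq> q"
  show "g_fun (weight \<Lambda> p) (weight \<Lambda> q) * (E_amp \<Lambda> q * E_amp (add_one \<Lambda> q) p) +
     g_fun (weight \<Lambda> q) (weight \<Lambda> p) * (E_amp \<Lambda> p * E_amp (add_one \<Lambda> p) q) = 0"
    using exchange_E_aux[OF *(1-5)] exchange_E_aux[OF *(1,3,2,5,4)] *(6)
    by (cases "p < q") (simp_all add: algebra_simps)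
qed

lemma exchange_F_aux:
  assumes "\<Lambda> \<in> Adm" "add_one \<Lambda> p \<in> Adm" "add_one \<Lambda> q \<in> Adm" "1 \<le> p" "1 \<le> q" "p < q"
  shows "F_lim (add_one \<Lambda> p) q = F_lim \<Lambda> q"
    and "F_lim (add_one \<Lambda> q) p * g_fun (weight \<Lambda> p) (weight \<Lambda> q) =
      - (F_lim \<Lambda> p * g_fun (weight \<Lambda> q) (weight \<Lambda> p))"
proof -
  obtain N where N: "settled N \<Lambda>" using settled_exists[OF assms(1)] by blast
  have "p < N" "q < N" using addable_less[OF assms(1) N] assms by blast+
  then have N': "settled (N + n) \<Lambda>" "settled (N + n) (add_one \<Lambda> p)" "settled (N + n) (add_one \<Lambda> q)"
    using N settled_add_one settled_mono[of N \<Lambda> "N + n"] by auto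
  have pq: "add_one (add_one \<Lambda> p) q \<in> Adm" "add_one (add_one \<Lambda> q) p \<in> Adm"
    using assms by (auto intro: add_one_twice_Adm)
  note F = F_lim_eq[OF assms(1,2,4) N'(1)] F_lim_eq[OF assms(1,3,5) N'(1)]
    F_lim_eq[OF assms(2) pq(1) assms(5) N'(2)] F_lim_eq[OF assms(3) pq(2) assms(4) N'(3)]
  show "F_lim (add_one \<Lambda> p) q = F_lim \<Lambda> q"
    unfolding F F_amp_eq using assms(6) by (subst amplitude_other) auto
  have "amplitude (N + n) {p<..N + n + n} (add_one \<Lambda> q) p * g_fun (weight \<Lambda> p) (weight \<Lambda> q) =
      - (amplitude (N + n) {p<..N + n + n} \<Lambda> p * g_fun (weight \<Lambda> q) (weight \<Lambda> p))"
    using assms \<open>q < N\<close> by (intro amplitude_shift) auto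
  then show "F_lim (add_one \<Lambda> q) p * g_fun (weight \<Lambda> p) (weight \<Lambda> q) =
      - (F_lim \<Lambda> p * g_fun (weight \<Lambda> q) (weight \<Lambda> p))"
    unfolding F F_amp_eq by (metis mult.assoc mult_minus_right)
qed

lemma exchangeable_F: "exchangeable F_lim"
  unfolding exchangeable_def
proof (intro allI impI)
  fix \<Lambda> p q
  assume *: "\<Lambda> \<in> Adm" "add_one \<Lambda> p \<in> Adm" "add_one \<Lambda> q \<in> Adm" "1 \<le> p" "1 \<le> q" "p \<noteq> q"
  show "g_fun (weight \<Lambda> p) (weight \<Lambda> q) * (F_lim \<Lambda> q * F_lim (add_one \<Lambda> q) p) +
     g_fun (weight \<Lambda> q) (weight \<Lambda> p) * (F_lim \<Lambda> p * F_lim (add_one \<Lambda> p) q) = 0"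
    using exchange_F_aux[OF *(1-5)] exchange_F_aux[OF *(1,3,2,5,4)] *(6)
    by (cases "p < q") (simp_all add: algebra_simps)
qed

text \<open>
  The off-diagonal part of the commutator of \<open>e\<close> and \<open>f\<close> vanishes: for \<open>p < q\<close> neither coefficient notices the
  other step, and for \<open>q < p\<close> both change by reciprocal factors, by the exchange law.
\<close>

lemma add_remove_commute:
  assumes "\<Lambda> \<in> Adm" "add_one \<Lambda> p \<in> Adm" "add_one \<Lambda> q \<in> Adm" "1 \<le> p" "1 \<le> q" "p \<noteq> q"
  shows "E_amp (add_one \<Lambda> q) p * F_lim (add_one \<Lambda> p) q = E_amp \<Lambda> p * F_lim \<Lambda> q"
proof (cases "p < q")
  case True
  then show ?thesis using exchange_E_aux(1)[OF assms(1-5)] exchange_F_aux(1)[OF assms(1-5)] by simp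
next
  case False
  then have qp: "q < p" using assms(6) by simp
  let ?g = "g_fun (weight \<Lambda> p) (weight \<Lambda> q)" and ?g' = "g_fun (weight \<Lambda> q) (weight \<Lambda> p)"
  have "(E_amp (add_one \<Lambda> q) p * ?g) * (F_lim (add_one \<Lambda> p) q * ?g') = (E_amp \<Lambda> p * ?g') * (F_lim \<Lambda> q * ?g)"
    unfolding exchange_E_aux(2)[OF assms(1,3,2,5,4) qp] exchange_F_aux(2)[OF assms(1,3,2,5,4) qp] by simp
  then have "(E_amp (add_one \<Lambda> q) p * F_lim (add_one \<Lambda> p) q) * (?g * ?g') = (E_amp \<Lambda> p * F_lim \<Lambda> q) * (?g * ?g')"
    by (simp add: mult_ac)
  moreover have "?g \<noteq> 0" "?g' \<noteq> 0"
    using square_generic[OF assms] square_generic[OF assms(1,3,2,5,4)] assms(6) by auto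
  ultimately show ?thesis by simp
qed

text \<open>Coefficients extended by zero, so that sums over all positions can be used.\<close>

definition guarded :: "((nat \<Rightarrow> int) \<Rightarrow> nat \<Rightarrow> complex) \<Rightarrow> (nat \<Rightarrow> int) \<Rightarrow> nat \<Rightarrow> complex" where
  "guarded X \<Lambda> p = (if \<Lambda> \<in> Adm \<and> add_one \<Lambda> p \<in> Adm \<and> 1 \<le> p then X \<Lambda> p else 0)"

lemma guardedD: "guarded X \<Lambda> p \<noteq> 0 \<Longrightarrow> \<Lambda> \<in> Adm \<and> add_one \<Lambda> p \<in> Adm \<and> 1 \<le> p"
  by (auto simp: guarded_def split: if_splits)

text \<open>
  If raising \<open>p\<close> unblocks \<open>q\<close>, the two positions touch, \<open>q = p + 1\<close> or \<open>q = p + n\<close>, and the ratio of weights is a zero of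
  \<open>g\<close>.  This is why the exchange law survives with one of its two paths missing.
\<close>

lemma blocked_zero:
  assumes "\<Lambda> \<in> Adm" "add_one \<Lambda> p \<in> Adm" "add_one (add_one \<Lambda> p) q \<in> Adm" "add_one \<Lambda> q \<notin> Adm"
    "1 \<le> p" "1 \<le> q" "p \<noteq> q"
  shows "g_fun (weight \<Lambda> q) (weight \<Lambda> p) = 0"
proof -
  have not: "\<not> ((q > 1 \<longrightarrow> \<Lambda> q < \<Lambda> (q - 1)) \<and> (q > n \<longrightarrow> \<Lambda> q + int r < \<Lambda> (q - n)))"
    using add_one_Adm_iff[OF assms(1,6)] assms(4) by simp
  have yes: "(q > 1 \<longrightarrow> add_one \<Lambda> p q < add_one \<Lambda> p (q - 1)) \<and> (q > n \<longrightarrow> add_one \<Lambda> p q + int r < add_one \<Lambda> p (q - n))"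
    using add_one_Adm_iff[OF assms(2,6)] assms(3) by simp
  show ?thesis
  proof (cases "q > 1 \<and> \<Lambda> (q - 1) \<le> \<Lambda> q")
    case True
    then have pq: "p = q - 1" using yes assms(7) by (auto simp: add_one_apply split: if_splits)
    have "\<Lambda> (q - 1 + 1) \<le> \<Lambda> (q - 1)" using True by (intro Adm_Suc assms(1)) auto
    then have "\<Lambda> (p + 1) = \<Lambda> p" "q = p + 1" using True pq by auto
    then have "weight \<Lambda> q = q2 * weight \<Lambda> p" using weight_step[OF assms(5)] by simp
    then show ?thesis by (simp add: g_cubic_def)
  next
    case False
    then have F: "q > n" "\<Lambda> (q - n) \<le> \<Lambda> q + int r" using not by auto
    then have pq: "p = q - n" using yes assms(7) by (auto simp: add_one_apply split: if_splits)
    have "\<Lambda> (q - n + n) + int r \<le> \<Lambda> (q - n)" using F by (intro Adm_n assms(1)) simp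
    then have "\<Lambda> (p + n) + int r = \<Lambda> p" "q = p + n" using F pq by auto
    then have "weight \<Lambda> q = q3 * weight \<Lambda> p" using weight_step_n[OF assms(5)] by simp
    then show ?thesis by (simp add: g_cubic_def)
  qed
qed

lemma exchange:
  assumes "exchangeable X" "p \<noteq> q"
  shows "g_fun (weight \<Lambda> p) (weight \<Lambda> q) * (guarded X \<Lambda> q * guarded X (add_one \<Lambda> q) p) +
     g_fun (weight \<Lambda> q) (weight \<Lambda> p) * (guarded X \<Lambda> p * guarded X (add_one \<Lambda> p) q) = 0"
proof (cases "\<Lambda> \<in> Adm \<and> 1 \<le> p \<and> 1 \<le> q \<and> add_one (add_one \<Lambda> p) q \<in> Adm")
  case False
  have z: "guarded X \<Lambda> q * guarded X (add_one \<Lambda> q) p = 0" "guarded X \<Lambda> p * guarded X (add_one \<Lambda> p) q = 0"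
    using False guardedD[of X \<Lambda> q] guardedD[of X \<Lambda> p] guardedD[of X "add_one \<Lambda> q" p] guardedD[of X "add_one \<Lambda> p" q]
    unfolding add_one_commute[of \<Lambda> q p] mult_eq_0_iff by blast+
  show ?thesis unfolding z by simp
next
  case True
  then have *: "\<Lambda> \<in> Adm" "1 \<le> p" "1 \<le> q" "add_one (add_one \<Lambda> p) q \<in> Adm" "add_one (add_one \<Lambda> q) p \<in> Adm"
    unfolding add_one_commute[of \<Lambda> q p] by blast+
  consider "add_one \<Lambda> p \<in> Adm" "add_one \<Lambda> q \<in> Adm" | "add_one \<Lambda> p \<in> Adm" "add_one \<Lambda> q \<notin> Adm"
    | "add_one \<Lambda> p \<notin> Adm" "add_one \<Lambda> q \<in> Adm" | "add_one \<Lambda> p \<notin> Adm" "add_one \<Lambda> q \<notin> Adm" by blast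
  then show ?thesis
  proof cases
    case 1
    then show ?thesis using assms * by (simp add: guarded_def exchangeable_def)
  next
    case 2
    then show ?thesis using blocked_zero[of \<Lambda> p q] * assms(2) by (simp add: guarded_def)
  next
    case 3
    then show ?thesis using blocked_zero[of \<Lambda> q p] * assms(2) by (simp add: guarded_def)
  next
    case 4
    then show ?thesis by (simp add: guarded_def)
  qed
qed

section \<open>The cubic relation\<close>

text \<open>
  The powers of the three weights that \<open>[X\<^sub>0, [X\<^sub>1, X\<^sub>-\<^sub>1]]\<close> attaches to a path of three steps with weights \<open>x\<close>, \<open>y\<close>, \<open>z\<close>.
\<close>

definition serre_weight :: "complex \<Rightarrow> complex \<Rightarrow> complex \<Rightarrow> complex" where
  "serre_weight x y z = y / x - x / y - z / y + y / z"

lemma serre_weight_eq: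
  "x \<noteq> 0 \<Longrightarrow> y \<noteq> 0 \<Longrightarrow> z \<noteq> 0 \<Longrightarrow> serre_weight x y z = (x + z) * (y\<^sup>2 - x * z) / (x * y * z)"
  by (simp add: serre_weight_def divide_simps) (simp add: algebra_simps power2_eq_square)

definition path_amp :: "((nat \<Rightarrow> int) \<Rightarrow> nat \<Rightarrow> complex) \<Rightarrow> (nat \<Rightarrow> int) \<Rightarrow> nat \<Rightarrow> nat \<Rightarrow> nat \<Rightarrow> complex" where
  "path_amp X \<Lambda> p q s = guarded X \<Lambda> p * guarded X (add_one \<Lambda> p) q * guarded X (add_one (add_one \<Lambda> p) q) s"

definition path_term :: "((nat \<Rightarrow> int) \<Rightarrow> nat \<Rightarrow> complex) \<Rightarrow> (nat \<Rightarrow> int) \<Rightarrow> nat \<Rightarrow> nat \<Rightarrow> nat \<Rightarrow> complex" where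
  "path_term X \<Lambda> p q s = path_amp X \<Lambda> p q s *
     serre_weight (weight \<Lambda> p) (weight (add_one \<Lambda> p) q) (weight (add_one (add_one \<Lambda> p) q) s)"

lemma path_swap_12:
  assumes "exchangeable X" "p \<noteq> q"
  shows "g_fun (weight \<Lambda> p) (weight \<Lambda> q) * path_amp X \<Lambda> q p s + g_fun (weight \<Lambda> q) (weight \<Lambda> p) * path_amp X \<Lambda> p q s = 0"
proof -
  have gen: "g * (a1 * a2 * c) + g' * (b1 * b2 * c) = (g * (a1 * a2) + g' * (b1 * b2)) * c"
    for g g' a1 a2 b1 b2 c :: complex by (simp add: algebra_simps)
  have e: "add_one (add_one \<Lambda> q) p = add_one (add_one \<Lambda> p) q" by (rule add_one_commute)
  show ?thesis unfolding path_amp_def e gen exchange[OF assms, of \<Lambda>] by simp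
qed

lemma path_swap_23:
  assumes "exchangeable X" "q \<noteq> s"
  shows "g_fun (weight (add_one \<Lambda> p) q) (weight (add_one \<Lambda> p) s) * path_amp X \<Lambda> p s q +
    g_fun (weight (add_one \<Lambda> p) s) (weight (add_one \<Lambda> p) q) * path_amp X \<Lambda> p q s = 0"
proof -
  have gen: "g * (c * a1 * a2) + g' * (c * b1 * b2) = c * (g * (a1 * a2) + g' * (b1 * b2))"
    for g g' a1 a2 b1 b2 c :: complex by (simp add: algebra_simps)
  show ?thesis unfolding path_amp_def gen exchange[OF assms, of "add_one \<Lambda> p"] by simp
qed

text \<open>
  The exception is the only coincidence \<open>w\<^sub>p = q\<^sub>1 w\<^sub>s\<close> for \<open>p < s\<close>.  It is excluded in the cubic relation by
  \<open>raised_neighbours\<close>: there, raising \<open>s\<close> requires raising both \<open>p + n\<close> and \<open>p + 1\<close>, which are different from \<open>p\<close>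
  and \<open>s\<close>, and three steps do not suffice.
\<close>

lemma g_nonzero_later:
  assumes "1 \<le> p" "p < s" and D: "int r * int ((s - p) div n) \<le> \<Lambda> p - \<Lambda> s"
    and "\<not> (s = p + n + 1 \<and> \<Lambda> p = \<Lambda> s + int r)"
  shows "g_fun (weight \<Lambda> p) (weight \<Lambda> s) \<noteq> 0"
proof -
  note W = weight_coincidence_later[of p s \<Lambda>, OF assms(1-3)]
  have "weight \<Lambda> p \<noteq> q1 * weight \<Lambda> s" using W(2) assms(4) by blast
  with W(5,7) show ?thesis by (simp add: g_cubic_def)
qed

lemma raised_neighbours:
  assumes "\<Lambda> \<in> Adm" "\<Lambda>' \<in> Adm" "1 \<le> p" "s = p + n + 1" "\<Lambda> p = \<Lambda> s + int r" "\<Lambda> s < \<Lambda>' s"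
  shows "\<Lambda> (p + n) < \<Lambda>' (p + n)" and "\<Lambda> (p + 1) < \<Lambda>' (p + 1)"
proof -
  have e: "p + 1 + n = s" "p + n + 1 = s" using assms(4) by simp_all
  have pos: "1 \<le> p + n" "1 \<le> p + 1" using assms(3) by simp_all
  note below = Adm_n[OF assms(1,3)] Adm_Suc[OF assms(1,3)]
  note above = Adm_Suc[OF assms(2) pos(1), unfolded e] Adm_n[OF assms(2) pos(2), unfolded e]
  show "\<Lambda> (p + n) < \<Lambda>' (p + n)" using below(1) above(1) assms(5,6) by simp
  show "\<Lambda> (p + 1) < \<Lambda>' (p + 1)" using below(2) above(2) assms(5,6) by simp
qed

text \<open>
  All six paths have amplitudes that are proportional to one of them, by repeated exchange, as long as \<open>g\<close> does
  not vanish for the pairs in their natural order.  With \<open>t\<close> the common factor, the sum is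
  \<open>serre_identity\<close> at the three weights.
\<close>

lemma serre_distinct:
  assumes X: "exchangeable X" and d: "p < q" "q < s" and "1 \<le> p"
  shows "path_term X \<Lambda> p q s + path_term X \<Lambda> p s q + path_term X \<Lambda> q p s + path_term X \<Lambda> q s p +
    path_term X \<Lambda> s p q + path_term X \<Lambda> s q p = 0"
proof (cases "\<Lambda> \<in> Adm \<and> add_one (add_one (add_one \<Lambda> p) q) s \<in> Adm")
  case False
  have zero: "path_amp X \<Lambda> a b c = 0"
    if "add_one (add_one (add_one \<Lambda> a) b) c = add_one (add_one (add_one \<Lambda> p) q) s" for a b c
    using False unfolding that[symmetric] by (auto simp: path_amp_def guarded_def)
  have "path_amp X \<Lambda> p q s = 0" "path_amp X \<Lambda> p s q = 0" "path_amp X \<Lambda> q p s = 0"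
    "path_amp X \<Lambda> q s p = 0" "path_amp X \<Lambda> s p q = 0" "path_amp X \<Lambda> s q p = 0"
    by (rule zero, simp only: add_one_commute)+
  then show ?thesis by (simp add: path_term_def)
next
  case True
  then have L: "\<Lambda> \<in> Adm" and L3: "add_one (add_one (add_one \<Lambda> p) q) s \<in> Adm" by auto
  let ?L3 = "add_one (add_one (add_one \<Lambda> p) q) s"
  define x y z where "x = weight \<Lambda> p" and "y = weight \<Lambda> q" and "z = weight \<Lambda> s"
  have nz: "x \<noteq> 0" "y \<noteq> 0" "z \<noteq> 0" by (auto simp: x_def y_def z_def)
  have gxy: "g_fun x y \<noteq> 0" unfolding x_def y_def
  proof (rule g_nonzero_later[of _ _ \<Lambda>, OF \<open>1 \<le> p\<close> d(1) Adm_diff[OF L \<open>1 \<le> p\<close> less_imp_le[OF d(1)]]], safe)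
    assume h: "q = p + n + 1" "\<Lambda> p = \<Lambda> (p + n + 1) + int r"
    have "\<Lambda> (p + n) < ?L3 (p + n)"
      by (rule raised_neighbours(1)[OF L L3 \<open>1 \<le> p\<close> h(1)]) (use h d in \<open>auto simp: add_one_apply\<close>)
    then show False using h d by (auto simp: add_one_apply split: if_splits)
  qed
  have gyz: "g_fun y z \<noteq> 0" unfolding z_def y_def
  proof (rule g_nonzero_later[of _ _ \<Lambda>, OF _ d(2) Adm_diff[OF L _ less_imp_le[OF d(2)]]], safe)
    assume h: "s = q + n + 1" "\<Lambda> q = \<Lambda> (q + n + 1) + int r"
    have "\<Lambda> (q + n) < ?L3 (q + n)"
      by (rule raised_neighbours(1)[OF L L3 _ h(1)]) (use h d in \<open>auto simp: add_one_apply\<close>)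
    then show False using h d by (auto simp: add_one_apply split: if_splits)
  qed (use d in auto)
  have gxz: "g_fun x z \<noteq> 0" unfolding x_def z_def
  proof (rule g_nonzero_later[of _ _ \<Lambda>, OF \<open>1 \<le> p\<close> _ Adm_diff[OF L \<open>1 \<le> p\<close>]], safe)
    assume h: "s = p + n + 1" "\<Lambda> p = \<Lambda> (p + n + 1) + int r"
    have "\<Lambda> (p + n) < ?L3 (p + n)" "\<Lambda> (p + 1) < ?L3 (p + 1)"
      by (rule raised_neighbours[OF L L3 \<open>1 \<le> p\<close> h(1)]; use h d in \<open>auto simp: add_one_apply\<close>)+
    then show False using h d n_ge_2 by (auto simp: add_one_apply split: if_splits)
  qed (use d in auto)
  \<comment> \<open>A swap multiplies the amplitude by \<open>- g(b, a) / g(a, b)\<close>; in terms of \<open>t\<close> no denominators remain.\<close>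
  define t where "t = path_amp X \<Lambda> p q s / (g_fun x y * g_fun x z * g_fun y z)"
  have w: "weight (add_one \<Lambda> p) q = y" "weight (add_one \<Lambda> p) s = z" "weight (add_one \<Lambda> q) p = x"
    "weight (add_one \<Lambda> q) s = z" "weight (add_one \<Lambda> s) p = x" "weight (add_one \<Lambda> s) q = y"
    using d by (auto simp: weight_add_one x_def y_def z_def)
  have w2: "weight (add_one (add_one \<Lambda> p) q) s = z" "weight (add_one (add_one \<Lambda> p) s) q = y"
    "weight (add_one (add_one \<Lambda> q) p) s = z" "weight (add_one (add_one \<Lambda> q) s) p = x"
    "weight (add_one (add_one \<Lambda> s) p) q = y" "weight (add_one (add_one \<Lambda> s) q) p = x"
    using d by (auto simp: weight_add_one x_def y_def z_def)
  have ne: "p \<noteq> q" "q \<noteq> s" "p \<noteq> s" using d by auto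
  have solve: "A = - (g' * C)" if "g * A + g' * B = 0" "g \<noteq> 0" "B = g * C" for g g' A B C :: complex
  proof -
    have "g * (A + g' * C) = 0" using that(1) unfolding that(3) by (simp add: algebra_simps)
    then show ?thesis using that(2) by (simp add: add_eq_0_iff2)
  qed
  have a1: "path_amp X \<Lambda> p q s = t * (g_fun x y * g_fun x z * g_fun y z)"
    unfolding t_def using gxy gyz gxz by simp
  have a2: "path_amp X \<Lambda> q p s = - (g_fun y x * (t * g_fun x z * g_fun y z))"
    by (rule solve[OF path_swap_12[OF X ne(1), of \<Lambda> s, folded x_def y_def] gxy])
      (simp only: a1 mult_ac)
  have a3: "path_amp X \<Lambda> p s q = - (g_fun z y * (t * g_fun x y * g_fun x z))"
    by (rule solve[OF path_swap_23[OF X ne(2), of \<Lambda> p, unfolded w] gyz])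
      (simp only: a1 mult_ac)
  have a4: "path_amp X \<Lambda> q s p = - (g_fun z x * - (g_fun y x * (t * g_fun y z)))"
    by (rule solve[OF path_swap_23[OF X ne(3), of \<Lambda> q, unfolded w] gxz])
      (simp only: a2 mult_minus_right mult_ac)
  have a5: "path_amp X \<Lambda> s p q = - (g_fun z x * - (g_fun z y * (t * g_fun x y)))"
    by (rule solve[OF path_swap_12[OF X ne(3), of \<Lambda> q, folded x_def z_def] gxz])
      (simp only: a3 mult_minus_right mult_ac)
  have a6: "path_amp X \<Lambda> s q p = - (g_fun z y * (g_fun z x * (g_fun y x * t)))"
    by (rule solve[OF path_swap_12[OF X ne(2), of \<Lambda> p, folded y_def z_def] gyz])
      (simp only: a4 mult_minus_right minus_minus mult_ac)
  have sw: "serre_weight x y z = (x + z) * (y\<^sup>2 - x * z) / (x * y * z)"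
    "serre_weight x z y = (x + y) * (z\<^sup>2 - x * y) / (x * y * z)"
    "serre_weight y x z = (y + z) * (x\<^sup>2 - y * z) / (x * y * z)"
    "serre_weight y z x = (y + x) * (z\<^sup>2 - x * y) / (x * y * z)"
    "serre_weight z x y = (z + y) * (x\<^sup>2 - y * z) / (x * y * z)"
    "serre_weight z y x = (z + x) * (y\<^sup>2 - x * z) / (x * y * z)"
    by (simp_all only: serre_weight_eq[OF nz(1,2,3)] serre_weight_eq[OF nz(1,3,2)] serre_weight_eq[OF nz(2,1,3)]
        serre_weight_eq[OF nz(2,3,1)] serre_weight_eq[OF nz(3,1,2)] serre_weight_eq[OF nz(3,2,1)] mult_ac)
  have gen: "t * (a * b * c) * (w1 / D) + - (c' * (t * a * b)) * (w2 / D) + - (a' * (t * b * c)) * (w3 / D)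
      + - (b' * - (a' * (t * c))) * (w4 / D) + - (b' * - (c' * (t * a))) * (w5 / D) + - (c' * (b' * (a' * t))) * (w6 / D) =
      t / D * (a * b * c * w1 - a' * b * c * w3 - a * b * c' * w2 + c * a' * b' * w4 + b' * c' * a * w5 - c' * b' * a' * w6)"
    for a b c a' b' c' w1 w2 w3 w4 w5 w6 t D :: complex
    by (simp add: divide_inverse ring_distribs mult_ac)
  have "path_term X \<Lambda> p q s + path_term X \<Lambda> p s q + path_term X \<Lambda> q p s + path_term X \<Lambda> q s p +
    path_term X \<Lambda> s p q + path_term X \<Lambda> s q p = t / (x * y * z) *
    (g_fun x y * g_fun x z * g_fun y z * ((x + z) * (y\<^sup>2 - x * z)) - g_fun y x * g_fun x z * g_fun y z * ((y + z) * (x\<^sup>2 - y * z))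
    - g_fun x y * g_fun x z * g_fun z y * ((x + y) * (z\<^sup>2 - x * y)) + g_fun y z * g_fun y x * g_fun z x * ((y + x) * (z\<^sup>2 - x * y))
    + g_fun z x * g_fun z y * g_fun x y * ((z + y) * (x\<^sup>2 - y * z)) - g_fun z y * g_fun z x * g_fun y x * ((z + x) * (y\<^sup>2 - x * z)))"
    unfolding path_term_def w w2 x_def[symmetric] y_def[symmetric] z_def[symmetric] a1 a2 a3 a4 a5 a6 sw by (rule gen)
  also have "\<dots> = 0"
    unfolding g_cubic_expand[OF q123] serre_identity by simp
  finally show ?thesis .
qed

text \<open>
  Raising \<open>p\<close> twice uses the weights \<open>x\<close> and \<open>x' = q\<^sub>1 x\<close>.  Since \<open>g (x', x) = 0\<close>, three of the six terms of
  \<open>serre_identity\<close> at \<open>x, x', y\<close> drop out and the others are the three paths, up to the factor \<open>g (x, x') \<noteq> 0\<close>.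
\<close>

lemma serre_two_equal:
  assumes X: "exchangeable X" and ne: "p \<noteq> s" and pos: "1 \<le> p" "1 \<le> s"
  shows "path_term X \<Lambda> p p s + path_term X \<Lambda> p s p + path_term X \<Lambda> s p p = 0"
proof (cases "\<Lambda> \<in> Adm \<and> add_one (add_one (add_one \<Lambda> p) p) s \<in> Adm")
  case False
  have zero: "path_amp X \<Lambda> a b c = 0"
    if "add_one (add_one (add_one \<Lambda> a) b) c = add_one (add_one (add_one \<Lambda> p) p) s" for a b c
    using False unfolding that[symmetric] by (auto simp: path_amp_def guarded_def)
  have "path_amp X \<Lambda> p p s = 0" "path_amp X \<Lambda> p s p = 0" "path_amp X \<Lambda> s p p = 0"
    by (rule zero, simp only: add_one_commute)+
  then show ?thesis by (simp add: path_term_def)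
next
  case True
  let ?L3 = "add_one (add_one (add_one \<Lambda> p) p) s" and ?M = "add_one \<Lambda> p"
  from True have L: "\<Lambda> \<in> Adm" and L3: "?L3 \<in> Adm" by auto
  define x x' y where "x = weight \<Lambda> p" and "x' = weight ?M p" and "y = weight \<Lambda> s"
  have x': "x' = q1 * x" by (simp add: x'_def x_def weight_add_one)
  have nz: "x \<noteq> 0" "x' \<noteq> 0" "y \<noteq> 0" by (auto simp: x_def y_def x'_def)
  have w: "weight (add_one \<Lambda> p) s = y" "weight (add_one \<Lambda> s) p = x"
    "weight (add_one (add_one \<Lambda> p) p) s = y" "weight (add_one (add_one \<Lambda> p) s) p = x'"
    "weight (add_one (add_one \<Lambda> s) p) p = x'"
    using ne by (auto simp: weight_add_one x_def y_def x'_def)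
  have val: "?L3 j = \<Lambda> j + (if j = p then 2 else if j = s then 1 else 0)" for j
    using ne by (simp add: add_one_apply)
  have M: "?M j = \<Lambda> j + (if j = p then 1 else 0)" for j by (simp add: add_one_apply)
  have swap1: "g_fun x' y * path_amp X \<Lambda> p s p + g_fun y x' * path_amp X \<Lambda> p p s = 0"
    using path_swap_23[OF X ne, of \<Lambda> p] unfolding w x'_def .
  have swap2: "g_fun x y * path_amp X \<Lambda> s p p + g_fun y x * path_amp X \<Lambda> p s p = 0"
    using path_swap_12[OF X ne, of \<Lambda> p] unfolding x_def y_def .
  have solve: "A = - (g' * C)" if "g * A + g' * B = 0" "g \<noteq> 0" "B = g * C" for g g' A B C :: complex
  proof -
    have "g * (A + g' * C) = 0" using that(1) unfolding that(3) by (simp add: algebra_simps)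
    then show ?thesis using that(2) by (simp add: add_eq_0_iff2)
  qed
  have "\<exists>t. path_amp X \<Lambda> p p s = t * (g_fun x y * g_fun x' y) \<and> path_amp X \<Lambda> p s p = - (t * (g_fun x y * g_fun y x')) \<and>
      path_amp X \<Lambda> s p p = t * (g_fun y x * g_fun y x')"
  proof (cases "p < s")
    case lt: True
    note D = Adm_diff[OF L pos(1) less_imp_le[OF lt]]
    have 1: "g_fun x y \<noteq> 0" unfolding x_def y_def
    proof (rule g_nonzero_later[of _ _ \<Lambda>, OF pos(1) lt D], rule notI)
      assume h: "s = p + n + 1 \<and> \<Lambda> p = \<Lambda> s + int r"
      then have h': "s = p + n + 1" "\<Lambda> p = \<Lambda> s + int r" by blast+
      have "\<Lambda> s < ?L3 s" using ne by (simp add: val)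
      then have "\<Lambda> (p + n) < ?L3 (p + n)" by (rule raised_neighbours(1)[OF L L3 pos(1) h'])
      then show False unfolding val using h'(1) by simp
    qed
    have 2: "g_fun x' y \<noteq> 0" unfolding x'_def w(1)[symmetric]
    proof (rule g_nonzero_later[of _ _ "?M", OF pos(1) lt], goal_cases)
      case 1
      then show ?case using D ne by (simp add: M)
    next
      case 2
      show ?case
      proof
        assume h: "s = p + n + 1 \<and> ?M p = ?M s + int r"
        then have "(s - p) div n = 1" using n_ge_2 by (simp add: div_if)
        then have "int r \<le> \<Lambda> p - \<Lambda> s" using D by simp
        moreover have "\<Lambda> p + 1 = \<Lambda> s + int r" using conjunct2[OF h] ne by (simp add: M)
        ultimately show False by linarith
      qed
    qed
    define t where "t = path_amp X \<Lambda> p p s / (g_fun x y * g_fun x' y)"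
    have a1: "path_amp X \<Lambda> p p s = t * (g_fun x y * g_fun x' y)" unfolding t_def using 1 2 by simp
    have a2: "path_amp X \<Lambda> p s p = - (g_fun y x' * (t * g_fun x y))"
      by (rule solve[OF swap1 2]) (simp only: a1 mult_ac)
    have a3: "path_amp X \<Lambda> s p p = - (g_fun y x * - (g_fun y x' * t))"
      by (rule solve[OF swap2 1]) (simp only: a2 mult_minus_right mult_ac)
    show ?thesis by (rule exI[of _ t]) (simp add: a1 a2 a3 mult_ac)
  next
    case False
    then have lt: "s < p" using ne by simp
    note D = Adm_diff[OF L pos(2) less_imp_le[OF lt]]
    have 1: "g_fun y x \<noteq> 0" unfolding x_def y_def
    proof (rule g_nonzero_later[of _ _ \<Lambda>, OF pos(2) lt D], rule notI)
      assume h: "p = s + n + 1 \<and> \<Lambda> s = \<Lambda> p + int r"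
      then have h': "p = s + n + 1" "\<Lambda> s = \<Lambda> p + int r" by blast+
      have "\<Lambda> p < ?L3 p" using ne by (simp add: val)
      then have "\<Lambda> (s + n) < ?L3 (s + n)" by (rule raised_neighbours(1)[OF L L3 pos(2) h'])
      then show False unfolding val using h'(1) by simp
    qed
    have 2: "g_fun y x' \<noteq> 0" unfolding x'_def w(1)[symmetric]
    proof (rule g_nonzero_later[of _ _ "?M", OF pos(2) lt], goal_cases)
      case 1
      then show ?case using Adm_diff[OF L3 pos(2) less_imp_le[OF lt]] ne by (simp add: M val)
    next
      case 2
      show ?case
      proof
        assume h: "p = s + n + 1 \<and> ?M s = ?M p + int r"
        have "1 \<le> s + n" using pos by simp
        have hp: "s + n + 1 = p" "\<Lambda> s = \<Lambda> p + 1 + int r" using h ne by (simp_all add: M)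
        have "?L3 p \<le> ?L3 (s + n)" using Adm_Suc[OF L3 \<open>1 \<le> s + n\<close>] unfolding hp(1) .
        moreover have "?L3 (s + n) = \<Lambda> (s + n)" unfolding val using hp(1) by auto
        moreover have "?L3 p = \<Lambda> p + 2" by (simp only: val) simp
        ultimately show False using Adm_n[OF L pos(2)] hp(2) by linarith
      qed
    qed
    define t where "t = path_amp X \<Lambda> s p p / (g_fun y x * g_fun y x')"
    have a1: "path_amp X \<Lambda> s p p = t * (g_fun y x * g_fun y x')" unfolding t_def using 1 2 by simp
    have a2: "path_amp X \<Lambda> p s p = - (g_fun x y * (t * g_fun y x'))"
      by (rule solve[OF _ 1 _]) (use swap2 in \<open>simp add: add.commute\<close>, simp only: a1 mult_ac)
    have a3: "path_amp X \<Lambda> p p s = - (g_fun x' y * - (g_fun x y * t))"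
      by (rule solve[OF _ 2 _]) (use swap1 in \<open>simp add: add.commute\<close>, simp only: a2 mult_minus_right mult_ac)
    show ?thesis by (rule exI[of _ t]) (simp add: a1 a2 a3 mult_ac)
  qed
  then obtain t where t: "path_amp X \<Lambda> p p s = t * (g_fun x y * g_fun x' y)"
    "path_amp X \<Lambda> p s p = - (t * (g_fun x y * g_fun y x'))" "path_amp X \<Lambda> s p p = t * (g_fun y x * g_fun y x')"
    by blast
  have g0: "g_fun x' x = 0" by (simp add: g_cubic_def x')
  have g1: "g_fun x x' \<noteq> 0"
  proof -
    have "q1 * q1 \<noteq> 1" using nru1 unfolding not_root_of_unity_def
      by (metis one_le_numeral power2_eq_square)
    moreover have "q2 * q1 \<noteq> 1" using q123 q_ne_1(3) by (metis mult.commute mult_1)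
    moreover have "q3 * q1 \<noteq> 1" using q123 q_ne_1(2) by (metis mult.assoc mult.commute mult_1)
    ultimately show ?thesis using nz by (simp add: g_cubic_def x' mult.assoc[symmetric])
  qed
  have sw: "serre_weight x x' y = (x + y) * (x'\<^sup>2 - x * y) / (x * x' * y)"
    "serre_weight x y x' = (x + x') * (y\<^sup>2 - x * x') / (x * x' * y)"
    "serre_weight y x x' = (y + x') * (x\<^sup>2 - x' * y) / (x * x' * y)"
    by (simp_all only: serre_weight_eq[OF nz(1,2,3)] serre_weight_eq[OF nz(1,3,2)] serre_weight_eq[OF nz(3,1,2)] mult_ac)
  have gen: "t * (b * c) * (w1 / D) + - (t * (b * c')) * (w2 / D) + t * (b' * c') * (w3 / D) =
      t / D * (b * c * w1 - b * c' * w2 + b' * c' * w3)"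
    for b c b' c' w1 w2 w3 t D :: complex
    by (simp add: divide_inverse ring_distribs mult_ac)
  have gen2: "c * (b * d * w1 - b * d' * w3 + b' * d' * w5) = 0"
    if "c * b * d * w1 - z * b * d * w2 - c * b * d' * w3 + d * z * b' * w4 + b' * d' * c * w5 - d' * b' * z * w6 = 0"
      "z = 0"
    for b c d b' c' d' z w1 w2 w3 w4 w5 w6 :: complex
    using that by (simp add: algebra_simps)
  have "g_fun x x' * (g_fun x y * g_fun x' y * ((x + y) * (x'\<^sup>2 - x * y)) - g_fun x y * g_fun y x' * ((x + x') * (y\<^sup>2 - x * x'))
      + g_fun y x * g_fun y x' * ((y + x') * (x\<^sup>2 - x' * y))) = 0"
    by (rule gen2[OF serre_identity[where x = x and y = x' and z = y
          and \<sigma> = "q1 + q2 + q3" and \<tau> = "q1 * q2 + q1 * q3 + q2 * q3",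
          folded g_cubic_expand[OF q123]] g0])
  then have "g_fun x y * g_fun x' y * ((x + y) * (x'\<^sup>2 - x * y)) - g_fun x y * g_fun y x' * ((x + x') * (y\<^sup>2 - x * x'))
      + g_fun y x * g_fun y x' * ((y + x') * (x\<^sup>2 - x' * y)) = 0" (is "?K = 0") using g1 by simp
  moreover have "path_term X \<Lambda> p p s + path_term X \<Lambda> p s p + path_term X \<Lambda> s p p = t / (x * x' * y) * ?K"
    unfolding path_term_def w x_def[symmetric] x'_def[symmetric] y_def[symmetric] t sw by (rule gen)
  ultimately show ?thesis by simp
qed

text \<open>The weights \<open>w, q\<^sub>1 w, q\<^sub>1\<^sup>2 w\<close> form a geometric progression, for which \<open>serre_weight\<close> vanishes.\<close>

lemma serre_three_equal: "path_term X \<Lambda> p p p = 0"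
  by (simp add: path_term_def weight_add_one serre_weight_def)

lemma serre_symmetrized:
  assumes X: "exchangeable X" and "1 \<le> p" "1 \<le> q" "1 \<le> s"
  shows "path_term X \<Lambda> p q s + path_term X \<Lambda> p s q + path_term X \<Lambda> q p s + path_term X \<Lambda> q s p +
    path_term X \<Lambda> s p q + path_term X \<Lambda> s q p = 0" (is "?S = 0")
proof -
  note two = serre_two_equal[OF X]
  consider "p = q" "q = s" | "p = q" "q \<noteq> s" | "p = s" "q \<noteq> s" | "q = s" "p \<noteq> q"
    | "p < q" "q < s" | "p < s" "s < q" | "q < p" "p < s" | "q < s" "s < p" | "s < p" "p < q" | "s < q" "q < p"
    by linarith
  then show ?thesis
  proof cases
    case 1 then show ?thesis by (simp add: serre_three_equal)
  next
    case 2
    then have "path_term X \<Lambda> q q s + path_term X \<Lambda> q s q + path_term X \<Lambda> s q q = 0" using two[of q s \<Lambda>] assms by blast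
    moreover have "?S = (path_term X \<Lambda> q q s + path_term X \<Lambda> q s q + path_term X \<Lambda> s q q) + (path_term X \<Lambda> q q s + path_term X \<Lambda> q s q + path_term X \<Lambda> s q q)"
      unfolding \<open>p = q\<close> by (simp only: add_ac)
    ultimately show ?thesis by (simp only: add_0)
  next
    case 3
    then have "path_term X \<Lambda> s s q + path_term X \<Lambda> s q s + path_term X \<Lambda> q s s = 0" using two[of s q \<Lambda>] assms by blast
    moreover have "?S = (path_term X \<Lambda> s s q + path_term X \<Lambda> s q s + path_term X \<Lambda> q s s) + (path_term X \<Lambda> s s q + path_term X \<Lambda> s q s + path_term X \<Lambda> q s s)"
      unfolding \<open>p = s\<close> by (simp only: add_ac)
    ultimately show ?thesis by (simp only: add_0)
  next
    case 4
    then have "path_term X \<Lambda> s s p + path_term X \<Lambda> s p s + path_term X \<Lambda> p s s = 0" using two[of s p \<Lambda>] assms by blast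
    moreover have "?S = (path_term X \<Lambda> s s p + path_term X \<Lambda> s p s + path_term X \<Lambda> p s s) + (path_term X \<Lambda> s s p + path_term X \<Lambda> s p s + path_term X \<Lambda> p s s)"
      unfolding \<open>q = s\<close> by (simp only: add_ac)
    ultimately show ?thesis by (simp only: add_0)
  next
    case 5
    from serre_distinct[OF X this, of \<Lambda>] assms show ?thesis by (simp only: add_ac)
  next
    case 6
    from serre_distinct[OF X this, of \<Lambda>] assms show ?thesis by (simp only: add_ac)
  next
    case 7
    from serre_distinct[OF X this, of \<Lambda>] assms show ?thesis by (simp only: add_ac)
  next
    case 8
    from serre_distinct[OF X this, of \<Lambda>] assms show ?thesis by (simp only: add_ac)
  next
    case 9
    from serre_distinct[OF X this, of \<Lambda>] assms show ?thesis by (simp only: add_ac)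
  next
    case 10
    from serre_distinct[OF X this, of \<Lambda>] assms show ?thesis by (simp only: add_ac)
  qed
qed

end

context resonant_parameters begin

section \<open>The eigenvalues of psi\<close>

abbreviation "C \<equiv> (fls_const :: complex \<Rightarrow> complex fls)"

definition Psi :: "complex fls \<Rightarrow> (nat \<Rightarrow> int) \<Rightarrow> complex fls" where
  "Psi Z \<Lambda> = G_psi n r a (C q1) (C q2) (C q3) (C u) \<Lambda> Z"

lemma q123_fls: "C q1 * C q2 * C q3 = 1"
  using q123 by (simp add: fls_const_mult_const)

lemma Psi_truncated:
  assumes Z: "\<And>c. Z \<noteq> C c" and N: "settled N \<Lambda>"
  shows "Psi Z \<Lambda> = (\<Prod>j\<in>{1..N}. box_factor (C q1) (C q2) (C q3) (C (weight \<Lambda> j) / Z)) *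
    (\<Prod>j\<in>{N<..N + n}. psi_empty (C q2) (C (weight \<Lambda> j) / Z))"
proof -
  have const: "C q1 powi \<Lambda>' j * C q2 ^ (j - 1) * (C u / Z) = C (weight \<Lambda>' j) / Z" for \<Lambda>' j
    unfolding weight_def
    by (simp only: fls_const_mult_const[symmetric] fls_const_powi fls_const_power times_divide_eq_right)
  have Z0: "Z \<noteq> 0" using Z[of 0] by simp
  then have not1: "C c / Z \<noteq> 1" for c using Z[of c] by (metis eq_divide_eq_1 divide_eq_1_iff)
  have not1': "C q2 * (C c / Z) \<noteq> 1" for c
    using not1[of "q2 * c"] by (simp only: fls_const_mult_const[symmetric] times_divide_eq_right not_False_eq_True)
  have eq: "G_bracket n r a (C q1) (C q2) (C q3) (C u) \<Lambda> 0 Z =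
     (\<Prod>j\<in>{0<..N}. box_factor (C q1) (C q2) (C q3) (C q1 powi \<Lambda> j * C q2 ^ (j - 1) * (C u / Z))) *
    (\<Prod>j\<in>{N<..N + n}. psi_empty (C q2) (C q1 powi \<Lambda>0 j * C q2 ^ (j - 1) * (C u / Z)))"
  proof (rule G_bracket_truncated)
    show "C q1 * C q2 * C q3 = 1" by (rule q123_fls)
    show "C q3 = C q1 powi - int r * C q2 ^ n"
      unfolding fls_const_powi[symmetric] fls_const_power[symmetric] fls_const_mult_const
      by (subst q3_vac) simp
    show "C q1 powi \<Lambda>0 j * C q2 ^ (j - 1) * (C u / Z) \<noteq> 1" for j unfolding const by (rule not1)
    show "C q2 * (C q1 powi \<Lambda>0 j * C q2 ^ (j - 1) * (C u / Z)) \<noteq> 1" for j unfolding const by (rule not1')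
  qed (use N in \<open>auto simp: settled_after\<close>)
  have "{0<..N} = {1..N}" by auto
  moreover have "(\<Prod>j\<in>{N<..N + n}. psi_empty (C q2) (C (weight \<Lambda>0 j) / Z)) =
      (\<Prod>j\<in>{N<..N + n}. psi_empty (C q2) (C (weight \<Lambda> j) / Z))"
    using settled_after[OF N] by (intro prod.cong) (auto simp: weight_def)
  ultimately show ?thesis unfolding Psi_def G_psi_eq_G_bracket eq const by simp
qed

lemma Psi_add_one:
  assumes Z: "\<And>c. Z \<noteq> C c" and N: "settled N \<Lambda>" "settled N (add_one \<Lambda> p)" and p: "1 \<le> p" "p \<le> N"
  shows "Psi Z (add_one \<Lambda> p) * g_cubic (C q1) (C q2) (C q3) Z (C (weight \<Lambda> p)) =
    - (Psi Z \<Lambda> * g_cubic (C q1) (C q2) (C q3) (C (weight \<Lambda> p)) Z)"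
proof -
  define W where "W = C (weight \<Lambda> p)"
  define R where "R = (\<Prod>j\<in>{1..N} - {p}. box_factor (C q1) (C q2) (C q3) (C (weight \<Lambda> j) / Z)) *
    (\<Prod>j\<in>{N<..N + n}. psi_empty (C q2) (C (weight \<Lambda> j) / Z))"
  have 1: "Psi Z \<Lambda> = box_factor (C q1) (C q2) (C q3) (W / Z) * R"
    unfolding Psi_truncated[OF Z N(1)] R_def W_def using p by (subst prod.remove[of _ p]) auto
  have "Psi Z (add_one \<Lambda> p) = box_factor (C q1) (C q2) (C q3) (C (weight (add_one \<Lambda> p) p) / Z) *
      ((\<Prod>j\<in>{1..N} - {p}. box_factor (C q1) (C q2) (C q3) (C (weight (add_one \<Lambda> p) j) / Z)) *
    (\<Prod>j\<in>{N<..N + n}. psi_empty (C q2) (C (weight (add_one \<Lambda> p) j) / Z)))"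
    unfolding Psi_truncated[OF Z N(2)] using p by (subst prod.remove[of _ p]) auto
  also have "\<dots> = box_factor (C q1) (C q2) (C q3) (C q1 * W / Z) * R"
    unfolding R_def W_def using p
    by (intro arg_cong2[where f = "(*)"] prod.cong) (auto simp: weight_add_one fls_const_mult_const)
  finally have 2: "Psi Z (add_one \<Lambda> p) = box_factor (C q1) (C q2) (C q3) (C q1 * W / Z) * R" .
  have "box_factor (C q1) (C q2) (C q3) (C q1 * W / Z) * g_cubic (C q1) (C q2) (C q3) Z W =
    - (box_factor (C q1) (C q2) (C q3) (W / Z) * g_cubic (C q1) (C q2) (C q3) W Z)"
  proof (rule box_factor_shift[OF q123_fls])
    show "Z \<noteq> 0" using Z[of 0] by simp
    show "Z \<noteq> W" "Z \<noteq> C q1 * W" unfolding W_def fls_const_mult_const by (rule Z)+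
    show "W \<noteq> C q1 * Z"
    proof
      assume "W = C q1 * Z"
      then have "C (1 / q1) * W = (C (1 / q1) * C q1) * Z" by (simp only: mult.assoc)
      also have "\<dots> = Z" unfolding fls_const_mult_const by simp
      finally have "Z = C (1 / q1) * W" ..
      then show False unfolding W_def fls_const_mult_const using Z by blast
    qed
  qed
  then show ?thesis unfolding 1 2 W_def[symmetric] by (simp add: mult_ac)
qed

text \<open>
  Numerator and denominator of the eigenvalue as polynomials in \<open>1/z\<close>, without any cancellation.  In the last \<open>n\<close>
  columns only the factors of \<open>psi_empty\<close> remain.
\<close>

definition psi_numerator :: "nat \<Rightarrow> (nat \<Rightarrow> int) \<Rightarrow> complex poly" where
  "psi_numerator N \<Lambda> = (\<Prod>j\<in>{1..N}. [:1, - (q3 * weight \<Lambda> j):]) * (\<Prod>j\<in>{1..N + n}. [:1, - (q2 * weight \<Lambda> j):])"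

definition psi_denominator :: "nat \<Rightarrow> (nat \<Rightarrow> int) \<Rightarrow> complex poly" where
  "psi_denominator N \<Lambda> = (\<Prod>j\<in>{1..N}. [:1, - (weight \<Lambda> j / q1):]) * (\<Prod>j\<in>{1..N + n}. [:1, - weight \<Lambda> j:])"

abbreviation at_inverse :: "complex fls \<Rightarrow> complex poly \<Rightarrow> complex fls" where
  "at_inverse Z p \<equiv> poly (map_poly C p) (1 / Z)"

lemmas at_inverse_hom = poly_map_poly_hom(1-3)[OF ring_hom_fls_const]
  poly_map_poly_hom_prod[OF ring_hom_fls_const] poly_map_poly_hom_sum[OF ring_hom_fls_const]

lemma at_inverse_linear: "at_inverse Z [:1, - c:] = 1 - C c / Z"
  unfolding poly_map_poly_hom(4)[OF ring_hom_fls_const] by (simp add: fls_const_uminus divide_inverse)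

lemma Psi_eq_quotient:
  assumes Z: "\<And>c. Z \<noteq> C c" and N: "settled N \<Lambda>"
  shows "Psi Z \<Lambda> = at_inverse Z (psi_numerator N \<Lambda>) / at_inverse Z (psi_denominator N \<Lambda>)"
proof -
  have split: "(\<Prod>j\<in>{1..N + n}. f j) = (\<Prod>j\<in>{1..N}. f j) * (\<Prod>j\<in>{N<..N + n}. f j)" for f :: "nat \<Rightarrow> complex fls"
    by (subst prod.union_disjoint[symmetric]) (auto intro!: prod.cong)
  have c1: "C (q3 * c) / Z = C q3 * (C c / Z)" "C (q2 * c) / Z = C q2 * (C c / Z)" "C (c / q1) / Z = C c / Z / C q1" for c
    by (simp_all only: fls_const_mult_const[symmetric] divide_inverse fls_inverse_const[symmetric] mult.assoc
        mult.commute[of _ "inverse (C q1)"] mult.left_commute[of _ "inverse (C q1)"])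
  show ?thesis
    unfolding Psi_truncated[OF Z N] psi_numerator_def psi_denominator_def at_inverse_hom at_inverse_linear split
      c1 box_factor_def psi_empty_def prod.distrib prod_dividef
    by (simp only: times_divide_times_eq mult_ac)
qed

lemma psi_poly_nz: "psi_numerator N \<Lambda> \<noteq> 0" "psi_denominator N \<Lambda> \<noteq> 0"
  by (auto simp: psi_numerator_def psi_denominator_def prod_zero_iff)

lemma psi_poly_degree: "degree (psi_numerator N \<Lambda>) = 2 * N + n" "degree (psi_denominator N \<Lambda>) = 2 * N + n"
proof -
  have nz: "(\<Prod>j\<in>A. [:1, - (c j :: complex):]) \<noteq> 0" if "finite A" for A :: "nat set" and c
    using that by (simp add: prod_zero_iff)
  show "degree (psi_numerator N \<Lambda>) = 2 * N + n" "degree (psi_denominator N \<Lambda>) = 2 * N + n"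
    unfolding psi_numerator_def psi_denominator_def by (simp_all add: degree_mult_eq nz degree_linear_factors)
qed

definition addable :: "(nat \<Rightarrow> int) \<Rightarrow> nat set" where
  "addable \<Lambda> = {p. 1 \<le> p \<and> add_one \<Lambda> p \<in> Adm}"

definition removable :: "(nat \<Rightarrow> int) \<Rightarrow> nat set" where
  "removable \<Lambda> = {p. 1 \<le> p \<and> sub_one \<Lambda> p \<in> Adm}"

lemma addable_subset: "\<Lambda> \<in> Adm \<Longrightarrow> settled N \<Lambda> \<Longrightarrow> addable \<Lambda> \<subseteq> {1..N}"
  using addable_less by (force simp: addable_def)

lemma removable_subset: "\<Lambda> \<in> Adm \<Longrightarrow> settled N \<Lambda> \<Longrightarrow> removable \<Lambda> \<subseteq> {1..N}"
  using removable_less by (force simp: removable_def)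

lemma finite_addable [simp]: "\<Lambda> \<in> Adm \<Longrightarrow> finite (addable \<Lambda>)"
  and finite_removable [simp]: "\<Lambda> \<in> Adm \<Longrightarrow> finite (removable \<Lambda>)"
  using settled_exists addable_subset removable_subset by (meson finite_atLeastAtMost finite_subset le_refl)+

text \<open>Where \<open>e\<close>, respectively \<open>f\<close>, can act on \<open>|\<Lambda>\<rangle>\<close>; these turn out to be the poles of the eigenvalue of \<open>\<psi>\<close>.\<close>

definition poles :: "(nat \<Rightarrow> int) \<Rightarrow> complex set" where
  "poles \<Lambda> = weight \<Lambda> ` addable \<Lambda> \<union> (\<lambda>p. weight (sub_one \<Lambda> p) p) ` removable \<Lambda>"

lemma card_le_1I: "finite A \<Longrightarrow> (\<And>x y. x \<in> A \<Longrightarrow> y \<in> A \<Longrightarrow> x = y) \<Longrightarrow> card A \<le> 1"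
  by (metis card_le_Suc0_iff_eq One_nat_def)

text \<open>
  The multiplicity of the factor \<open>1 - s / z\<close> in the denominator and in the numerator of the eigenvalue.  By injectivity
  of the weights both cardinalities on the left are at most 1.  A column \<open>j\<close> that contributes on the left is either
  addable or removable, or else blocked by a neighbour at distance 1 or \<open>n\<close>, whose factor in the numerator
  cancels it.  If both contribute, two neighbours do.
\<close>

lemma pole_count:
  assumes L: "\<Lambda> \<in> Adm" and N: "settled N \<Lambda>"
  shows "card {j \<in> {1..N}. weight \<Lambda> j = q1 * s} + card {j \<in> {1..N + n}. weight \<Lambda> j = s} \<le>
    card {j \<in> {1..N}. q3 * weight \<Lambda> j = s} + card {j \<in> {1..N + n}. q2 * weight \<Lambda> j = s} + (if s \<in> poles \<Lambda> then 1 else 0)"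
    (is "card ?B + card ?A \<le> card ?T + card ?S + ?P")
proof -
  have fin: "finite ?B" "finite ?A" "finite ?T" "finite ?S" by auto
  have inj: "x = y" if "1 \<le> x" "1 \<le> y" "weight \<Lambda> x = c" "weight \<Lambda> y = c" for x y c
    by (rule weight_inj[OF L that(1,2)]) (simp only: that)
  have A1: "card ?A \<le> 1" by (rule card_le_1I[OF fin(2)], rule inj[where c = s]) auto
  have B1: "card ?B \<le> 1" by (rule card_le_1I[OF fin(1)], rule inj[where c = "q1 * s"]) auto
  have pos: "1 \<le> card X" if "x \<in> X" "finite X" for x and X :: "nat set"
    using that by (metis card_gt_0_iff empty_iff Suc_leI One_nat_def)
  have N_n: "n < N" using N by (simp add: settled_def)
  show ?thesis
  proof (cases "?A = {}")
    case A: True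
    show ?thesis
    proof (cases "?B = {}")
      case False
      then obtain j where j: "1 \<le> j" "j \<le> N" "weight \<Lambda> j = q1 * s" by auto
      show ?thesis
      proof (cases "\<Lambda> (j + n) + int r = \<Lambda> j")
        case True
        have "q2 * weight \<Lambda> (j + n) = (q1 * q2 * q3) * s"
          unfolding weight_step_n[OF j(1) True] j(3) by (simp add: mult_ac)
        then have "j + n \<in> ?S" using j by (simp add: q123)
        then have "1 \<le> card ?S" by (rule pos[OF _ fin(4)])
        then show ?thesis using B1 unfolding A by simp
      next
        case r1: False
        show ?thesis
        proof (cases "\<Lambda> (j + 1) = \<Lambda> j")
          case True
          have "j \<noteq> N"
          proof
            assume "j = N"
            then have "\<Lambda> j = \<Lambda>0 j" "\<Lambda> (j + n) = \<Lambda>0 (j + n)" using settled_after[OF N] by auto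
            then show False using r1 vac_add_n[OF j(1)] by simp
          qed
          have "q3 * weight \<Lambda> (j + 1) = (q1 * q2 * q3) * s"
            unfolding weight_step[OF j(1) True] j(3) by (simp add: mult_ac)
          then have "j + 1 \<in> ?T" using j \<open>j \<noteq> N\<close> by (simp add: q123)
          then have "1 \<le> card ?T" by (rule pos[OF _ fin(3)])
          then show ?thesis using B1 unfolding A by simp
        next
          case False
          then have "sub_one \<Lambda> j \<in> Adm"
            using r1 Adm_Suc[OF L j(1)] Adm_n[OF L j(1)] by (simp add: sub_one_Adm_iff[OF L j(1)])
          moreover have "weight (sub_one \<Lambda> j) j = s" using j by (simp add: weight_sub_one)
          ultimately have "s \<in> poles \<Lambda>" using j unfolding poles_def removable_def by blast
          then show ?thesis using B1 unfolding A by simp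
        qed
      qed
    next
      case True
      show ?thesis unfolding A True by simp
    qed
  next
    case False
    then obtain j where j: "1 \<le> j" "j \<le> N + n" "weight \<Lambda> j = s" by auto
    show ?thesis
    proof (cases "?B = {}")
      case False
      then obtain k where k: "1 \<le> k" "k \<le> N" "weight \<Lambda> k = q1 * s" by auto
      then have kj: "j = k + n + 1" "\<Lambda> k = \<Lambda> j + int r"
        using weight_eq_q1[OF L k(1) j(1)] j(3) by auto
      have "1 \<le> k + n" "1 \<le> k + 1" using k by auto
      have ineq: "\<Lambda> (k + n) + int r \<le> \<Lambda> k" "\<Lambda> (k + n + 1) \<le> \<Lambda> (k + n)"
        "\<Lambda> (k + 1 + n) + int r \<le> \<Lambda> (k + 1)" "\<Lambda> (k + 1) \<le> \<Lambda> k"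
        by (rule Adm_n[OF L k(1)], rule Adm_Suc[OF L \<open>1 \<le> k + n\<close>],
            rule Adm_n[OF L \<open>1 \<le> k + 1\<close>], rule Adm_Suc[OF L k(1)])
      have e: "k + 1 + n = j" "k + n + 1 = j" using kj(1) by auto
      have "\<Lambda> (k + n + 1) = \<Lambda> (k + n)" "\<Lambda> (k + 1 + n) + int r = \<Lambda> (k + 1)"
        using ineq kj(2) unfolding e by auto
      then have "q2 * weight \<Lambda> (k + n) = s" "q3 * weight \<Lambda> (k + 1) = s"
        using weight_step[OF \<open>1 \<le> k + n\<close>, of \<Lambda>] weight_step_n[OF \<open>1 \<le> k + 1\<close>, of \<Lambda>] unfolding e j(3) by auto
      then have S: "k + n \<in> ?S" and T: "k + 1 \<in> ?T" using k j kj N_n n_ge_2 by auto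
      have "1 \<le> card ?S" "1 \<le> card ?T" by (rule pos[OF S fin(4)], rule pos[OF T fin(3)])
      then show ?thesis using A1 B1 by linarith
    next
      case B: True
      show ?thesis
      proof (cases "add_one \<Lambda> j \<in> Adm")
        case True
        then have "s \<in> poles \<Lambda>" using j unfolding poles_def addable_def by blast
        then show ?thesis using A1 unfolding B by simp
      next
        case False
        then have "(1 < j \<and> \<Lambda> (j - 1) \<le> \<Lambda> j) \<or> (n < j \<and> \<Lambda> (j - n) \<le> \<Lambda> j + int r)"
          unfolding add_one_Adm_iff[OF L j(1)] by auto
        then show ?thesis
        proof (elim disjE conjE)
          assume h: "1 < j" "\<Lambda> (j - 1) \<le> \<Lambda> j"
          then have p: "1 \<le> j - 1" "j - 1 + 1 = j" by auto
          then have "\<Lambda> (j - 1 + 1) = \<Lambda> (j - 1)" using Adm_Suc[OF L p(1)] h by simp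
          from weight_step[OF p(1) this] have "q2 * weight \<Lambda> (j - 1) = s" using p j by simp
          then have "j - 1 \<in> ?S" using p j by auto
          then have "1 \<le> card ?S" by (rule pos[OF _ fin(4)])
          then show ?thesis using A1 unfolding B by simp
        next
          assume h: "n < j" "\<Lambda> (j - n) \<le> \<Lambda> j + int r"
          then have p: "1 \<le> j - n" "j - n + n = j" by auto
          then have "\<Lambda> (j - n + n) + int r = \<Lambda> (j - n)" using Adm_n[OF L p(1)] h by simp
          from weight_step_n[OF p(1) this] have "q3 * weight \<Lambda> (j - n) = s" using p j by simp
          then have "j - n \<in> ?T" using p j by auto
          then have "1 \<le> card ?T" by (rule pos[OF _ fin(3)])
          then show ?thesis using A1 unfolding B by simp
        qed
      qed
    qed
  qed
qed

lemma finite_poles: "\<Lambda> \<in> Adm \<Longrightarrow> finite (poles \<Lambda>)"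
  by (simp add: poles_def)

lemma zero_not_pole: "0 \<notin> poles \<Lambda>"
  by (auto simp: poles_def)

lemma psi_order:
  assumes L: "\<Lambda> \<in> Adm" and N: "settled N \<Lambda>"
  shows "order x (psi_denominator N \<Lambda>) \<le> order x (psi_numerator N \<Lambda> * (\<Prod>s\<in>poles \<Lambda>. [:1, - s:]))"
proof -
  have nz: "(\<Prod>j\<in>A. [:1, - (c j :: complex):]) \<noteq> 0" if "finite A" for A :: "'i set" and c
    using that by (simp add: prod_zero_iff)
  have nz': "(\<Prod>s\<in>poles \<Lambda>. [:1, - s:]) \<noteq> 0"
    using finite_poles[OF L] by (simp add: prod_zero_iff)
  have oden: "order x (psi_denominator N \<Lambda>) =
      card {j \<in> {1..N}. weight \<Lambda> j / q1 * x = 1} + card {j \<in> {1..N + n}. weight \<Lambda> j * x = 1}"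
    unfolding psi_denominator_def order_mult[OF psi_poly_nz(2)[of N \<Lambda>, unfolded psi_denominator_def]]
    by (simp only: order_linear_factors finite_atLeastAtMost)
  have onum: "order x (psi_numerator N \<Lambda> * (\<Prod>s\<in>poles \<Lambda>. [:1, - s:])) =
      card {j \<in> {1..N}. q3 * weight \<Lambda> j * x = 1} + card {j \<in> {1..N + n}. q2 * weight \<Lambda> j * x = 1}
      + card {s \<in> poles \<Lambda>. s * x = 1}"
  proof -
    have "psi_numerator N \<Lambda> * (\<Prod>s\<in>poles \<Lambda>. [:1, - s:]) \<noteq> 0" using psi_poly_nz nz' by simp
    then have "order x (psi_numerator N \<Lambda> * (\<Prod>s\<in>poles \<Lambda>. [:1, - s:])) =
        order x (psi_numerator N \<Lambda>) + order x (\<Prod>s\<in>poles \<Lambda>. [:1, - s:])" by (rule order_mult)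
    moreover have "order x (psi_numerator N \<Lambda>) = card {j \<in> {1..N}. q3 * weight \<Lambda> j * x = 1} +
        card {j \<in> {1..N + n}. q2 * weight \<Lambda> j * x = 1}"
      unfolding psi_numerator_def order_mult[OF psi_poly_nz(1)[of N \<Lambda>, unfolded psi_numerator_def]]
      by (simp only: order_linear_factors finite_atLeastAtMost)
    moreover have "order x (\<Prod>s\<in>poles \<Lambda>. [:1, - s:]) = card {s \<in> poles \<Lambda>. s * x = 1}"
      using order_linear_factors[OF finite_poles[OF L], of x "\<lambda>s. s"] by simp
    ultimately show ?thesis by simp
  qed
  show ?thesis
  proof (cases "x = 0")
    case True
    then show ?thesis unfolding oden by simp
  next
    case x: False
    have e: "c * x = 1 \<longleftrightarrow> c = 1 / x" for c using x by (auto simp: field_simps)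
    have e': "c / q1 = 1 / x \<longleftrightarrow> c = q1 * (1 / x)" for c by (auto simp: field_simps)
    have "{s \<in> poles \<Lambda>. s = 1 / x} = (if 1 / x \<in> poles \<Lambda> then {1 / x} else {})" by auto
    then have "card {s \<in> poles \<Lambda>. s = 1 / x} = (if 1 / x \<in> poles \<Lambda> then 1 else 0)" by simp
    then show ?thesis unfolding oden onum e e' using pole_count[OF L N, of "1 / x"] by simp
  qed
qed

lemma column_product:
  assumes p: "1 \<le> p" "p \<le> N"
  shows "((\<Prod>j\<in>{1..N} - {p}. 1 - q3 * x j) * (\<Prod>j\<in>{1..N + n} - {p}. 1 - q2 * x j)) /
     ((\<Prod>j\<in>{1..N} - {p}. 1 - x j / q1) * (\<Prod>j\<in>{1..N + n} - {p}. 1 - x j)) =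
     (\<Prod>j\<in>{1..N + n} - {p}. column_factor N j (x j))"
proof -
  have split: "(\<Prod>j\<in>{1..N + n} - {p}. f j) = (\<Prod>j\<in>{1..N} - {p}. f j) * (\<Prod>j\<in>{N<..N + n}. f j)" for f :: "nat \<Rightarrow> complex"
    using p by (subst prod.union_disjoint[symmetric]) (auto intro!: prod.cong)
  have "(\<Prod>j\<in>{1..N} - {p}. column_factor N j (x j)) = (\<Prod>j\<in>{1..N} - {p}. box_factor q1 q2 q3 (x j))"
    "(\<Prod>j\<in>{N<..N + n}. column_factor N j (x j)) = (\<Prod>j\<in>{N<..N + n}. psi_empty q2 (x j))"
    by (auto intro!: prod.cong simp: column_factor_def)
  then show ?thesis unfolding split by (simp add: box_factor_def psi_empty_def prod.distrib prod_dividef mult_ac)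
qed

text \<open>
  The product no longer refers to the order of positions; the same product arises from every other order.
\<close>

lemma EF_amp:
  assumes "1 \<le> p" "p \<le> N"
  shows "E_amp \<Lambda> p * F_amp N \<Lambda> p =
    q1 / (1 - q1)\<^sup>2 * (\<Prod>j\<in>{1..N + n} - {p}. column_factor N j (weight \<Lambda> j / weight \<Lambda> p))"
proof -
  have "(\<Prod>j\<in>{1..N + n} - {p}. f j) = (\<Prod>j\<in>{1..<p}. f j) * (\<Prod>j\<in>{p<..N + n}. f j)" for f :: "nat \<Rightarrow> complex"
    using assms by (subst prod.union_disjoint[symmetric]) (auto intro!: prod.cong)
  moreover have "p \<le> N + 1" using assms by simp
  ultimately show ?thesis
    by (simp add: E_amp_eq[of p N] F_amp_eq amplitude_def power2_eq_square)
qed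

definition g11 :: complex where "g11 = (1 - q1) * (1 - q2) * (1 - q3)"

text \<open>
  The residue prescribed by the commutator of \<open>e\<close> and \<open>f\<close>.  It is a sum only formally: the weights of addable
  and removable positions are all different.
\<close>

definition pole_residue :: "(nat \<Rightarrow> int) \<Rightarrow> complex \<Rightarrow> complex" where
  "pole_residue \<Lambda> s = g11 * ((\<Sum>p\<in>removable \<Lambda>. if weight (sub_one \<Lambda> p) p = s then E_amp (sub_one \<Lambda> p) p * F_lim (sub_one \<Lambda> p) p else 0)
    - (\<Sum>p\<in>addable \<Lambda>. if weight \<Lambda> p = s then E_amp \<Lambda> p * F_lim \<Lambda> p else 0))"

lemma weight_removed_inj:
  assumes "\<Lambda> \<in> Adm" "1 \<le> p" "1 \<le> p'" "weight (sub_one \<Lambda> p) p = weight (sub_one \<Lambda> p') p'"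
  shows "p = p'"
  using assms weight_inj[OF assms(1-3)] by (simp add: weight_sub_one)

lemma weight_addable_removable:
  assumes "\<Lambda> \<in> Adm" "p \<in> addable \<Lambda>" "p' \<in> removable \<Lambda>"
  shows "weight \<Lambda> p \<noteq> weight (sub_one \<Lambda> p') p'"
proof
  assume h: "weight \<Lambda> p = weight (sub_one \<Lambda> p') p'"
  have p: "1 \<le> p" "1 \<le> p'" using assms by (auto simp: addable_def removable_def)
  have "weight \<Lambda> p' = q1 * weight \<Lambda> p" using h by (simp add: weight_sub_one)
  then have *: "p = p' + n + 1" "\<Lambda> p' = \<Lambda> p + int r" using weight_eq_q1[OF assms(1) p(2,1)] by auto
  have "\<Lambda> p' > \<Lambda> (p' + n) + int r" using assms(3) sub_one_Adm_iff[OF assms(1) p(2)] by (simp add: removable_def)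
  moreover have "\<Lambda> (p' + n + 1) \<le> \<Lambda> (p' + n)" using p by (intro Adm_Suc assms(1)) simp
  ultimately show False using * by simp
qed

lemma pole_residue_addable:
  assumes "\<Lambda> \<in> Adm" "p \<in> addable \<Lambda>"
  shows "pole_residue \<Lambda> (weight \<Lambda> p) = - (g11 * (E_amp \<Lambda> p * F_lim \<Lambda> p))"
proof -
  have e: "weight \<Lambda> p' = weight \<Lambda> p \<longleftrightarrow> p' = p" if "p' \<in> addable \<Lambda>" for p'
    using weight_inj[OF assms(1)] that assms(2) unfolding addable_def by blast
  have "(\<Sum>p'\<in>addable \<Lambda>. if weight \<Lambda> p' = weight \<Lambda> p then E_amp \<Lambda> p' * F_lim \<Lambda> p' else 0) =
      (\<Sum>p'\<in>addable \<Lambda>. if p' = p then E_amp \<Lambda> p' * F_lim \<Lambda> p' else 0)"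
    by (intro sum.cong refl) (simp only: e)
  also have "\<dots> = E_amp \<Lambda> p * F_lim \<Lambda> p" using assms by (simp add: sum.delta)
  finally have 1: "(\<Sum>p'\<in>addable \<Lambda>. if weight \<Lambda> p' = weight \<Lambda> p then E_amp \<Lambda> p' * F_lim \<Lambda> p' else 0) =
      E_amp \<Lambda> p * F_lim \<Lambda> p" .
  have 2: "(\<Sum>p'\<in>removable \<Lambda>. if weight (sub_one \<Lambda> p') p' = weight \<Lambda> p then
      E_amp (sub_one \<Lambda> p') p' * F_lim (sub_one \<Lambda> p') p' else 0) = 0"
    using weight_addable_removable[OF assms, THEN not_sym] by (intro sum.neutral ballI) (simp only: if_False)
  show ?thesis unfolding pole_residue_def 1 2 by simp
qed

lemma pole_residue_removable:
  assumes "\<Lambda> \<in> Adm" "p \<in> removable \<Lambda>"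
  shows "pole_residue \<Lambda> (weight (sub_one \<Lambda> p) p) = g11 * (E_amp (sub_one \<Lambda> p) p * F_lim (sub_one \<Lambda> p) p)"
proof -
  have e: "weight (sub_one \<Lambda> p') p' = weight (sub_one \<Lambda> p) p \<longleftrightarrow> p' = p" if "p' \<in> removable \<Lambda>" for p'
    using weight_removed_inj[OF assms(1)] that assms(2) unfolding removable_def by blast
  have "(\<Sum>p'\<in>removable \<Lambda>. if weight (sub_one \<Lambda> p') p' = weight (sub_one \<Lambda> p) p then
      E_amp (sub_one \<Lambda> p') p' * F_lim (sub_one \<Lambda> p') p' else 0) =
      (\<Sum>p'\<in>removable \<Lambda>. if p' = p then E_amp (sub_one \<Lambda> p') p' * F_lim (sub_one \<Lambda> p') p' else 0)"
    by (intro sum.cong refl) (simp only: e)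
  also have "\<dots> = E_amp (sub_one \<Lambda> p) p * F_lim (sub_one \<Lambda> p) p" using assms by (simp add: sum.delta)
  finally have 1: "(\<Sum>p'\<in>removable \<Lambda>. if weight (sub_one \<Lambda> p') p' = weight (sub_one \<Lambda> p) p then
      E_amp (sub_one \<Lambda> p') p' * F_lim (sub_one \<Lambda> p') p' else 0) = E_amp (sub_one \<Lambda> p) p * F_lim (sub_one \<Lambda> p) p" .
  have 2: "(\<Sum>p'\<in>addable \<Lambda>. if weight \<Lambda> p' = weight (sub_one \<Lambda> p) p then E_amp \<Lambda> p' * F_lim \<Lambda> p' else 0) = 0"
    using weight_addable_removable[OF assms(1) _ assms(2)] by (intro sum.neutral ballI) (simp only: if_False)
  show ?thesis unfolding pole_residue_def 1 2 by simp
qed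

text \<open>
  At the weight of an addable position, the factor \<open>1 - s / z\<close> stands in the denominator once, in the column \<open>p\<close>; all
  other columns are regular there and multiply to the product in \<open>EF_amp\<close>.
\<close>

lemma addable_residue:
  assumes L: "\<Lambda> \<in> Adm" and N: "settled N \<Lambda>" and p: "p \<in> addable \<Lambda>"
  defines "s \<equiv> weight \<Lambda> p"
  shows "\<exists>A B. psi_numerator N \<Lambda> * [:1, - s:] * B = A * psi_denominator N \<Lambda> \<and> poly B (1 / s) \<noteq> 0 \<and>
      pole_residue \<Lambda> s = poly A (1 / s) / poly B (1 / s)"
proof -
  have p1: "1 \<le> p" "add_one \<Lambda> p \<in> Adm" using p by (auto simp: addable_def)
  have pN: "p \<le> N" using addable_subset[OF L N] p by auto
  define x where "x j = weight \<Lambda> j / s" for j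
  have xp: "x p = 1" by (simp add: x_def s_def)
  define B where "B = (\<Prod>j\<in>{1..N}. [:1, - (weight \<Lambda> j / q1):]) * (\<Prod>j\<in>{1..N + n} - {p}. [:1, - weight \<Lambda> j:])"
  have den: "psi_denominator N \<Lambda> = [:1, - s:] * B"
  proof -
    have "(\<Prod>j\<in>{1..N + n}. [:1, - weight \<Lambda> j:]) = [:1, - s:] * (\<Prod>j\<in>{1..N + n} - {p}. [:1, - weight \<Lambda> j:])"
      unfolding s_def using p1 pN by (intro prod.remove) auto
    then show ?thesis unfolding psi_denominator_def B_def by (simp only: mult_ac)
  qed
  define U where "U = (\<Prod>j\<in>{1..N} - {p}. 1 - q3 * x j) * (\<Prod>j\<in>{1..N + n} - {p}. 1 - q2 * x j)"
  define V where "V = (\<Prod>j\<in>{1..N} - {p}. 1 - x j / q1) * (\<Prod>j\<in>{1..N + n} - {p}. 1 - x j)"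
  have rem: "(\<Prod>j\<in>{1..M}. f j) = f p * (\<Prod>j\<in>{1..M} - {p}. f j)" if "N \<le> M" for M and f :: "nat \<Rightarrow> complex"
    using p1 pN that by (intro prod.remove) auto
  have lin: "poly [:1, - (c * weight \<Lambda> j):] (1 / s) = 1 - c * x j"
    "poly [:1, - (weight \<Lambda> j / q1):] (1 / s) = 1 - x j / q1"
    "poly [:1, - weight \<Lambda> j:] (1 / s) = 1 - x j" for c j by (simp_all add: x_def)
  have pB: "poly B (1 / s) = (1 - 1 / q1) * V"
    unfolding B_def V_def poly_mult poly_prod lin rem[of N, OF le_refl] xp by simp
  have pA: "poly (psi_numerator N \<Lambda>) (1 / s) = (1 - q3) * (1 - q2) * U"
    unfolding psi_numerator_def U_def poly_mult poly_prod lin rem[of "N + n", OF le_add1] rem[of N, OF le_refl] xp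
    by simp
  have V0: "V \<noteq> 0"
  proof -
    have "1 - x j \<noteq> 0 \<and> 1 - x j / q1 \<noteq> 0" if "1 \<le> j" "j \<noteq> p" for j
      using addable_generic(1,2)[OF L p1(2) that(1) p1(1) that(2)] by (simp add: x_def s_def divide_simps mult.commute)
    then show ?thesis unfolding V_def by (simp add: prod_zero_iff)
  qed
  have UV: "U / V = (\<Prod>j\<in>{1..N + n} - {p}. column_factor N j (x j))"
    unfolding U_def V_def by (rule column_product[OF p1(1) pN])
  have "pole_residue \<Lambda> s = - (g11 * (q1 / (1 - q1)\<^sup>2 * (U / V)))"
    unfolding s_def pole_residue_addable[OF L p] F_lim_eq[OF L p1(2,1) N] EF_amp[OF p1(1) pN] UV x_def ..
  also have "\<dots> = ((1 - q3) * (1 - q2) * U) / ((1 - 1 / q1) * V)"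
  proof -
    have gen: "- ((a * b * c) * (Q / a\<^sup>2 * (U / V))) = (c * b * U) / ((1 - 1 / Q) * V)"
      if "a = 1 - Q" "a \<noteq> 0" "Q \<noteq> 0" "V \<noteq> 0" for a b c Q U V :: complex
      using that by (simp add: divide_simps power2_eq_square) (simp add: algebra_simps)
    show ?thesis unfolding g11_def using V0 by (intro gen) auto
  qed
  finally have "pole_residue \<Lambda> s = poly (psi_numerator N \<Lambda>) (1 / s) / poly B (1 / s)"
    unfolding pA pB .
  moreover have "psi_numerator N \<Lambda> * [:1, - s:] * B = psi_numerator N \<Lambda> * psi_denominator N \<Lambda>"
    unfolding den by (simp only: mult.assoc)
  moreover have "poly B (1 / s) \<noteq> 0" unfolding pB using V0 by simp
  ultimately show ?thesis by blast
qed

text \<open>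
  The same for a removable position, where the pole comes from the other factor \<open>1 - w\<^sub>p / (q\<^sub>1 z)\<close> of the column \<open>p\<close>
  and the remaining factors are those seen from the lowered partition.
\<close>

lemma removable_residue:
  assumes L: "\<Lambda> \<in> Adm" and N: "settled N \<Lambda>" and p: "p \<in> removable \<Lambda>"
  defines "s \<equiv> weight (sub_one \<Lambda> p) p"
  shows "\<exists>A B. psi_numerator N \<Lambda> * [:1, - s:] * B = A * psi_denominator N \<Lambda> \<and> poly B (1 / s) \<noteq> 0 \<and>
      pole_residue \<Lambda> s = poly A (1 / s) / poly B (1 / s)"
proof -
  let ?M = "sub_one \<Lambda> p"
  have p1: "1 \<le> p" "?M \<in> Adm" using p by (auto simp: removable_def)
  have pN: "p \<le> N" using removable_subset[OF L N] p by auto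
  have add: "add_one ?M p = \<Lambda>" by simp
  have NM: "settled N ?M" using settled_add_one_removed[of N ?M p] N p1 L by simp
  have F: "F_lim ?M p = F_amp N ?M p" by (rule F_lim_eq) (use p1 NM L in auto)
  define x where "x j = weight ?M j / s" for j
  have wp: "weight \<Lambda> p / q1 = s" by (simp add: s_def weight_sub_one)
  have s0: "s \<noteq> 0" by (simp add: s_def)
  have xj: "weight \<Lambda> j / s = x j" if "j \<noteq> p" for j using that by (simp add: x_def weight_sub_one)
  have xp: "weight \<Lambda> p / s = q1" by (simp add: s_def weight_sub_one)
  define B where "B = (\<Prod>j\<in>{1..N} - {p}. [:1, - (weight \<Lambda> j / q1):]) * (\<Prod>j\<in>{1..N + n}. [:1, - weight \<Lambda> j:])"
  have den: "psi_denominator N \<Lambda> = [:1, - s:] * B"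
  proof -
    have "(\<Prod>j\<in>{1..N}. [:1, - (weight \<Lambda> j / q1):]) = [:1, - s:] * (\<Prod>j\<in>{1..N} - {p}. [:1, - (weight \<Lambda> j / q1):])"
      unfolding wp[symmetric] using p1 pN by (intro prod.remove) auto
    then show ?thesis unfolding psi_denominator_def B_def by (simp only: mult_ac)
  qed
  define U where "U = (\<Prod>j\<in>{1..N} - {p}. 1 - q3 * x j) * (\<Prod>j\<in>{1..N + n} - {p}. 1 - q2 * x j)"
  define V where "V = (\<Prod>j\<in>{1..N} - {p}. 1 - x j / q1) * (\<Prod>j\<in>{1..N + n} - {p}. 1 - x j)"
  have rem: "(\<Prod>j\<in>{1..M}. f j) = f p * (\<Prod>j\<in>{1..M} - {p}. f j)" if "N \<le> M" for M and f :: "nat \<Rightarrow> complex"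
    using p1 pN that by (intro prod.remove) auto
  have lin: "poly [:1, - (c * weight \<Lambda> j):] (1 / s) = 1 - c * (weight \<Lambda> j / s)"
    "poly [:1, - (weight \<Lambda> j / q1):] (1 / s) = 1 - (weight \<Lambda> j / s) / q1"
    "poly [:1, - weight \<Lambda> j:] (1 / s) = 1 - weight \<Lambda> j / s" for c j by simp_all
  have pB: "poly B (1 / s) = (1 - q1) * V"
    unfolding B_def V_def poly_mult poly_prod lin rem[of "N + n", OF le_add1] xp
    by (simp add: xj)
  have pA: "poly (psi_numerator N \<Lambda>) (1 / s) = (1 - q3 * q1) * (1 - q2 * q1) * U"
    unfolding psi_numerator_def U_def poly_mult poly_prod lin rem[of "N + n", OF le_add1] rem[of N, OF le_refl] xp
    by (simp add: xj)
  have V0: "V \<noteq> 0"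
  proof -
    have "1 - x j \<noteq> 0 \<and> 1 - x j / q1 \<noteq> 0" if "1 \<le> j" "j \<noteq> p" for j
      using addable_generic(1,2)[OF p1(2) _ that(1) p1(1) that(2)] L by (simp add: x_def s_def divide_simps mult.commute)
    then show ?thesis unfolding V_def by (simp add: prod_zero_iff)
  qed
  have UV: "U / V = (\<Prod>j\<in>{1..N + n} - {p}. column_factor N j (x j))"
    unfolding U_def V_def by (rule column_product[OF p1(1) pN])
  have "pole_residue \<Lambda> s = g11 * (q1 / (1 - q1)\<^sup>2 * (U / V))"
    unfolding s_def pole_residue_removable[OF L p] F EF_amp[OF p1(1) pN] UV x_def ..
  also have "\<dots> = ((1 - q3 * q1) * (1 - q2 * q1) * U) / ((1 - q1) * V)"
  proof -
    have q: "(1 - q3 * q1) * (1 - q2 * q1) = q1 * ((1 - q2) * (1 - q3)) "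
    proof -
      have "(1 - q3 * q1) * (1 - q2 * q1) = 1 - q1 * q3 - q1 * q2 + q1 * (q1 * q2 * q3)"
        by (simp add: algebra_simps)
      also have "\<dots> = q1 * q2 * q3 - q1 * q3 - q1 * q2 + q1" unfolding q123 by simp
      finally show ?thesis by (simp add: algebra_simps)
    qed
    have gen: "(a * b * c) * (Q / a\<^sup>2 * (U / V)) = (Q * (b * c) * U) / (a * V)"
      if "a \<noteq> 0" for a b c Q U V :: complex
      using that by (simp add: power2_eq_square)
    show ?thesis unfolding g11_def q by (intro gen) auto
  qed
  finally have "pole_residue \<Lambda> s = poly (psi_numerator N \<Lambda>) (1 / s) / poly B (1 / s)"
    unfolding pA pB .
  moreover have "psi_numerator N \<Lambda> * [:1, - s:] * B = psi_numerator N \<Lambda> * psi_denominator N \<Lambda>"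
    unfolding den by (simp only: mult.assoc)
  moreover have "poly B (1 / s) \<noteq> 0" unfolding pB using V0 by simp
  ultimately show ?thesis by blast
qed

text \<open>
  The decomposition holds with the same coefficients for every \<open>Z\<close>, so it can be expanded in both ways.
\<close>

lemma Psi_partial_fractions:
  assumes L: "\<Lambda> \<in> Adm"
  shows "\<exists>c. \<forall>Z. (\<forall>d. Z \<noteq> C d) \<longrightarrow>
    Psi Z \<Lambda> = C c + (\<Sum>s\<in>poles \<Lambda>. C (pole_residue \<Lambda> s) * (1 / (1 - C s / Z)))"
proof -
  obtain N where N: "settled N \<Lambda>" using settled_exists[OF L] by blast
  let ?P = "psi_numerator N \<Lambda>" and ?Q = "psi_denominator N \<Lambda>" and ?S = "poles \<Lambda>"
  have fin: "finite ?S" by (rule finite_poles[OF L])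
  have res: "\<exists>A B. ?P * [:1, - s:] * B = A * ?Q \<and> poly B (1 / s) \<noteq> 0 \<and>
      pole_residue \<Lambda> s = poly A (1 / s) / poly B (1 / s)" if "s \<in> ?S" for s
    using that addable_residue[OF L N] removable_residue[OF L N] unfolding poles_def by blast
  have "degree ?P \<le> degree ?Q" by (simp add: psi_poly_degree)
  from partial_fractions[OF fin zero_not_pole psi_poly_nz this psi_order[OF L N] res]
  obtain c where c: "?P * (\<Prod>s\<in>?S. [:1, - s:]) =
    ?Q * (smult c (\<Prod>s\<in>?S. [:1, - s:]) + (\<Sum>s\<in>?S. smult (pole_residue \<Lambda> s) (\<Prod>t\<in>?S - {s}. [:1, - t:])))"
    by blast
  show ?thesis
  proof (intro exI[of _ c] allI impI)
    fix Z :: "complex fls" assume Z: "\<forall>d. Z \<noteq> C d"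
    then have Z0: "Z \<noteq> 0" using fls_const_0 by metis
    define T where "T = (\<Prod>s\<in>?S. 1 - C s / Z)"
    define T' where "T' s = (\<Prod>t\<in>?S - {s}. 1 - C t / Z)" for s
    have nz: "1 - C s / Z \<noteq> 0" for s
    proof
      assume "1 - C s / Z = 0"
      then have "Z = C s" using Z0 by (simp add: divide_simps)
      then show False using Z by blast
    qed
    have T0: "T \<noteq> 0" unfolding T_def using nz fin by (simp only: prod_zero_iff) blast
    have T': "T' s / T = 1 / (1 - C s / Z)" if "s \<in> ?S" for s
    proof -
      have "T = (1 - C s / Z) * T' s" unfolding T_def T'_def using fin that by (rule prod.remove)
      then show ?thesis using T0 by (metis divide_divide_eq_left' divide_self_if mult_zero_right nonzero_divide_mult_cancel_right)
    qed
    have Q0: "at_inverse Z ?Q \<noteq> 0"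
    proof -
      have "at_inverse Z ?Q = (\<Prod>j\<in>{1..N}. 1 - C (weight \<Lambda> j / q1) / Z) * (\<Prod>j\<in>{1..N + n}. 1 - C (weight \<Lambda> j) / Z)"
        unfolding psi_denominator_def at_inverse_hom at_inverse_linear ..
      then show ?thesis using nz by (simp only: mult_eq_0_iff prod_zero_iff finite_atLeastAtMost) blast
    qed
    have "at_inverse Z ?P * T = at_inverse Z ?Q * (C c * T + (\<Sum>s\<in>?S. C (pole_residue \<Lambda> s) * T' s))"
      using arg_cong[OF c, of "at_inverse Z"] unfolding at_inverse_hom at_inverse_linear T_def T'_def .
    then have "at_inverse Z ?P / at_inverse Z ?Q = (C c * T + (\<Sum>s\<in>?S. C (pole_residue \<Lambda> s) * T' s)) / T"
      using Q0 T0 by (simp add: frac_eq_eq mult.commute)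
    also have "\<dots> = C c + (\<Sum>s\<in>?S. C (pole_residue \<Lambda> s) * (T' s / T))"
      using T0 by (simp add: add_divide_distrib sum_divide_distrib)
    also have "\<dots> = C c + (\<Sum>s\<in>?S. C (pole_residue \<Lambda> s) * (1 / (1 - C s / Z)))"
      using T' by (intro arg_cong2[where f = "(+)"] sum.cong refl) simp
    finally show "Psi Z \<Lambda> = C c + (\<Sum>s\<in>?S. C (pole_residue \<Lambda> s) * (1 / (1 - C s / Z)))"
      using Psi_eq_quotient[OF _ N, of Z] Z by simp
  qed
qed

text \<open>
  The constant drops out of the difference of the two expansions and every pole contributes a delta function.
\<close>

lemma psi_difference:
  assumes L: "\<Lambda> \<in> Adm"
  shows "coeff_plus (Psi (inverse fls_X) \<Lambda>) k - coeff_minus (Psi fls_X \<Lambda>) k =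
    g11 * ((\<Sum>p\<in>removable \<Lambda>. weight (sub_one \<Lambda> p) p powi k * (E_amp (sub_one \<Lambda> p) p * F_lim (sub_one \<Lambda> p) p))
      - (\<Sum>p\<in>addable \<Lambda>. weight \<Lambda> p powi k * (E_amp \<Lambda> p * F_lim \<Lambda> p)))"
proof -
  obtain c where c: "\<And>Z. \<forall>d. Z \<noteq> C d \<Longrightarrow>
    Psi Z \<Lambda> = C c + (\<Sum>s\<in>poles \<Lambda>. C (pole_residue \<Lambda> s) * (1 / (1 - C s / Z)))"
    using Psi_partial_fractions[OF L] by blast
  have p: "Psi (inverse fls_X) \<Lambda> = C c + (\<Sum>s\<in>poles \<Lambda>. C (pole_residue \<Lambda> s) * (1 / (1 - C s / inverse fls_X)))"
    using plus.Z_nonconst by (intro c) blast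
  have m: "Psi fls_X \<Lambda> = C c + (\<Sum>s\<in>poles \<Lambda>. C (pole_residue \<Lambda> s) * (1 / (1 - C s / fls_X)))"
    using minus.Z_nonconst by (intro c) blast
  have "coeff_plus (Psi (inverse fls_X) \<Lambda>) k - coeff_minus (Psi fls_X \<Lambda>) k =
      (\<Sum>s\<in>poles \<Lambda>. pole_residue \<Lambda> s * (coeff_plus (1 / (1 - C s / inverse fls_X)) k - coeff_minus (1 / (1 - C s / fls_X)) k))"
    unfolding p m plus.cf_add plus.cf_sum plus.cf_scale plus.cf_const minus.cf_add minus.cf_sum minus.cf_scale minus.cf_const
    by (simp only: right_diff_distrib sum_subtractf add_diff_cancel_left)
  also have "\<dots> = (\<Sum>s\<in>poles \<Lambda>. pole_residue \<Lambda> s * s powi k)"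
    using zero_not_pole[of \<Lambda>] by (intro sum.cong refl) (metis delta_expansion)
  also have "\<dots> = (\<Sum>s\<in>weight \<Lambda> ` addable \<Lambda>. pole_residue \<Lambda> s * s powi k) +
      (\<Sum>s\<in>(\<lambda>p. weight (sub_one \<Lambda> p) p) ` removable \<Lambda>. pole_residue \<Lambda> s * s powi k)"
    unfolding poles_def using weight_addable_removable[OF L] L by (intro sum.union_disjoint) auto
  also have "(\<Sum>s\<in>weight \<Lambda> ` addable \<Lambda>. pole_residue \<Lambda> s * s powi k) =
      (\<Sum>p\<in>addable \<Lambda>. - (g11 * (E_amp \<Lambda> p * F_lim \<Lambda> p)) * weight \<Lambda> p powi k)"
  proof -
    have "inj_on (weight \<Lambda>) (addable \<Lambda>)"
      using weight_inj[OF L] unfolding inj_on_def addable_def by blast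
    then show ?thesis by (subst sum.reindex) (auto simp: pole_residue_addable[OF L])
  qed
  also have "(\<Sum>s\<in>(\<lambda>p. weight (sub_one \<Lambda> p) p) ` removable \<Lambda>. pole_residue \<Lambda> s * s powi k) =
      (\<Sum>p\<in>removable \<Lambda>. g11 * (E_amp (sub_one \<Lambda> p) p * F_lim (sub_one \<Lambda> p) p) * weight (sub_one \<Lambda> p) p powi k)"
  proof -
    have "inj_on (\<lambda>p. weight (sub_one \<Lambda> p) p) (removable \<Lambda>)"
      using weight_removed_inj[OF L] unfolding inj_on_def removable_def by blast
    then show ?thesis by (subst sum.reindex) (auto simp: pole_residue_removable[OF L])
  qed
  finally show ?thesis
    by (simp add: right_diff_distrib sum_distrib_left sum_negf mult_ac)
qed

end

section \<open>Power series with invertible constant term\<close>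

context specialization begin

text \<open>
  Specialization of Laurent series without negative terms coefficient by coefficient.  The invertible constant term
  makes the relation closed under division, by the recursion for the coefficients of an inverse.
\<close>

definition unit_series :: "'a fls \<Rightarrow> 'k fls \<Rightarrow> bool" where
  "unit_series F F' \<longleftrightarrow> (\<exists>f f'. F = fps_to_fls f \<and> F' = fps_to_fls f' \<and> (\<forall>k. S (f $ k) (f' $ k)) \<and> f' $ 0 \<noteq> 0)"

lemma unit_series_nth: "unit_series F F' \<Longrightarrow> S (fls_nth F k) (fls_nth F' k)"
  unfolding unit_series_def using zero by auto

lemma unit_series_neg: "unit_series F F' \<Longrightarrow> k < 0 \<Longrightarrow> fls_nth F' k = 0"
  unfolding unit_series_def by auto

lemma unit_series_0: "unit_series F F' \<Longrightarrow> fls_nth F' 0 \<noteq> 0"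
  unfolding unit_series_def by auto

lemma unit_series_mult:
  assumes "unit_series F F'" "unit_series G G'"
  shows "unit_series (F * G) (F' * G')"
proof -
  obtain f f' g g' where *: "F = fps_to_fls f" "F' = fps_to_fls f'" "\<And>k. S (f $ k) (f' $ k)" "f' $ 0 \<noteq> 0"
    "G = fps_to_fls g" "G' = fps_to_fls g'" "\<And>k. S (g $ k) (g' $ k)" "g' $ 0 \<noteq> 0"
    using assms unfolding unit_series_def by blast
  show ?thesis unfolding unit_series_def
    by (rule exI[of _ "f * g"], rule exI[of _ "f' * g'"])
      (use * in \<open>auto simp: fls_times_fps_to_fls fps_mult_nth intro!: sum mult\<close>)
qed

lemma unit_series_one: "unit_series 1 1"
  unfolding unit_series_def using one zero
  by (intro exI[of _ 1]) auto

lemma unit_series_prod: "(\<And>i. i \<in> A \<Longrightarrow> unit_series (F i) (F' i)) \<Longrightarrow> unit_series (\<Prod>i\<in>A. F i) (\<Prod>i\<in>A. F' i)"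
  by (induction A rule: infinite_finite_induct) (auto intro: unit_series_one unit_series_mult)

lemma fps_inverse_step:
  fixes f :: "'x::field fps"
  assumes "f $ 0 \<noteq> 0"
  shows "inverse f $ 0 = inverse (f $ 0)"
    and "inverse f $ Suc m = - (inverse (f $ 0) * (\<Sum>i\<in>{1..Suc m}. f $ i * inverse f $ (Suc m - i)))"
proof -
  have e: "f * inverse f = 1" using assms by (simp add: inverse_mult_eq_1')
  show "inverse f $ 0 = inverse (f $ 0)" by simp
  have "(\<Sum>i\<in>{0..Suc m}. f $ i * inverse f $ (Suc m - i)) = 0"
    using arg_cong[OF e, of "\<lambda>h. h $ Suc m"] by (simp add: fps_mult_nth)
  moreover have "(\<Sum>i\<in>{0..Suc m}. f $ i * inverse f $ (Suc m - i)) =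
      f $ 0 * inverse f $ Suc m + (\<Sum>i\<in>{1..Suc m}. f $ i * inverse f $ (Suc m - i))"
    by (subst sum.atLeast_Suc_atMost) auto
  ultimately have "f $ 0 * inverse f $ Suc m = - (\<Sum>i\<in>{1..Suc m}. f $ i * inverse f $ (Suc m - i))"
    by (simp add: add_eq_0_iff2)
  then have "inverse (f $ 0) * (f $ 0 * inverse f $ Suc m) =
      inverse (f $ 0) * - (\<Sum>i\<in>{1..Suc m}. f $ i * inverse f $ (Suc m - i))" by simp
  then show "inverse f $ Suc m = - (inverse (f $ 0) * (\<Sum>i\<in>{1..Suc m}. f $ i * inverse f $ (Suc m - i)))"
    by (simp only: mult.assoc[symmetric] left_inverse[OF assms] mult_1 mult_minus_right)
qed

lemma fps_to_fls_inverse: "(f :: 'x::field fps) $ 0 \<noteq> 0 \<Longrightarrow> inverse (fps_to_fls f) = fps_to_fls (inverse f)"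
proof -
  assume "f $ 0 \<noteq> 0"
  then have "f * inverse f = 1" by (simp add: inverse_mult_eq_1')
  then have "fps_to_fls f * fps_to_fls (inverse f) = 1" by (simp flip: fls_times_fps_to_fls)
  then show ?thesis by (rule inverse_unique)
qed

lemma unit_series_inverse:
  assumes "unit_series F F'"
  shows "unit_series (inverse F) (inverse F')"
proof -
  obtain f f' where *: "F = fps_to_fls f" "F' = fps_to_fls f'" "\<And>k. S (f $ k) (f' $ k)" "f' $ 0 \<noteq> 0"
    using assms unfolding unit_series_def by blast
  have f0: "f $ 0 \<noteq> 0" using nonzero * by blast
  have "S (inverse f $ k) (inverse f' $ k)" for k
  proof (induction k rule: less_induct)
    case (less k)
    show ?case
    proof (cases k)
      case 0
      show ?thesis unfolding 0 fps_inverse_step(1)[OF f0] fps_inverse_step(1)[OF *(4)]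
        by (rule inverse[OF *(3,4)])
    next
      case (Suc m)
      show ?thesis unfolding Suc fps_inverse_step(2)[OF f0] fps_inverse_step(2)[OF *(4)]
        using less Suc by (intro uminus mult inverse sum *(3,4)) auto
    qed
  qed
  moreover have "inverse f' $ 0 \<noteq> 0" using *(4) by simp
  ultimately show ?thesis unfolding unit_series_def *(1,2) fps_to_fls_inverse[OF f0] fps_to_fls_inverse[OF *(4)] by blast
qed

lemma unit_series_divide: "unit_series F F' \<Longrightarrow> unit_series G G' \<Longrightarrow> unit_series (F / G) (F' / G')"
  unfolding divide_inverse by (intro unit_series_mult unit_series_inverse)

lemma unit_series_one_minus:
  assumes "S c c'"
  shows "unit_series (1 - fls_const c / inverse fls_X) (1 - fls_const c' / inverse fls_X)"
proof -
  have e: "1 - fls_const d / inverse fls_X = fps_to_fls (1 - fps_const d * fps_X)" for d :: "'x::field"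
    by (simp add: fls_times_fps_to_fls divide_inverse)
  have K: "S ((1 - fps_const c * fps_X) $ k) ((1 - fps_const c' * fps_X) $ k)" for k
    using assms one zero uminus by (cases "k = 0"; cases "k = 1") auto
  show ?thesis unfolding unit_series_def e
    by (rule exI[of _ "1 - fps_const c * fps_X"], rule exI[of _ "1 - fps_const c' * fps_X"], intro conjI allI refl K) simp
qed

lemma unit_series_X_minus:
  assumes "S c c'" "c' \<noteq> 0"
  shows "unit_series (fls_X - fls_const c) (fls_X - fls_const c')"
proof -
  have e: "fls_X - fls_const d = fps_to_fls (fps_X - fps_const d)" for d :: "'x::field" by simp
  have K: "S ((fps_X - fps_const c) $ k) ((fps_X - fps_const c') $ k)" for k
    using assms one zero uminus by (cases "k = 0"; cases "k = 1") auto
  show ?thesis unfolding unit_series_def e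
    by (rule exI[of _ "fps_X - fps_const c"], rule exI[of _ "fps_X - fps_const c'"], intro conjI allI refl K)
      (simp add: assms(2))
qed

lemma unit_series_ratio:
  assumes "S c c'" "c' \<noteq> 0" "S d d'" "d' \<noteq> 0" and Z: "Z = inverse fls_X \<and> Z' = inverse fls_X \<or> Z = fls_X \<and> Z' = fls_X"
  shows "unit_series ((1 - fls_const c / Z) / (1 - fls_const d / Z)) ((1 - fls_const c' / Z') / (1 - fls_const d' / Z'))"
  using Z
proof (elim disjE conjE)
  assume *: "Z = inverse fls_X" "Z' = inverse fls_X"
  show ?thesis unfolding * by (intro unit_series_divide unit_series_one_minus assms)
next
  assume *: "Z = fls_X" "Z' = fls_X"
  have e: "(1 - fls_const c / fls_X) / (1 - fls_const d / fls_X) = (fls_X - fls_const c) / (fls_X - fls_const d)"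
    for c d :: "'x::field"
  proof -
    have gen: "(1 - u / x) / (1 - v / x) = (x - u) / (x - v)" if "x \<noteq> 0" for u v x :: "'x fls"
    proof -
      have "1 - u / x = (x - u) / x" "1 - v / x = (x - v) / x" using that by (simp_all add: diff_divide_distrib)
      then show ?thesis using that by simp
    qed
    show ?thesis by (rule gen) simp
  qed
  show ?thesis unfolding * e by (intro unit_series_divide unit_series_X_minus assms)
qed

lemma unit_series_box_factor:
  assumes "S Q1 q1" "S Q2 q2" "S Q3 q3" "S c c'" "q1 \<noteq> 0" "q2 \<noteq> 0" "q3 \<noteq> 0" "c' \<noteq> 0"
    and Z: "Z = inverse fls_X \<and> Z' = inverse fls_X \<or> Z = fls_X \<and> Z' = fls_X"
  shows "unit_series (box_factor (fls_const Q1) (fls_const Q2) (fls_const Q3) (fls_const c / Z))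
    (box_factor (fls_const q1) (fls_const q2) (fls_const q3) (fls_const c' / Z'))"
proof -
  have e: "box_factor (fls_const Q1) (fls_const Q2) (fls_const Q3) (fls_const c / Z) =
    ((1 - fls_const (Q3 * c) / Z) / (1 - fls_const c / Z)) * ((1 - fls_const (Q2 * c) / Z) / (1 - fls_const (c / Q1) / Z))"
    for Q1 Q2 Q3 c :: "'x::field" and Z
  proof -
    have "fls_const (Q3 * c) / Z = fls_const Q3 * (fls_const c / Z)" "fls_const (Q2 * c) / Z = fls_const Q2 * (fls_const c / Z)"
      by (simp_all only: fls_const_mult_const[symmetric] times_divide_eq_right)
    moreover have "fls_const (c / Q1) / Z = fls_const c / Z / fls_const Q1"
      by (simp only: divide_inverse fls_const_mult_const[symmetric] fls_inverse_const[symmetric] mult_ac)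
    ultimately show ?thesis unfolding box_factor_def by simp
  qed
  show ?thesis unfolding e
    using assms by (intro unit_series_mult unit_series_ratio mult divide Z) auto
qed

lemma unit_series_psi_empty:
  assumes "S Q2 q2" "S c c'" "q2 \<noteq> 0" "c' \<noteq> 0"
    and Z: "Z = inverse fls_X \<and> Z' = inverse fls_X \<or> Z = fls_X \<and> Z' = fls_X"
  shows "unit_series (psi_empty (fls_const Q2) (fls_const c / Z)) (psi_empty (fls_const q2) (fls_const c' / Z'))"
proof -
  have e: "psi_empty (fls_const Q2) (fls_const c / Z) = (1 - fls_const (Q2 * c) / Z) / (1 - fls_const c / Z)"
    for Q2 c :: "'x::field" and Z
    unfolding psi_empty_def by (simp only: fls_const_mult_const[symmetric] times_divide_eq_right)
  show ?thesis unfolding e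
    using assms by (intro unit_series_ratio mult Z) auto
qed

end

text \<open>The identity as a specialization: it yields that eigenvalues of \<open>\<psi>\<close> are power series with non-zero constant term.\<close>

interpretation trivial: specialization "(=) :: complex \<Rightarrow> complex \<Rightarrow> bool"
  by standard auto

section \<open>Linear operators on finitely supported functions\<close>

lemma lookup_scale [simp]: "Poly_Mapping.lookup (scale c x) b = c * Poly_Mapping.lookup x b"
  by (auto simp: scale_def Poly_Mapping.map.rep_eq when_def)

lemma scale_add: "scale c (x + y) = scale c x + scale c y"
  by (rule poly_mapping_eqI) (simp add: lookup_add algebra_simps)

lemma scale_0 [simp]: "scale c 0 = 0"
  by (rule poly_mapping_eqI) simp

lemma scale_scale [simp]: "scale c (scale d x) = scale (c * d) x"
  by (rule poly_mapping_eqI) simp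

lemma scale_one [simp]: "scale 1 x = x"
  by (rule poly_mapping_eqI) simp

lemma scale_single [simp]: "scale c (Poly_Mapping.single b d) = Poly_Mapping.single b (c * d)"
  by (rule poly_mapping_eqI) (simp add: lookup_single when_def)

lemma scale_diff: "scale c (x - y) = scale c x - scale c y"
  by (rule poly_mapping_eqI) (simp add: lookup_minus algebra_simps)

lemma scale_sum: "scale c (\<Sum>i\<in>A. x i) = (\<Sum>i\<in>A. scale c (x i))"
  by (induction A rule: infinite_finite_induct) (auto simp: scale_add)

lemma single_sum: "Poly_Mapping.single b (\<Sum>i\<in>A. c i) = (\<Sum>i\<in>A. Poly_Mapping.single b (c i))"
  by (induction A rule: infinite_finite_induct) (auto simp: single_add)

definition linear_op :: "(('b \<Rightarrow>\<^sub>0 complex) \<Rightarrow> ('c \<Rightarrow>\<^sub>0 complex)) \<Rightarrow> bool" where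
  "linear_op T \<longleftrightarrow> (\<forall>x y. T (x + y) = T x + T y) \<and> (\<forall>c x. T (scale c x) = scale c (T x))"

lemma linear_opD:
  assumes "linear_op T"
  shows "T (x + y) = T x + T y" "T (scale c x) = scale c (T x)" "T 0 = 0" "T (\<Sum>i\<in>A. f i) = (\<Sum>i\<in>A. T (f i))"
    "T (- x) = - T x" "T (x - y) = T x - T y"
proof -
  show add: "T (x + y) = T x + T y" for x y using assms by (simp add: linear_op_def)
  show "T (scale c x) = scale c (T x)" using assms by (simp add: linear_op_def)
  show zero: "T 0 = 0" using add[of 0 0] by simp
  show "T (\<Sum>i\<in>A. f i) = (\<Sum>i\<in>A. T (f i))"
    by (induction A rule: infinite_finite_induct) (auto simp: add zero)
  show minus: "T (- x) = - T x" for x using add[of x "- x"] zero by (simp add: eq_neg_iff_add_eq_0 add.commute)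
  show "T (x - y) = T x - T y" using add[of x "- y"] by (simp add: minus)
qed

lemma linear_extension_superset:
  assumes "finite A" "Poly_Mapping.keys x \<subseteq> A"
  shows "linear_extension F x = (\<Sum>b\<in>A. scale (Poly_Mapping.lookup x b) (F b))"
  unfolding linear_extension_def
proof (rule sum.mono_neutral_left[OF assms], intro ballI)
  fix b assume "b \<in> A - Poly_Mapping.keys x"
  then have "Poly_Mapping.lookup x b = 0" by (simp add: in_keys_iff)
  then show "scale (Poly_Mapping.lookup x b) (F b) = 0" by (intro poly_mapping_eqI) simp
qed

lemma scale_left_add: "scale (c + d) x = scale c x + scale d x"
  by (rule poly_mapping_eqI) (simp add: lookup_add algebra_simps)

lemma linear_op_linear_extension: "linear_op (linear_extension F)"
  unfolding linear_op_def
proof (intro conjI allI)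
  fix x y :: "'a \<Rightarrow>\<^sub>0 complex" and c
  let ?A = "Poly_Mapping.keys x \<union> Poly_Mapping.keys y"
  have "linear_extension F (x + y) = (\<Sum>b\<in>?A. scale (Poly_Mapping.lookup (x + y) b) (F b))"
    using Poly_Mapping.keys_add[of x y] by (intro linear_extension_superset) auto
  also have "\<dots> = (\<Sum>b\<in>?A. scale (Poly_Mapping.lookup x b) (F b)) + (\<Sum>b\<in>?A. scale (Poly_Mapping.lookup y b) (F b))"
    by (simp add: lookup_add scale_left_add sum.distrib)
  also have "\<dots> = linear_extension F x + linear_extension F y"
    by (simp add: linear_extension_superset[of ?A x] linear_extension_superset[of ?A y])
  finally show "linear_extension F (x + y) = linear_extension F x + linear_extension F y" .
  have "Poly_Mapping.keys (scale c x) \<subseteq> Poly_Mapping.keys x" by (auto simp: in_keys_iff)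
  then have "linear_extension F (scale c x) = (\<Sum>b\<in>Poly_Mapping.keys x. scale (Poly_Mapping.lookup (scale c x) b) (F b))"
    by (intro linear_extension_superset) auto
  then show "linear_extension F (scale c x) = scale c (linear_extension F x)"
    by (simp add: linear_extension_def scale_sum)
qed

lemma linear_extension_single: "linear_extension F (Poly_Mapping.single b c) = scale c (F b)"
  by (subst linear_extension_superset[of "{b}"]) (auto simp: lookup_single)

lemma sum_single_lookup_general: "(\<Sum>b\<in>Poly_Mapping.keys x. scale (Poly_Mapping.lookup x b) (Poly_Mapping.single b 1)) = x"
  by (rule poly_mapping_eqI) (auto simp: lookup_sum lookup_single when_def in_keys_iff)

lemma linear_op_expand:
  assumes "linear_op T"
  shows "T x = (\<Sum>b\<in>Poly_Mapping.keys x. scale (Poly_Mapping.lookup x b) (T (Poly_Mapping.single b 1)))"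
proof -
  have "T x = T (\<Sum>b\<in>Poly_Mapping.keys x. scale (Poly_Mapping.lookup x b) (Poly_Mapping.single b 1))"
    by (simp only: sum_single_lookup_general)
  then show ?thesis by (simp only: linear_opD[OF assms])
qed

lemma linear_op_eqI:
  assumes "linear_op T" "linear_op T'" "Poly_Mapping.keys x \<subseteq> B"
    and "\<And>b. b \<in> B \<Longrightarrow> T (Poly_Mapping.single b 1) = T' (Poly_Mapping.single b 1)"
  shows "T x = T' x"
  unfolding linear_op_expand[OF assms(1), of x] linear_op_expand[OF assms(2), of x]
  using assms(3,4) by (intro sum.cong refl) (metis subsetD)

lemma linear_op_matrix_op: "linear_op (matrix_op B m)"
  unfolding matrix_op_def by (rule linear_op_linear_extension)

lemma linear_op_diagonal_op: "linear_op (diagonal_op d)"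
  unfolding diagonal_op_def by (rule linear_op_linear_extension)

lemma diagonal_op_single [simp]: "diagonal_op d (Poly_Mapping.single b c) = Poly_Mapping.single b (c * d b)"
  by (simp add: diagonal_op_def linear_extension_single)

lemma linear_op_compose: "linear_op T \<Longrightarrow> linear_op T' \<Longrightarrow> linear_op (\<lambda>x. T (T' x))"
  by (simp add: linear_op_def)

lemma linear_op_scale: "linear_op T \<Longrightarrow> linear_op (\<lambda>x. scale c (T x))"
  by (simp add: linear_op_def scale_add mult.commute)

lemma linear_op_add: "linear_op T \<Longrightarrow> linear_op T' \<Longrightarrow> linear_op (\<lambda>x. T x + T' x)"
  by (simp add: linear_op_def scale_add add_ac)

lemma linear_op_uminus: "linear_op T \<Longrightarrow> linear_op (\<lambda>x. - T x)"
  using linear_op_scale[of T "-1"] by (simp add: linear_op_def) (metis minus_add_distrib scale_diff diff_0 scale_0 uminus_add_conv_diff)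

lemma linear_op_diff: "linear_op T \<Longrightarrow> linear_op T' \<Longrightarrow> linear_op (\<lambda>x. T x - T' x)"
  by (simp add: linear_op_def scale_diff)

lemma linear_op_zero: "linear_op (\<lambda>x. 0)"
  by (simp add: linear_op_def)

lemma linear_op_sum: "(\<And>i. i \<in> A \<Longrightarrow> linear_op (T i)) \<Longrightarrow> linear_op (\<lambda>x. \<Sum>i\<in>A. T i x)"
  by (induction A rule: infinite_finite_induct) (auto intro: linear_op_zero linear_op_add)

lemmas linear_op_intros = linear_op_compose linear_op_scale linear_op_add linear_op_uminus linear_op_diff linear_op_sum linear_op_zero

lemma linear_op_on_space: "linear_op T \<Longrightarrow> linear_on_space S T"
  by (simp add: linear_op_def linear_on_space_def)

text \<open>
  Matrix coefficients given by a sum over steps \<open>i\<close> of which at most one leads from \<open>b\<close> to \<open>b'\<close> are turned into a sum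
  over all possible steps from \<open>b\<close>.
\<close>

lemma matrix_op_single:
  assumes inj: "inj_on step {i. P i}" and m: "\<And>b'. b' \<in> B \<Longrightarrow> m b' b = (\<Sum>i | P i \<and> b' = step i. w i)"
    and fin: "finite {i. P i \<and> step i \<in> B}"
  shows "matrix_op B m (Poly_Mapping.single b c) =
    (\<Sum>i | P i \<and> step i \<in> B. Poly_Mapping.single (step i) (c * w i))"
proof -
  let ?Q = "{i. P i \<and> step i \<in> B}"
  have val: "m (step i) b = w i" if "i \<in> ?Q" for i
  proof -
    have one: "{i'. P i' \<and> step i = step i'} = {i}" using inj that unfolding inj_on_def by blast
    have "m (step i) b = (\<Sum>i' | P i' \<and> step i = step i'. w i')" using that by (intro m) simp
    then show ?thesis unfolding one by simp
  qed
  have sub: "{b' \<in> B. m b' b \<noteq> 0} \<subseteq> step ` ?Q"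
  proof
    fix b' assume b': "b' \<in> {b' \<in> B. m b' b \<noteq> 0}"
    show "b' \<in> step ` ?Q"
    proof (rule ccontr)
      assume "b' \<notin> step ` ?Q"
      then have none: "{i. P i \<and> b' = step i} = {}" using b' by blast
      have "m b' b = (\<Sum>i | P i \<and> b' = step i. w i)" using b' by (intro m) simp
      then show False using b' unfolding none by simp
    qed
  qed
  have "(\<Sum>b' | b' \<in> B \<and> m b' b \<noteq> 0. Poly_Mapping.single b' (m b' b)) = (\<Sum>b'\<in>step ` ?Q. Poly_Mapping.single b' (m b' b))"
  proof (rule sum.mono_neutral_left[OF finite_imageI[OF fin] sub], rule ballI)
    fix b' assume "b' \<in> step ` ?Q - {b' \<in> B. m b' b \<noteq> 0}"
    then have "m b' b = 0" by blast
    then show "Poly_Mapping.single b' (m b' b) = 0" by simp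
  qed
  also have "\<dots> = (\<Sum>i\<in>?Q. Poly_Mapping.single (step i) (m (step i) b))"
  proof -
    have "inj_on step ?Q" by (rule inj_on_subset[OF inj]) blast
    then show ?thesis by (simp only: sum.reindex o_def)
  qed
  also have "\<dots> = (\<Sum>i\<in>?Q. Poly_Mapping.single (step i) (w i))"
    using val by (intro sum.cong refl) simp
  finally show ?thesis unfolding matrix_op_def linear_extension_single by (simp add: scale_sum)
qed

lemma homogeneous_opI:
  assumes lin: "linear_op T"
    and keys: "\<And>b b'. b \<in> labels V \<Longrightarrow> b' \<in> Poly_Mapping.keys (T (Poly_Mapping.single b 1)) \<Longrightarrow>
      b' \<in> labels V \<and> label_deg V b' = label_deg V b + s"
  shows "homogeneous_op V s T"
proof -
  have main: "\<exists>b\<in>Poly_Mapping.keys x. b' \<in> Poly_Mapping.keys (T (Poly_Mapping.single b 1))"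
    if "b' \<in> Poly_Mapping.keys (T x)" for x b'
  proof (rule ccontr)
    assume no: "\<not> ?thesis"
    have "Poly_Mapping.lookup (T x) b' =
      (\<Sum>b\<in>Poly_Mapping.keys x. Poly_Mapping.lookup x b * Poly_Mapping.lookup (T (Poly_Mapping.single b 1)) b')"
      by (subst linear_op_expand[OF lin]) (simp add: lookup_sum)
    also have "\<dots> = 0" using no by (intro sum.neutral) (auto simp: in_keys_iff)
    finally show False using that by (simp add: in_keys_iff)
  qed
  show ?thesis unfolding homogeneous_op_def
  proof (intro conjI allI subsetI)
    show "linear_on_space (space V) T" by (rule linear_op_on_space[OF lin])
    show "y \<in> space V" if "y \<in> T ` space V" for y
      using that main keys unfolding space_def by fastforce
    show "y \<in> component V (d + s)" if y: "y \<in> T ` component V d" for y d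
    proof -
      obtain x where x: "y = T x" "x \<in> component V d" using y by blast
      have "b' \<in> labels V \<and> label_deg V b' = d + s" if "b' \<in> Poly_Mapping.keys y" for b'
        using main[of b' x] that x keys unfolding component_def space_def by fastforce
      then show ?thesis unfolding component_def space_def by blast
    qed
  qed
qed

lemma lookup_diagonal_op [simp]: "Poly_Mapping.lookup (diagonal_op d x) b = Poly_Mapping.lookup x b * d b"
proof -
  have "Poly_Mapping.lookup (diagonal_op d x) b =
      (\<Sum>b'\<in>Poly_Mapping.keys x. if b' = b then Poly_Mapping.lookup x b' * d b' else 0)"
    unfolding diagonal_op_def linear_extension_def by (simp add: lookup_sum lookup_single when_def)
  also have "\<dots> = (if b \<in> Poly_Mapping.keys x then Poly_Mapping.lookup x b * d b else 0)"
    by (rule sum.delta) simp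
  finally show ?thesis by (simp add: in_keys_iff)
qed

lemma bij_diagonal_op:
  assumes d: "\<And>b. b \<in> labels V \<Longrightarrow> d b \<noteq> 0"
  shows "bij_betw (diagonal_op d) (space V) (space V)"
proof (rule bij_betw_byWitness[where f' = "diagonal_op (\<lambda>b. inverse (d b))"])
  have keys: "diagonal_op e x \<in> space V" if "x \<in> space V" for e x
    using that unfolding space_def by (auto simp: in_keys_iff)
  then show "diagonal_op d ` space V \<subseteq> space V" "diagonal_op (\<lambda>b. inverse (d b)) ` space V \<subseteq> space V"
    by blast+
  have cancel: "Poly_Mapping.lookup x b = 0 \<or> d b \<noteq> 0" if "x \<in> space V" for x b
  proof (cases "b \<in> Poly_Mapping.keys x")
    case True
    then show ?thesis using that d unfolding space_def by blast
  qed (simp add: in_keys_iff)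
  show "\<forall>x\<in>space V. diagonal_op (\<lambda>b. inverse (d b)) (diagonal_op d x) = x"
    by (intro ballI poly_mapping_eqI) (use cancel in force)
  show "\<forall>x\<in>space V. diagonal_op d (diagonal_op (\<lambda>b. inverse (d b)) x) = x"
    by (intro ballI poly_mapping_eqI) (use cancel in force)
qed

lemma double_sum_zero:
  fixes T :: "nat \<Rightarrow> nat \<Rightarrow> ('b \<Rightarrow>\<^sub>0 complex)"
  assumes "\<And>p q. p \<in> A \<Longrightarrow> q \<in> A \<Longrightarrow> T p q + T q p = 0"
  shows "(\<Sum>p\<in>A. \<Sum>q\<in>A. T p q) = 0"
proof -
  let ?S = "\<Sum>p\<in>A. \<Sum>q\<in>A. T p q"
  have "?S + ?S = (\<Sum>p\<in>A. \<Sum>q\<in>A. T p q) + (\<Sum>p\<in>A. \<Sum>q\<in>A. T q p)"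
    by (simp only: sum.swap[of T A A])
  also have "\<dots> = (\<Sum>p\<in>A. \<Sum>q\<in>A. T p q + T q p)" by (simp only: sum.distrib)
  also have "\<dots> = 0" using assms by (intro sum.neutral ballI) auto
  finally have "?S + ?S = 0" .
  then have "Poly_Mapping.lookup ?S b + Poly_Mapping.lookup ?S b = 0" for b
    by (metis lookup_add lookup_zero)
  then show ?thesis by (intro poly_mapping_eqI) simp
qed

lemma triple_sum_zero:
  fixes T :: "nat \<Rightarrow> nat \<Rightarrow> nat \<Rightarrow> ('b \<Rightarrow>\<^sub>0 complex)"
  assumes "\<And>p q s. p \<in> A \<Longrightarrow> q \<in> A \<Longrightarrow> s \<in> A \<Longrightarrow> T p q s + T p s q + T q p s + T q s p + T s p q + T s q p = 0"
  shows "(\<Sum>p\<in>A. \<Sum>q\<in>A. \<Sum>s\<in>A. T p q s) = 0"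
proof -
  let ?S = "\<Sum>p\<in>A. \<Sum>q\<in>A. \<Sum>s\<in>A. T p q s"
  have s12: "(\<Sum>p\<in>A. \<Sum>q\<in>A. \<Sum>s\<in>A. U q p s) = (\<Sum>p\<in>A. \<Sum>q\<in>A. \<Sum>s\<in>A. U p q s)"
    for U :: "nat \<Rightarrow> nat \<Rightarrow> nat \<Rightarrow> ('b \<Rightarrow>\<^sub>0 complex)" by (rule sum.swap)
  have s23: "(\<Sum>p\<in>A. \<Sum>q\<in>A. \<Sum>s\<in>A. U p s q) = (\<Sum>p\<in>A. \<Sum>q\<in>A. \<Sum>s\<in>A. U p q s)"
    for U :: "nat \<Rightarrow> nat \<Rightarrow> nat \<Rightarrow> ('b \<Rightarrow>\<^sub>0 complex)" by (intro sum.cong refl sum.swap)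
  have e: "(\<Sum>p\<in>A. \<Sum>q\<in>A. \<Sum>s\<in>A. T p s q) = ?S" "(\<Sum>p\<in>A. \<Sum>q\<in>A. \<Sum>s\<in>A. T q p s) = ?S"
    "(\<Sum>p\<in>A. \<Sum>q\<in>A. \<Sum>s\<in>A. T q s p) = ?S" "(\<Sum>p\<in>A. \<Sum>q\<in>A. \<Sum>s\<in>A. T s p q) = ?S"
    "(\<Sum>p\<in>A. \<Sum>q\<in>A. \<Sum>s\<in>A. T s q p) = ?S"
    using s23[of T] s12[of T] s12[of "\<lambda>p q s. T p s q"] s23[of "\<lambda>p q s. T q p s"]
      s23[of "\<lambda>p q s. T q s p"] s12[of "\<lambda>p q s. T s p q"] by auto
  have "?S + ?S + ?S + ?S + ?S + ?S = (\<Sum>p\<in>A. \<Sum>q\<in>A. \<Sum>s\<in>A. T p q s + T p s q + T q p s + T q s p + T s p q + T s q p)"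
    unfolding sum.distrib e ..
  also have "\<dots> = 0" using assms by (intro sum.neutral ballI) auto
  finally have z: "?S + ?S + ?S + ?S + ?S + ?S = 0" .
  show ?thesis
  proof (rule poly_mapping_eqI)
    fix b
    have "6 * Poly_Mapping.lookup ?S b = Poly_Mapping.lookup (?S + ?S + ?S + ?S + ?S + ?S) b"
      by (simp only: lookup_add) simp
    then show "Poly_Mapping.lookup ?S b = Poly_Mapping.lookup 0 b" unfolding z by simp
  qed
qed

section \<open>Sums over paths\<close>

lemma keys_sum_subset: "Poly_Mapping.keys (\<Sum>i\<in>A. f i) \<subseteq> (\<Union>i\<in>A. Poly_Mapping.keys (f i))"
proof (induction A rule: infinite_finite_induct)
  case (insert i A)
  then show ?case using Poly_Mapping.keys_add[of "f i" "\<Sum>i\<in>A. f i"] by auto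
qed auto

lemma quadratic_relI:
  assumes lin: "\<And>k. linear_op (X k)" "\<And>k. linear_op (Y k)"
    and basis: "\<And>b k l. b \<in> labels V \<Longrightarrow>
      (\<Sum>a\<le>3. scale (\<gamma> a) (X (k + int a) (Y (l + 3 - int a) (Poly_Mapping.single b 1)))) =
      - (\<Sum>a\<le>3. scale (\<gamma> a) (Y (l + int a) (X (k + 3 - int a) (Poly_Mapping.single b 1))))"
  shows "quadratic_rel \<gamma> (space V) X Y"
  unfolding quadratic_rel_def
proof (intro allI ballI)
  fix k l v assume "v \<in> space V"
  then have v: "Poly_Mapping.keys v \<subseteq> labels V" by (simp add: space_def)
  show "(\<Sum>a\<le>3. scale (\<gamma> a) (X (k + int a) (Y (l + 3 - int a) v))) =
      - (\<Sum>a\<le>3. scale (\<gamma> a) (Y (l + int a) (X (k + 3 - int a) v)))"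
  proof (rule linear_op_eqI[where T = "\<lambda>v. \<Sum>a\<le>3. scale (\<gamma> a) (X (k + int a) (Y (l + 3 - int a) v))"
        and T' = "\<lambda>v. - (\<Sum>a\<le>3. scale (\<gamma> a) (Y (l + int a) (X (k + 3 - int a) v)))", OF _ _ v])
    show "linear_op (\<lambda>v. \<Sum>a\<le>3. scale (\<gamma> a) (X (k + int a) (Y (l + 3 - int a) v)))"
      by (rule linear_op_sum, rule linear_op_scale, rule linear_op_compose[OF lin])
    show "linear_op (\<lambda>v. - (\<Sum>a\<le>3. scale (\<gamma> a) (Y (l + int a) (X (k + 3 - int a) v))))"
      by (rule linear_op_uminus, rule linear_op_sum, rule linear_op_scale, rule linear_op_compose[OF lin(2,1)])
  qed (rule basis)
qed

lemma op_comm_linear: "linear_op X \<Longrightarrow> linear_op Y \<Longrightarrow> linear_op (op_comm X Y)"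
  unfolding op_comm_def[abs_def] by (rule linear_op_diff; rule linear_op_compose)

lemma op_eqI:
  assumes "linear_op T" "linear_op T'" "v \<in> space V"
    and "\<And>b. b \<in> labels V \<Longrightarrow> T (Poly_Mapping.single b 1) = T' (Poly_Mapping.single b 1)"
  shows "T v = T' v"
  using linear_op_eqI[OF assms(1,2) _ assms(4), of v "labels V"] assms(3) by (auto simp: space_def)

text \<open>
  An operator-valued series \<open>\<Sum> op k z\<^sup>-\<^sup>k\<close> that moves a basis vector \<open>b\<close> along steps \<open>p\<close> to \<open>st b p\<close>, with coefficient
  \<open>am b p\<close> times the delta function at \<open>wt b p\<close>.  This treats \<open>e\<close> (raising) and \<open>f\<close> (lowering) together.  The predicate
  \<open>good\<close> describes the vectors for which the finite set \<open>I\<close> contains all possible steps.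
\<close>

locale current =
  fixes op :: "int \<Rightarrow> ('b \<Rightarrow>\<^sub>0 complex) \<Rightarrow> ('b \<Rightarrow>\<^sub>0 complex)" and good :: "'b \<Rightarrow> bool" and I :: "nat set"
    and st :: "'b \<Rightarrow> nat \<Rightarrow> 'b" and wt :: "'b \<Rightarrow> nat \<Rightarrow> complex" and am :: "'b \<Rightarrow> nat \<Rightarrow> complex"
  assumes lin: "linear_op (op k)"
    and step: "(c \<noteq> 0 \<Longrightarrow> good b) \<Longrightarrow>
      op k (Poly_Mapping.single b c) = (\<Sum>p\<in>I. Poly_Mapping.single (st b p) (c * (wt b p powi k * am b p)))"
    and wt_nz: "wt b p \<noteq> 0"
begin

lemma one_step: "good b \<Longrightarrow> op k (Poly_Mapping.single b 1) = (\<Sum>p\<in>I. Poly_Mapping.single (st b p) (wt b p powi k * am b p))"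
  using step[of 1 b k] by simp

lemma two_steps:
  assumes "good b" "\<And>p. p \<in> I \<Longrightarrow> am b p \<noteq> 0 \<Longrightarrow> good (st b p)"
  shows "op k (op l (Poly_Mapping.single b 1)) = (\<Sum>p\<in>I. \<Sum>q\<in>I. Poly_Mapping.single (st (st b p) q)
    (am b p * am (st b p) q * (wt b p powi l * wt (st b p) q powi k)))"
proof -
  have "op k (op l (Poly_Mapping.single b 1)) =
      (\<Sum>p\<in>I. op k (Poly_Mapping.single (st b p) (wt b p powi l * am b p)))"
    unfolding one_step[OF assms(1)] linear_opD(4)[OF lin] ..
  also have "\<dots> = (\<Sum>p\<in>I. \<Sum>q\<in>I. Poly_Mapping.single (st (st b p) q)
      ((wt b p powi l * am b p) * (wt (st b p) q powi k * am (st b p) q)))"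
    using assms(2) by (intro sum.cong refl step) simp
  also have "\<dots> = (\<Sum>p\<in>I. \<Sum>q\<in>I. Poly_Mapping.single (st (st b p) q)
      (am b p * am (st b p) q * (wt b p powi l * wt (st b p) q powi k)))"
    by (intro sum.cong refl arg_cong[where f = "Poly_Mapping.single _"]) (simp only: mult_ac)
  finally show ?thesis .
qed

lemma three_steps:
  assumes "good b" "\<And>p. p \<in> I \<Longrightarrow> am b p \<noteq> 0 \<Longrightarrow> good (st b p)"
    and "\<And>p q. p \<in> I \<Longrightarrow> q \<in> I \<Longrightarrow> am b p \<noteq> 0 \<Longrightarrow> am (st b p) q \<noteq> 0 \<Longrightarrow> good (st (st b p) q)"
  shows "op k (op l (op m (Poly_Mapping.single b 1))) = (\<Sum>p\<in>I. \<Sum>q\<in>I. \<Sum>s\<in>I. Poly_Mapping.single (st (st (st b p) q) s)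
    (am b p * am (st b p) q * am (st (st b p) q) s *
      (wt b p powi m * wt (st b p) q powi l * wt (st (st b p) q) s powi k)))"
proof -
  have two: "op l (op m (Poly_Mapping.single b 1)) = (\<Sum>p\<in>I. \<Sum>q\<in>I. Poly_Mapping.single (st (st b p) q)
    (am b p * am (st b p) q * (wt b p powi m * wt (st b p) q powi l)))"
    by (rule two_steps[OF assms(1)]) (rule assms(2))
  have "op k (op l (op m (Poly_Mapping.single b 1))) = (\<Sum>p\<in>I. \<Sum>q\<in>I. op k (Poly_Mapping.single (st (st b p) q)
    (am b p * am (st b p) q * (wt b p powi m * wt (st b p) q powi l))))"
    unfolding two linear_opD(4)[OF lin] ..
  also have "\<dots> = (\<Sum>p\<in>I. \<Sum>q\<in>I. \<Sum>s\<in>I. Poly_Mapping.single (st (st (st b p) q) s)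
      ((am b p * am (st b p) q * (wt b p powi m * wt (st b p) q powi l)) *
       (wt (st (st b p) q) s powi k * am (st (st b p) q) s)))"
    using assms(3) by (intro sum.cong refl step) simp
  also have "\<dots> = (\<Sum>p\<in>I. \<Sum>q\<in>I. \<Sum>s\<in>I. Poly_Mapping.single (st (st (st b p) q) s)
    (am b p * am (st b p) q * am (st (st b p) q) s *
      (wt b p powi m * wt (st b p) q powi l * wt (st (st b p) q) s powi k)))"
    by (intro sum.cong refl arg_cong[where f = "Poly_Mapping.single _"]) (simp only: mult_ac)
  finally show ?thesis .
qed

text \<open>
  Both sides are sums over pairs of steps.  The terms for \<open>(p, q)\<close> and \<open>(q, p)\<close> lead to the same vector and cancel by the
  exchange law; two equal steps have ratio \<open>q\<^sub>1\<close> of weights, a zero of \<open>g\<close>.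
\<close>

lemma quadratic_on_basis:
  fixes \<gamma> :: "nat \<Rightarrow> complex" and gg :: "complex \<Rightarrow> complex \<Rightarrow> complex"
  assumes good: "good b" "\<And>p. p \<in> I \<Longrightarrow> am b p \<noteq> 0 \<Longrightarrow> good (st b p)"
    and gg: "\<And>x y k l. x \<noteq> 0 \<Longrightarrow> y \<noteq> 0 \<Longrightarrow>
      (\<Sum>a\<le>3. \<gamma> a * (x powi (l + 3 - int a) * y powi (k + int a))) = x powi l * y powi k * gg y x"
    and comm: "\<And>p q. st (st b p) q = st (st b q) p"
    and wt: "\<And>p q. p \<noteq> q \<Longrightarrow> wt (st b p) q = wt b q"
    and same: "\<And>p. gg (wt (st b p) p) (wt b p) = 0"
    and exch: "\<And>p q. p \<noteq> q \<Longrightarrow> gg (wt b q) (wt b p) * (am b p * am (st b p) q) +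
      gg (wt b p) (wt b q) * (am b q * am (st b q) p) = 0"
  shows "(\<Sum>a\<le>3. scale (\<gamma> a) (op (k + int a) (op (l + 3 - int a) (Poly_Mapping.single b 1)))) =
    - (\<Sum>a\<le>3. scale (\<gamma> a) (op (l + int a) (op (k + 3 - int a) (Poly_Mapping.single b 1))))"
proof -
  have two: "op k (op l (Poly_Mapping.single b 1)) = (\<Sum>p\<in>I. \<Sum>q\<in>I. Poly_Mapping.single (st (st b p) q)
    (am b p * am (st b p) q * (wt b p powi l * wt (st b p) q powi k)))" for k l
    by (rule two_steps[OF good(1)]) (rule good(2))
  have side: "(\<Sum>a\<le>3. scale (\<gamma> a) (op (k + int a) (op (l + 3 - int a) (Poly_Mapping.single b 1)))) =
      (\<Sum>p\<in>I. \<Sum>q\<in>I. Poly_Mapping.single (st (st b p) q) (am b p * am (st b p) q *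
        (wt b p powi l * wt (st b p) q powi k * gg (wt (st b p) q) (wt b p))))" for k l
  proof -
    have "(\<Sum>a\<le>3. scale (\<gamma> a) (op (k + int a) (op (l + 3 - int a) (Poly_Mapping.single b 1)))) =
        (\<Sum>a\<le>3. \<Sum>p\<in>I. \<Sum>q\<in>I. Poly_Mapping.single (st (st b p) q) (\<gamma> a *
          (am b p * am (st b p) q * (wt b p powi (l + 3 - int a) * wt (st b p) q powi (k + int a)))))"
      unfolding two scale_sum scale_single ..
    also have "\<dots> = (\<Sum>p\<in>I. \<Sum>q\<in>I. \<Sum>a\<le>3. Poly_Mapping.single (st (st b p) q) (\<gamma> a *
          (am b p * am (st b p) q * (wt b p powi (l + 3 - int a) * wt (st b p) q powi (k + int a)))))"
      by (rule trans[OF sum.swap]) (intro sum.cong refl sum.swap)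
    also have "\<dots> = (\<Sum>p\<in>I. \<Sum>q\<in>I. Poly_Mapping.single (st (st b p) q) (am b p * am (st b p) q *
        (\<Sum>a\<le>3. \<gamma> a * (wt b p powi (l + 3 - int a) * wt (st b p) q powi (k + int a)))))"
      by (intro sum.cong refl) (simp only: single_sum[symmetric] sum_distrib_left mult_ac)
    finally show ?thesis unfolding gg[OF wt_nz wt_nz] .
  qed
  have "(\<Sum>p\<in>I. \<Sum>q\<in>I. Poly_Mapping.single (st (st b p) q) (am b p * am (st b p) q *
        (wt b p powi l * wt (st b p) q powi k * gg (wt (st b p) q) (wt b p))) +
      Poly_Mapping.single (st (st b p) q) (am b p * am (st b p) q *
        (wt b p powi k * wt (st b p) q powi l * gg (wt (st b p) q) (wt b p)))) = 0"
    (is "(\<Sum>p\<in>I. \<Sum>q\<in>I. ?T p q) = 0")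
  proof (rule double_sum_zero)
    fix p q
    let ?c = "\<lambda>p q. am b p * am (st b p) q *
       ((wt b p powi l * wt (st b p) q powi k + wt b p powi k * wt (st b p) q powi l) * gg (wt (st b p) q) (wt b p))"
    have T: "?T p q = Poly_Mapping.single (st (st b p) q) (?c p q)" for p q
      by (simp only: single_add[symmetric]) (simp add: algebra_simps)
    have "?c p q + ?c q p = 0"
    proof (cases "p = q")
      case True
      then show ?thesis using same by simp
    next
      case False
      define s where "s = wt b p powi l * wt b q powi k + wt b p powi k * wt b q powi l"
      have "?c p q + ?c q p = s * (gg (wt b q) (wt b p) * (am b p * am (st b p) q) +
          gg (wt b p) (wt b q) * (am b q * am (st b q) p))"
        unfolding wt[OF False] wt[OF False[symmetric]] s_def by (simp add: algebra_simps)
      then show ?thesis unfolding exch[OF False] by simp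
    qed
    moreover have "?T p q + ?T q p = Poly_Mapping.single (st (st b p) q) (?c p q + ?c q p)"
      unfolding T[of p q] T[of q p] by (simp only: comm[of q p] single_add)
    ultimately show "?T p q + ?T q p = 0" by (simp only: single_zero)
  qed
  then show ?thesis unfolding side eq_neg_iff_add_eq_0 by (simp only: sum.distrib)
qed

text \<open>
  The double commutator is a sum over paths of three steps, and the six orders of the steps end at the
  same vector.
\<close>

lemma cubic_on_basis:
  assumes good: "good b" "\<And>p. p \<in> I \<Longrightarrow> am b p \<noteq> 0 \<Longrightarrow> good (st b p)"
      "\<And>p q. p \<in> I \<Longrightarrow> q \<in> I \<Longrightarrow> am b p \<noteq> 0 \<Longrightarrow> am (st b p) q \<noteq> 0 \<Longrightarrow> good (st (st b p) q)"
    and c: "\<And>p q s. am b p * am (st b p) q * am (st (st b p) q) s *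
      (wt (st b p) q / wt b p - wt b p / wt (st b p) q - wt (st (st b p) q) s / wt (st b p) q
       + wt (st b p) q / wt (st (st b p) q) s) = c p q s"
    and comm: "\<And>b p q. st (st b p) q = st (st b q) p"
    and sym: "\<And>p q s. p \<in> I \<Longrightarrow> q \<in> I \<Longrightarrow> s \<in> I \<Longrightarrow> c p q s + c p s q + c q p s + c q s p + c s p q + c s q p = 0"
  shows "op_comm (op 0) (op_comm (op 1) (op (- 1))) (Poly_Mapping.single b 1) = 0"
proof -
  let ?v = "Poly_Mapping.single b 1"
  have three: "op k (op l (op m ?v)) = (\<Sum>p\<in>I. \<Sum>q\<in>I. \<Sum>s\<in>I. Poly_Mapping.single (st (st (st b p) q) s)
    (am b p * am (st b p) q * am (st (st b p) q) s *
      (wt b p powi m * wt (st b p) q powi l * wt (st (st b p) q) s powi k)))" for k l m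
    by (rule three_steps[OF good(1)]) (rule good, assumption+)+
  have "op_comm (op 0) (op_comm (op 1) (op (- 1))) ?v =
      op 0 (op 1 (op (-1) ?v)) - op 0 (op (-1) (op 1 ?v)) - op 1 (op (-1) (op 0 ?v)) + op (-1) (op 1 (op 0 ?v))"
    unfolding op_comm_def linear_opD(6)[OF lin] by simp
  also have "\<dots> = (\<Sum>p\<in>I. \<Sum>q\<in>I. \<Sum>s\<in>I. Poly_Mapping.single (st (st (st b p) q) s) (c p q s))"
    unfolding three c[symmetric] sum_subtractf[symmetric] sum.distrib[symmetric] single_diff[symmetric] single_add[symmetric]
    by (intro sum.cong refl arg_cong[where f = "Poly_Mapping.single _"])
      (simp add: algebra_simps power_int_minus divide_inverse)
  also have "\<dots> = 0"
  proof (rule triple_sum_zero)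
    fix p q s assume I: "p \<in> I" "q \<in> I" "s \<in> I"
    have t: "st (st (st b p) s) q = st (st (st b p) q) s" "st (st (st b q) p) s = st (st (st b p) q) s"
      "st (st (st b q) s) p = st (st (st b p) q) s" "st (st (st b s) p) q = st (st (st b p) q) s"
      "st (st (st b s) q) p = st (st (st b p) q) s"
      using comm by metis+
    show "Poly_Mapping.single (st (st (st b p) q) s) (c p q s) + Poly_Mapping.single (st (st (st b p) s) q) (c p s q)
      + Poly_Mapping.single (st (st (st b q) p) s) (c q p s) + Poly_Mapping.single (st (st (st b q) s) p) (c q s p)
      + Poly_Mapping.single (st (st (st b s) p) q) (c s p q) + Poly_Mapping.single (st (st (st b s) q) p) (c s q p) = 0"
      unfolding t single_add[symmetric] sym[OF I] by simp
  qed
  finally show ?thesis .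
qed

end

context resonant_parameters begin

section \<open>The module G\<close>

abbreviation "G \<equiv> G_rep n r a q1 q2 q3 u"

lemma labels_G [simp]: "labels G = Adm"
  by (simp add: G_rep_def)

lemma psi_plus_G: "op_psi_plus G k = diagonal_op (\<lambda>\<Lambda>. coeff_plus (Psi (inverse fls_X) \<Lambda>) k)"
  by (simp add: G_rep_def G_psi_plus_def[abs_def] coeff_plus_def Psi_def)

lemma psi_minus_G: "op_psi_minus G k = diagonal_op (\<lambda>\<Lambda>. coeff_minus (Psi fls_X \<Lambda>) k)"
  by (simp add: G_rep_def G_psi_minus_def[abs_def] coeff_minus_def Psi_def)

lemma linear_e: "linear_op (op_e G k)" and linear_f: "linear_op (op_f G k)"
  by (simp_all add: G_rep_def linear_op_matrix_op)

lemma e_single: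
  assumes L: "\<Lambda> \<in> Adm"
  shows "op_e G k (Poly_Mapping.single \<Lambda> c) =
    (\<Sum>p\<in>addable \<Lambda>. Poly_Mapping.single (add_one \<Lambda> p) (c * (weight \<Lambda> p powi k * E_amp \<Lambda> p)))"
proof -
  have "op_e G k (Poly_Mapping.single \<Lambda> c) =
    (\<Sum>p | 1 \<le> p \<and> add_one \<Lambda> p \<in> Adm. Poly_Mapping.single (add_one \<Lambda> p) (c * G_e q1 q2 q3 u \<Lambda> p k))"
    unfolding G_rep_def graded_rep.simps
  proof (rule matrix_op_single)
    show "inj_on (add_one \<Lambda>) {i. 1 \<le> i}" by (auto intro: inj_onI)
    show "finite {p. 1 \<le> p \<and> add_one \<Lambda> p \<in> Adm}" using finite_addable[OF L] by (simp add: addable_def)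
  qed (rule refl)
  also have "\<dots> = (\<Sum>p\<in>addable \<Lambda>. Poly_Mapping.single (add_one \<Lambda> p) (c * (weight \<Lambda> p powi k * E_amp \<Lambda> p)))"
    unfolding addable_def[symmetric]
    by (intro sum.cong refl arg_cong[where f = "Poly_Mapping.single _"] arg_cong[where f = "(*) c"] G_e_eq)
      (simp add: addable_def)
  finally show ?thesis .
qed

lemma f_single:
  assumes L: "\<Lambda> \<in> Adm"
  shows "op_f G k (Poly_Mapping.single \<Lambda> c) =
    (\<Sum>p\<in>removable \<Lambda>. Poly_Mapping.single (sub_one \<Lambda> p) (c * (weight (sub_one \<Lambda> p) p powi k * F_lim (sub_one \<Lambda> p) p)))"
proof -
  have add_iff: "M = add_one \<Lambda>' i \<longleftrightarrow> \<Lambda>' = sub_one M i" for M \<Lambda>' i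
    using add_sub_one by metis
  have "op_f G k (Poly_Mapping.single \<Lambda> c) =
    (\<Sum>p | 1 \<le> p \<and> sub_one \<Lambda> p \<in> Adm. Poly_Mapping.single (sub_one \<Lambda> p) (c * G_f n r a q1 q2 q3 u (sub_one \<Lambda> p) p k))"
    unfolding G_rep_def graded_rep.simps
  proof (rule matrix_op_single)
    show "inj_on (sub_one \<Lambda>) {i. 1 \<le> i}"
    proof (rule inj_onI)
      fix x y assume "sub_one \<Lambda> x = sub_one \<Lambda> y"
      from fun_cong[OF this, of x] show "x = y" by (simp add: sub_one_apply split: if_splits)
    qed
    show "finite {p. 1 \<le> p \<and> sub_one \<Lambda> p \<in> Adm}" using finite_removable[OF L] by (simp add: removable_def)
    show "(\<Sum>i | 1 \<le> i \<and> \<Lambda> = add_one b' i. G_f n r a q1 q2 q3 u b' i k) =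
        (\<Sum>i | 1 \<le> i \<and> b' = sub_one \<Lambda> i. G_f n r a q1 q2 q3 u (sub_one \<Lambda> i) i k)" for b'
      unfolding add_iff by (rule sum.cong) auto
  qed
  also have "\<dots> = (\<Sum>p\<in>removable \<Lambda>. Poly_Mapping.single (sub_one \<Lambda> p)
      (c * (weight (sub_one \<Lambda> p) p powi k * F_lim (sub_one \<Lambda> p) p)))"
    unfolding removable_def[symmetric]
  proof (intro sum.cong refl arg_cong[where f = "Poly_Mapping.single _"] arg_cong[where f = "(*) c"])
    fix p assume "p \<in> removable \<Lambda>"
    then show "G_f n r a q1 q2 q3 u (sub_one \<Lambda> p) p k = weight (sub_one \<Lambda> p) p powi k * F_lim (sub_one \<Lambda> p) p"
      using L by (intro G_f_eq_F_lim) (auto simp: removable_def)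
  qed
  finally show ?thesis .
qed

text \<open>The coefficient of \<open>f\<close> is attached to the label it starts from, whereas \<open>F_lim\<close> refers to the one it leads to.\<close>

definition f_amp :: "(nat \<Rightarrow> int) \<Rightarrow> nat \<Rightarrow> complex" where
  "f_amp \<Lambda> p = guarded F_lim (sub_one \<Lambda> p) p"

definition f_weight :: "(nat \<Rightarrow> int) \<Rightarrow> nat \<Rightarrow> complex" where
  "f_weight \<Lambda> p = weight (sub_one \<Lambda> p) p"

definition good :: "nat \<Rightarrow> (nat \<Rightarrow> int) \<Rightarrow> bool" where
  "good K \<Lambda> \<longleftrightarrow> \<Lambda> \<in> Adm \<and> settled K \<Lambda>"

lemma current_e: "current (op_e G) (good K) {1..K} add_one weight (guarded E_amp)"
proof
  fix c :: complex and k \<Lambda> assume g: "c \<noteq> 0 \<Longrightarrow> good K \<Lambda>"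
  show "op_e G k (Poly_Mapping.single \<Lambda> c) =
      (\<Sum>p\<in>{1..K}. Poly_Mapping.single (add_one \<Lambda> p) (c * (weight \<Lambda> p powi k * guarded E_amp \<Lambda> p)))"
  proof (cases "c = 0")
    case True
    then show ?thesis by (simp add: linear_opD(3)[OF linear_e])
  next
    case False
    then have L: "\<Lambda> \<in> Adm" "settled K \<Lambda>" using g by (auto simp: good_def)
    have "op_e G k (Poly_Mapping.single \<Lambda> c) =
      (\<Sum>p\<in>addable \<Lambda>. Poly_Mapping.single (add_one \<Lambda> p) (c * (weight \<Lambda> p powi k * guarded E_amp \<Lambda> p)))"
      unfolding e_single[OF L(1)] using L(1)
      by (intro sum.cong refl) (simp add: guarded_def addable_def)
    also have "\<dots> = (\<Sum>p\<in>{1..K}. Poly_Mapping.single (add_one \<Lambda> p) (c * (weight \<Lambda> p powi k * guarded E_amp \<Lambda> p)))"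
      by (intro sum.mono_neutral_left addable_subset[OF L]) (auto simp: guarded_def addable_def)
    finally show ?thesis .
  qed
qed (simp_all add: linear_e)

lemma current_f: "current (op_f G) (good K) {1..K} sub_one f_weight f_amp"
proof
  fix c :: complex and k \<Lambda> assume g: "c \<noteq> 0 \<Longrightarrow> good K \<Lambda>"
  show "op_f G k (Poly_Mapping.single \<Lambda> c) =
      (\<Sum>p\<in>{1..K}. Poly_Mapping.single (sub_one \<Lambda> p) (c * (f_weight \<Lambda> p powi k * f_amp \<Lambda> p)))"
  proof (cases "c = 0")
    case True
    then show ?thesis by (simp add: linear_opD(3)[OF linear_f])
  next
    case False
    then have L: "\<Lambda> \<in> Adm" "settled K \<Lambda>" using g by (auto simp: good_def)
    have "op_f G k (Poly_Mapping.single \<Lambda> c) =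
      (\<Sum>p\<in>removable \<Lambda>. Poly_Mapping.single (sub_one \<Lambda> p) (c * (f_weight \<Lambda> p powi k * f_amp \<Lambda> p)))"
      unfolding f_single[OF L(1)] using L(1)
      by (intro sum.cong refl) (simp add: f_amp_def f_weight_def guarded_def removable_def)
    also have "\<dots> = (\<Sum>p\<in>{1..K}. Poly_Mapping.single (sub_one \<Lambda> p) (c * (f_weight \<Lambda> p powi k * f_amp \<Lambda> p)))"
      by (intro sum.mono_neutral_left removable_subset[OF L]) (auto simp: f_amp_def guarded_def removable_def)
    finally show ?thesis .
  qed
qed (simp_all add: linear_f f_weight_def)

lemma good_add_one:
  assumes "good M \<Lambda>" "guarded X \<Lambda> p \<noteq> 0"
  shows "good (M + n) (add_one \<Lambda> p)"
proof -
  have "\<Lambda> \<in> Adm" "add_one \<Lambda> p \<in> Adm" "1 \<le> p" using guardedD[OF assms(2)] by auto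
  then show ?thesis using assms(1) addable_less[of \<Lambda> M p] settled_add_one[of M \<Lambda> p] by (simp add: good_def)
qed

lemma good_sub_one:
  assumes "good M \<Lambda>" "f_amp \<Lambda> p \<noteq> 0"
  shows "good M (sub_one \<Lambda> p)"
proof -
  have *: "sub_one \<Lambda> p \<in> Adm" "\<Lambda> \<in> Adm" "1 \<le> p"
    using guardedD[OF assms(2)[unfolded f_amp_def]] by auto
  then have "settled M (sub_one \<Lambda> p)"
    using assms(1) settled_add_one_removed[of M "sub_one \<Lambda> p" p] by (simp add: good_def)
  then show ?thesis using * by (simp add: good_def)
qed

lemma good_mono: "good M \<Lambda> \<Longrightarrow> M \<le> K \<Longrightarrow> good K \<Lambda>"
  using settled_mono by (auto simp: good_def)

lemma good_exists: "\<Lambda> \<in> Adm \<Longrightarrow> \<exists>M. good M \<Lambda>"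
  using settled_exists by (auto simp: good_def)

lemma g_sum:
  assumes "x \<noteq> 0" "y \<noteq> 0"
  shows "(\<Sum>a\<le>3. g_coeff q1 q2 q3 a * (x powi (l + 3 - int a) * y powi (k + int a))) = x powi l * y powi k * g_fun y x"
    and "(\<Sum>a\<le>3. g_coeff q1 q2 q3 (3 - a) * (x powi (l + 3 - int a) * y powi (k + int a))) = x powi l * y powi k * g_fun x y"
proof -
  have pw: "w powi (m + int d) = w powi m * w ^ d" if "w \<noteq> 0" for w :: complex and m d
    using that by (simp add: power_int_add)
  have p: "x powi (l + 3 - int a) = x powi l * x ^ (3 - a)" "y powi (k + int a) = y powi k * y ^ a" if "a \<le> 3" for a
  proof -
    have e: "l + 3 - int a = l + int (3 - a)" using that by simp
    show "x powi (l + 3 - int a) = x powi l * x ^ (3 - a)" unfolding e by (rule pw[OF assms(1)])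
    show "y powi (k + int a) = y powi k * y ^ a" by (rule pw[OF assms(2)])
  qed
  have rev_coeffs: "g_coeff q1 q2 q3 (3 - 0) = 1" "g_coeff q1 q2 q3 (3 - Suc 0) = - (q1 + q2 + q3)"
    "g_coeff q1 q2 q3 (3 - 2) = q1 * q2 + q1 * q3 + q2 * q3" "g_coeff q1 q2 q3 (3 - 3) = -1"
    using g_coeff_eqs[OF q123] by simp_all
  have gen1: "- 1 * (X * x ^ (3 - 0) * (Y * y ^ 0)) + s2 * (X * x ^ (3 - Suc 0) * (Y * y ^ Suc 0)) +
      - s1 * (X * x ^ (3 - 2) * (Y * y ^ 2)) + 1 * (X * x ^ (3 - 3) * (Y * y ^ 3)) =
      X * Y * (y ^ 3 - s1 * y\<^sup>2 * x + s2 * y * x\<^sup>2 - x ^ 3)" for X Y s1 s2 :: complex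
    by (simp add: algebra_simps)
  have gen2: "1 * (X * x ^ (3 - 0) * (Y * y ^ 0)) + - s1 * (X * x ^ (3 - Suc 0) * (Y * y ^ Suc 0)) +
      s2 * (X * x ^ (3 - 2) * (Y * y ^ 2)) + - 1 * (X * x ^ (3 - 3) * (Y * y ^ 3)) =
      X * Y * (x ^ 3 - s1 * x\<^sup>2 * y + s2 * x * y\<^sup>2 - y ^ 3)" for X Y s1 s2 :: complex
    by (simp add: algebra_simps)
  have "(\<Sum>a\<le>3. g_coeff q1 q2 q3 a * (x powi (l + 3 - int a) * y powi (k + int a))) =
      (\<Sum>a\<le>3. g_coeff q1 q2 q3 a * (x powi l * x ^ (3 - a) * (y powi k * y ^ a)))"
    by (intro sum.cong refl) (simp only: p atMost_iff)
  also have "\<dots> = x powi l * y powi k * g_fun y x"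
    unfolding sum_upto_3 g_coeff_eqs[OF q123] g_cubic_expand[OF q123] by (rule gen1)
  finally show "(\<Sum>a\<le>3. g_coeff q1 q2 q3 a * (x powi (l + 3 - int a) * y powi (k + int a))) = x powi l * y powi k * g_fun y x" .
  have "(\<Sum>a\<le>3. g_coeff q1 q2 q3 (3 - a) * (x powi (l + 3 - int a) * y powi (k + int a))) =
      (\<Sum>a\<le>3. g_coeff q1 q2 q3 (3 - a) * (x powi l * x ^ (3 - a) * (y powi k * y ^ a)))"
    by (intro sum.cong refl) (simp only: p atMost_iff)
  also have "\<dots> = x powi l * y powi k * g_fun x y"
    unfolding sum_upto_3 rev_coeffs g_cubic_expand[OF q123] by (rule gen2)
  finally show "(\<Sum>a\<le>3. g_coeff q1 q2 q3 (3 - a) * (x powi (l + 3 - int a) * y powi (k + int a))) = x powi l * y powi k * g_fun x y" .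
qed

lemma quadratic_e: "quadratic_rel (g_coeff q1 q2 q3) (space G) (op_e G) (op_e G)"
proof (rule quadratic_relI)
    fix \<Lambda> k l assume "\<Lambda> \<in> labels G"
    then have L: "\<Lambda> \<in> Adm" by simp
    from L obtain M where M: "good M \<Lambda>" using good_exists by blast
    define K where "K = M + n"
    interpret current "op_e G" "good K" "{1..K}" add_one weight "guarded E_amp" by (rule current_e)
    show "(\<Sum>a\<le>3. scale (g_coeff q1 q2 q3 a) (op_e G (k + int a) (op_e G (l + 3 - int a) (Poly_Mapping.single \<Lambda> 1)))) =
      - (\<Sum>a\<le>3. scale (g_coeff q1 q2 q3 a) (op_e G (l + int a) (op_e G (k + 3 - int a) (Poly_Mapping.single \<Lambda> 1))))"
    proof (rule quadratic_on_basis[where gg = g_fun])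
      show "g_fun (weight (add_one \<Lambda> p) p) (weight \<Lambda> p) = 0" for p by (simp add: weight_add_one g_cubic_def)
      show "g_fun (weight \<Lambda> q) (weight \<Lambda> p) * (guarded E_amp \<Lambda> p * guarded E_amp (add_one \<Lambda> p) q) +
          g_fun (weight \<Lambda> p) (weight \<Lambda> q) * (guarded E_amp \<Lambda> q * guarded E_amp (add_one \<Lambda> q) p) = 0" if "p \<noteq> q" for p q
        using exchange[OF exchangeable_E that[symmetric]] .
      show "add_one (add_one \<Lambda> p) q = add_one (add_one \<Lambda> q) p" for p q by (rule add_one_commute)
      show "good K \<Lambda>" unfolding K_def by (rule good_mono[OF M]) simp
      show "good K (add_one \<Lambda> p)" if "guarded E_amp \<Lambda> p \<noteq> 0" for p
        unfolding K_def by (rule good_add_one[OF M that])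
      show "(\<Sum>a\<le>3. g_coeff q1 q2 q3 a * (x powi (l + 3 - int a) * y powi (k + int a))) = x powi l * y powi k * g_fun y x"
        if "x \<noteq> 0" "y \<noteq> 0" for x y k l using that by (rule g_sum(1))
      show "weight (add_one \<Lambda> p) q = weight \<Lambda> q" if "p \<noteq> q" for p q using that by (simp add: weight_add_one)
    qed
qed (rule linear_e)+

lemma sub_one_commute: "sub_one (sub_one \<Lambda> p) q = sub_one (sub_one \<Lambda> q) p"
  by (auto simp: sub_one_def fun_eq_iff)

lemma quadratic_f: "quadratic_rel (\<lambda>a. g_coeff q1 q2 q3 (3 - a)) (space G) (op_f G) (op_f G)"
proof (rule quadratic_relI)
    fix \<Lambda> k l assume "\<Lambda> \<in> labels G"
    then have L: "\<Lambda> \<in> Adm" by simp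
    from L obtain K where K: "good K \<Lambda>" using good_exists by blast
    interpret current "op_f G" "good K" "{1..K}" sub_one f_weight f_amp by (rule current_f)
    show "(\<Sum>a\<le>3. scale (g_coeff q1 q2 q3 (3 - a)) (op_f G (k + int a) (op_f G (l + 3 - int a) (Poly_Mapping.single \<Lambda> 1)))) =
      - (\<Sum>a\<le>3. scale (g_coeff q1 q2 q3 (3 - a)) (op_f G (l + int a) (op_f G (k + 3 - int a) (Poly_Mapping.single \<Lambda> 1))))"
    proof (rule quadratic_on_basis[where gg = "\<lambda>x y. g_fun y x"])
      show "g_fun (f_weight \<Lambda> p) (f_weight (sub_one \<Lambda> p) p) = 0" for p
        by (simp add: f_weight_def weight_sub_one g_cubic_def)
      show "g_fun (f_weight \<Lambda> p) (f_weight \<Lambda> q) * (f_amp \<Lambda> p * f_amp (sub_one \<Lambda> p) q) +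
          g_fun (f_weight \<Lambda> q) (f_weight \<Lambda> p) * (f_amp \<Lambda> q * f_amp (sub_one \<Lambda> q) p) = 0" if pq: "p \<noteq> q" for p q
      proof -
        define M where "M = sub_one (sub_one \<Lambda> p) q"
        have M: "sub_one \<Lambda> p = add_one M q" "sub_one \<Lambda> q = add_one M p" "sub_one (sub_one \<Lambda> q) p = M"
          unfolding M_def using pq by (auto simp: sub_one_def add_one_def fun_eq_iff)
        have w: "f_weight \<Lambda> p = weight M p" "f_weight \<Lambda> q = weight M q"
          unfolding f_weight_def M using pq by (simp_all add: weight_add_one)
        have am: "f_amp \<Lambda> p = guarded F_lim (add_one M q) p" "f_amp \<Lambda> q = guarded F_lim (add_one M p) q"
          "f_amp (sub_one \<Lambda> p) q = guarded F_lim M q" "f_amp (sub_one \<Lambda> q) p = guarded F_lim M p"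
          unfolding f_amp_def M by simp_all
        show ?thesis unfolding w am using exchange[OF exchangeable_F pq, of M] by (simp add: mult.commute)
      qed
      show "f_weight (sub_one \<Lambda> p) q = f_weight \<Lambda> q" if "p \<noteq> q" for p q
        using that by (simp add: f_weight_def weight_sub_one)
      show "sub_one (sub_one \<Lambda> p) q = sub_one (sub_one \<Lambda> q) p" for p q by (rule sub_one_commute)
      show "good K \<Lambda>" by (rule K)
      show "good K (sub_one \<Lambda> p)" if "f_amp \<Lambda> p \<noteq> 0" for p by (rule good_sub_one[OF K that])
      show "(\<Sum>a\<le>3. g_coeff q1 q2 q3 (3 - a) * (x powi (l + 3 - int a) * y powi (k + int a))) = x powi l * y powi k * g_fun x y"
        if "x \<noteq> 0" "y \<noteq> 0" for x y k l using that by (rule g_sum(2))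
    qed
qed (rule linear_f)+

lemma serre_weight_sym: "serre_weight x y z = serre_weight z y x"
  by (simp add: serre_weight_def)

lemma cubic_e:
  assumes "v \<in> space G"
  shows "op_comm (op_e G 0) (op_comm (op_e G 1) (op_e G (- 1))) v = 0"
proof (rule op_eqI[where T = "op_comm (op_e G 0) (op_comm (op_e G 1) (op_e G (- 1)))" and T' = "\<lambda>v. 0",
      OF _ linear_op_zero assms])
    fix \<Lambda> assume "\<Lambda> \<in> labels G"
    then have L: "\<Lambda> \<in> Adm" by simp
    from L obtain M where M: "good M \<Lambda>" using good_exists by blast
    define K where "K = M + n + n"
    interpret current "op_e G" "good K" "{1..K}" add_one weight "guarded E_amp" by (rule current_e)
    show "op_comm (op_e G 0) (op_comm (op_e G 1) (op_e G (- 1))) (Poly_Mapping.single \<Lambda> 1) = 0"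
    proof (rule cubic_on_basis[where c = "path_term E_amp \<Lambda>"])
      show "path_term E_amp \<Lambda> p q s + path_term E_amp \<Lambda> p s q + path_term E_amp \<Lambda> q p s + path_term E_amp \<Lambda> q s p +
          path_term E_amp \<Lambda> s p q + path_term E_amp \<Lambda> s q p = 0" if "p \<in> {1..K}" "q \<in> {1..K}" "s \<in> {1..K}" for p q s
        using that by (intro serre_symmetrized exchangeable_E) auto
      show "add_one (add_one M p) q = add_one (add_one M q) p" for M p q by (rule add_one_commute)
      show "good K \<Lambda>" unfolding K_def by (rule good_mono[OF M]) simp
      show "good K (add_one \<Lambda> p)" if "guarded E_amp \<Lambda> p \<noteq> 0" for p
        unfolding K_def by (rule good_mono[OF good_add_one[OF M that]]) simp
      show "good K (add_one (add_one \<Lambda> p) q)" if "guarded E_amp \<Lambda> p \<noteq> 0" "guarded E_amp (add_one \<Lambda> p) q \<noteq> 0" for p q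
        unfolding K_def by (rule good_add_one[OF good_add_one[OF M that(1)] that(2)])
    qed (simp only: path_term_def path_amp_def serre_weight_def)
qed (intro op_comm_linear linear_e)

lemma cubic_f:
  assumes "v \<in> space G"
  shows "op_comm (op_f G 0) (op_comm (op_f G 1) (op_f G (- 1))) v = 0"
proof (rule op_eqI[where T = "op_comm (op_f G 0) (op_comm (op_f G 1) (op_f G (- 1)))" and T' = "\<lambda>v. 0",
      OF _ linear_op_zero assms])
    fix \<Lambda> assume "\<Lambda> \<in> labels G"
    then have L: "\<Lambda> \<in> Adm" by simp
    from L obtain K where K: "good K \<Lambda>" using good_exists by blast
    interpret current "op_f G" "good K" "{1..K}" sub_one f_weight f_amp by (rule current_f)
    define M where "M p q s = sub_one (sub_one (sub_one \<Lambda> p) q) s" for p q s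
    have M: "M p s q = M p q s" "M q p s = M p q s" "M q s p = M p q s" "M s p q = M p q s" "M s q p = M p q s" for p q s
      unfolding M_def by (auto simp: sub_one_def fun_eq_iff)
    have M1: "add_one (M p q s) s = sub_one (sub_one \<Lambda> p) q"
      "add_one (add_one (M p q s) s) q = sub_one \<Lambda> p" for p q s
      unfolding M_def by simp_all
    show "op_comm (op_f G 0) (op_comm (op_f G 1) (op_f G (- 1))) (Poly_Mapping.single \<Lambda> 1) = 0"
    proof (rule cubic_on_basis[where c = "\<lambda>p q s. path_term F_lim (M p q s) s q p"])
      fix p q s
      show "f_amp \<Lambda> p * f_amp (sub_one \<Lambda> p) q * f_amp (sub_one (sub_one \<Lambda> p) q) s *
          (f_weight (sub_one \<Lambda> p) q / f_weight \<Lambda> p - f_weight \<Lambda> p / f_weight (sub_one \<Lambda> p) q -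
           f_weight (sub_one (sub_one \<Lambda> p) q) s / f_weight (sub_one \<Lambda> p) q +
           f_weight (sub_one \<Lambda> p) q / f_weight (sub_one (sub_one \<Lambda> p) q) s) = path_term F_lim (M p q s) s q p"
        unfolding path_term_def path_amp_def M1 f_amp_def f_weight_def M_def[symmetric]
        by (subst serre_weight_sym) (simp add: serre_weight_def mult_ac)
      assume "p \<in> {1..K}" "q \<in> {1..K}" "s \<in> {1..K}"
      then have "path_term F_lim (M p q s) p q s + path_term F_lim (M p q s) p s q + path_term F_lim (M p q s) q p s
          + path_term F_lim (M p q s) q s p + path_term F_lim (M p q s) s p q + path_term F_lim (M p q s) s q p = 0"
        by (intro serre_symmetrized exchangeable_F) auto
      then show "path_term F_lim (M p q s) s q p + path_term F_lim (M p s q) q s p + path_term F_lim (M q p s) s p q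
          + path_term F_lim (M q s p) p s q + path_term F_lim (M s p q) q p s + path_term F_lim (M s q p) p q s = 0"
        unfolding M[where p = p and q = q and s = s] by (simp only: add_ac)
      next
      show "sub_one (sub_one M p) q = sub_one (sub_one M q) p" for M p q by (rule sub_one_commute)
      show "good K \<Lambda>" by (rule K)
      show "good K (sub_one \<Lambda> p)" if "f_amp \<Lambda> p \<noteq> 0" for p by (rule good_sub_one[OF K that])
      show "good K (sub_one (sub_one \<Lambda> p) q)" if "f_amp \<Lambda> p \<noteq> 0" "f_amp (sub_one \<Lambda> p) q \<noteq> 0" for p q
        by (rule good_sub_one[OF good_sub_one[OF K that(1)] that(2)])
    qed
qed (intro op_comm_linear linear_f)

lemma Psi_unit:
  assumes "\<Lambda> \<in> Adm" and Z: "Z = inverse fls_X \<or> Z = fls_X"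
  shows "trivial.unit_series (Psi Z \<Lambda>) (Psi Z \<Lambda>)"
proof -
  obtain N where N: "settled N \<Lambda>" using settled_exists[OF assms(1)] by blast
  have nc: "Z \<noteq> C c" for c using Z
    by (elim disjE) (simp_all only: plus.Z_nonconst minus.Z_nonconst not_False_eq_True)
  show ?thesis unfolding Psi_truncated[OF nc N]
    using Z by (intro trivial.unit_series_mult trivial.unit_series_prod trivial.unit_series_box_factor
        trivial.unit_series_psi_empty) auto
qed

lemma psi_coefficients:
  assumes "\<Lambda> \<in> Adm"
  shows "k < 0 \<Longrightarrow> coeff_plus (Psi (inverse fls_X) \<Lambda>) k = 0" "coeff_plus (Psi (inverse fls_X) \<Lambda>) 0 \<noteq> 0"
    "k > 0 \<Longrightarrow> coeff_minus (Psi fls_X \<Lambda>) k = 0" "coeff_minus (Psi fls_X \<Lambda>) 0 \<noteq> 0"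
  using trivial.unit_series_neg[OF Psi_unit[OF assms]] trivial.unit_series_0[OF Psi_unit[OF assms]]
  unfolding coeff_plus_def coeff_minus_def by simp_all

text \<open>The relation between \<open>\<psi>\<close> and \<open>e\<close> on one edge, read off from \<open>Psi_add_one\<close> coefficient by coefficient.\<close>

lemma psi_exchange:
  assumes ex: "expansion Z cf" and L: "\<Lambda> \<in> Adm" "add_one \<Lambda> p \<in> Adm" "1 \<le> p"
  shows "(\<Sum>a\<le>3. g_coeff q1 q2 q3 a * cf (Psi Z (add_one \<Lambda> p)) (k + int a) * weight \<Lambda> p ^ (3 - a)) =
    - (\<Sum>a\<le>3. g_coeff q1 q2 q3 a * cf (Psi Z \<Lambda>) (k + 3 - int a) * weight \<Lambda> p ^ a)"
proof -
  interpret expansion Z cf by (rule ex)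
  obtain N where N: "settled N (add_one \<Lambda> p)" using settled_exists[OF L(2)] by blast
  have N': "settled N \<Lambda>" by (rule settled_add_one_removed[OF N L])
  have "p \<le> N" using addable_less[OF L(1) N' L(3,2)] by simp
  from arg_cong[OF Psi_add_one[OF Z_nonconst N' N L(3) this], of "\<lambda>F. cf F k"]
  show ?thesis unfolding cf_uminus cf_times_g[OF q123] .
qed

definition psi_op :: "complex fls \<Rightarrow> (complex fls \<Rightarrow> int \<Rightarrow> complex) \<Rightarrow> int \<Rightarrow> ((nat \<Rightarrow> int) \<Rightarrow>\<^sub>0 complex) \<Rightarrow> ((nat \<Rightarrow> int) \<Rightarrow>\<^sub>0 complex)" where
  "psi_op Z cf k = diagonal_op (\<lambda>\<Lambda>. cf (Psi Z \<Lambda>) k)"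

lemma psi_plus_op: "op_psi_plus G = psi_op (inverse fls_X) coeff_plus"
  and psi_minus_op: "op_psi_minus G = psi_op fls_X coeff_minus"
  by (rule ext, simp only: psi_plus_G psi_minus_G psi_op_def)+

lemma linear_psi: "linear_op (psi_op Z cf k)"
  unfolding psi_op_def by (rule linear_op_diagonal_op)

lemma psi_op_single: "psi_op Z cf k (Poly_Mapping.single \<Lambda> c) = Poly_Mapping.single \<Lambda> (c * cf (Psi Z \<Lambda>) k)"
  unfolding psi_op_def by (rule diagonal_op_single)

lemma weight_power_shift:
  assumes "i \<le> (3::nat)" "w \<noteq> (0::complex)"
  shows "w powi (l + 3 - int i) = w powi l * w ^ (3 - i)" "w powi (l + int i) = w powi l * w ^ i"
proof -
  have e: "l + 3 - int i = l + int (3 - i)" using assms(1) by simp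
  show "w powi (l + 3 - int i) = w powi l * w ^ (3 - i)" unfolding e using assms(2) by (simp add: power_int_add)
  show "w powi (l + int i) = w powi l * w ^ i" using assms(2) by (simp add: power_int_add)
qed

lemma quadratic_psi_e:
  assumes ex: "expansion Z cf"
  shows "quadratic_rel (g_coeff q1 q2 q3) (space G) (psi_op Z cf) (op_e G)"
proof (rule quadratic_relI)
  fix \<Lambda> k l assume "\<Lambda> \<in> labels G"
  then have L: "\<Lambda> \<in> Adm" by simp
  let ?v = "Poly_Mapping.single \<Lambda> 1"
  have 1: "(\<Sum>a\<le>3. scale (g_coeff q1 q2 q3 a) (psi_op Z cf (k + int a) (op_e G (l + 3 - int a) ?v))) =
    (\<Sum>p\<in>addable \<Lambda>. Poly_Mapping.single (add_one \<Lambda> p) (weight \<Lambda> p powi l * E_amp \<Lambda> p *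
      (\<Sum>a\<le>3. g_coeff q1 q2 q3 a * cf (Psi Z (add_one \<Lambda> p)) (k + int a) * weight \<Lambda> p ^ (3 - a))))"
  proof -
    have "(\<Sum>a\<le>3. scale (g_coeff q1 q2 q3 a) (psi_op Z cf (k + int a) (op_e G (l + 3 - int a) ?v))) =
      (\<Sum>a\<le>3. \<Sum>p\<in>addable \<Lambda>. Poly_Mapping.single (add_one \<Lambda> p)
        (g_coeff q1 q2 q3 a * (1 * (weight \<Lambda> p powi (l + 3 - int a) * E_amp \<Lambda> p) * cf (Psi Z (add_one \<Lambda> p)) (k + int a))))"
      unfolding e_single[OF L] linear_opD(4)[OF linear_psi] psi_op_single scale_sum scale_single ..
    also have "\<dots> = (\<Sum>p\<in>addable \<Lambda>. \<Sum>a\<le>3. Poly_Mapping.single (add_one \<Lambda> p)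
        (g_coeff q1 q2 q3 a * (1 * (weight \<Lambda> p powi (l + 3 - int a) * E_amp \<Lambda> p) * cf (Psi Z (add_one \<Lambda> p)) (k + int a))))"
      by (rule sum.swap)
    also have "\<dots> = (\<Sum>p\<in>addable \<Lambda>. Poly_Mapping.single (add_one \<Lambda> p) (weight \<Lambda> p powi l * E_amp \<Lambda> p *
      (\<Sum>a\<le>3. g_coeff q1 q2 q3 a * cf (Psi Z (add_one \<Lambda> p)) (k + int a) * weight \<Lambda> p ^ (3 - a))))"
      unfolding single_sum[symmetric] sum_distrib_left
      by (intro sum.cong refl arg_cong[where f = "Poly_Mapping.single _"])
        (simp only: atMost_iff weight_power_shift[OF _ weight_nz] mult_1 mult_ac)
    finally show ?thesis .
  qed
  have 2: "(\<Sum>a\<le>3. scale (g_coeff q1 q2 q3 a) (op_e G (l + int a) (psi_op Z cf (k + 3 - int a) ?v))) =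
    (\<Sum>p\<in>addable \<Lambda>. Poly_Mapping.single (add_one \<Lambda> p) (weight \<Lambda> p powi l * E_amp \<Lambda> p *
      (\<Sum>a\<le>3. g_coeff q1 q2 q3 a * cf (Psi Z \<Lambda>) (k + 3 - int a) * weight \<Lambda> p ^ a)))"
  proof -
    have "(\<Sum>a\<le>3. scale (g_coeff q1 q2 q3 a) (op_e G (l + int a) (psi_op Z cf (k + 3 - int a) ?v))) =
      (\<Sum>a\<le>3. \<Sum>p\<in>addable \<Lambda>. Poly_Mapping.single (add_one \<Lambda> p)
        (g_coeff q1 q2 q3 a * (1 * cf (Psi Z \<Lambda>) (k + 3 - int a) * (weight \<Lambda> p powi (l + int a) * E_amp \<Lambda> p))))"
      unfolding psi_op_single e_single[OF L] scale_sum scale_single ..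
    also have "\<dots> = (\<Sum>p\<in>addable \<Lambda>. \<Sum>a\<le>3. Poly_Mapping.single (add_one \<Lambda> p)
        (g_coeff q1 q2 q3 a * (1 * cf (Psi Z \<Lambda>) (k + 3 - int a) * (weight \<Lambda> p powi (l + int a) * E_amp \<Lambda> p))))"
      by (rule sum.swap)
    also have "\<dots> = (\<Sum>p\<in>addable \<Lambda>. Poly_Mapping.single (add_one \<Lambda> p) (weight \<Lambda> p powi l * E_amp \<Lambda> p *
      (\<Sum>a\<le>3. g_coeff q1 q2 q3 a * cf (Psi Z \<Lambda>) (k + 3 - int a) * weight \<Lambda> p ^ a)))"
      unfolding single_sum[symmetric] sum_distrib_left
      by (intro sum.cong refl arg_cong[where f = "Poly_Mapping.single _"])
        (simp only: atMost_iff weight_power_shift[OF _ weight_nz] mult_1 mult_ac)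
    finally show ?thesis .
  qed
  show "(\<Sum>a\<le>3. scale (g_coeff q1 q2 q3 a) (psi_op Z cf (k + int a) (op_e G (l + 3 - int a) ?v))) =
    - (\<Sum>a\<le>3. scale (g_coeff q1 q2 q3 a) (op_e G (l + int a) (psi_op Z cf (k + 3 - int a) ?v)))"
    unfolding 1 2 sum_negf[symmetric]
  proof (intro sum.cong refl)
    fix p assume "p \<in> addable \<Lambda>"
    then have "add_one \<Lambda> p \<in> Adm" "1 \<le> p" by (auto simp: addable_def)
    note e = psi_exchange[OF ex L this]
    show "Poly_Mapping.single (add_one \<Lambda> p) (weight \<Lambda> p powi l * E_amp \<Lambda> p *
        (\<Sum>a\<le>3. g_coeff q1 q2 q3 a * cf (Psi Z (add_one \<Lambda> p)) (k + int a) * weight \<Lambda> p ^ (3 - a))) =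
      - Poly_Mapping.single (add_one \<Lambda> p) (weight \<Lambda> p powi l * E_amp \<Lambda> p *
        (\<Sum>a\<le>3. g_coeff q1 q2 q3 a * cf (Psi Z \<Lambda>) (k + 3 - int a) * weight \<Lambda> p ^ a))"
      unfolding e by (simp only: single_uminus mult_minus_right)
  qed
qed (rule linear_psi linear_e)+

lemma sum_reverse_3: "(\<Sum>a\<le>(3::nat). f a) = (\<Sum>a\<le>3. f (3 - a) :: 'x::comm_monoid_add)"
  by (rule sum.reindex_bij_witness[of _ "\<lambda>a. 3 - a" "\<lambda>a. 3 - a"]) auto

lemma reversed_sums:
  fixes X :: "int \<Rightarrow> complex" and \<gamma> :: "nat \<Rightarrow> complex"
  shows "(\<Sum>i\<le>3. \<gamma> (3 - i) * X (k + int i) * w ^ (3 - i)) = (\<Sum>i\<le>3. \<gamma> i * X (k + 3 - int i) * w ^ i)"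
    and "(\<Sum>i\<le>3. \<gamma> (3 - i) * X (k + 3 - int i) * w ^ i) = (\<Sum>i\<le>3. \<gamma> i * X (k + int i) * w ^ (3 - i))"
  by (subst (2) sum_reverse_3, intro sum.cong refl, simp add: of_nat_diff algebra_simps)+

lemma quadratic_psi_f:
  assumes ex: "expansion Z cf"
  shows "quadratic_rel (\<lambda>a. g_coeff q1 q2 q3 (3 - a)) (space G) (psi_op Z cf) (op_f G)"
proof (rule quadratic_relI)
  fix \<Lambda> k l assume "\<Lambda> \<in> labels G"
  then have L: "\<Lambda> \<in> Adm" by simp
  let ?v = "Poly_Mapping.single \<Lambda> 1"
  let ?w = "\<lambda>p. weight (sub_one \<Lambda> p) p" and ?F = "\<lambda>p. F_lim (sub_one \<Lambda> p) p"
  have 1: "(\<Sum>a\<le>3. scale (g_coeff q1 q2 q3 (3 - a)) (psi_op Z cf (k + int a) (op_f G (l + 3 - int a) ?v))) =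
    (\<Sum>p\<in>removable \<Lambda>. Poly_Mapping.single (sub_one \<Lambda> p) (?w p powi l * ?F p *
      (\<Sum>a\<le>3. g_coeff q1 q2 q3 a * cf (Psi Z (sub_one \<Lambda> p)) (k + 3 - int a) * ?w p ^ a)))"
  proof -
    have "(\<Sum>a\<le>3. scale (g_coeff q1 q2 q3 (3 - a)) (psi_op Z cf (k + int a) (op_f G (l + 3 - int a) ?v))) =
      (\<Sum>a\<le>3. \<Sum>p\<in>removable \<Lambda>. Poly_Mapping.single (sub_one \<Lambda> p)
        (g_coeff q1 q2 q3 (3 - a) * (1 * (?w p powi (l + 3 - int a) * ?F p) * cf (Psi Z (sub_one \<Lambda> p)) (k + int a))))"
      unfolding f_single[OF L] linear_opD(4)[OF linear_psi] psi_op_single scale_sum scale_single ..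
    also have "\<dots> = (\<Sum>p\<in>removable \<Lambda>. \<Sum>a\<le>3. Poly_Mapping.single (sub_one \<Lambda> p)
        (g_coeff q1 q2 q3 (3 - a) * (1 * (?w p powi (l + 3 - int a) * ?F p) * cf (Psi Z (sub_one \<Lambda> p)) (k + int a))))"
      by (rule sum.swap)
    also have "\<dots> = (\<Sum>p\<in>removable \<Lambda>. Poly_Mapping.single (sub_one \<Lambda> p) (?w p powi l * ?F p *
      (\<Sum>a\<le>3. g_coeff q1 q2 q3 (3 - a) * cf (Psi Z (sub_one \<Lambda> p)) (k + int a) * ?w p ^ (3 - a))))"
      unfolding single_sum[symmetric] sum_distrib_left
      by (intro sum.cong refl arg_cong[where f = "Poly_Mapping.single _"])
        (simp only: atMost_iff weight_power_shift[OF _ weight_nz] mult_1 mult_ac)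
    also have "\<dots> = (\<Sum>p\<in>removable \<Lambda>. Poly_Mapping.single (sub_one \<Lambda> p) (?w p powi l * ?F p *
      (\<Sum>a\<le>3. g_coeff q1 q2 q3 a * cf (Psi Z (sub_one \<Lambda> p)) (k + 3 - int a) * ?w p ^ a)))"
      unfolding reversed_sums(1)[of "g_coeff q1 q2 q3"] ..
    finally show ?thesis .
  qed
  have 2: "(\<Sum>a\<le>3. scale (g_coeff q1 q2 q3 (3 - a)) (op_f G (l + int a) (psi_op Z cf (k + 3 - int a) ?v))) =
    (\<Sum>p\<in>removable \<Lambda>. Poly_Mapping.single (sub_one \<Lambda> p) (?w p powi l * ?F p *
      (\<Sum>a\<le>3. g_coeff q1 q2 q3 a * cf (Psi Z \<Lambda>) (k + int a) * ?w p ^ (3 - a))))"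
  proof -
    have "(\<Sum>a\<le>3. scale (g_coeff q1 q2 q3 (3 - a)) (op_f G (l + int a) (psi_op Z cf (k + 3 - int a) ?v))) =
      (\<Sum>a\<le>3. \<Sum>p\<in>removable \<Lambda>. Poly_Mapping.single (sub_one \<Lambda> p)
        (g_coeff q1 q2 q3 (3 - a) * (1 * cf (Psi Z \<Lambda>) (k + 3 - int a) * (?w p powi (l + int a) * ?F p))))"
      unfolding psi_op_single f_single[OF L] scale_sum scale_single ..
    also have "\<dots> = (\<Sum>p\<in>removable \<Lambda>. \<Sum>a\<le>3. Poly_Mapping.single (sub_one \<Lambda> p)
        (g_coeff q1 q2 q3 (3 - a) * (1 * cf (Psi Z \<Lambda>) (k + 3 - int a) * (?w p powi (l + int a) * ?F p))))"
      by (rule sum.swap)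
    also have "\<dots> = (\<Sum>p\<in>removable \<Lambda>. Poly_Mapping.single (sub_one \<Lambda> p) (?w p powi l * ?F p *
      (\<Sum>a\<le>3. g_coeff q1 q2 q3 (3 - a) * cf (Psi Z \<Lambda>) (k + 3 - int a) * ?w p ^ a)))"
      unfolding single_sum[symmetric] sum_distrib_left
      by (intro sum.cong refl arg_cong[where f = "Poly_Mapping.single _"])
        (simp only: atMost_iff weight_power_shift[OF _ weight_nz] mult_1 mult_ac)
    also have "\<dots> = (\<Sum>p\<in>removable \<Lambda>. Poly_Mapping.single (sub_one \<Lambda> p) (?w p powi l * ?F p *
      (\<Sum>a\<le>3. g_coeff q1 q2 q3 a * cf (Psi Z \<Lambda>) (k + int a) * ?w p ^ (3 - a))))"
      unfolding reversed_sums(2)[of "g_coeff q1 q2 q3"] ..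
    finally show ?thesis .
  qed
  show "(\<Sum>a\<le>3. scale (g_coeff q1 q2 q3 (3 - a)) (psi_op Z cf (k + int a) (op_f G (l + 3 - int a) ?v))) =
    - (\<Sum>a\<le>3. scale (g_coeff q1 q2 q3 (3 - a)) (op_f G (l + int a) (psi_op Z cf (k + 3 - int a) ?v)))"
    unfolding 1 2 sum_negf[symmetric]
  proof (intro sum.cong refl)
    fix p assume "p \<in> removable \<Lambda>"
    then have "sub_one \<Lambda> p \<in> Adm" "add_one (sub_one \<Lambda> p) p \<in> Adm" "1 \<le> p" using L by (auto simp: removable_def)
    note e = psi_exchange[OF ex this, of k, unfolded add_sub_one]
    show "Poly_Mapping.single (sub_one \<Lambda> p) (?w p powi l * ?F p *
        (\<Sum>a\<le>3. g_coeff q1 q2 q3 a * cf (Psi Z (sub_one \<Lambda> p)) (k + 3 - int a) * ?w p ^ a)) =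
      - Poly_Mapping.single (sub_one \<Lambda> p) (?w p powi l * ?F p *
        (\<Sum>a\<le>3. g_coeff q1 q2 q3 a * cf (Psi Z \<Lambda>) (k + int a) * ?w p ^ (3 - a)))"
      unfolding e by (simp only: single_uminus mult_minus_right minus_minus)
  qed
qed (rule linear_psi linear_f)+

text \<open>
  Raising \<open>p\<close> and lowering \<open>q \<noteq> p\<close> commute by \<open>add_remove_commute\<close>, both orders being possible or impossible together
  because squares of admissible partitions can be completed.  The diagonal terms are those in \<open>psi_difference\<close>.
\<close>

lemma commutator:
  assumes "v \<in> space G"
  shows "op_comm (op_e G k) (op_f G l) v =
    scale (1 / g11) (op_psi_plus G (k + l) v - op_psi_minus G (k + l) v)"
proof (rule op_eqI[where T = "op_comm (op_e G k) (op_f G l)" and T' = "\<lambda>v. scale (1 / g11) (op_psi_plus G (k + l) v - op_psi_minus G (k + l) v)", OF _ _ assms])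
  show "linear_op (op_comm (op_e G k) (op_f G l))" by (intro op_comm_linear linear_e linear_f)
  show "linear_op (\<lambda>v. scale (1 / g11) (op_psi_plus G (k + l) v - op_psi_minus G (k + l) v))"
    unfolding psi_plus_op psi_minus_op by (rule linear_op_scale, rule linear_op_diff; rule linear_psi)
  fix \<Lambda> assume "\<Lambda> \<in> labels G"
  then have L: "\<Lambda> \<in> Adm" by simp
  from L obtain M where M: "good M \<Lambda>" using good_exists by blast
  \<comment> \<open>The cut-off must also serve for all partitions \<open>\<Lambda> + 1\<^sub>p\<close>.\<close>
  define K where "K = M + n"
  have K: "good K \<Lambda>" unfolding K_def by (rule good_mono[OF M]) simp
  interpret e: current "op_e G" "good K" "{1..K}" add_one weight "guarded E_amp" by (rule current_e)
  interpret f: current "op_f G" "good K" "{1..K}" sub_one f_weight f_amp by (rule current_f)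
  let ?v = "Poly_Mapping.single \<Lambda> (1::complex)"
  let ?A = "\<lambda>q p. (f_weight \<Lambda> q powi l * f_amp \<Lambda> q) * (weight (sub_one \<Lambda> q) p powi k * guarded E_amp (sub_one \<Lambda> q) p)"
  let ?B = "\<lambda>q p. (weight \<Lambda> p powi k * guarded E_amp \<Lambda> p) * (f_weight (add_one \<Lambda> p) q powi l * f_amp (add_one \<Lambda> p) q)"
  have ef: "op_e G k (op_f G l ?v) = (\<Sum>q\<in>{1..K}. \<Sum>p\<in>{1..K}. Poly_Mapping.single (add_one (sub_one \<Lambda> q) p) (?A q p))"
  proof -
    have "op_e G k (op_f G l ?v) = (\<Sum>q\<in>{1..K}. op_e G k (Poly_Mapping.single (sub_one \<Lambda> q) (f_weight \<Lambda> q powi l * f_amp \<Lambda> q)))"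
      unfolding f.one_step[OF K] linear_opD(4)[OF linear_e] ..
    also have "\<dots> = (\<Sum>q\<in>{1..K}. \<Sum>p\<in>{1..K}. Poly_Mapping.single (add_one (sub_one \<Lambda> q) p) (?A q p))"
    proof (rule sum.cong[OF refl], rule e.step)
      fix q assume "f_weight \<Lambda> q powi l * f_amp \<Lambda> q \<noteq> 0"
      then have "f_amp \<Lambda> q \<noteq> 0" by simp
      then show "good K (sub_one \<Lambda> q)" by (rule good_sub_one[OF K])
    qed
    finally show ?thesis .
  qed
  have fe: "op_f G l (op_e G k ?v) = (\<Sum>q\<in>{1..K}. \<Sum>p\<in>{1..K}. Poly_Mapping.single (sub_one (add_one \<Lambda> p) q) (?B q p))"
  proof -
    have "op_f G l (op_e G k ?v) = (\<Sum>p\<in>{1..K}. op_f G l (Poly_Mapping.single (add_one \<Lambda> p) (weight \<Lambda> p powi k * guarded E_amp \<Lambda> p)))"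
      unfolding e.one_step[OF K] linear_opD(4)[OF linear_f] ..
    also have "\<dots> = (\<Sum>p\<in>{1..K}. \<Sum>q\<in>{1..K}. Poly_Mapping.single (sub_one (add_one \<Lambda> p) q) (?B q p))"
    proof (rule sum.cong[OF refl], rule f.step)
      fix p assume "weight \<Lambda> p powi k * guarded E_amp \<Lambda> p \<noteq> 0"
      then have "guarded E_amp \<Lambda> p \<noteq> 0" by simp
      then show "good K (add_one \<Lambda> p)" unfolding K_def by (rule good_add_one[OF M])
    qed
    also have "\<dots> = (\<Sum>q\<in>{1..K}. \<Sum>p\<in>{1..K}. Poly_Mapping.single (sub_one (add_one \<Lambda> p) q) (?B q p))"
      by (rule sum.swap)
    finally show ?thesis .
  qed
  let ?d = "\<lambda>q. f_weight \<Lambda> q powi (k + l) * (f_amp \<Lambda> q * guarded E_amp (sub_one \<Lambda> q) q)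
    - weight \<Lambda> q powi (k + l) * (guarded E_amp \<Lambda> q * guarded F_lim \<Lambda> q)"
  have entry: "Poly_Mapping.single (add_one (sub_one \<Lambda> q) p) (?A q p) - Poly_Mapping.single (sub_one (add_one \<Lambda> p) q) (?B q p) =
      (if p = q then Poly_Mapping.single \<Lambda> (?d q) else 0)" for p q
  proof (cases "p = q")
    case True
    have eq: "?A q q = f_weight \<Lambda> q powi (k + l) * (f_amp \<Lambda> q * guarded E_amp (sub_one \<Lambda> q) q)"
      "?B q q = weight \<Lambda> q powi (k + l) * (guarded E_amp \<Lambda> q * guarded F_lim \<Lambda> q)"
      by (simp_all add: f_weight_def f_amp_def power_int_add mult_ac)
    show ?thesis unfolding True eq add_sub_one by (simp only: single_diff if_True refl)
  next
    case False
    define m where "m = sub_one \<Lambda> q"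
    have m: "\<Lambda> = add_one m q" "sub_one (add_one \<Lambda> p) q = add_one m p"
      unfolding m_def using False by (auto simp: add_sub_commute)
    have amp: "guarded F_lim m q * guarded E_amp m p = guarded E_amp \<Lambda> p * guarded F_lim (add_one m p) q"
    proof (cases "m \<in> Adm \<and> add_one m p \<in> Adm \<and> 1 \<le> p \<and> 1 \<le> q")
      case True
      then have a: "m \<in> Adm" "add_one m p \<in> Adm" "add_one m q \<in> Adm" "1 \<le> p" "1 \<le> q" using L m(1) by auto
      have b: "add_one (add_one m p) q \<in> Adm" "add_one (add_one m q) p \<in> Adm"
        using add_one_twice_Adm[OF a(2,3) False] add_one_twice_Adm[OF a(3,2) not_sym[OF False]] .
      show ?thesis using add_remove_commute[OF a False] a b unfolding m(1) by (simp add: guarded_def mult.commute)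
    next
      case no: False
      have "guarded F_lim m q * guarded E_amp m p = 0"
        using no guardedD[of F_lim m q] guardedD[of E_amp m p] by auto
      moreover have "guarded E_amp \<Lambda> p * guarded F_lim (add_one m p) q = 0"
      proof (rule ccontr)
        assume "guarded E_amp \<Lambda> p * guarded F_lim (add_one m p) q \<noteq> 0"
        then have *: "guarded E_amp \<Lambda> p \<noteq> 0" "guarded F_lim (add_one m p) q \<noteq> 0" by auto
        have "1 \<le> p" "1 \<le> q" "add_one m p \<in> Adm" "add_one m q \<in> Adm"
          using guardedD[OF *(1)] guardedD[OF *(2)] L m(1) by auto
        then show False using no add_one_meet_Adm[of m p q] False by blast
      qed
      ultimately show ?thesis by (rule trans[OF _ sym])
    qed
    have w: "f_weight \<Lambda> q = weight m q" "weight m p = weight \<Lambda> p" "f_weight (add_one \<Lambda> p) q = weight m q"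
      using False m by (simp_all add: f_weight_def weight_add_one m_def weight_sub_one)
    have "?A q p = ?B q p"
      unfolding w f_amp_def m(2) m_def[symmetric] using amp by (simp add: mult_ac)
    then show ?thesis using False unfolding m_def[symmetric] m(2) by simp
  qed
  have "op_comm (op_e G k) (op_f G l) ?v = (\<Sum>q\<in>{1..K}. \<Sum>p\<in>{1..K}. if p = q then Poly_Mapping.single \<Lambda> (?d q) else 0)"
    unfolding op_comm_def ef fe sum_subtractf[symmetric] entry ..
  also have "\<dots> = (\<Sum>q\<in>{1..K}. Poly_Mapping.single \<Lambda> (?d q))"
    by (intro sum.cong refl) (simp add: sum.delta')
  also have "\<dots> = Poly_Mapping.single \<Lambda> ((\<Sum>q\<in>{1..K}. f_weight \<Lambda> q powi (k + l) * (f_amp \<Lambda> q * guarded E_amp (sub_one \<Lambda> q) q))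
      - (\<Sum>q\<in>{1..K}. weight \<Lambda> q powi (k + l) * (guarded E_amp \<Lambda> q * guarded F_lim \<Lambda> q)))"
    by (simp only: single_sum[symmetric] sum_subtractf)
  also have "(\<Sum>q\<in>{1..K}. f_weight \<Lambda> q powi (k + l) * (f_amp \<Lambda> q * guarded E_amp (sub_one \<Lambda> q) q)) =
      (\<Sum>p\<in>removable \<Lambda>. weight (sub_one \<Lambda> p) p powi (k + l) * (E_amp (sub_one \<Lambda> p) p * F_lim (sub_one \<Lambda> p) p))"
  proof (rule sum.mono_neutral_cong_right)
    show "removable \<Lambda> \<subseteq> {1..K}" using K by (intro removable_subset) (auto simp: good_def)
  qed (use L in \<open>auto simp: f_weight_def f_amp_def guarded_def removable_def\<close>)
  also have "(\<Sum>q\<in>{1..K}. weight \<Lambda> q powi (k + l) * (guarded E_amp \<Lambda> q * guarded F_lim \<Lambda> q)) =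
      (\<Sum>p\<in>addable \<Lambda>. weight \<Lambda> p powi (k + l) * (E_amp \<Lambda> p * F_lim \<Lambda> p))"
  proof (rule sum.mono_neutral_cong_right)
    show "addable \<Lambda> \<subseteq> {1..K}" using K by (intro addable_subset) (auto simp: good_def)
  qed (use L in \<open>auto simp: guarded_def addable_def\<close>)
  finally have 1: "op_comm (op_e G k) (op_f G l) ?v = Poly_Mapping.single \<Lambda>
    ((\<Sum>p\<in>removable \<Lambda>. weight (sub_one \<Lambda> p) p powi (k + l) * (E_amp (sub_one \<Lambda> p) p * F_lim (sub_one \<Lambda> p) p))
     - (\<Sum>p\<in>addable \<Lambda>. weight \<Lambda> p powi (k + l) * (E_amp \<Lambda> p * F_lim \<Lambda> p)))" .
  have "g11 \<noteq> 0" by (simp add: g11_def)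
  then show "op_comm (op_e G k) (op_f G l) ?v = scale (1 / g11) (op_psi_plus G (k + l) ?v - op_psi_minus G (k + l) ?v)"
    unfolding 1 psi_plus_op psi_minus_op psi_op_single single_diff[symmetric] mult_1 psi_difference[OF L] scale_single
    by simp
qed

lemma deg_add_one:
  assumes "\<Lambda> \<in> Adm"
  shows "label_deg G (add_one \<Lambda> p) = label_deg G \<Lambda> + 1"
proof -
  obtain N where N: "\<forall>j\<ge>N. \<Lambda> j = \<Lambda>0 j" using Adm_stable[OF assms] by blast
  have sup: "Sum_any f = (\<Sum>j\<in>{..N + p}. f j)" if "\<And>j. N + p < j \<Longrightarrow> f j = 0" for f :: "nat \<Rightarrow> int"
    by (rule Sum_any.expand_superset) (use that in \<open>auto simp: not_le[symmetric]\<close>)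
  have "(\<Sum>j\<in>{..N + p}. add_one \<Lambda> p j - \<Lambda>0 j) = (\<Sum>j\<in>{..N + p}. (\<Lambda> j - \<Lambda>0 j) + (if j = p then 1 else 0))"
    by (intro sum.cong) (auto simp: add_one_apply)
  also have "\<dots> = (\<Sum>j\<in>{..N + p}. \<Lambda> j - \<Lambda>0 j) + 1" by (simp add: sum.distrib)
  finally show ?thesis unfolding G_rep_def graded_rep.simps
    using N by (subst (1 2) sup) (auto simp: add_one_apply)
qed

lemma G_module: "graded_E_module q1 q2 q3 G"
  unfolding graded_E_module_def Let_def
proof (intro conjI allI ballI impI)
  show "homogeneous_op G 1 (op_e G k)" for k
  proof (rule homogeneous_opI[OF linear_e])
    fix \<Lambda> M assume "\<Lambda> \<in> labels G" and M: "M \<in> Poly_Mapping.keys (op_e G k (Poly_Mapping.single \<Lambda> 1))"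
    then have L: "\<Lambda> \<in> Adm" by simp
    have "M \<in> (\<Union>p\<in>addable \<Lambda>. {add_one \<Lambda> p})"
      using M keys_sum_subset unfolding e_single[OF L] by (fastforce split: if_splits)
    then obtain p where "p \<in> addable \<Lambda>" "M = add_one \<Lambda> p" by blast
    then show "M \<in> labels G \<and> label_deg G M = label_deg G \<Lambda> + 1"
      using deg_add_one[OF L] by (simp add: addable_def)
  qed
  show "homogeneous_op G (- 1) (op_f G k)" for k
  proof (rule homogeneous_opI[OF linear_f])
    fix \<Lambda> M assume "\<Lambda> \<in> labels G" and M: "M \<in> Poly_Mapping.keys (op_f G k (Poly_Mapping.single \<Lambda> 1))"
    then have L: "\<Lambda> \<in> Adm" by simp
    have "M \<in> (\<Union>p\<in>removable \<Lambda>. {sub_one \<Lambda> p})"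
      using M keys_sum_subset unfolding f_single[OF L] by (fastforce split: if_splits)
    then obtain p where p: "p \<in> removable \<Lambda>" "M = sub_one \<Lambda> p" by blast
    then have "M \<in> Adm" by (simp add: removable_def)
    from deg_add_one[OF this, of p] show "M \<in> labels G \<and> label_deg G M = label_deg G \<Lambda> + - 1"
      using \<open>M \<in> Adm\<close> p by simp
  qed
  have hom_psi: "homogeneous_op G 0 (psi_op Z cf k)" for Z cf k
    by (rule homogeneous_opI[OF linear_psi]) (auto simp: psi_op_single split: if_splits)
  show "homogeneous_op G 0 (op_psi_plus G k)" "homogeneous_op G 0 (op_psi_minus G k)" for k
    unfolding psi_plus_op psi_minus_op by (rule hom_psi)+
  show "op_psi_plus G k v = 0" if "k < 0" "v \<in> space G" for k v
    by (rule op_eqI[where T = "op_psi_plus G k" and T' = "\<lambda>v. 0", OF _ linear_op_zero that(2)])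
      (simp_all add: psi_plus_op linear_psi psi_op_single psi_coefficients(1)[OF _ that(1)])
  show "op_psi_minus G k v = 0" if "0 < k" "v \<in> space G" for k v
    by (rule op_eqI[where T = "op_psi_minus G k" and T' = "\<lambda>v. 0", OF _ linear_op_zero that(2)])
      (simp_all add: psi_minus_op linear_psi psi_op_single psi_coefficients(3)[OF _ that(1)])
  show "bij_betw (op_psi_plus G 0) (space G) (space G)" "bij_betw (op_psi_minus G 0) (space G) (space G)"
    unfolding psi_plus_G psi_minus_G by (rule bij_diagonal_op; simp add: psi_coefficients)+
  show "quadratic_rel (g_coeff q1 q2 q3) (space G) (op_e G) (op_e G)" by (rule quadratic_e)
  show "quadratic_rel (\<lambda>a. g_coeff q1 q2 q3 (3 - a)) (space G) (op_f G) (op_f G)" by (rule quadratic_f)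
  show "quadratic_rel (g_coeff q1 q2 q3) (space G) (op_psi_plus G) (op_e G)"
    "quadratic_rel (g_coeff q1 q2 q3) (space G) (op_psi_minus G) (op_e G)"
    unfolding psi_plus_op psi_minus_op
    by (rule quadratic_psi_e[OF plus.expansion_axioms], rule quadratic_psi_e[OF minus.expansion_axioms])
  show "quadratic_rel (\<lambda>a. g_coeff q1 q2 q3 (3 - a)) (space G) (op_psi_plus G) (op_f G)"
    "quadratic_rel (\<lambda>a. g_coeff q1 q2 q3 (3 - a)) (space G) (op_psi_minus G) (op_f G)"
    unfolding psi_plus_op psi_minus_op
    by (rule quadratic_psi_f[OF plus.expansion_axioms], rule quadratic_psi_f[OF minus.expansion_axioms])
  show "op_comm (op_e G k) (op_f G l) v =
      scale (1 / ((1 - q1) * (1 - q2) * (1 - q3))) (op_psi_plus G (k + l) v - op_psi_minus G (k + l) v)"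
    if "v \<in> space G" for k l v
    using commutator[OF that] unfolding g11_def .
  have comm: "op_comm (diagonal_op d) (diagonal_op d') v = 0" for d d' :: "(nat \<Rightarrow> int) \<Rightarrow> complex" and v
    by (rule poly_mapping_eqI) (simp add: op_comm_def lookup_minus)
  show "op_comm (op_psi_plus G k) (op_psi_plus G l) v = 0" "op_comm (op_psi_minus G k) (op_psi_minus G l) v = 0"
    "op_comm (op_psi_plus G k) (op_psi_minus G l) v = 0" for k l v
    unfolding psi_plus_G psi_minus_G by (rule comm)+
  show "op_comm (op_e G 0) (op_comm (op_e G 1) (op_e G (- 1))) v = 0" if "v \<in> space G" for v by (rule cubic_e[OF that])
  show "op_comm (op_f G 0) (op_comm (op_f G 1) (op_f G (- 1))) v = 0" if "v \<in> space G" for v by (rule cubic_f[OF that])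
qed

end

section \<open>Transport of module structures\<close>

lemma space_closed:
  "0 \<in> space V" "x \<in> space V \<Longrightarrow> y \<in> space V \<Longrightarrow> x + y \<in> space V" "x \<in> space V \<Longrightarrow> y \<in> space V \<Longrightarrow> x - y \<in> space V"
  "x \<in> space V \<Longrightarrow> - x \<in> space V" "x \<in> space V \<Longrightarrow> scale c x \<in> space V"
  by (auto simp: space_def in_keys_iff lookup_add lookup_minus subset_iff) (metis add_0 diff_0_right)+

lemma space_closed_sum: "(\<And>i. i \<in> A \<Longrightarrow> f i \<in> space V) \<Longrightarrow> sum f A \<in> space V"
  by (induction A rule: infinite_finite_induct) (auto intro: space_closed)

text \<open>
  The defining relations only involve compositions and linear combinations of the operators.  A bijective
  intertwiner therefore carries them back from \<open>W\<close> to \<open>V\<close>.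
\<close>

locale transport =
  fixes V :: "'b graded_rep" and W :: "'c graded_rep" and \<phi> :: "('b \<Rightarrow>\<^sub>0 complex) \<Rightarrow> ('c \<Rightarrow>\<^sub>0 complex)"
    and q1 q2 q3 :: complex
  assumes lin: "linear_op \<phi>" and bij: "bij_betw \<phi> (space V) (space W)"
    and comp: "\<phi> ` component V d = component W d"
    and lin_V: "linear_op (op_e V k)" "linear_op (op_f V k)" "linear_op (op_psi_plus V k)" "linear_op (op_psi_minus V k)"
    and maps: "v \<in> space V \<Longrightarrow> op_e V k v \<in> space V" "v \<in> space V \<Longrightarrow> op_f V k v \<in> space V"
      "v \<in> space V \<Longrightarrow> op_psi_plus V k v \<in> space V" "v \<in> space V \<Longrightarrow> op_psi_minus V k v \<in> space V"
    and inter: "v \<in> space V \<Longrightarrow> \<phi> (op_e V k v) = op_e W k (\<phi> v)" "v \<in> space V \<Longrightarrow> \<phi> (op_f V k v) = op_f W k (\<phi> v)"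
      "v \<in> space V \<Longrightarrow> \<phi> (op_psi_plus V k v) = op_psi_plus W k (\<phi> v)"
      "v \<in> space V \<Longrightarrow> \<phi> (op_psi_minus V k v) = op_psi_minus W k (\<phi> v)"
    and mod: "graded_E_module q1 q2 q3 W"
begin

lemma image: "v \<in> space V \<Longrightarrow> \<phi> v \<in> space W"
  using bij by (auto simp: bij_betw_def)

lemma inject: "v \<in> space V \<Longrightarrow> w \<in> space V \<Longrightarrow> \<phi> v = \<phi> w \<Longrightarrow> v = w"
  using bij by (auto simp: bij_betw_def inj_on_def)

lemma vanish: "v \<in> space V \<Longrightarrow> \<phi> v = 0 \<Longrightarrow> v = 0"
  using inject[OF _ space_closed(1)] linear_opD(3)[OF lin] by auto

lemma homogeneous:
  assumes "linear_op T" and T: "\<And>v. v \<in> space V \<Longrightarrow> T v \<in> space V" "\<And>v. v \<in> space V \<Longrightarrow> \<phi> (T v) = T' (\<phi> v)"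
    and "homogeneous_op W s T'"
  shows "homogeneous_op V s T"
  unfolding homogeneous_op_def
proof (intro conjI allI subsetI)
  show "linear_on_space (space V) T" by (rule linear_op_on_space[OF assms(1)])
  show "y \<in> space V" if "y \<in> T ` space V" for y using that T(1) by blast
  show "y \<in> component V (d + s)" if "y \<in> T ` component V d" for d y
  proof -
    from that obtain v where v: "v \<in> component V d" "y = T v" by blast
    then have vV: "v \<in> space V" by (simp add: component_def)
    have "\<phi> v \<in> component W d" using v(1) comp by blast
    then have "T' (\<phi> v) \<in> component W (d + s)" using assms(4) unfolding homogeneous_op_def by blast
    then have "\<phi> y \<in> \<phi> ` component V (d + s)" unfolding comp v(2) T(2)[OF vV] .
    then obtain w where w: "w \<in> component V (d + s)" "\<phi> y = \<phi> w" by blast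
    then have "w \<in> space V" by (simp add: component_def)
    then have "y = w" using inject[OF _ _ w(2)] T(1)[OF vV] v(2) by blast
    then show ?thesis using w by simp
  qed
qed

lemma quadratic:
  assumes X: "\<And>v k. v \<in> space V \<Longrightarrow> X k v \<in> space V" "\<And>v k. v \<in> space V \<Longrightarrow> \<phi> (X k v) = X' k (\<phi> v)"
    and Y: "\<And>v k. v \<in> space V \<Longrightarrow> Y k v \<in> space V" "\<And>v k. v \<in> space V \<Longrightarrow> \<phi> (Y k v) = Y' k (\<phi> v)"
    and W: "quadratic_rel \<gamma> (space W) X' Y'"
  shows "quadratic_rel \<gamma> (space V) X Y"
  unfolding quadratic_rel_def
proof (intro allI ballI)
  fix k l v assume v: "v \<in> space V"
  show "(\<Sum>a\<le>3. scale (\<gamma> a) (X (k + int a) (Y (l + 3 - int a) v))) =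
      - (\<Sum>a\<le>3. scale (\<gamma> a) (Y (l + int a) (X (k + 3 - int a) v)))"
  proof (rule inject)
    show "(\<Sum>a\<le>3. scale (\<gamma> a) (X (k + int a) (Y (l + 3 - int a) v))) \<in> space V"
      "- (\<Sum>a\<le>3. scale (\<gamma> a) (Y (l + int a) (X (k + 3 - int a) v))) \<in> space V"
      by (intro space_closed space_closed_sum X Y v)+
    show "\<phi> (\<Sum>a\<le>3. scale (\<gamma> a) (X (k + int a) (Y (l + 3 - int a) v))) =
        \<phi> (- (\<Sum>a\<le>3. scale (\<gamma> a) (Y (l + int a) (X (k + 3 - int a) v))))"
      unfolding linear_opD[OF lin] X(2)[OF Y(1)[OF v]] Y(2)[OF X(1)[OF v]] X(2)[OF v] Y(2)[OF v]
      using W image[OF v] unfolding quadratic_rel_def by blast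
  qed
qed

lemma op_comm_maps:
  assumes "\<And>v. v \<in> space V \<Longrightarrow> X v \<in> space V" "\<And>v. v \<in> space V \<Longrightarrow> Y v \<in> space V" "v \<in> space V"
  shows "op_comm X Y v \<in> space V"
  unfolding op_comm_def by (intro space_closed assms)

lemma op_comm_inter:
  assumes "\<And>v. v \<in> space V \<Longrightarrow> X v \<in> space V" "\<And>v. v \<in> space V \<Longrightarrow> Y v \<in> space V"
    "\<And>v. v \<in> space V \<Longrightarrow> \<phi> (X v) = X' (\<phi> v)" "\<And>v. v \<in> space V \<Longrightarrow> \<phi> (Y v) = Y' (\<phi> v)" "v \<in> space V"
  shows "\<phi> (op_comm X Y v) = op_comm X' Y' (\<phi> v)"
  unfolding op_comm_def linear_opD[OF lin] using assms by simp

lemma bij_transport: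
  assumes "\<And>v. v \<in> space V \<Longrightarrow> X v \<in> space V" "\<And>v. v \<in> space V \<Longrightarrow> \<phi> (X v) = X' (\<phi> v)"
    and "bij_betw X' (space W) (space W)"
  shows "bij_betw X (space V) (space V)"
proof -
  have "bij_betw (X' \<circ> \<phi>) (space V) (space W)" using bij assms(3) by (rule bij_betw_trans)
  then have "bij_betw (\<phi> \<circ> X) (space V) (space W)"
    by (rule bij_betw_cong[THEN iffD1, rotated]) (simp add: assms(2))
  moreover have "X ` space V \<subseteq> space V" using assms(1) by blast
  ultimately show ?thesis using bij_betw_comp_iff2[OF bij, of X "space V"] by blast
qed

theorem module_V: "graded_E_module q1 q2 q3 V"
proof -
  note M = mod[unfolded graded_E_module_def Let_def]
  have M': "homogeneous_op W 1 (op_e W k)" "homogeneous_op W (- 1) (op_f W k)"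
    "homogeneous_op W 0 (op_psi_plus W k)" "homogeneous_op W 0 (op_psi_minus W k)"
    "k < 0 \<Longrightarrow> w \<in> space W \<Longrightarrow> op_psi_plus W k w = 0" "0 < k \<Longrightarrow> w \<in> space W \<Longrightarrow> op_psi_minus W k w = 0"
    "bij_betw (op_psi_plus W 0) (space W) (space W)" "bij_betw (op_psi_minus W 0) (space W) (space W)"
    "quadratic_rel (g_coeff q1 q2 q3) (space W) (op_e W) (op_e W)"
    "quadratic_rel (\<lambda>a. g_coeff q1 q2 q3 (3 - a)) (space W) (op_f W) (op_f W)"
    "quadratic_rel (g_coeff q1 q2 q3) (space W) (op_psi_plus W) (op_e W)"
    "quadratic_rel (g_coeff q1 q2 q3) (space W) (op_psi_minus W) (op_e W)"
    "quadratic_rel (\<lambda>a. g_coeff q1 q2 q3 (3 - a)) (space W) (op_psi_plus W) (op_f W)"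
    "quadratic_rel (\<lambda>a. g_coeff q1 q2 q3 (3 - a)) (space W) (op_psi_minus W) (op_f W)" for k w
    using M by simp_all
  have comm_W: "w \<in> space W \<Longrightarrow> op_comm (op_e W k) (op_f W l) w =
      scale (1 / ((1 - q1) * (1 - q2) * (1 - q3))) (op_psi_plus W (k + l) w - op_psi_minus W (k + l) w)"
    "w \<in> space W \<Longrightarrow> op_comm (op_psi_plus W k) (op_psi_plus W l) w = 0"
    "w \<in> space W \<Longrightarrow> op_comm (op_psi_minus W k) (op_psi_minus W l) w = 0"
    "w \<in> space W \<Longrightarrow> op_comm (op_psi_plus W k) (op_psi_minus W l) w = 0"
    "w \<in> space W \<Longrightarrow> op_comm (op_e W 0) (op_comm (op_e W 1) (op_e W (- 1))) w = 0"
    "w \<in> space W \<Longrightarrow> op_comm (op_f W 0) (op_comm (op_f W 1) (op_f W (- 1))) w = 0" for k l w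
    using M by simp_all
  show ?thesis unfolding graded_E_module_def Let_def
  proof (intro conjI allI ballI impI)
    show "homogeneous_op V 1 (op_e V k)" for k 
      by (rule homogeneous[where T = "op_e V k" and T' = "op_e W k"]) (simp_all add: lin_V maps inter M')
    show "homogeneous_op V (- 1) (op_f V k)" for k 
      by (rule homogeneous[where T = "op_f V k" and T' = "op_f W k"]) (simp_all add: lin_V maps inter M')
    show "homogeneous_op V 0 (op_psi_plus V k)" for k 
      by (rule homogeneous[where T = "op_psi_plus V k" and T' = "op_psi_plus W k"]) (simp_all add: lin_V maps inter M')
    show "homogeneous_op V 0 (op_psi_minus V k)" for k 
      by (rule homogeneous[where T = "op_psi_minus V k" and T' = "op_psi_minus W k"]) (simp_all add: lin_V maps inter M')
    show "op_psi_plus V k v = 0" if "k < 0" "v \<in> space V" for k v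
      by (rule vanish[OF maps(3)[OF that(2)]], unfold inter(3)[OF that(2)]) (use M' that image in simp)
    show "op_psi_minus V k v = 0" if "0 < k" "v \<in> space V" for k v
      by (rule vanish[OF maps(4)[OF that(2)]], unfold inter(4)[OF that(2)]) (use M' that image in simp)
    show "bij_betw (op_psi_plus V 0) (space V) (space V)"
      by (rule bij_transport[where X = "op_psi_plus V 0" and X' = "op_psi_plus W 0"]) (simp_all add: maps inter M')
    show "bij_betw (op_psi_minus V 0) (space V) (space V)"
      by (rule bij_transport[where X = "op_psi_minus V 0" and X' = "op_psi_minus W 0"]) (simp_all add: maps inter M')
    show "quadratic_rel (g_coeff q1 q2 q3) (space V) (op_e V) (op_e V)"
      by (rule quadratic[where X = "op_e V" and X' = "op_e W" and Y = "op_e V" and Y' = "op_e W"])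
        (simp_all add: maps inter M')
    show "quadratic_rel (\<lambda>a. g_coeff q1 q2 q3 (3 - a)) (space V) (op_f V) (op_f V)"
      by (rule quadratic[where X = "op_f V" and X' = "op_f W" and Y = "op_f V" and Y' = "op_f W"])
        (simp_all add: maps inter M')
    show "quadratic_rel (g_coeff q1 q2 q3) (space V) (op_psi_plus V) (op_e V)"
      by (rule quadratic[where X = "op_psi_plus V" and X' = "op_psi_plus W" and Y = "op_e V" and Y' = "op_e W"])
        (simp_all add: maps inter M')
    show "quadratic_rel (g_coeff q1 q2 q3) (space V) (op_psi_minus V) (op_e V)"
      by (rule quadratic[where X = "op_psi_minus V" and X' = "op_psi_minus W" and Y = "op_e V" and Y' = "op_e W"])
        (simp_all add: maps inter M')
    show "quadratic_rel (\<lambda>a. g_coeff q1 q2 q3 (3 - a)) (space V) (op_psi_plus V) (op_f V)"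
      by (rule quadratic[where X = "op_psi_plus V" and X' = "op_psi_plus W" and Y = "op_f V" and Y' = "op_f W"])
        (simp_all add: maps inter M')
    show "quadratic_rel (\<lambda>a. g_coeff q1 q2 q3 (3 - a)) (space V) (op_psi_minus V) (op_f V)"
      by (rule quadratic[where X = "op_psi_minus V" and X' = "op_psi_minus W" and Y = "op_f V" and Y' = "op_f W"])
        (simp_all add: maps inter M')
    show "op_comm (op_e V k) (op_f V l) v =
        scale (1 / ((1 - q1) * (1 - q2) * (1 - q3))) (op_psi_plus V (k + l) v - op_psi_minus V (k + l) v)"
      if v: "v \<in> space V" for k l v
    proof (rule inject)
      show "op_comm (op_e V k) (op_f V l) v \<in> space V" by (rule op_comm_maps) (simp_all add: maps v)
      show "scale (1 / ((1 - q1) * (1 - q2) * (1 - q3))) (op_psi_plus V (k + l) v - op_psi_minus V (k + l) v) \<in> space V"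
        by (intro space_closed maps v)
      have "\<phi> (op_comm (op_e V k) (op_f V l) v) = op_comm (op_e W k) (op_f W l) (\<phi> v)"
        by (rule op_comm_inter) (simp_all add: maps inter v)
      then show "\<phi> (op_comm (op_e V k) (op_f V l) v) =
          \<phi> (scale (1 / ((1 - q1) * (1 - q2) * (1 - q3))) (op_psi_plus V (k + l) v - op_psi_minus V (k + l) v))"
        unfolding linear_opD[OF lin] inter(3,4)[OF v] using comm_W(1)[OF image[OF v]] by simp
    qed
    have commute: "op_comm X Y v = 0"
      if "\<And>v. v \<in> space V \<Longrightarrow> X v \<in> space V" "\<And>v. v \<in> space V \<Longrightarrow> Y v \<in> space V"
        "\<And>v. v \<in> space V \<Longrightarrow> \<phi> (X v) = X' (\<phi> v)" "\<And>v. v \<in> space V \<Longrightarrow> \<phi> (Y v) = Y' (\<phi> v)"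
        "\<And>w. w \<in> space W \<Longrightarrow> op_comm X' Y' w = 0" "v \<in> space V" for X Y X' Y' v
    proof (rule vanish)
      show "op_comm X Y v \<in> space V" by (rule op_comm_maps[where X = X and Y = Y]) (simp_all add: that(1,2,6))
      have "\<phi> (op_comm X Y v) = op_comm X' Y' (\<phi> v)"
        by (rule op_comm_inter[where X = X and Y = Y and X' = X' and Y' = Y']) (simp_all add: that)
      then show "\<phi> (op_comm X Y v) = 0" using that(5)[OF image[OF that(6)]] by simp
    qed
    show "op_comm (op_psi_plus V k) (op_psi_plus V l) v = 0" if "v \<in> space V" for k l v
      by (rule commute[where X' = "op_psi_plus W k" and Y' = "op_psi_plus W l"]) (simp_all add: maps inter comm_W that)
    show "op_comm (op_psi_minus V k) (op_psi_minus V l) v = 0" if "v \<in> space V" for k l v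
      by (rule commute[where X' = "op_psi_minus W k" and Y' = "op_psi_minus W l"]) (simp_all add: maps inter comm_W that)
    show "op_comm (op_psi_plus V k) (op_psi_minus V l) v = 0" if "v \<in> space V" for k l v
      by (rule commute[where X' = "op_psi_plus W k" and Y' = "op_psi_minus W l"]) (simp_all add: maps inter comm_W that)
    have ee: "op_comm (op_e V 1) (op_e V (- 1)) v \<in> space V"
      "\<phi> (op_comm (op_e V 1) (op_e V (- 1)) v) = op_comm (op_e W 1) (op_e W (- 1)) (\<phi> v)" if "v \<in> space V" for v
      by (rule op_comm_maps, simp_all add: maps that) (rule op_comm_inter, simp_all add: maps inter that)
    show "op_comm (op_e V 0) (op_comm (op_e V 1) (op_e V (- 1))) v = 0" if "v \<in> space V" for v
      by (rule commute[where X' = "op_e W 0" and Y' = "op_comm (op_e W 1) (op_e W (- 1))"])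
        (simp_all add: maps inter ee comm_W that)
    have ff: "op_comm (op_f V 1) (op_f V (- 1)) v \<in> space V"
      "\<phi> (op_comm (op_f V 1) (op_f V (- 1)) v) = op_comm (op_f W 1) (op_f W (- 1)) (\<phi> v)" if "v \<in> space V" for v
      by (rule op_comm_maps, simp_all add: maps that) (rule op_comm_inter, simp_all add: maps inter that)
    show "op_comm (op_f V 0) (op_comm (op_f V 1) (op_f V (- 1))) v = 0" if "v \<in> space V" for v
      by (rule commute[where X' = "op_f W 0" and Y' = "op_comm (op_f W 1) (op_f W (- 1))"])
        (simp_all add: maps inter ff comm_W that)
  qed
qed

theorem iso: "graded_E_iso q1 q2 q3 V W \<phi>"
  unfolding graded_E_iso_def
  by (intro conjI allI ballI module_V mod linear_op_on_space lin bij comp inter)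

end

lemma relabel_bij:
  fixes c :: "'c \<Rightarrow> complex"
  assumes bij: "bij_betw f (labels V) (labels W)" and nz: "\<And>y. y \<in> labels W \<Longrightarrow> c y \<noteq> 0"
    and deg: "\<And>b. b \<in> labels V \<Longrightarrow> label_deg W (f b) = label_deg V b"
  defines "\<phi> \<equiv> linear_extension (\<lambda>b. Poly_Mapping.single (f b) (c (f b)))"
  shows "bij_betw \<phi> (space V) (space W)" and "\<phi> ` component V d = component W d"
proof -
  define g where "g = inv_into (labels V) f"
  define \<psi> where "\<psi> = linear_extension (\<lambda>y. Poly_Mapping.single (g y) (inverse (c y)))"
  have g: "g y \<in> labels V" "f (g y) = y" if "y \<in> labels W" for y
    using that bij unfolding g_def bij_betw_def by (auto intro: inv_into_into f_inv_into_f)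
  have gf: "g (f b) = b" "f b \<in> labels W" if "b \<in> labels V" for b
    using that bij unfolding g_def bij_betw_def by auto
  have lin: "linear_op \<phi>" "linear_op \<psi>" unfolding \<phi>_def \<psi>_def by (rule linear_op_linear_extension)+
  have \<phi>1: "\<phi> (Poly_Mapping.single b e) = Poly_Mapping.single (f b) (e * c (f b))" for b e
    unfolding \<phi>_def linear_extension_single by simp
  have \<psi>1: "\<psi> (Poly_Mapping.single y e) = Poly_Mapping.single (g y) (e * inverse (c y))" for y e
    unfolding \<psi>_def linear_extension_single by simp
  have keys_ext: "Poly_Mapping.keys (linear_extension (\<lambda>b. Poly_Mapping.single (h b) (w b)) x) \<subseteq> h ` Poly_Mapping.keys x"
    for h :: "'x \<Rightarrow> 'y" and w x
  proof -
    have "Poly_Mapping.keys (linear_extension (\<lambda>b. Poly_Mapping.single (h b) (w b)) x) \<subseteq>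
        (\<Union>b\<in>Poly_Mapping.keys x. Poly_Mapping.keys (scale (Poly_Mapping.lookup x b) (Poly_Mapping.single (h b) (w b))))"
      unfolding linear_extension_def by (rule keys_sum_subset)
    also have "\<dots> \<subseteq> h ` Poly_Mapping.keys x" by (auto split: if_splits)
    finally show ?thesis .
  qed
  have id: "linear_op (\<lambda>x::'z \<Rightarrow>\<^sub>0 complex. x)" by (simp add: linear_op_def)
  have inv1: "\<psi> (\<phi> x) = x" if "x \<in> space V" for x
    by (rule op_eqI[where T = "\<lambda>x. \<psi> (\<phi> x)" and T' = "\<lambda>x. x", OF linear_op_compose[OF lin(2,1)] id that])
      (simp add: \<phi>1 \<psi>1 gf nz)
  have inv2: "\<phi> (\<psi> x) = x" if "x \<in> space W" for x
    by (rule op_eqI[where T = "\<lambda>x. \<phi> (\<psi> x)" and T' = "\<lambda>x. x", OF linear_op_compose[OF lin(1,2)] id that])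
      (simp add: \<phi>1 \<psi>1 g nz)
  have m1: "\<phi> x \<in> component W d" if "x \<in> component V d" for x d
    proof -
    have K: "Poly_Mapping.keys (\<phi> x) \<subseteq> f ` Poly_Mapping.keys x" unfolding \<phi>_def by (rule keys_ext)
    have "y \<in> labels W \<and> label_deg W y = d" if y: "y \<in> Poly_Mapping.keys (\<phi> x)" for y
    proof -
      obtain b where b: "b \<in> Poly_Mapping.keys x" "y = f b" using y K by auto
      then have "b \<in> labels V" "label_deg V b = d"
        using \<open>x \<in> component V d\<close> by (auto simp: component_def space_def)
      then show ?thesis using b(2) gf(2) deg by simp
    qed
    then show ?thesis by (auto simp: component_def space_def)
  qed
  have m2: "\<psi> x \<in> component V d" if "x \<in> component W d" for x d
    proof -
    have K: "Poly_Mapping.keys (\<psi> x) \<subseteq> g ` Poly_Mapping.keys x" unfolding \<psi>_def by (rule keys_ext)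
    have "b \<in> labels V \<and> label_deg V b = d" if b: "b \<in> Poly_Mapping.keys (\<psi> x)" for b
    proof -
      obtain y where y: "y \<in> Poly_Mapping.keys x" "b = g y" using b K by auto
      then have "y \<in> labels W" "label_deg W y = d"
        using \<open>x \<in> component W d\<close> by (auto simp: component_def space_def)
      then show ?thesis using y(2) g deg[of b] by simp
    qed
    then show ?thesis by (auto simp: component_def space_def)
  qed
  have s1: "\<phi> x \<in> space W" if "x \<in> space V" for x
    using that keys_ext[of f "\<lambda>b. c (f b)" x] gf unfolding space_def \<phi>_def by blast
  have s2: "\<psi> x \<in> space V" if "x \<in> space W" for x
    using that keys_ext[of g "\<lambda>y. inverse (c y)" x] g unfolding space_def \<psi>_def by blast
  show "bij_betw \<phi> (space V) (space W)"
    by (rule bij_betw_byWitness[where f' = \<psi>]) (use inv1 inv2 s1 s2 in auto)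
  show "\<phi> ` component V d = component W d"
  proof (intro equalityI subsetI)
    fix y assume "y \<in> component W d"
    then show "y \<in> \<phi> ` component V d"
      using m2[of y d] inv2[of y] by (auto simp: component_def intro!: image_eqI[of _ _ "\<psi> y"])
  qed (use m1 in blast)
qed

lemma keys_matrix_op: "Poly_Mapping.keys (matrix_op B m x) \<subseteq> B"
proof -
  have "Poly_Mapping.keys (matrix_op B m x) \<subseteq> (\<Union>b\<in>Poly_Mapping.keys x. Poly_Mapping.keys (scale (Poly_Mapping.lookup x b)
      (\<Sum>b' | b' \<in> B \<and> m b' b \<noteq> 0. Poly_Mapping.single b' (m b' b))))"
    unfolding matrix_op_def linear_extension_def by (rule keys_sum_subset)
  also have "\<dots> \<subseteq> B"
  proof (rule UN_least)
    fix b
    have "Poly_Mapping.keys (\<Sum>b' | b' \<in> B \<and> m b' b \<noteq> 0. Poly_Mapping.single b' (Poly_Mapping.lookup x b * m b' b)) \<subseteq>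
        (\<Union>b'\<in>{b'. b' \<in> B \<and> m b' b \<noteq> 0}. Poly_Mapping.keys (Poly_Mapping.single b' (Poly_Mapping.lookup x b * m b' b)))"
      by (rule keys_sum_subset)
    also have "\<dots> \<subseteq> B" by (auto split: if_splits)
    finally show "Poly_Mapping.keys (scale (Poly_Mapping.lookup x b)
      (\<Sum>b' | b' \<in> B \<and> m b' b \<noteq> 0. Poly_Mapping.single b' (m b' b))) \<subseteq> B" by (simp add: scale_sum)
  qed
  finally show ?thesis .
qed

section \<open>Solving a multiplicative cocycle equation\<close>

context resonant_parameters begin

definition size_above :: "(nat \<Rightarrow> int) \<Rightarrow> nat" where
  "size_above \<Lambda> = nat (label_deg G \<Lambda>)"

lemma deg_vac: "label_deg G \<Lambda>0 = 0"
  by (simp add: G_rep_def)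

lemma deg_nonneg: "\<Lambda> \<in> Adm \<Longrightarrow> 0 \<le> label_deg G \<Lambda>"
proof -
  assume L: "\<Lambda> \<in> Adm"
  then obtain N where N: "\<forall>j\<ge>N. \<Lambda> j = \<Lambda>0 j" using Adm_stable by blast
  have "Sum_any (\<lambda>j. \<Lambda> j - \<Lambda>0 j) = (\<Sum>j\<in>{..N}. \<Lambda> j - \<Lambda>0 j)"
    by (rule Sum_any.expand_superset) (use N in \<open>auto intro: leI dest: less_imp_le\<close>)
  also have "\<dots> \<ge> 0" using Adm_ge_vac[OF L] by (intro sum_nonneg) simp
  finally show ?thesis by (simp add: G_rep_def)
qed

lemma size_above_add_one: "\<Lambda> \<in> Adm \<Longrightarrow> size_above (add_one \<Lambda> p) = Suc (size_above \<Lambda>)"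
  using deg_add_one[of \<Lambda> p] deg_nonneg[of \<Lambda>] by (simp add: size_above_def)

text \<open>
  Starting from the vacuum, \<open>c \<Lambda>\<close> is the product of \<open>\<rho>\<close> along one chosen path that removes a box at a time.  By induction on
  the size, the equation holds for all other edges: if the chosen last step \<open>q\<close> to \<open>\<Lambda> + 1\<^sub>p\<close> differs from \<open>p\<close>, the two
  edges span a square down to an admissible partition, where the hypothesis applies.
\<close>

lemma cocycle_solution:
  fixes \<rho> :: "(nat \<Rightarrow> int) \<Rightarrow> nat \<Rightarrow> complex"
  assumes nz: "\<And>\<Lambda> p. \<Lambda> \<in> Adm \<Longrightarrow> add_one \<Lambda> p \<in> Adm \<Longrightarrow> 1 \<le> p \<Longrightarrow> \<rho> \<Lambda> p \<noteq> 0"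
    and square: "\<And>\<Lambda> p q. \<Lambda> \<in> Adm \<Longrightarrow> add_one \<Lambda> p \<in> Adm \<Longrightarrow> add_one \<Lambda> q \<in> Adm \<Longrightarrow> 1 \<le> p \<Longrightarrow> 1 \<le> q \<Longrightarrow> p \<noteq> q \<Longrightarrow>
      \<rho> \<Lambda> p * \<rho> (add_one \<Lambda> p) q = \<rho> \<Lambda> q * \<rho> (add_one \<Lambda> q) p"
  shows "\<exists>c. (\<forall>\<Lambda>\<in>Adm. c \<Lambda> \<noteq> 0) \<and>
    (\<forall>\<Lambda> p. \<Lambda> \<in> Adm \<longrightarrow> add_one \<Lambda> p \<in> Adm \<longrightarrow> 1 \<le> p \<longrightarrow> c (add_one \<Lambda> p) = c \<Lambda> * \<rho> \<Lambda> p)"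
proof -
  define pick where "pick \<Lambda> = (SOME p. p \<in> removable \<Lambda>)" for \<Lambda>
  have pick: "pick \<Lambda> \<in> removable \<Lambda>" if "\<Lambda> \<in> Adm" "\<Lambda> \<noteq> \<Lambda>0" for \<Lambda>
  proof -
    have "\<exists>p. p \<in> removable \<Lambda>" using last_removable[OF that] by (auto simp: removable_def)
    then show ?thesis unfolding pick_def by (rule someI_ex)
  qed
  define C' where "C' = rec_nat (\<lambda>_. 1 :: complex)
    (\<lambda>d h \<Lambda>. h (sub_one \<Lambda> (pick \<Lambda>)) * \<rho> (sub_one \<Lambda> (pick \<Lambda>)) (pick \<Lambda>))"
  define c where "c \<Lambda> = C' (size_above \<Lambda>) \<Lambda>" for \<Lambda>
  have not_vac: "add_one \<Lambda> p \<noteq> \<Lambda>0" if "\<Lambda> \<in> Adm" for \<Lambda> p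
    using size_above_add_one[OF that, of p] deg_vac by (auto simp: size_above_def)
  have c_step: "c \<Lambda> = c (sub_one \<Lambda> (pick \<Lambda>)) * \<rho> (sub_one \<Lambda> (pick \<Lambda>)) (pick \<Lambda>)"
    if "\<Lambda> \<in> Adm" "\<Lambda> \<noteq> \<Lambda>0" for \<Lambda>
  proof -
    have "sub_one \<Lambda> (pick \<Lambda>) \<in> Adm" using pick[OF that] by (simp add: removable_def)
    then have "size_above \<Lambda> = Suc (size_above (sub_one \<Lambda> (pick \<Lambda>)))"
      using size_above_add_one[of "sub_one \<Lambda> (pick \<Lambda>)" "pick \<Lambda>"] by simp
    then show ?thesis by (simp add: c_def C'_def)
  qed
  have main: "c (add_one \<Lambda> p) = c \<Lambda> * \<rho> \<Lambda> p" if "\<Lambda> \<in> Adm" "add_one \<Lambda> p \<in> Adm" "1 \<le> p" for \<Lambda> p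
    using that
  proof (induction "size_above \<Lambda>" arbitrary: \<Lambda> p rule: less_induct)
    case less
    define q where "q = pick (add_one \<Lambda> p)"
    have q: "1 \<le> q" "sub_one (add_one \<Lambda> p) q \<in> Adm"
      using pick[OF less.prems(2) not_vac[OF less.prems(1)]] by (auto simp: q_def removable_def)
    have step: "c (add_one \<Lambda> p) = c (sub_one (add_one \<Lambda> p) q) * \<rho> (sub_one (add_one \<Lambda> p) q) q"
      unfolding q_def by (rule c_step[OF less.prems(2) not_vac[OF less.prems(1)]])
    show ?case
    proof (cases "p = q")
      case True
      then show ?thesis using step by simp
    next
      case False
      define m where "m = sub_one \<Lambda> q"
      have m: "\<Lambda> = add_one m q" unfolding m_def by simp
      have m2: "sub_one (add_one \<Lambda> p) q = add_one m p" unfolding m_def by (rule add_sub_commute[OF False, symmetric])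
      have mp: "add_one m p \<in> Adm" "add_one m q \<in> Adm"
        using q(2) less.prems(1) unfolding m2 by (simp_all only: m[symmetric])
      have mL: "m \<in> Adm" by (rule add_one_meet_Adm[OF mp False])
      have small: "size_above m < size_above \<Lambda>" using size_above_add_one[OF mL, of q] unfolding m[symmetric] by simp
      have IH: "c (add_one m p) = c m * \<rho> m p" "c \<Lambda> = c m * \<rho> m q"
        using less.hyps[OF small mL mp(1) less.prems(3)] less.hyps[OF small mL mp(2) q(1)] unfolding m[symmetric] by simp_all
      have "c (add_one \<Lambda> p) = c m * (\<rho> m p * \<rho> (add_one m p) q)"
        unfolding step m2 IH(1) by (simp only: mult.assoc)
      also have "\<dots> = c m * (\<rho> m q * \<rho> (add_one m q) p)"
        using square[OF mL mp less.prems(3) q(1) False] by simp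
      also have "\<dots> = c \<Lambda> * \<rho> \<Lambda> p" unfolding IH(2) m[symmetric] by (simp only: mult.assoc)
      finally show ?thesis .
    qed
  qed
  have "c \<Lambda> \<noteq> 0" if "\<Lambda> \<in> Adm" for \<Lambda>
    using that
  proof (induction "size_above \<Lambda>" arbitrary: \<Lambda> rule: less_induct)
    case less
    show ?case
    proof (cases "\<Lambda> = \<Lambda>0")
      case True
      then show ?thesis using deg_vac by (simp add: c_def C'_def size_above_def)
    next
      case False
      let ?m = "sub_one \<Lambda> (pick \<Lambda>)"
      have m: "?m \<in> Adm" "1 \<le> pick \<Lambda>" using pick[OF less.prems False] by (auto simp: removable_def)
      have "size_above ?m < size_above \<Lambda>" using size_above_add_one[OF m(1), of "pick \<Lambda>"] by simp
      then show ?thesis unfolding c_step[OF less.prems False]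
        using less.hyps m nz[OF m(1) _ m(2)] less.prems by simp
    qed
  qed
  with main show ?thesis by blast
qed

end

section \<open>Truncated products for partitions\<close>

lemma psi_part_eq:
  fixes Q1 :: "'k::field"
  assumes "1 \<le> t" "Q1 \<noteq> 0"
  shows "psi_part Q1 Q2 Q3 lam t x = box_factor Q1 Q2 Q3 (Q1 ^ lam t * Q3 ^ (t - 1) * x)"
proof -
  obtain t' where "t = Suc t'" using assms(1) by (cases t) auto
  then show ?thesis using assms(2)
    by (simp add: psi_part_def box_factor_def power_int_diff mult_ac)
qed

text \<open>
  The columns of the empty partition telescope in steps of one.  With \<open>s = 0\<close> this is the full factor of a
  component, otherwise the part of it after the row \<open>s\<close> together with the boundary factor in the coefficient of \<open>f\<close>.
\<close>

lemma partition_truncated: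
  fixes Q1 Q2 Q3 x :: "'k::field"
  assumes q: "Q1 * Q2 * Q3 = 1"
    and nz: "\<And>t. s \<le> t \<Longrightarrow> Q3 ^ t * x \<noteq> 1" "\<And>t. s \<le> t \<Longrightarrow> Q2 * (Q3 ^ t * x) \<noteq> 1"
    and T: "\<And>t. T < t \<Longrightarrow> lam t = 0" and "s \<le> T"
  shows "psi_empty Q2 (Q3 ^ s * x) *
      Prod_any (\<lambda>t. if s < t then psi_part Q1 Q2 Q3 lam t x / psi_part Q1 Q2 Q3 (\<lambda>_. 0) t x else 1) =
    (\<Prod>t\<in>{s<..T}. box_factor Q1 Q2 Q3 (Q1 ^ lam t * Q3 ^ (t - 1) * x)) * psi_empty Q2 (Q3 ^ T * x)"
proof -
  have Q1: "Q1 \<noteq> 0" using q by auto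
  define B where "B t = box_factor Q1 Q2 Q3 (Q1 ^ lam t * Q3 ^ (t - 1) * x)" for t
  define p where "p t = psi_empty Q2 (Q3 ^ t * x)" for t
  have p_nz: "p t \<noteq> 0" if "s \<le> t" for t
    using nz[OF that] by (simp add: p_def psi_empty_def)
  have empty_part: "psi_part Q1 Q2 Q3 (\<lambda>_. 0) t x = p (t - 1) / p t" if t: "1 \<le> t" for t
  proof -
    have "Q3 * (Q3 ^ (t - 1) * x) = Q3 ^ t * x" using t by (cases t) simp_all
    then show ?thesis
      unfolding psi_part_eq[OF t Q1] box_factor_eq_psi_empty[OF q] p_def by (simp only: power_0 mult_1)
  qed
  have part: "psi_part Q1 Q2 Q3 lam t x = B t" if "1 \<le> t" for t
    unfolding psi_part_eq[OF that Q1] B_def ..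
  have "Prod_any (\<lambda>t. if s < t then psi_part Q1 Q2 Q3 lam t x / psi_part Q1 Q2 Q3 (\<lambda>_. 0) t x else 1) =
      (\<Prod>t\<in>{s<..T}. if s < t then psi_part Q1 Q2 Q3 lam t x / psi_part Q1 Q2 Q3 (\<lambda>_. 0) t x else 1)"
  proof (rule Prod_any.expand_superset)
    show "{t. (if s < t then psi_part Q1 Q2 Q3 lam t x / psi_part Q1 Q2 Q3 (\<lambda>_. 0) t x else 1) \<noteq> 1} \<subseteq> {s<..T}"
    proof
      fix t assume "t \<in> {t. (if s < t then psi_part Q1 Q2 Q3 lam t x / psi_part Q1 Q2 Q3 (\<lambda>_. 0) t x else 1) \<noteq> 1}"
      then have t: "s < t" "psi_part Q1 Q2 Q3 lam t x / psi_part Q1 Q2 Q3 (\<lambda>_. 0) t x \<noteq> 1"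
        by (auto split: if_splits)
      have "t \<le> T"
      proof (rule ccontr)
        assume "\<not> t \<le> T"
        then have "psi_part Q1 Q2 Q3 lam t x = psi_part Q1 Q2 Q3 (\<lambda>_. 0) t x"
          using T[of t] by (simp add: psi_part_def)
        moreover have "psi_part Q1 Q2 Q3 (\<lambda>_. 0) t x \<noteq> 0"
          using t empty_part[of t] p_nz[of t] p_nz[of "t - 1"] by simp
        ultimately show False using t by simp
      qed
      then show "t \<in> {s<..T}" using t by simp
    qed
  qed simp
  also have "\<dots> = (\<Prod>t\<in>{s<..T}. B t * (p t / p (t - 1)))"
    by (intro prod.cong) (auto simp: part empty_part)
  also have "\<dots> = (\<Prod>t\<in>{s<..T}. B t) * (p T / p s)"
  proof -
    have "(\<Prod>t\<in>{s<..s + d}. p t / p (t - 1)) = p (s + d) / p s" for d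
    proof (induction d)
      case 0
      then show ?case using p_nz[of s] by simp
    next
      case (Suc d)
      have "{s<..s + Suc d} = insert (s + Suc d) {s<..s + d}" by auto
      then have "(\<Prod>t\<in>{s<..s + Suc d}. p t / p (t - 1)) = p (s + Suc d) / p (s + d) * (p (s + d) / p s)"
        using Suc by simp
      then show ?case using p_nz[of "s + d"] by simp
    qed
    from this[of "T - s"] have "(\<Prod>t\<in>{s<..T}. p t / p (t - 1)) = p T / p s" using \<open>s \<le> T\<close> by simp
    then show ?thesis unfolding prod.distrib by (rule arg_cong)
  qed
  finally show ?thesis using p_nz[of s] unfolding B_def[symmetric] p_def[symmetric] by simp
qed

lemma psi_partition_truncated:
  fixes Q1 Q2 Q3 x :: "'k::field"
  assumes q: "Q1 * Q2 * Q3 = 1"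
    and nz: "\<And>t. Q3 ^ t * x \<noteq> 1" "\<And>t. Q2 * (Q3 ^ t * x) \<noteq> 1"
    and T: "\<And>t. T < t \<Longrightarrow> lam t = 0"
  shows "psi_partition Q1 Q2 Q3 lam x =
    (\<Prod>t\<in>{1..T}. box_factor Q1 Q2 Q3 (Q1 ^ lam t * Q3 ^ (t - 1) * x)) * psi_empty Q2 (Q3 ^ T * x)"
proof -
  have set: "{0<..T} = {1..T}" by auto
  have guard: "(\<lambda>t. if 1 \<le> t then psi_part Q1 Q2 Q3 lam t x / psi_part Q1 Q2 Q3 (\<lambda>_. 0) t x else 1) =
    (\<lambda>t. if 0 < t then psi_part Q1 Q2 Q3 lam t x / psi_part Q1 Q2 Q3 (\<lambda>_. 0) t x else 1)" by auto
  then show ?thesis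
    using partition_truncated[where s = 0 and T = T and lam = lam, OF q nz T] unfolding psi_partition_def guard set by simp
qed

text \<open>
  For independent parameters no factor degenerates.  Evaluation at \<open>q\<^sub>1 = 2\<close>, \<open>q\<^sub>3 = 1/2\<close>, \<open>u\<^sub>i = 1\<close> and all other
  \<open>u\<^sub>j = 0\<close>, where \<open>q\<^sub>2 = 1\<close>, shows this: both expressions take a value less than 1 in modulus.
\<close>

lemma generic_nondegenerate:
  fixes i j l s t :: nat
  defines "x \<equiv> rf_u j / (rf_q1 ^ l * rf_q3 ^ (s - 1) * rf_u i)"
  assumes "1 \<le> i" "1 \<le> j" "1 \<le> s" and ij: "j \<noteq> i \<or> s \<le> t"
  shows "rf_q3 ^ t * x \<noteq> 1" and "rf_q2 * (rf_q3 ^ t * x) \<noteq> 1"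
proof -
  define y :: "nat \<Rightarrow> complex" where "y = (\<lambda>m. if m = 0 then 2 else if m = 1 then 1 / 2 else if m = i + 1 then 1 else 0)"
  interpret Y: specialization "evaluates (eval_cpoly (\<lambda>c::complex. c) y)"
    by (intro ring_hom_to_field.specialization_evaluates ring_hom_eval_cpoly ring_hom_id)
  have v: "evaluates (eval_cpoly (\<lambda>c::complex. c) y) rf_q1 2" "evaluates (eval_cpoly (\<lambda>c::complex. c) y) rf_q3 (1 / 2)"
    "evaluates (eval_cpoly (\<lambda>c::complex. c) y) (rf_u i) 1"
    "evaluates (eval_cpoly (\<lambda>c::complex. c) y) (rf_u j) (if j = i then 1 else 0)"
    using evaluates_ratfun_var[OF ring_hom_id, of y 0] evaluates_ratfun_var[OF ring_hom_id, of y 1]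
      evaluates_ratfun_var[OF ring_hom_id, of y "i + 1"] evaluates_ratfun_var[OF ring_hom_id, of y "j + 1"] assms(2,3)
    by (simp_all add: y_def split: if_splits)
  define w :: complex where "w = (if j = i then 1 else 0) / (2 ^ l * (1 / 2) ^ (s - 1) * 1)"
  have x: "evaluates (eval_cpoly (\<lambda>c::complex. c) y) (rf_q3 ^ t * x) ((1 / 2) ^ t * w)"
    unfolding x_def w_def by (intro Y.mult Y.divide Y.power v) simp
  have q2: "evaluates (eval_cpoly (\<lambda>c::complex. c) y) rf_q2 (inverse (2 * (1 / 2)))"
    by (intro Y.inverse Y.mult v) simp
  have "norm ((1 / 2) ^ t * w) < 1"
  proof (cases "j = i")
    case True
    then have st: "s \<le> t" using ij by simp
    have "norm ((1 / 2) ^ t * w) = (1 / 2) ^ t * 2 ^ (s - 1) / 2 ^ l"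
      using True by (simp add: w_def norm_mult norm_divide norm_power power_divide)
    also have "\<dots> \<le> (1 / 2) ^ t * 2 ^ (s - 1)" by (simp add: field_simps)
    also have "\<dots> \<le> (1 / 2) ^ t * 2 ^ (t - 1)" using st by (simp add: power_increasing)
    also have "\<dots> < 1" using st \<open>1 \<le> s\<close> by (cases t) (simp_all add: power_divide)
    finally show ?thesis .
  qed (simp add: w_def)
  then have "(1 / 2) ^ t * w \<noteq> 1" by auto
  then show "rf_q3 ^ t * x \<noteq> 1" using Y.unique[OF x] Y.one by metis
  have "evaluates (eval_cpoly (\<lambda>c::complex. c) y) (rf_q2 * (rf_q3 ^ t * x)) (inverse (2 * (1 / 2)) * ((1 / 2) ^ t * w))"
    by (rule Y.mult[OF q2 x])
  then have "evaluates (eval_cpoly (\<lambda>c::complex. c) y) (rf_q2 * (rf_q3 ^ t * x)) ((1 / 2) ^ t * w)" by simp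
  then show "rf_q2 * (rf_q3 ^ t * x) \<noteq> 1" using Y.unique Y.one \<open>(1 / 2) ^ t * w \<noteq> 1\<close> by metis
qed

section \<open>Components and rows of a position\<close>

context resonant_parameters begin

text \<open>
  The position \<open>pos i t = n (t - 1) + i\<close> corresponds to the row \<open>t\<close> of the component \<open>i\<close>.
\<close>

definition comp :: "nat \<Rightarrow> nat" where "comp j = (j - 1) mod n + 1"
definition row :: "nat \<Rightarrow> nat" where "row j = (j - 1) div n + 1"
definition pos :: "nat \<Rightarrow> nat \<Rightarrow> nat" where "pos i t = n * (t - 1) + i"

lemma comp_range: "comp j \<in> {1..n}" "1 \<le> comp j" "comp j \<le> n" and row_ge_1: "1 \<le> row j"
  using mod_less_divisor[of n "j - 1"] n_pos by (auto simp: comp_def row_def Suc_le_eq simp del: mod_less_divisor)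

lemma pos_comp_row: "1 \<le> j \<Longrightarrow> pos (comp j) (row j) = j"
  by (simp add: pos_def comp_def row_def)

lemma div_mod_pos:
  assumes "1 \<le> i" "i \<le> n"
  shows "(pos i t - 1) mod n = i - 1" "(pos i t - 1) div n = t - 1"
proof -
  obtain m where m: "i = Suc m" using assms(1) by (cases i) auto
  then have "pos i t - 1 = m + (t - 1) * n" by (simp add: pos_def mult.commute)
  then show "(pos i t - 1) mod n = i - 1" "(pos i t - 1) div n = t - 1" using m assms(2) by simp_all
qed

lemma comp_pos: "1 \<le> i \<Longrightarrow> i \<le> n \<Longrightarrow> comp (pos i t) = i"
  and row_pos: "1 \<le> i \<Longrightarrow> i \<le> n \<Longrightarrow> 1 \<le> t \<Longrightarrow> row (pos i t) = t"
  unfolding comp_def row_def by (simp_all only: div_mod_pos le_add_diff_inverse2)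

lemma pos_ge_1: "1 \<le> i \<Longrightarrow> 1 \<le> pos i t"
  by (simp add: pos_def)

lemmas position_simps [simp] = comp_range comp_range(2)[unfolded One_nat_def] row_ge_1 row_ge_1[unfolded One_nat_def]
  pos_comp_row pos_comp_row[unfolded One_nat_def] comp_pos comp_pos[unfolded One_nat_def]
  row_pos row_pos[unfolded One_nat_def] pos_ge_1 pos_ge_1[unfolded One_nat_def]

lemma pos_add_n: "1 \<le> t \<Longrightarrow> pos i t + n = pos i (t + 1)"
  by (cases t) (simp_all add: pos_def)

lemma row_le_iff: "1 \<le> j \<Longrightarrow> row j \<le> K \<longleftrightarrow> j \<le> n * K"
  unfolding row_def using div_less_iff_less_mult[of n "j - 1" K] n_pos by (auto simp: mult.commute Suc_le_eq)

lemma pos_le_iff: "1 \<le> i \<Longrightarrow> i \<le> n \<Longrightarrow> 1 \<le> t \<Longrightarrow> pos i t \<le> n * K \<longleftrightarrow> t \<le> K"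
  using row_le_iff[OF pos_ge_1, of i t K] by simp

lemma pos_bij: "bij_betw (\<lambda>(i, t). pos i t) ({1..n} \<times> {1..K}) {1..n * K}"
  by (rule bij_betw_byWitness[where f' = "\<lambda>j. (comp j, row j)"]) (auto simp: pos_le_iff row_le_iff simp del: One_nat_def)

lemma prod_positions: "(\<Prod>j\<in>{1..n * K}. f j) = (\<Prod>i\<in>{1..n}. \<Prod>t\<in>{1..K}. f (pos i t))"
  unfolding prod.reindex_bij_betw[OF pos_bij, symmetric] by (simp add: prod.cartesian_product split_beta)

lemma sum_positions: "(\<Sum>j\<in>{1..n * K}. f j) = (\<Sum>i\<in>{1..n}. \<Sum>t\<in>{1..K}. f (pos i t))"
  unfolding sum.reindex_bij_betw[OF pos_bij, symmetric] by (simp add: sum.cartesian_product split_beta)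

lemma vac_pos: "1 \<le> i \<Longrightarrow> i \<le> n \<Longrightarrow> 1 \<le> t \<Longrightarrow> \<Lambda>0 (pos i t) = - int ((t - 1) * r) - int (\<Sum>k\<in>{1..<i}. a k)"
proof -
  assume i: "1 \<le> i" "i \<le> n" "1 \<le> t"
  have "{1..i - 1} = {1..<i}" by auto
  then show ?thesis unfolding vac_def div_mod_pos[OF i(1,2)] by simp
qed

lemma vac_next_comp: "1 \<le> i \<Longrightarrow> i < n \<Longrightarrow> 1 \<le> t \<Longrightarrow> \<Lambda>0 (pos (i + 1) t) = \<Lambda>0 (pos i t) - int (a i)"
  by (subst (1 2) vac_pos) simp_all

lemma vac_next_row: "1 \<le> t \<Longrightarrow> \<Lambda>0 (pos 1 (t + 1)) = \<Lambda>0 (pos n t) - int (a n)"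
proof -
  assume t: "1 \<le> t"
  have "(\<Sum>k\<in>{1..n}. a k) = (\<Sum>k\<in>{1..<n}. a k) + a n"
    using n_ge_2 sum.last_plus[of 1 n a] by (simp add: atLeastLessThanSuc_atLeastAtMost[symmetric] add.commute)
  then have "int r = int (\<Sum>k\<in>{1..<n}. a k) + int (a n)" unfolding sum_a by (simp only: of_nat_add)
  moreover have "int ((t + 1 - 1) * r) = int ((t - 1) * r) + int r" using t by (cases t) simp_all
  ultimately show ?thesis using vac_pos[of 1 "t + 1"] vac_pos[of n t] t n_ge_2 by simp
qed

lemma pos_Suc: "1 \<le> t \<Longrightarrow> pos i t + 1 = pos (i + 1) t" "1 \<le> t \<Longrightarrow> pos n t + 1 = pos 1 (t + 1)"
  by (simp_all add: pos_def) (cases t, simp_all)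

section \<open>The bijection of labels\<close>

abbreviation "MP \<equiv> M_labels n a"
abbreviation "io \<equiv> iota n r a"

lemma iota_eq: "1 \<le> j \<Longrightarrow> io lam j = int (lam (comp j) (row j)) + \<Lambda>0 j"
  by (simp add: iota_def comp_def row_def)

lemma iota_pos: "1 \<le> i \<Longrightarrow> i \<le> n \<Longrightarrow> 1 \<le> t \<Longrightarrow> io lam (pos i t) = int (lam i t) + \<Lambda>0 (pos i t)"
  using iota_eq[of "pos i t" lam] pos_ge_1[of i t] by simp

definition iota_inv :: "(nat \<Rightarrow> int) \<Rightarrow> nat \<Rightarrow> nat \<Rightarrow> nat" where
  "iota_inv \<Lambda> i t = (if i \<in> {1..n} \<and> 1 \<le> t then nat (\<Lambda> (pos i t) - \<Lambda>0 (pos i t)) else 0)"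

text \<open>
  The inequalities between neighbouring components are those between the entries \<open>j\<close> and \<open>j + 1\<close>, where the last component
  is followed by the first one in the next row; the inequalities within a component are those between \<open>j\<close> and \<open>j + n\<close>.
\<close>

lemma iota_Adm:
  assumes "lam \<in> MP"
  shows "io lam \<in> Adm"
proof -
  have fp: "\<And>i. i \<in> {1..n} \<Longrightarrow> finite_partition (lam i)"
    and step: "\<And>i t. 1 \<le> i \<Longrightarrow> i < n \<Longrightarrow> 1 \<le> t \<Longrightarrow> int (lam (i + 1) t) - int (a i) \<le> int (lam i t)"
    and wrap: "\<And>t. 1 \<le> t \<Longrightarrow> int (lam 1 (t + 1)) - int (a n) \<le> int (lam n t)"
    using assms by (auto simp: M_labels_def)
  have 1: "io lam (j + 1) \<le> io lam j" if j: "1 \<le> j" for j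
  proof (cases "comp j < n")
    case True
    have p: "pos (comp j) (row j) + 1 = pos (comp j + 1) (row j)" by (rule pos_Suc) simp
    then have "j + 1 = pos (comp j + 1) (row j)" using j by simp
    then have "io lam (j + 1) = int (lam (comp j + 1) (row j)) + (\<Lambda>0 (pos (comp j) (row j)) - int (a (comp j)))"
      using iota_pos[of "comp j + 1" "row j" lam] vac_next_comp[of "comp j" "row j"] True by simp
    then show ?thesis using step[of "comp j" "row j"] True iota_eq[OF j, of lam] j by simp
  next
    case False
    then have c: "comp j = n" using comp_range(3)[of j] by linarith
    have p: "pos n (row j) + 1 = pos 1 (row j + 1)" by (rule pos_Suc) simp
    then have "j + 1 = pos 1 (row j + 1)" using j c pos_comp_row[OF j] by simp
    then have "io lam (j + 1) = int (lam 1 (row j + 1)) + (\<Lambda>0 (pos n (row j)) - int (a n))"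
      using iota_pos[of 1 "row j + 1" lam] vac_next_row[of "row j"] n_ge_2 by simp
    then show ?thesis using wrap[of "row j"] iota_eq[OF j, of lam] c pos_comp_row[OF j] by simp
  qed
  have 2: "int r \<le> io lam j - io lam (j + n)" if j: "1 \<le> j" for j
  proof -
    have p: "j + n = pos (comp j) (row j + 1)" using pos_add_n[of "row j" "comp j"] j by simp
    have "lam (comp j) (row j + 1) \<le> lam (comp j) (row j)"
      using fp[OF comp_range(1)] by (simp add: finite_partition_def)
    moreover have "io lam (j + n) = int (lam (comp j) (row j + 1)) + \<Lambda>0 (j + n)"
      using iota_pos[of "comp j" "row j + 1" lam] p by simp
    ultimately show ?thesis using iota_eq[OF j, of lam] vac_add_n[OF j] by simp
  qed
  have 3: "\<forall>\<^sub>F j in sequentially. io lam j = \<Lambda>0 j"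
  proof -
    have "finite (\<Union>i\<in>{1..n}. pos i ` {t. lam i t \<noteq> 0})" using fp by (auto simp: finite_partition_def)
    then obtain K where K: "\<And>j. j \<in> (\<Union>i\<in>{1..n}. pos i ` {t. lam i t \<noteq> 0}) \<Longrightarrow> j < K"
      using finite_nat_set_iff_bounded by meson
    have "io lam j = \<Lambda>0 j" if "K + 1 \<le> j" for j
    proof -
      have j: "1 \<le> j" using that by simp
      have "lam (comp j) (row j) = 0"
      proof (rule ccontr)
        assume "lam (comp j) (row j) \<noteq> 0"
        then have "pos (comp j) (row j) < K" by (intro K) (auto intro!: bexI[of _ "comp j"])
        then show False using j that by simp
      qed
      then show ?thesis using iota_eq[OF j, of lam] by simp
    qed
    then show ?thesis unfolding eventually_sequentially by blast
  qed
  show ?thesis unfolding G_labels_def using 1 2 3 by (simp add: iota_def)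
qed

lemma iota_inv_M:
  assumes L: "\<Lambda> \<in> Adm"
  shows "iota_inv \<Lambda> \<in> MP"
proof -
  have val: "int (iota_inv \<Lambda> i t) = \<Lambda> (pos i t) - \<Lambda>0 (pos i t)" if "1 \<le> i" "i \<le> n" "1 \<le> t" for i t
    using that Adm_ge_vac[OF L, of "pos i t"] by (simp add: iota_inv_def)
  have part: "finite_partition (iota_inv \<Lambda> i)" if i: "1 \<le> i" "i \<le> n" for i
  proof -
    obtain N where N: "\<forall>j\<ge>N. \<Lambda> j = \<Lambda>0 j" using Adm_stable[OF L] by blast
    have "{t. iota_inv \<Lambda> i t \<noteq> 0} \<subseteq> {..N + 1}"
    proof
      fix t assume t: "t \<in> {t. iota_inv \<Lambda> i t \<noteq> 0}"
      have "\<not> N \<le> pos i t" using t N by (auto simp: iota_inv_def split: if_splits)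
      moreover have "t - 1 \<le> n * (t - 1)" using mult_le_mono1[of 1 n "t - 1"] n_ge_2 by linarith
      ultimately have "t - 1 < N" unfolding pos_def by linarith
      then show "t \<in> {..N + 1}" by simp
    qed
    moreover have "iota_inv \<Lambda> i (t + 1) \<le> iota_inv \<Lambda> i t" if t: "1 \<le> t" for t
    proof -
      have "pos i t + n = pos i (t + 1)" by (rule pos_add_n[OF t])
      then have "int (iota_inv \<Lambda> i (t + 1)) \<le> int (iota_inv \<Lambda> i t)"
        using val[OF i t] val[of i "t + 1"] i Adm_n[OF L, of "pos i t"] vac_add_n[of "pos i t"] by simp
      then show ?thesis by simp
    qed
    moreover have "iota_inv \<Lambda> i 0 = 0" by (simp add: iota_inv_def)
    ultimately show ?thesis unfolding finite_partition_def
      by (intro conjI allI impI) (blast intro: finite_subset[OF _ finite_atMost])+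
  qed
  have step: "int (iota_inv \<Lambda> (i + 1) t) - int (a i) \<le> int (iota_inv \<Lambda> i t)" if "1 \<le> i" "i < n" "1 \<le> t" for i t
    using val[of i t] val[of "i + 1" t] vac_next_comp[of i t] that Adm_Suc[OF L, of "pos i t"] pos_Suc(1)[of t i] by simp
  have wrap: "int (iota_inv \<Lambda> 1 (t + 1)) - int (a n) \<le> int (iota_inv \<Lambda> n t)" if "1 \<le> t" for t
    using val[of n t] val[of 1 "t + 1"] vac_next_row[of t] that Adm_Suc[OF L, of "pos n t"] pos_Suc(2)[of t] n_ge_2 by simp
  have out: "iota_inv \<Lambda> i = (\<lambda>_. 0)" if "i \<notin> {1..n}" for i
    by (rule ext) (use that in \<open>simp only: iota_inv_def if_False simp_thms\<close>)
  show ?thesis unfolding M_labels_def mem_Collect_eq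
    using part step wrap out by (intro conjI ballI allI impI) simp_all
qed

lemma iota_iota_inv: "\<Lambda> \<in> Adm \<Longrightarrow> io (iota_inv \<Lambda>) = \<Lambda>"
proof (rule ext)
  fix j assume L: "\<Lambda> \<in> Adm"
  show "io (iota_inv \<Lambda>) j = \<Lambda> j"
  proof (cases "j = 0")
    case True
    then show ?thesis using Adm_0[OF L] by (simp add: iota_def)
  next
    case False
    then have j: "1 \<le> j" by simp
    have "int (iota_inv \<Lambda> (comp j) (row j)) = \<Lambda> j - \<Lambda>0 j"
      using Adm_ge_vac[OF L, of j] j by (simp add: iota_inv_def)
    then show ?thesis using iota_eq[OF j] by simp
  qed
qed

lemma iota_inv_iota:
  assumes "\<And>i t. \<not> (i \<in> {1..n} \<and> 1 \<le> t) \<Longrightarrow> lam i t = 0"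
  shows "iota_inv (io lam) = lam"
proof (intro ext)
  fix i t
  show "iota_inv (io lam) i t = lam i t"
  proof (cases "i \<in> {1..n} \<and> 1 \<le> t")
    case True
    then show ?thesis using iota_pos[of i t lam] by (simp add: iota_inv_def)
  next
    case False
    then have "lam i t = 0" by (rule assms)
    then show ?thesis using False unfolding iota_inv_def by (simp only: if_False)
  qed
qed

lemma M_labels_support:
  assumes "lam \<in> MP" "\<not> (i \<in> {1..n} \<and> 1 \<le> t)"
  shows "lam i t = 0"
proof (cases "i \<in> {1..n}")
  case True
  then have "t = 0" using assms(2) by simp
  then show ?thesis using assms(1) True by (simp add: M_labels_def finite_partition_def)
next
  case False
  then have "lam i = (\<lambda>_. 0)" using assms(1) by (simp add: M_labels_def)
  then show ?thesis by simp
qed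

lemma iota_bij: "bij_betw io MP Adm"
proof (rule bij_betw_byWitness[where f' = iota_inv])
  show "\<forall>lam\<in>MP. iota_inv (io lam) = lam" by (intro ballI iota_inv_iota) (rule M_labels_support)
  show "\<forall>\<Lambda>\<in>Adm. io (iota_inv \<Lambda>) = \<Lambda>" by (intro ballI iota_iota_inv)
  show "io ` MP \<subseteq> Adm" using iota_Adm by blast
  show "iota_inv ` Adm \<subseteq> MP" using iota_inv_M by blast
qed

lemma iota_add_box: "1 \<le> i \<Longrightarrow> i \<le> n \<Longrightarrow> 1 \<le> s \<Longrightarrow> io (add_box lam i s) = add_one (io lam) (pos i s)"
proof (rule ext)
  fix j assume i: "1 \<le> i" "i \<le> n" "1 \<le> s"
  show "io (add_box lam i s) j = add_one (io lam) (pos i s) j"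
  proof (cases "j = 0")
    case True
    moreover have "pos i s \<noteq> 0" using i by (simp add: pos_def)
    ultimately show ?thesis by (simp add: iota_def add_one_def)
  next
    case False
    then have j: "1 \<le> j" by simp
    have "j = pos i s \<longleftrightarrow> comp j = i \<and> row j = s" using i pos_comp_row[OF j] by auto
    then show ?thesis unfolding add_one_apply iota_eq[OF j] by (simp add: add_box_def)
  qed
qed

lemma M_deg: "lam \<in> MP \<Longrightarrow> (\<Sum>i\<in>{1..n}. Sum_any (\<lambda>s. int (lam i s))) = label_deg G (io lam)"
proof -
  assume lam: "lam \<in> MP"
  obtain K where K: "\<forall>j\<ge>K. io lam j = \<Lambda>0 j" using Adm_stable[OF iota_Adm[OF lam]] by blast
  have "K \<le> n * K" using mult_le_mono1[of 1 n K] n_ge_2 by linarith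
  have zero: "lam i t = 0" if "i \<in> {1..n}" "K < t" for i t
  proof -
    have "n * K < pos i t" using that pos_le_iff[of i t K] by simp
    then show ?thesis using K iota_pos[of i t lam] that \<open>K \<le> n * K\<close> by simp
  qed
  have "Sum_any (\<lambda>s. int (lam i s)) = (\<Sum>s\<in>{1..K}. int (lam i s))" if i: "i \<in> {1..n}" for i
  proof (rule Sum_any.expand_superset)
    have "lam i 0 = 0" using lam i by (simp add: M_labels_def finite_partition_def)
    then show "{s. int (lam i s) \<noteq> 0} \<subseteq> {1..K}" using zero[OF i] by (auto simp: Suc_le_eq not_less[symmetric] intro!: gr0I)
  qed simp
  then have "(\<Sum>i\<in>{1..n}. Sum_any (\<lambda>s. int (lam i s))) = (\<Sum>i\<in>{1..n}. \<Sum>s\<in>{1..K}. io lam (pos i s) - \<Lambda>0 (pos i s))"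
    by (simp add: iota_pos)
  also have "\<dots> = (\<Sum>j\<in>{1..n * K}. io lam j - \<Lambda>0 j)" by (rule sum_positions[symmetric])
  also have "\<dots> = Sum_any (\<lambda>j. io lam j - \<Lambda>0 j)"
  proof (rule Sum_any.expand_superset[symmetric])
    show "{j. io lam j - \<Lambda>0 j \<noteq> 0} \<subseteq> {1..n * K}"
    proof
      fix j assume j: "j \<in> {j. io lam j - \<Lambda>0 j \<noteq> 0}"
      have "j \<noteq> 0" using j by (intro notI) (simp add: iota_def)
      moreover have "j < K" using j K by (auto simp: not_le[symmetric])
      ultimately show "j \<in> {1..n * K}" using \<open>K \<le> n * K\<close> unfolding atLeastAtMost_iff by linarith
    qed
  qed simp
  finally show ?thesis by (simp add: G_rep_def)
qed

end

text \<open>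
  A scaled relabelling intertwines two matrices as soon as the entries match.  The columns may have infinitely many entries:
  then both sums are zero by convention.
\<close>

lemma matrix_op_transport:
  fixes c :: "'b \<Rightarrow> complex"
  assumes bij: "bij_betw f B B'" and nz: "\<And>b. b \<in> B \<Longrightarrow> c b \<noteq> 0"
    and m: "\<And>b b'. b \<in> B \<Longrightarrow> b' \<in> B \<Longrightarrow> m' (f b') (f b) * c b = c b' * m b' b"
    and b: "b \<in> B"
  shows "linear_extension (\<lambda>b. Poly_Mapping.single (f b) (c b)) (matrix_op B m (Poly_Mapping.single b 1)) =
    matrix_op B' m' (linear_extension (\<lambda>b. Poly_Mapping.single (f b) (c b)) (Poly_Mapping.single b 1))"
proof -
  have nonzero_iff: "m' (f b') (f b) \<noteq> 0 \<longleftrightarrow> m b' b \<noteq> 0" if "b' \<in> B" for b'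
    using m[OF b that] nz[OF b] nz[OF that] by (metis mult_eq_0_iff)
  have b2: "bij_betw f {b'. b' \<in> B \<and> m b' b \<noteq> 0} {y. y \<in> B' \<and> m' y (f b) \<noteq> 0}"
    using bij nonzero_iff by (auto simp: bij_betw_def inj_on_def)
  have "linear_extension (\<lambda>b. Poly_Mapping.single (f b) (c b)) (matrix_op B m (Poly_Mapping.single b 1)) =
      (\<Sum>b' | b' \<in> B \<and> m b' b \<noteq> 0. Poly_Mapping.single (f b') (m b' b * c b'))"
    unfolding matrix_op_def linear_extension_single scale_one linear_opD(4)[OF linear_op_linear_extension] scale_single ..
  also have "\<dots> = (\<Sum>b' | b' \<in> B \<and> m b' b \<noteq> 0. Poly_Mapping.single (f b') (c b * m' (f b') (f b)))"
    using m[OF b] by (intro sum.cong refl arg_cong[where f = "Poly_Mapping.single _"]) (simp add: mult.commute)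
  also have "\<dots> = (\<Sum>y | y \<in> B' \<and> m' y (f b) \<noteq> 0. Poly_Mapping.single y (c b * m' y (f b)))"
    by (rule sum.reindex_bij_betw[OF b2])
  also have "\<dots> = matrix_op B' m' (linear_extension (\<lambda>b. Poly_Mapping.single (f b) (c b)) (Poly_Mapping.single b 1))"
    unfolding matrix_op_def linear_extension_single scale_one scale_sum scale_single mult_1 ..
  finally show ?thesis .
qed

lemma keys_diagonal_op: "Poly_Mapping.keys (diagonal_op d x) \<subseteq> Poly_Mapping.keys x"
  by (auto simp: in_keys_iff)

section \<open>Specialized matrix coefficients\<close>

context resonant_parameters begin

abbreviation "SP \<equiv> specializes a q1 q3 u"

interpretation sp: specialization SP
  by (rule specialization_specializes)

text \<open>
  Positions that precede, respectively follow, \<open>p\<close> in the order of the tensor product: by component, then by row.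
\<close>

definition before :: "nat \<Rightarrow> nat \<Rightarrow> nat set" where
  "before N p = {j \<in> {1..N + n}. comp j < comp p \<or> comp j = comp p \<and> row j < row p}"

definition after :: "nat \<Rightarrow> nat \<Rightarrow> nat set" where
  "after N p = {j \<in> {1..N + n}. comp p < comp j \<or> comp j = comp p \<and> row p < row j}"

lemma before_after:
  assumes "1 \<le> p"
  shows "before N p \<inter> after N p = {}" "before N p \<union> after N p = {1..N + n} - {p}"
    "p \<notin> before N p" "0 \<notin> before N p"
proof -
  have "comp j \<noteq> comp p \<or> row j \<noteq> row p" if "j \<noteq> p" "1 \<le> j" for j
    using that pos_comp_row[OF assms] pos_comp_row[OF that(2)] by metis
  then show "before N p \<union> after N p = {1..N + n} - {p}" by (auto simp: before_def after_def) (metis One_nat_def linorder_neqE_nat)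
qed (auto simp: before_def after_def)

lemma prod_before:
  assumes "1 \<le> i" "i \<le> n" "1 \<le> s" "s \<le> T"
  shows "(\<Prod>j\<in>before (n * T) (pos i s). h j) =
    (\<Prod>j\<in>{1..<i}. \<Prod>t\<in>{1..T + 1}. h (pos j t)) * (\<Prod>t\<in>{1..<s}. h (pos i t))"
proof -
  have N: "n * T + n = n * (T + 1)" by simp
  have "(\<Prod>j\<in>before (n * T) (pos i s). h j) =
      (\<Prod>(j, t)\<in>{1..<i} \<times> {1..T + 1} \<union> {i} \<times> {1..<s}. h (pos j t))"
    unfolding before_def N
    by (rule prod.reindex_bij_witness[of _ "\<lambda>(j, t). pos j t" "\<lambda>j. (comp j, row j)"])
      (use assms in \<open>auto simp: pos_le_iff row_le_iff simp del: One_nat_def\<close>)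
  also have "\<dots> = (\<Prod>(j, t)\<in>{1..<i} \<times> {1..T + 1}. h (pos j t)) * (\<Prod>(j, t)\<in>{i} \<times> {1..<s}. h (pos j t))"
    by (rule prod.union_disjoint) auto
  finally show ?thesis by (simp add: prod.cartesian_product[symmetric])
qed

lemma prod_after:
  assumes "1 \<le> i" "i \<le> n" "1 \<le> s" "s \<le> T"
  shows "(\<Prod>j\<in>after (n * T) (pos i s). h j) =
    (\<Prod>t\<in>{s<..T + 1}. h (pos i t)) * (\<Prod>j\<in>{i<..n}. \<Prod>t\<in>{1..T + 1}. h (pos j t))"
proof -
  have N: "n * T + n = n * (T + 1)" by simp
  have "(\<Prod>j\<in>after (n * T) (pos i s). h j) =
      (\<Prod>(j, t)\<in>{i} \<times> {s<..T + 1} \<union> {i<..n} \<times> {1..T + 1}. h (pos j t))"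
    unfolding after_def N
    by (rule prod.reindex_bij_witness[of _ "\<lambda>(j, t). pos j t" "\<lambda>j. (comp j, row j)"])
      (use assms in \<open>auto simp: pos_le_iff row_le_iff simp del: One_nat_def\<close>)
  also have "\<dots> = (\<Prod>(j, t)\<in>{i} \<times> {s<..T + 1}. h (pos j t)) * (\<Prod>(j, t)\<in>{i<..n} \<times> {1..T + 1}. h (pos j t))"
    by (rule prod.union_disjoint) auto
  finally show ?thesis by (simp add: prod.cartesian_product[symmetric])
qed

lemma sp_q1: "SP rf_q1 q1" and sp_q3: "SP rf_q3 q3" and sp_q2: "SP rf_q2 q2"
proof -
  show 1: "SP rf_q1 q1" "SP rf_q3 q3" by (rule specializes_q1, rule specializes_q3)
  have "SP rf_q2 (inverse (q1 * q3))" by (intro sp.inverse sp.mult 1) simp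
  moreover have "inverse (q1 * q3) = q2" by (rule inverse_unique) (use q123 in \<open>simp add: mult_ac\<close>)
  ultimately show "SP rf_q2 q2" by simp
qed

lemma rf_nz [simp]: "rf_q1 \<noteq> 0" "rf_q3 \<noteq> 0"
  by (rule sp.nonzero[OF sp_q1 q_nz(1)], rule sp.nonzero[OF sp_q3 q_nz(3)])

lemma rf_q123: "rf_q1 * rf_q2 * rf_q3 = 1"
  using rf_nz by (simp only: inverse_mult_distrib mult.assoc mult.left_commute[of rf_q1] right_inverse left_inverse mult_1_right not_False_eq_True)

text \<open>The value of \<open>u\<^sub>i\<close> at the resonance is the weight of the position \<open>i\<close> in the vacuum.\<close>

lemma sp_u:
  assumes "1 \<le> i" "i \<le> n"
  shows "SP (rf_u i) (weight \<Lambda>0 i)"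
proof -
  have q13: "inverse (q1 * q3) = q2" by (rule inverse_unique) (use q123 in \<open>simp add: mult_ac\<close>)
  have "inverse (q1 ^ (a k + 1) * q3) = q1 powi (- int (a k)) * q2" for k
    unfolding q13[symmetric] by (simp add: power_int_minus power_int_of_nat)
  then have "(\<Prod>k\<in>{1..<i}. inverse (q1 ^ (a k + 1) * q3)) = (\<Prod>k\<in>{1..<i}. q1 powi (- int (a k))) * q2 ^ (i - 1)"
    by (simp add: prod.distrib)
  also have "(\<Prod>k\<in>{1..<i}. q1 powi (- int (a k))) = inverse (q1 ^ (\<Sum>k\<in>{1..<i}. a k))"
    by (simp add: power_int_minus power_int_of_nat prod_inversef[symmetric] o_def power_sum)
  also have "\<dots> = q1 powi \<Lambda>0 i"
    using vac_pos[OF assms, of 1] by (simp add: pos_def power_int_minus power_int_of_nat del: of_nat_sum)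
  finally have "u * (\<Prod>k\<in>{1..<i}. inverse (q1 ^ (a k + 1) * q3)) = weight \<Lambda>0 i"
    by (simp add: weight_def mult_ac)
  then show ?thesis using specializes_u[OF q_nz(1,3) assms(1), of a u] by simp
qed

text \<open>
  The point \<open>v\<close> of the delta function for the row \<open>t\<close> of the component \<open>i\<close> becomes the weight of the position \<open>pos i t\<close>.
\<close>

lemma weight_pos:
  assumes "1 \<le> i" "i \<le> n" "1 \<le> t"
  shows "weight (io lam) (pos i t) = q1 ^ lam i t * q3 ^ (t - 1) * weight \<Lambda>0 i"
proof -
  have p: "pos i t - 1 = n * (t - 1) + (i - 1)" using assms(1) by (simp add: pos_def)
  have i: "pos i 1 = i" by (simp add: pos_def)
  have "\<Lambda>0 (pos i t) = (- int r) * int (t - 1) + \<Lambda>0 i"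
    using vac_pos[OF assms] vac_pos[OF assms(1,2), of 1] unfolding i by simp
  then have L: "io lam (pos i t) = int (lam i t) + ((- int r) * int (t - 1) + \<Lambda>0 i)"
    using iota_pos[OF assms] by simp
  have "q3 ^ (t - 1) = (q1 powi (- int r)) ^ (t - 1) * q2 ^ (n * (t - 1))"
    by (subst q3_vac) (simp only: power_mult_distrib power_mult)
  also have "(q1 powi (- int r)) ^ (t - 1) = q1 powi ((- int r) * int (t - 1))"
    by (simp only: power_int_mult power_int_of_nat)
  finally have q3: "q3 ^ (t - 1) = q1 powi ((- int r) * int (t - 1)) * q2 ^ (n * (t - 1))" .
  have "q1 powi (io lam (pos i t)) = q1 ^ lam i t * (q1 powi ((- int r) * int (t - 1)) * q1 powi \<Lambda>0 i)"
    unfolding L by (simp only: power_int_add[OF disjI1[OF q_nz(1)]] power_int_of_nat)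
  then show ?thesis unfolding weight_def p q3 power_add by (simp only: mult_ac)
qed

definition tensor_weight :: "(nat \<Rightarrow> nat \<Rightarrow> nat) \<Rightarrow> nat \<Rightarrow> nat \<Rightarrow> cpoly fract" where
  "tensor_weight lam i t = rf_q1 ^ lam i t * rf_q3 ^ (t - 1) * rf_u i"

lemma sp_weight:
  assumes "1 \<le> i" "i \<le> n" "1 \<le> t"
  shows "SP (tensor_weight lam i t) (weight (io lam) (pos i t))"
  unfolding weight_pos[OF assms] tensor_weight_def
  by (intro sp.mult sp.power sp_q1 sp_q3 sp_u assms)

lemma settled_multiple: "\<Lambda> \<in> Adm \<Longrightarrow> \<exists>K. \<forall>T\<ge>K. settled (n * T) \<Lambda>"
proof -
  assume "\<Lambda> \<in> Adm"
  then obtain K where K: "\<forall>N\<ge>K. settled N \<Lambda>" using settled_exists by blast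
  have "T \<le> n * T" for T using mult_le_mono1[of 1 n T] n_ge_2 by linarith
  then have "\<forall>T\<ge>K. settled (n * T) \<Lambda>" using K order_trans by blast
  then show ?thesis by blast
qed

lemma settled_zero:
  assumes "settled (n * T) (io lam)" "1 \<le> i" "i \<le> n" "T < t"
  shows "lam i t = 0"
proof -
  have t: "1 \<le> t" using assms(4) by simp
  have "\<not> pos i t \<le> n * T" using pos_le_iff[OF assms(2,3) t] assms(4) by simp
  then show ?thesis using settled_after[OF assms(1), of "pos i t"] iota_pos[OF assms(2,3) t, of lam] by simp
qed

context
  fixes lam :: "nat \<Rightarrow> nat \<Rightarrow> nat" and i s T :: nat
  assumes lam: "io lam \<in> Adm" and add: "add_one (io lam) (pos i s) \<in> Adm" and i: "1 \<le> i" "i \<le> n" "1 \<le> s"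
    and T: "settled (n * T) (io lam)"
begin

lemma s_le_T: "s \<le> T"
  using addable_less[OF lam T pos_ge_1[OF i(1)] add] pos_le_iff[OF i, of T] by simp

lemma sp_column:
  assumes "1 \<le> j" "j \<le> n" "1 \<le> t" "pos j t \<noteq> pos i s"
  shows "SP (box_factor rf_q1 rf_q2 rf_q3 (rf_q1 ^ lam j t * rf_q3 ^ (t - 1) * (rf_u j / tensor_weight lam i s)))
      (box_factor q1 q2 q3 (weight (io lam) (pos j t) / weight (io lam) (pos i s)))"
    and "lam j t = 0 \<Longrightarrow> SP (psi_empty rf_q2 (rf_q3 ^ (t - 1) * (rf_u j / tensor_weight lam i s)))
      (psi_empty q2 (weight (io lam) (pos j t) / weight (io lam) (pos i s)))"
proof -
  note g = addable_generic[OF lam add pos_ge_1[OF assms(1)] pos_ge_1[OF i(1)] assms(4)]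
  have ratio: "SP (rf_q1 ^ lam j t * rf_q3 ^ (t - 1) * (rf_u j / tensor_weight lam i s))
      (weight (io lam) (pos j t) / weight (io lam) (pos i s))"
    using sp.divide[OF sp_weight[OF assms(1-3), of lam] sp_weight[OF i, of lam] weight_nz]
    by (simp add: tensor_weight_def[of lam j])
  have ne: "weight (io lam) (pos j t) / weight (io lam) (pos i s) \<noteq> 1"
    "weight (io lam) (pos j t) / weight (io lam) (pos i s) \<noteq> q1"
    using g(1,2) by (simp_all add: divide_eq_eq)
  show "SP (box_factor rf_q1 rf_q2 rf_q3 (rf_q1 ^ lam j t * rf_q3 ^ (t - 1) * (rf_u j / tensor_weight lam i s)))
      (box_factor q1 q2 q3 (weight (io lam) (pos j t) / weight (io lam) (pos i s)))"
    by (rule sp.box_factor[OF sp_q1 sp_q2 sp_q3 ratio q_nz(1) ne])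
  assume "lam j t = 0"
  then have "SP (rf_q3 ^ (t - 1) * (rf_u j / tensor_weight lam i s))
      (weight (io lam) (pos j t) / weight (io lam) (pos i s))"
    using ratio by (simp only: power_0 mult_1)
  then show "SP (psi_empty rf_q2 (rf_q3 ^ (t - 1) * (rf_u j / tensor_weight lam i s)))
      (psi_empty q2 (weight (io lam) (pos j t) / weight (io lam) (pos i s)))"
    by (rule sp.psi_empty[OF sp_q2 _ ne(1)])
qed

abbreviation (input) "cf t j \<equiv> column_factor (n * T) (pos j t) (weight (io lam) (pos j t) / weight (io lam) (pos i s))"

text \<open>
  The rows after \<open>s'\<close> of one component.  After truncation in the field of rational functions each factor is
  evaluated separately, which is possible by \<open>addable_generic\<close>.
\<close>

lemma sp_tail:
  assumes j: "1 \<le> j" "j \<le> n" and "s' \<le> T"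
    and ne: "\<And>t. s' < t \<Longrightarrow> pos j t \<noteq> pos i s"
    and nd: "j \<noteq> i \<or> s \<le> s'"
  shows "SP (psi_empty rf_q2 (rf_q3 ^ s' * (rf_u j / tensor_weight lam i s)) *
      Prod_any (\<lambda>t. if s' < t then psi_part rf_q1 rf_q2 rf_q3 (lam j) t (rf_u j / tensor_weight lam i s) /
        psi_part rf_q1 rf_q2 rf_q3 (\<lambda>_. 0) t (rf_u j / tensor_weight lam i s) else 1))
    (\<Prod>t\<in>{s'<..T + 1}. cf t j)"
proof -
  have set: "{s'<..T + 1} = insert (T + 1) {s'<..T}" using assms(3) by auto
  have "(\<Prod>t\<in>{s'<..T + 1}. cf t j) =
      (\<Prod>t\<in>{s'<..T}. box_factor q1 q2 q3 (weight (io lam) (pos j t) / weight (io lam) (pos i s))) *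
      psi_empty q2 (weight (io lam) (pos j (T + 1)) / weight (io lam) (pos i s))"
  proof -
    have "(\<Prod>t\<in>{s'<..T}. cf t j) =
        (\<Prod>t\<in>{s'<..T}. box_factor q1 q2 q3 (weight (io lam) (pos j t) / weight (io lam) (pos i s)))"
      by (intro prod.cong refl) (use j in \<open>auto simp: column_factor_def pos_le_iff\<close>)
    moreover have "\<not> pos j (T + 1) \<le> n * T" using pos_le_iff[OF j, of "T + 1" T] by simp
    ultimately show ?thesis unfolding set by (simp add: column_factor_def)
  qed
  moreover have "SP (psi_empty rf_q2 (rf_q3 ^ s' * (rf_u j / tensor_weight lam i s)) *
      Prod_any (\<lambda>t. if s' < t then psi_part rf_q1 rf_q2 rf_q3 (lam j) t (rf_u j / tensor_weight lam i s) /
        psi_part rf_q1 rf_q2 rf_q3 (\<lambda>_. 0) t (rf_u j / tensor_weight lam i s) else 1))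
     ((\<Prod>t\<in>{s'<..T}. box_factor q1 q2 q3 (weight (io lam) (pos j t) / weight (io lam) (pos i s))) *
      psi_empty q2 (weight (io lam) (pos j (T + 1)) / weight (io lam) (pos i s)))"
  proof (subst partition_truncated[where T = T, OF rf_q123])
    fix t assume t: "s' \<le> t"
    then have "j \<noteq> i \<or> s \<le> t" using nd by auto
    then show "rf_q3 ^ t * (rf_u j / tensor_weight lam i s) \<noteq> 1"
      "rf_q2 * (rf_q3 ^ t * (rf_u j / tensor_weight lam i s)) \<noteq> 1"
      unfolding tensor_weight_def by (intro generic_nondegenerate i j; assumption)+
  next
    show "lam j t = 0" if "T < t" for t by (rule settled_zero[OF T j that])
    show "s' \<le> T" by fact
    show "SP ((\<Prod>t\<in>{s'<..T}. box_factor rf_q1 rf_q2 rf_q3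
          (rf_q1 ^ lam j t * rf_q3 ^ (t - 1) * (rf_u j / tensor_weight lam i s))) *
        psi_empty rf_q2 (rf_q3 ^ T * (rf_u j / tensor_weight lam i s)))
     ((\<Prod>t\<in>{s'<..T}. box_factor q1 q2 q3 (weight (io lam) (pos j t) / weight (io lam) (pos i s))) *
      psi_empty q2 (weight (io lam) (pos j (T + 1)) / weight (io lam) (pos i s)))"
    proof (rule sp.mult[OF sp.prod])
      fix t assume "t \<in> {s'<..T}"
      then have t: "1 \<le> t" "s' < t" by auto
      show "SP (box_factor rf_q1 rf_q2 rf_q3 (rf_q1 ^ lam j t * rf_q3 ^ (t - 1) * (rf_u j / tensor_weight lam i s)))
        (box_factor q1 q2 q3 (weight (io lam) (pos j t) / weight (io lam) (pos i s)))"
        by (rule sp_column(1)[OF j t(1) ne[OF t(2)]])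
    next
      have T1: "pos j (T + 1) \<noteq> pos i s" by (rule ne) (use assms(3) in simp)
      have "lam j (T + 1) = 0" by (rule settled_zero[OF T j]) simp
      from sp_column(2)[OF j _ T1 this]
      show "SP (psi_empty rf_q2 (rf_q3 ^ T * (rf_u j / tensor_weight lam i s)))
        (psi_empty q2 (weight (io lam) (pos j (T + 1)) / weight (io lam) (pos i s)))" by simp
    qed
  qed
  ultimately show ?thesis by simp
qed

lemma pos_ne: "1 \<le> j \<Longrightarrow> j \<le> n \<Longrightarrow> 1 \<le> t \<Longrightarrow> j \<noteq> i \<or> t \<noteq> s \<Longrightarrow> pos j t \<noteq> pos i s"
  using comp_pos[of j t] row_pos[of j t] comp_pos[OF i(1,2)] row_pos[OF i] by metis

lemma sp_partition:
  assumes j: "1 \<le> j" "j \<le> n" "j \<noteq> i"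
  shows "SP (psi_partition rf_q1 rf_q2 rf_q3 (lam j) (rf_u j / tensor_weight lam i s)) (\<Prod>t\<in>{1..T + 1}. cf t j)"
proof -
  have set: "{0<..T + 1} = {1..T + 1}" by auto
  have guard: "(\<lambda>t. if 1 \<le> t then psi_part rf_q1 rf_q2 rf_q3 (lam j) t x / psi_part rf_q1 rf_q2 rf_q3 (\<lambda>_. 0) t x else 1) =
    (\<lambda>t. if 0 < t then psi_part rf_q1 rf_q2 rf_q3 (lam j) t x / psi_part rf_q1 rf_q2 rf_q3 (\<lambda>_. 0) t x else 1)" for x
    by auto
  have "pos j t \<noteq> pos i s" if "0 < t" for t using pos_ne[of j t] j that by simp
  then show ?thesis
    using sp_tail[of j 0] j unfolding psi_partition_def guard set power_0 mult_1 by simp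
qed

text \<open>
  The components before \<open>i\<close> contribute all rows, the component \<open>i\<close> those before \<open>s\<close>: together the positions in \<open>before\<close>.
\<close>

theorem sp_tensor_e:
  "SP (tensor_e rf_q1 rf_q2 rf_q3 rf_u lam i s k)
    (weight (io lam) (pos i s) powi k * (1 / (1 - q1) * amplitude (n * T) (before (n * T) (pos i s)) (io lam) (pos i s)))"
proof -
  have e: "tensor_e rf_q1 rf_q2 rf_q3 rf_u lam i s k =
     tensor_weight lam i s powi k * (1 / (1 - rf_q1) *
       ((\<Prod>j\<in>{1..<i}. psi_partition rf_q1 rf_q2 rf_q3 (lam j) (rf_u j / tensor_weight lam i s)) *
        (\<Prod>t\<in>{1..<s}. box_factor rf_q1 rf_q2 rf_q3 (rf_q1 ^ lam i t * rf_q3 ^ (t - 1) * (rf_u i / tensor_weight lam i s)))))"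
    unfolding tensor_e_def Let_def tensor_weight_def[symmetric] by (simp add: psi_part_eq)
  have cf: "box_factor q1 q2 q3 (weight (io lam) (pos i t) / weight (io lam) (pos i s)) = cf t i" if "t \<in> {1..<s}" for t
    using that s_le_T i by (auto simp: column_factor_def pos_le_iff)
  have amp: "amplitude (n * T) (before (n * T) (pos i s)) (io lam) (pos i s) =
     (\<Prod>j\<in>{1..<i}. \<Prod>t\<in>{1..T + 1}. cf t j) *
     (\<Prod>t\<in>{1..<s}. box_factor q1 q2 q3 (weight (io lam) (pos i t) / weight (io lam) (pos i s)))"
    unfolding amplitude_def prod_before[OF i s_le_T] by (simp only: cf cong: prod.cong)
  show ?thesis unfolding e amp
  proof (intro sp.mult)
    show "SP (tensor_weight lam i s powi k) (weight (io lam) (pos i s) powi k)"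
      by (intro sp.power_int sp_weight i weight_nz)
    show "SP (1 / (1 - rf_q1)) (1 / (1 - q1))" by (intro sp.divide sp.diff sp.one sp_q1) simp
    show "SP (\<Prod>j\<in>{1..<i}. psi_partition rf_q1 rf_q2 rf_q3 (lam j) (rf_u j / tensor_weight lam i s))
        (\<Prod>j\<in>{1..<i}. \<Prod>t\<in>{1..T + 1}. cf t j)"
      by (rule sp.prod, rule sp_partition) (use i in auto)
    show "SP (\<Prod>t\<in>{1..<s}. box_factor rf_q1 rf_q2 rf_q3 (rf_q1 ^ lam i t * rf_q3 ^ (t - 1) * (rf_u i / tensor_weight lam i s)))
        (\<Prod>t\<in>{1..<s}. box_factor q1 q2 q3 (weight (io lam) (pos i t) / weight (io lam) (pos i s)))"
      by (rule sp.prod, rule sp_column(1)) (use i pos_ne in auto)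
  qed
qed

theorem sp_tensor_f:
  "SP (tensor_f n rf_q1 rf_q2 rf_q3 rf_u lam i s k)
    (weight (io lam) (pos i s) powi k * (q1 / (1 - q1) * amplitude (n * T) (after (n * T) (pos i s)) (io lam) (pos i s)))"
proof -
  have f: "tensor_f n rf_q1 rf_q2 rf_q3 rf_u lam i s k =
     tensor_weight lam i s powi k * (rf_q1 / (1 - rf_q1) *
       ((psi_empty rf_q2 (rf_q3 ^ s * (rf_u i / tensor_weight lam i s)) *
      Prod_any (\<lambda>t. if s < t then psi_part rf_q1 rf_q2 rf_q3 (lam i) t (rf_u i / tensor_weight lam i s) /
        psi_part rf_q1 rf_q2 rf_q3 (\<lambda>_. 0) t (rf_u i / tensor_weight lam i s) else 1)) *
       (\<Prod>j\<in>{i<..n}. psi_partition rf_q1 rf_q2 rf_q3 (lam j) (rf_u j / tensor_weight lam i s))))"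
    unfolding tensor_f_def Let_def tensor_weight_def[symmetric] psi_empty_def
    by (simp only: times_divide_eq_right times_divide_eq_left mult.assoc mult.left_commute[of rf_q1])
  have amp: "amplitude (n * T) (after (n * T) (pos i s)) (io lam) (pos i s) =
     (\<Prod>t\<in>{s<..T + 1}. cf t i) * (\<Prod>j\<in>{i<..n}. \<Prod>t\<in>{1..T + 1}. cf t j)"
    unfolding amplitude_def prod_after[OF i s_le_T] ..
  show ?thesis unfolding f amp
  proof (intro sp.mult[OF _ sp.mult[OF _ sp.mult]])
    show "SP (tensor_weight lam i s powi k) (weight (io lam) (pos i s) powi k)"
      by (intro sp.power_int sp_weight i weight_nz)
    show "SP (rf_q1 / (1 - rf_q1)) (q1 / (1 - q1))" by (intro sp.divide sp.diff sp.one sp_q1) simp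
    show "SP (\<Prod>j\<in>{i<..n}. psi_partition rf_q1 rf_q2 rf_q3 (lam j) (rf_u j / tensor_weight lam i s))
        (\<Prod>j\<in>{i<..n}. \<Prod>t\<in>{1..T + 1}. cf t j)"
      by (rule sp.prod, rule sp_partition) (use i in auto)
    show "SP (psi_empty rf_q2 (rf_q3 ^ s * (rf_u i / tensor_weight lam i s)) *
      Prod_any (\<lambda>t. if s < t then psi_part rf_q1 rf_q2 rf_q3 (lam i) t (rf_u i / tensor_weight lam i s) /
        psi_part rf_q1 rf_q2 rf_q3 (\<lambda>_. 0) t (rf_u i / tensor_weight lam i s) else 1))
      (\<Prod>t\<in>{s<..T + 1}. cf t i)"
      by (rule sp_tail) (use i s_le_T pos_ne in auto)
  qed
qed

end

text \<open>
  In the field of Laurent series a constant divided by \<open>z\<close> is never 1, so truncation is unconditional; the factors are then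
  specialized coefficientwise and regrouped by positions.
\<close>

lemma tensor_psi_unit:
  fixes Z :: "cpoly fract fls" and Z' :: "complex fls"
  assumes lam: "io lam \<in> Adm" and Z: "Z = inverse fls_X \<and> Z' = inverse fls_X \<or> Z = fls_X \<and> Z' = fls_X"
  shows "sp.unit_series (tensor_psi n (fls_const rf_q1) (fls_const rf_q2) (fls_const rf_q3) (\<lambda>i. fls_const (rf_u i)) lam Z)
    (Psi Z' (io lam))"
proof -
  let ?c = "fls_const :: cpoly fract \<Rightarrow> cpoly fract fls"
  have Zc: "Z \<noteq> ?c c" "Z' \<noteq> C d" for c d
  proof -
    have "fls_nth (fls_X :: cpoly fract fls) 1 \<noteq> fls_nth (?c c) 1" "fls_nth (inverse fls_X :: cpoly fract fls) (- 1) \<noteq> fls_nth (?c c) (- 1)"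
      by (simp_all add: fls_inverse_X)
    then show "Z \<noteq> ?c c" using Z by metis
    show "Z' \<noteq> C d" using Z plus.Z_nonconst minus.Z_nonconst by metis
  qed
  have Z0: "Z \<noteq> 0" using Zc(1)[of 0] by simp
  have not1: "?c c / Z \<noteq> 1" for c using Zc(1)[of c] Z0 by (metis eq_divide_eq_1 divide_eq_1_iff)
  obtain T where st: "settled (n * T) (io lam)" using settled_multiple[OF lam] by blast
  have part: "psi_partition (?c rf_q1) (?c rf_q2) (?c rf_q3) (lam i) (?c (rf_u i) / Z) =
      (\<Prod>t\<in>{1..T}. box_factor (?c rf_q1) (?c rf_q2) (?c rf_q3) (?c (tensor_weight lam i t) / Z)) *
      psi_empty (?c rf_q2) (?c (tensor_weight lam i (T + 1)) / Z)" if i: "1 \<le> i" "i \<le> n" for i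
  proof -
    have "psi_partition (?c rf_q1) (?c rf_q2) (?c rf_q3) (lam i) (?c (rf_u i) / Z) =
      (\<Prod>t\<in>{1..T}. box_factor (?c rf_q1) (?c rf_q2) (?c rf_q3) (?c rf_q1 ^ lam i t * ?c rf_q3 ^ (t - 1) * (?c (rf_u i) / Z))) *
      psi_empty (?c rf_q2) (?c rf_q3 ^ T * (?c (rf_u i) / Z))"
    proof (rule psi_partition_truncated)
      show "?c rf_q1 * ?c rf_q2 * ?c rf_q3 = 1" unfolding fls_const_mult_const rf_q123 by simp
      show "?c rf_q3 ^ t * (?c (rf_u i) / Z) \<noteq> 1" for t
        using not1[of "rf_q3 ^ t * rf_u i"]
        by (simp only: fls_const_mult_const[symmetric] fls_const_power times_divide_eq_right not_False_eq_True)
      show "?c rf_q2 * (?c rf_q3 ^ t * (?c (rf_u i) / Z)) \<noteq> 1" for t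
        using not1[of "rf_q2 * (rf_q3 ^ t * rf_u i)"]
        by (simp only: fls_const_mult_const[symmetric] fls_const_power times_divide_eq_right not_False_eq_True)
      show "lam i t = 0" if "T < t" for t by (rule settled_zero[OF st i that])
    qed
    moreover have "?c rf_q1 ^ lam i t * ?c rf_q3 ^ (t - 1) * (?c (rf_u i) / Z) = ?c (tensor_weight lam i t) / Z" for t
      unfolding tensor_weight_def
      by (simp only: fls_const_mult_const[symmetric] fls_const_power times_divide_eq_right)
    moreover have "lam i (T + 1) = 0" by (rule settled_zero[OF st i]) simp
    then have "?c rf_q3 ^ T * (?c (rf_u i) / Z) = ?c (tensor_weight lam i (T + 1)) / Z"
      unfolding tensor_weight_def
      by (simp only: fls_const_mult_const[symmetric] fls_const_power times_divide_eq_right power_0 mult_1 add_diff_cancel_right')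
    ultimately show ?thesis by (simp only:)
  qed
  define col where "col j = (if j \<le> n * T then box_factor (C q1) (C q2) (C q3) (C (weight (io lam) j) / Z')
      else psi_empty (C q2) (C (weight (io lam) j) / Z'))" for j
  have "Psi Z' (io lam) = (\<Prod>j\<in>{1..n * T}. col j) * (\<Prod>j\<in>{n * T<..n * T + n}. col j)"
    unfolding Psi_truncated[OF Zc(2) st] by (intro arg_cong2[where f = "(*)"] prod.cong) (auto simp: col_def)
  also have "\<dots> = (\<Prod>j\<in>{1..n * (T + 1)}. col j)"
  proof -
    have "{1..n * (T + 1)} = {1..n * T} \<union> {n * T<..n * T + n}" by auto
    then show ?thesis by (simp only:) (rule prod.union_disjoint[symmetric], auto)
  qed
  also have "\<dots> = (\<Prod>i\<in>{1..n}. (\<Prod>t\<in>{1..T}. col (pos i t)) * col (pos i (T + 1)))"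
    unfolding prod_positions by simp
  finally have Psi: "Psi Z' (io lam) = (\<Prod>i\<in>{1..n}. (\<Prod>t\<in>{1..T}. col (pos i t)) * col (pos i (T + 1)))" .
  show ?thesis unfolding Psi tensor_psi_def
  proof (rule sp.unit_series_prod)
    fix i assume "i \<in> {1..n}"
    then have i: "1 \<le> i" "i \<le> n" by auto
    show "sp.unit_series (psi_partition (?c rf_q1) (?c rf_q2) (?c rf_q3) (lam i) (?c (rf_u i) / Z))
        ((\<Prod>t\<in>{1..T}. col (pos i t)) * col (pos i (T + 1)))"
      unfolding part[OF i]
    proof (rule sp.unit_series_mult[OF sp.unit_series_prod])
      fix t assume "t \<in> {1..T}"
      then have t: "1 \<le> t" "t \<le> T" by auto
      have "col (pos i t) = box_factor (C q1) (C q2) (C q3) (C (weight (io lam) (pos i t)) / Z')"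
        using pos_le_iff[OF i t(1), of T] t by (simp add: col_def)
      then show "sp.unit_series (box_factor (?c rf_q1) (?c rf_q2) (?c rf_q3) (?c (tensor_weight lam i t) / Z)) (col (pos i t))"
        using sp.unit_series_box_factor[OF sp_q1 sp_q2 sp_q3 sp_weight[OF i t(1)] q_nz weight_nz Z] by simp
    next
      have "col (pos i (T + 1)) = psi_empty (C q2) (C (weight (io lam) (pos i (T + 1))) / Z')"
        using pos_le_iff[OF i, of "T + 1" T] by (simp add: col_def)
      then show "sp.unit_series (psi_empty (?c rf_q2) (?c (tensor_weight lam i (T + 1)) / Z)) (col (pos i (T + 1)))"
        using sp.unit_series_psi_empty[OF sp_q2 sp_weight[OF i] q_nz(2) weight_nz Z, of "T + 1"] by simp
    qed
  qed
qed

lemma psi_specialized: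
  assumes "io lam \<in> Adm"
  shows "specialize a q1 q3 u (tensor_psi_plus n lam k) = coeff_plus (Psi (inverse fls_X) (io lam)) k"
    and "specialize a q1 q3 u (tensor_psi_minus n lam k) = coeff_minus (Psi fls_X (io lam)) k"
  unfolding tensor_psi_plus_def tensor_psi_minus_def coeff_plus_def coeff_minus_def
  by (rule specialize_eq, rule sp.unit_series_nth, rule tensor_psi_unit[OF assms], simp)+

section \<open>Comparison of the two modules\<close>

text \<open>
  The coefficient of \<open>e\<close> in \<open>M\<close> at \<open>k = 0\<close>, transferred to admissible partitions.  As for \<open>F_lim\<close>, the definition avoids the
  cut-off in the formula \<open>EM_eq\<close>.
\<close>

definition EM :: "(nat \<Rightarrow> int) \<Rightarrow> nat \<Rightarrow> complex" where
  "EM \<Lambda> p = specialize a q1 q3 u (tensor_e rf_q1 rf_q2 rf_q3 rf_u (iota_inv \<Lambda>) (comp p) (row p) 0)"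

lemma EM_eq:
  assumes L: "\<Lambda> \<in> Adm" "add_one \<Lambda> p \<in> Adm" "1 \<le> p" and T: "settled (n * T) \<Lambda>"
  shows "EM \<Lambda> p = 1 / (1 - q1) * amplitude (n * T) (before (n * T) p) \<Lambda> p"
  using specialize_eq[OF sp_tensor_e[of "iota_inv \<Lambda>" "comp p" "row p" T 0]] L T iota_iota_inv[OF L(1)]
  by (simp add: EM_def)

lemma EM_nz: "\<Lambda> \<in> Adm \<Longrightarrow> add_one \<Lambda> p \<in> Adm \<Longrightarrow> 1 \<le> p \<Longrightarrow> EM \<Lambda> p \<noteq> 0"
proof -
  assume L: "\<Lambda> \<in> Adm" "add_one \<Lambda> p \<in> Adm" "1 \<le> p"
  obtain T where T: "settled (n * T) \<Lambda>" using settled_multiple[OF L(1)] by blast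
  show ?thesis unfolding EM_eq[OF L T]
    using amplitude_nz[OF L before_after(3,4)[OF L(3)]] by simp
qed

lemma E_amp_nz: "\<Lambda> \<in> Adm \<Longrightarrow> add_one \<Lambda> p \<in> Adm \<Longrightarrow> 1 \<le> p \<Longrightarrow> E_amp \<Lambda> p \<noteq> 0"
  using amplitude_nz[of \<Lambda> p "{1..<p}" p] by (simp add: E_amp_eq[of p p])

text \<open>
  If \<open>q\<close> precedes \<open>p\<close> in the order of \<open>M\<close>, the coefficient at \<open>q\<close> does not notice the raising of \<open>p\<close>, and the one at \<open>p\<close> changes by
  \<open>amplitude_shift\<close>; the argument uses nothing but that the order is linear.
\<close>

lemma exchangeable_EM: "exchangeable EM"
proof -
  have asym: "g_fun (weight \<Lambda> p) (weight \<Lambda> q) * (EM \<Lambda> q * EM (add_one \<Lambda> q) p) +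
     g_fun (weight \<Lambda> q) (weight \<Lambda> p) * (EM \<Lambda> p * EM (add_one \<Lambda> p) q) = 0"
    if L: "\<Lambda> \<in> Adm" "add_one \<Lambda> p \<in> Adm" "add_one \<Lambda> q \<in> Adm" "1 \<le> p" "1 \<le> q" "p \<noteq> q"
      and order: "comp q < comp p \<or> comp q = comp p \<and> row q < row p" for \<Lambda> p q
  proof -
    note both = add_one_twice_Adm[OF L(2,3,6)]
    obtain K where K: "\<forall>T\<ge>K. settled (n * T) \<Lambda>" using settled_multiple[OF L(1)] by blast
    obtain K1 where K1: "\<forall>T\<ge>K1. settled (n * T) (add_one \<Lambda> p)" using settled_multiple[OF L(2)] by blast
    obtain K2 where K2: "\<forall>T\<ge>K2. settled (n * T) (add_one \<Lambda> q)" using settled_multiple[OF L(3)] by blast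
    define T where "T = K + K1 + K2"
    have T: "settled (n * T) \<Lambda>" "settled (n * T) (add_one \<Lambda> p)" "settled (n * T) (add_one \<Lambda> q)"
      using K K1 K2 by (simp_all add: T_def)
    have qN: "q \<le> n * T" using addable_less[OF L(1) T(1) L(5,3)] by simp
    have mem: "q \<in> before (n * T) p" "p \<notin> before (n * T) q"
      using order L(5) qN by (auto simp: before_def)
    have fin: "finite (before (n * T) p)" by (simp add: before_def)
    have both': "add_one (add_one \<Lambda> q) p \<in> Adm" "add_one (add_one \<Lambda> p) q \<in> Adm"
      using both add_one_commute[of \<Lambda> p q] by simp_all
    have 1: "EM (add_one \<Lambda> p) q = EM \<Lambda> q"
      unfolding EM_eq[OF L(2) both'(2) L(5) T(2)] EM_eq[OF L(1,3,5) T(1)]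
      using amplitude_other[OF mem(2) L(6)] by simp
    have "EM (add_one \<Lambda> q) p * g_fun (weight \<Lambda> p) (weight \<Lambda> q) = - (EM \<Lambda> p * g_fun (weight \<Lambda> q) (weight \<Lambda> p))"
      unfolding EM_eq[OF L(3) both'(1) L(4) T(3)] EM_eq[OF L(1,2,4) T(1)]
      using amplitude_shift[OF L fin mem(1) qN] by simp
    then have "EM \<Lambda> q * (EM (add_one \<Lambda> q) p * g_fun (weight \<Lambda> p) (weight \<Lambda> q)) =
      EM \<Lambda> q * - (EM \<Lambda> p * g_fun (weight \<Lambda> q) (weight \<Lambda> p))" by simp
    then show ?thesis unfolding 1 by (simp add: algebra_simps)
  qed
  show ?thesis unfolding exchangeable_def
  proof (intro allI impI)
    fix \<Lambda> p q assume L: "\<Lambda> \<in> Adm" "add_one \<Lambda> p \<in> Adm" "add_one \<Lambda> q \<in> Adm" "1 \<le> p" "1 \<le> q" "p \<noteq> q"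
    have "comp p \<noteq> comp q \<or> row p \<noteq> row q"
      using L(6) pos_comp_row[OF L(4)] pos_comp_row[OF L(5)] by metis
    then consider "comp q < comp p \<or> comp q = comp p \<and> row q < row p" | "comp p < comp q \<or> comp p = comp q \<and> row p < row q"
      by linarith
    then show "g_fun (weight \<Lambda> p) (weight \<Lambda> q) * (EM \<Lambda> q * EM (add_one \<Lambda> q) p) +
     g_fun (weight \<Lambda> q) (weight \<Lambda> p) * (EM \<Lambda> p * EM (add_one \<Lambda> p) q) = 0"
    proof cases
      case 1
      then show ?thesis by (rule asym[OF L])
    next
      case 2
      have "q \<noteq> p" using L(6) by simp
      from asym[OF L(1,3,2,5,4) this 2] show ?thesis by (simp only: add.commute)
    qed
  qed
qed

text \<open>Dividing the exchange laws for the coefficients of \<open>e\<close> in \<open>G\<close> and in \<open>M\<close> eliminates \<open>g\<close>.\<close>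

lemma scaling_exists:
  "\<exists>c. (\<forall>\<Lambda>\<in>Adm. c \<Lambda> \<noteq> 0) \<and>
    (\<forall>\<Lambda> p. \<Lambda> \<in> Adm \<longrightarrow> add_one \<Lambda> p \<in> Adm \<longrightarrow> 1 \<le> p \<longrightarrow> c (add_one \<Lambda> p) = c \<Lambda> * (E_amp \<Lambda> p / EM \<Lambda> p))"
proof (rule cocycle_solution)
  show "E_amp \<Lambda> p / EM \<Lambda> p \<noteq> 0" if "\<Lambda> \<in> Adm" "add_one \<Lambda> p \<in> Adm" "1 \<le> p" for \<Lambda> p
    using E_amp_nz[OF that] EM_nz[OF that] by simp
  fix \<Lambda> p q assume L: "\<Lambda> \<in> Adm" "add_one \<Lambda> p \<in> Adm" "add_one \<Lambda> q \<in> Adm" "1 \<le> p" "1 \<le> q" "p \<noteq> q"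
  let ?A = "g_fun (weight \<Lambda> p) (weight \<Lambda> q)" and ?B = "g_fun (weight \<Lambda> q) (weight \<Lambda> p)"
  define e1 e2 m1 m2 where "e1 = E_amp \<Lambda> q * E_amp (add_one \<Lambda> q) p" and "e2 = E_amp \<Lambda> p * E_amp (add_one \<Lambda> p) q"
    and "m1 = EM \<Lambda> q * EM (add_one \<Lambda> q) p" and "m2 = EM \<Lambda> p * EM (add_one \<Lambda> p) q"
  have A: "?A \<noteq> 0" by (rule square_generic[OF L])
  have e: "?A * e1 + ?B * e2 = 0" and m: "?A * m1 + ?B * m2 = 0"
    using exchangeable_E exchangeable_EM L unfolding exchangeable_def e1_def e2_def m1_def m2_def by blast+
  have both: "add_one (add_one \<Lambda> q) p \<in> Adm" "add_one (add_one \<Lambda> p) q \<in> Adm"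
    using add_one_twice_Adm[OF L(2,3,6)] add_one_commute[of \<Lambda> p q] by simp_all
  have nz: "m1 \<noteq> 0" "m2 \<noteq> 0" unfolding m1_def m2_def
    using EM_nz[OF L(1,3,5)] EM_nz[OF L(3) both(1) L(4)] EM_nz[OF L(1,2,4)] EM_nz[OF L(2) both(2) L(5)] by simp_all
  have e': "?A * e1 = - (?B * e2)" and m': "?A * m1 = - (?B * m2)"
    using e m by (simp_all only: eq_neg_iff_add_eq_0)
  have "?A * (e1 * m2) = (?A * e1) * m2" by (simp only: mult.assoc)
  also have "\<dots> = e2 * - (?B * m2)" unfolding e' by (simp only: mult_minus_left mult_minus_right mult_ac)
  also have "\<dots> = ?A * (e2 * m1)" unfolding m'[symmetric] by (simp only: mult_ac)
  finally have "e1 * m2 = e2 * m1" using A by simp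
  then have "e2 / m2 = e1 / m1" using nz by (simp add: frac_eq_eq)
  then show "E_amp \<Lambda> p / EM \<Lambda> p * (E_amp (add_one \<Lambda> p) q / EM (add_one \<Lambda> p) q) =
      E_amp \<Lambda> q / EM \<Lambda> q * (E_amp (add_one \<Lambda> q) p / EM (add_one \<Lambda> q) p)"
    unfolding e1_def e2_def m1_def m2_def by simp
qed

abbreviation "M \<equiv> M_rep n a q1 q3 u"

lemma add_box_iff:
  assumes "lam \<in> MP" "\<mu> \<in> MP" "i \<in> {1..n}" "1 \<le> s"
  shows "\<mu> = add_box lam i s \<longleftrightarrow> io \<mu> = add_one (io lam) (pos i s)"
proof -
  have i: "1 \<le> i" "i \<le> n" using assms(3) by auto
  have "iota_inv (io (add_box lam i s)) = add_box lam i s"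
    by (rule iota_inv_iota) (use M_labels_support[OF assms(1)] assms(3,4) in \<open>auto simp: add_box_def\<close>)
  moreover have "iota_inv (io \<mu>) = \<mu>" by (rule iota_inv_iota[OF M_labels_support[OF assms(2)]])
  ultimately show ?thesis unfolding iota_add_box[OF i assms(4), symmetric] by metis
qed

lemma matrix_sum_reindex:
  assumes "lam \<in> MP" "\<mu> \<in> MP"
  shows "(\<Sum>(i, s) | i \<in> {1..n} \<and> 1 \<le> s \<and> \<mu> = add_box lam i s. w i s) =
    (\<Sum>p | 1 \<le> p \<and> io \<mu> = add_one (io lam) p. w (comp p) (row p))"
  by (rule sum.reindex_bij_witness[of _ "\<lambda>p. (comp p, row p)" "\<lambda>(i, s). pos i s"])
    (use add_box_iff[OF assms] in \<open>auto simp del: One_nat_def\<close>)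

text \<open>
  The equation for \<open>e\<close> is the defining property of \<open>c\<close>.  The one for \<open>f\<close> follows because the products of the coefficients
  of \<open>e\<close> and \<open>f\<close> agree: both are the product over all positions other than \<open>p\<close>.
\<close>

lemma coefficients_match:
  assumes c: "\<And>\<Lambda> p. \<Lambda> \<in> Adm \<Longrightarrow> add_one \<Lambda> p \<in> Adm \<Longrightarrow> 1 \<le> p \<Longrightarrow> c (add_one \<Lambda> p) = c \<Lambda> * (E_amp \<Lambda> p / EM \<Lambda> p)"
    and L: "io lam \<in> Adm" "add_one (io lam) p \<in> Adm" "1 \<le> p"
  shows "G_e q1 q2 q3 u (io lam) p k * c (io lam) =
      c (add_one (io lam) p) * specialize a q1 q3 u (tensor_e rf_q1 rf_q2 rf_q3 rf_u lam (comp p) (row p) k)"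
    and "G_f n r a q1 q2 q3 u (io lam) p k * c (add_one (io lam) p) =
      c (io lam) * specialize a q1 q3 u (tensor_f n rf_q1 rf_q2 rf_q3 rf_u lam (comp p) (row p) k)"
proof -
  obtain T where T: "settled (n * T) (io lam)" using settled_multiple[OF L(1)] by blast
  define W where "W = weight (io lam) p"
  define FM where "FM = q1 / (1 - q1) * amplitude (n * T) (after (n * T) p) (io lam) p"
  have e: "specialize a q1 q3 u (tensor_e rf_q1 rf_q2 rf_q3 rf_u lam (comp p) (row p) k) = W powi k * EM (io lam) p"
    using specialize_eq[OF sp_tensor_e[of lam "comp p" "row p" T k]] L T EM_eq[OF L T] by (simp add: W_def)
  have f: "specialize a q1 q3 u (tensor_f n rf_q1 rf_q2 rf_q3 rf_u lam (comp p) (row p) k) = W powi k * FM"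
    using specialize_eq[OF sp_tensor_f[of lam "comp p" "row p" T k]] L T by (simp add: W_def FM_def)
  have nz: "EM (io lam) p \<noteq> 0" by (rule EM_nz[OF L])
  have pN: "p \<le> n * T" using addable_less[OF L(1) T L(3,2)] by simp
  have EF: "E_amp (io lam) p * F_lim (io lam) p = EM (io lam) p * FM"
  proof -
    have "amplitude (n * T) (before (n * T) p) (io lam) p * amplitude (n * T) (after (n * T) p) (io lam) p =
        (\<Prod>j\<in>{1..n * T + n} - {p}. column_factor (n * T) j (weight (io lam) j / weight (io lam) p))"
      unfolding amplitude_def before_after(2)[OF L(3), symmetric]
      by (rule prod.union_disjoint[symmetric]) (use before_after(1)[OF L(3)] in \<open>auto simp: before_def after_def\<close>)
    then show ?thesis
      unfolding F_lim_eq[OF L T] EF_amp[OF L(3) pN] EM_eq[OF L T] FM_def by (simp add: power2_eq_square)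
  qed
  show "G_e q1 q2 q3 u (io lam) p k * c (io lam) =
      c (add_one (io lam) p) * specialize a q1 q3 u (tensor_e rf_q1 rf_q2 rf_q3 rf_u lam (comp p) (row p) k)"
    unfolding G_e_eq[OF L(3)] c[OF L] e W_def[symmetric] using nz by simp
  have "G_f n r a q1 q2 q3 u (io lam) p k * c (add_one (io lam) p) =
      W powi k * c (io lam) * ((E_amp (io lam) p * F_lim (io lam) p) / EM (io lam) p)"
    unfolding G_f_eq_F_lim[OF L] c[OF L] W_def[symmetric] by simp
  also have "\<dots> = c (io lam) * (W powi k * FM)" unfolding EF using nz by simp
  finally show "G_f n r a q1 q2 q3 u (io lam) p k * c (add_one (io lam) p) =
      c (io lam) * specialize a q1 q3 u (tensor_f n rf_q1 rf_q2 rf_q3 rf_u lam (comp p) (row p) k)"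
    unfolding f .
qed

theorem M_iso_G:
  "\<exists>c. (\<forall>\<Lambda>\<in>Adm. c \<Lambda> \<noteq> 0) \<and>
    graded_E_iso q1 q2 q3 M G (linear_extension (\<lambda>lam. Poly_Mapping.single (io lam) (c (io lam))))"
proof -
  obtain c where c_nz: "\<And>\<Lambda>. \<Lambda> \<in> Adm \<Longrightarrow> c \<Lambda> \<noteq> 0"
    and c: "\<And>\<Lambda> p. \<Lambda> \<in> Adm \<Longrightarrow> add_one \<Lambda> p \<in> Adm \<Longrightarrow> 1 \<le> p \<Longrightarrow> c (add_one \<Lambda> p) = c \<Lambda> * (E_amp \<Lambda> p / EM \<Lambda> p)"
    using scaling_exists by blast
  define \<phi> where "\<phi> = linear_extension (\<lambda>lam. Poly_Mapping.single (io lam) (c (io lam)))"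
  have labels: "labels M = MP" by (simp add: M_rep_def)
  have deg: "label_deg G (io lam) = label_deg M lam" if "lam \<in> MP" for lam
    using M_deg[OF that] by (simp add: M_rep_def)
  have lin: "linear_op \<phi>" unfolding \<phi>_def by (rule linear_op_linear_extension)
  have lin_M: "linear_op (op_e M k)" "linear_op (op_f M k)" "linear_op (op_psi_plus M k)" "linear_op (op_psi_minus M k)" for k
    by (simp_all add: M_rep_def linear_op_matrix_op linear_op_diagonal_op)
  have lin_G: "linear_op (op_psi_plus G k)" "linear_op (op_psi_minus G k)" for k
    by (simp_all add: psi_plus_G psi_minus_G linear_op_diagonal_op)
  have bij: "bij_betw io (labels M) (labels G)" unfolding labels labels_G by (rule iota_bij)
  have e1: "\<phi> (op_e M k (Poly_Mapping.single lam 1)) = op_e G k (\<phi> (Poly_Mapping.single lam 1))" if "lam \<in> MP" for k lam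
    unfolding \<phi>_def M_rep_def G_rep_def graded_rep.simps
  proof (rule matrix_op_transport[OF iota_bij _ _ that])
    fix \<mu> lam assume L: "lam \<in> MP" "\<mu> \<in> MP"
    show "c (io lam) \<noteq> 0" by (rule c_nz[OF iota_Adm[OF L(1)]])
    show "(\<Sum>i | 1 \<le> i \<and> io \<mu> = add_one (io lam) i. G_e q1 q2 q3 u (io lam) i k) * c (io lam) =
      c (io \<mu>) * (\<Sum>(i, s) | i \<in> {1..n} \<and> 1 \<le> s \<and> \<mu> = add_box lam i s.
        specialize a q1 q3 u (tensor_e rf_q1 rf_q2 rf_q3 rf_u lam i s k))"
      unfolding matrix_sum_reindex[OF L] sum_distrib_left sum_distrib_right
    proof (rule sum.cong[OF refl])
      fix p assume "p \<in> {p. 1 \<le> p \<and> io \<mu> = add_one (io lam) p}"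
      then have p: "1 \<le> p" "io \<mu> = add_one (io lam) p" by auto
      have "add_one (io lam) p \<in> Adm" using iota_Adm[OF L(2)] p(2) by simp
      from coefficients_match(1)[where c = c, OF c iota_Adm[OF L(1)] this p(1)]
      show "G_e q1 q2 q3 u (io lam) p k * c (io lam) =
        c (io \<mu>) * specialize a q1 q3 u (tensor_e rf_q1 rf_q2 rf_q3 rf_u lam (comp p) (row p) k)"
        unfolding p(2) .
    qed
  qed
  have f1: "\<phi> (op_f M k (Poly_Mapping.single lam 1)) = op_f G k (\<phi> (Poly_Mapping.single lam 1))" if "lam \<in> MP" for k lam
    unfolding \<phi>_def M_rep_def G_rep_def graded_rep.simps
  proof (rule matrix_op_transport[OF iota_bij _ _ that])
    fix \<mu> lam assume L: "\<mu> \<in> MP" "lam \<in> MP"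
    show "c (io \<mu>) \<noteq> 0" by (rule c_nz[OF iota_Adm[OF L(1)]])
    show "(\<Sum>i | 1 \<le> i \<and> io \<mu> = add_one (io lam) i. G_f n r a q1 q2 q3 u (io lam) i k) * c (io \<mu>) =
      c (io lam) * (\<Sum>(i, s) | i \<in> {1..n} \<and> 1 \<le> s \<and> \<mu> = add_box lam i s.
        specialize a q1 q3 u (tensor_f n rf_q1 rf_q2 rf_q3 rf_u lam i s k))"
      unfolding matrix_sum_reindex[OF L(2,1)] sum_distrib_left sum_distrib_right
    proof (rule sum.cong[OF refl])
      fix p assume "p \<in> {p. 1 \<le> p \<and> io \<mu> = add_one (io lam) p}"
      then have p: "1 \<le> p" "io \<mu> = add_one (io lam) p" by auto
      have "add_one (io lam) p \<in> Adm" using iota_Adm[OF L(1)] p(2) by simp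
      from coefficients_match(2)[where c = c, OF c iota_Adm[OF L(2)] this p(1)]
      show "G_f n r a q1 q2 q3 u (io lam) p k * c (io \<mu>) =
        c (io lam) * specialize a q1 q3 u (tensor_f n rf_q1 rf_q2 rf_q3 rf_u lam (comp p) (row p) k)"
        unfolding p(2) .
    qed
  qed
  have psi_M: "op_psi_plus M k (Poly_Mapping.single lam d) = Poly_Mapping.single lam (d * coeff_plus (Psi (inverse fls_X) (io lam)) k)"
    "op_psi_minus M k (Poly_Mapping.single lam d) = Poly_Mapping.single lam (d * coeff_minus (Psi fls_X (io lam)) k)"
    if "lam \<in> MP" for k lam d
    using psi_specialized[OF iota_Adm[OF that]] by (simp_all add: M_rep_def)
  have \<phi>1: "\<phi> (Poly_Mapping.single lam d) = Poly_Mapping.single (io lam) (d * c (io lam))" for lam d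
    by (simp add: \<phi>_def linear_extension_single)
  interpret transport M G \<phi> q1 q2 q3
  proof
    show "linear_op \<phi>" by (rule lin)
    show "bij_betw \<phi> (space M) (space G)" "\<phi> ` component M d = component G d" for d
      unfolding \<phi>_def
      by (rule relabel_bij[where V = M and W = G and f = io and c = c], rule bij, simp add: c_nz, simp add: deg labels)+
    show "linear_op (op_e M k)" "linear_op (op_f M k)" "linear_op (op_psi_plus M k)" "linear_op (op_psi_minus M k)" for k
      by (rule lin_M)+
    show "op_e M k v \<in> space M" "op_f M k v \<in> space M" for k v
      unfolding space_def labels mem_Collect_eq by (simp_all add: M_rep_def keys_matrix_op)
    show "op_psi_plus M k v \<in> space M" "op_psi_minus M k v \<in> space M" if "v \<in> space M" for k v
      using that unfolding space_def labels mem_Collect_eq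
      by (simp_all add: M_rep_def subset_trans[OF keys_diagonal_op])
    show "\<phi> (op_e M k v) = op_e G k (\<phi> v)" if "v \<in> space M" for k v
      by (rule op_eqI[where T = "\<lambda>v. \<phi> (op_e M k v)" and T' = "\<lambda>v. op_e G k (\<phi> v)",
          OF linear_op_compose[OF lin lin_M(1)] linear_op_compose[OF linear_e lin] that]) (simp add: labels e1)
    show "\<phi> (op_f M k v) = op_f G k (\<phi> v)" if "v \<in> space M" for k v
      by (rule op_eqI[where T = "\<lambda>v. \<phi> (op_f M k v)" and T' = "\<lambda>v. op_f G k (\<phi> v)",
          OF linear_op_compose[OF lin lin_M(2)] linear_op_compose[OF linear_f lin] that]) (simp add: labels f1)
    show "\<phi> (op_psi_plus M k v) = op_psi_plus G k (\<phi> v)" if "v \<in> space M" for k v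
      by (rule op_eqI[where T = "\<lambda>v. \<phi> (op_psi_plus M k v)" and T' = "\<lambda>v. op_psi_plus G k (\<phi> v)",
          OF linear_op_compose[OF lin lin_M(3)] linear_op_compose[OF lin_G(1) lin] that])
        (simp add: labels psi_M \<phi>1 psi_plus_G mult.commute)
    show "\<phi> (op_psi_minus M k v) = op_psi_minus G k (\<phi> v)" if "v \<in> space M" for k v
      by (rule op_eqI[where T = "\<lambda>v. \<phi> (op_psi_minus M k v)" and T' = "\<lambda>v. op_psi_minus G k (\<phi> v)",
          OF linear_op_compose[OF lin lin_M(4)] linear_op_compose[OF lin_G(2) lin] that])
        (simp add: labels psi_M \<phi>1 psi_minus_G mult.commute)
    show "graded_E_module q1 q2 q3 G" by (rule G_module)
  qed
  show ?thesis using iso c_nz unfolding \<phi>_def by blast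
qed

end

theorem theorem5p3:
  fixes q1 q2 q3 u :: complex and n r :: nat and a :: "nat \<Rightarrow> nat"
  assumes "n \<ge> 2" and "r \<ge> 2"
    and "(\<Sum>i\<in>{1..n}. a i) = r"
    and "q1 * q2 * q3 = 1"
    and "not_root_of_unity q1" and "not_root_of_unity q2" and "not_root_of_unity q3"
    and "\<And>x y :: int. q1 powi x * q3 powi y = 1 \<longleftrightarrow>
           (\<exists>\<kappa>::int. x = int (n + r) * \<kappa> \<and> y = int (n + 1) * \<kappa>)"
    and "u \<noteq> 0"
  shows "bij_betw (iota n r a) (M_labels n a) (G_labels n r a) \<and>
    (\<exists>c :: (nat \<Rightarrow> int) \<Rightarrow> complex.
       (\<forall>\<Lambda>\<in>G_labels n r a. c \<Lambda> \<noteq> 0) \<and>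
       graded_E_iso q1 q2 q3 (M_rep n a q1 q3 u) (G_rep n r a q1 q2 q3 u)
         (linear_extension (\<lambda>lam. Poly_Mapping.single (iota n r a lam) (c (iota n r a lam)))))"
proof -
  interpret resonant_parameters q1 q2 q3 u n r a
    by unfold_locales (rule assms)+
  show ?thesis using iota_bij M_iso_G by blast
qed

end
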